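(* For every $c\in\mathbb{R}$ the following are equivalent: (a) $f$ satisfies the $(CPS)_c$-condition; (b) every $(CPS)_c$-sequence of $f$ is bounded in $W_0^{1,\boldsymbol p}(\Omega)$.
   Context: Standing setting. $\Omega\subset\mathbb{R}^N$ is a bounded domain, $N\ge 2$, $d\ge1$ is an integer, $p_1,\dots,p_d>1$, $\boldsymbol p=(p_1,\dots,p_d)$, $\overline p=\max\{p_1,\dots,p_d\}$, and $W_0^{1,\boldsymbol p}(\Omega)=W_0^{1,p_1}(\Omega)\times\cdots\times W_0^{1,p_d}(\Omega)$ with norm $\|u\|=\sum_k\|\nabla u_k\|_{L^{p_k}}$; its dual is $W^{-1,\boldsymbol p'}(\Omega)=W^{-1,p_1'}(\Omega)\times\cdots\times W^{-1,p_d'}(\Omega)$, $p_k'=p_k/(p_k-1)$. $p_k^*=Np_k/(N-p_k)$ if $N>p_k$ and $p_k^*=\infty$ otherwise. For each $k$, $A_k:\Omega\times\mathbb{R}\to\mathbb{R}$ is $C^1$-Carathéodory ($A_k(\cdot,s)$ measurable for every $s$, $A_k(x,\cdot)\in C^1$ for a.e. $x$), and there are constants $C_0,\nu>0$ with, for a.e. $x$ and all $s\in\mathbb{R}$: (a.1) $|A_k(x,s)|,|D_sA_k(x,s)|\le C_0$; (a.2) $A_k(x,s)\ge\nu$. $G:\Omega\times\mathbb{R}^d\to\mathbb{R}$ is $C^1$-Carathéodory with $G(x,0)=0$, $G_{s_k}(x,0)=0$; write $g_k(x,s)=G_{s_k}(x,s)=\partial G/\partial s_k$. (g.1) There are $C>0$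 and $q_k\in(p_k,p_k^* )$ with $|g_k(x,s)|\le C\big(1+|s_k|^{q_k-1}+\sum_{j\ne k}|s_j|^{q_j(q_k-1)/q_k}\big)$ for a.e. $x$, all $s\in\mathbb{R}^d$, all $k$. There are $R>0$, $\mu>\overline p$, $\gamma\in(0,\mu-\overline p)$ such that for a.e. $x$: (g.2) $s\in\mathbb{R}^d$, $|s|\ge R\Rightarrow 0<\mu G(x,s)\le\sum_{k=1}^d s_k g_k(x,s)$; (a.3) $s\in\mathbb{R}$, $|s|\ge R\Rightarrow 0\le sD_sA_k(x,s)\le\gamma A_k(x,s)$ for each $k$. The energy functional $f:W_0^{1,\boldsymbol p}(\Omega)\to\mathbb{R}$ is $f(u)=\sum_{k=1}^d\frac1{p_k}\int_\Omega A_k(x,u_k)|\nabla u_k|^{p_k}-\int_\Omega G(x,u)$. A $(CPS)_c$-sequence is $\{u_n\}\subset W_0^{1,\boldsymbol p}(\Omega)$ with $f(u_n)\to c$ such that, for every $k$, the distribution $\omega_{n,k}:=-\mathrm{div}(A_k(x,u_{n,k})|\nabla u_{n,k}|^{p_k-2}\nabla u_{n,k})+\frac1{p_k}D_sA_k(x,u_{n,k})|\nabla u_{n,k}|^{p_k}-g_k(x,u_n)$ belongs to $W^{-1,p_k'}(\Omega)$ for $n$ large and $\omega_{n,k}\to0$ strongly in $W^{-1,p_k'}(\Omega)$; $f$ satisfies the $(CPS)_c$-condition if every $(CPS)_c$-sequence has a subsequence converging in $W_0^{1,\boldsymbol p}(\Omega)$. *)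

theory Defs
  imports "HOL-Analysis.Analysis"
begin

fun Ck :: "nat \<Rightarrow> ('a::euclidean_space \<Rightarrow> real) \<Rightarrow> bool" where
  "Ck 0 f = continuous_on UNIV f"
| "Ck (Suc n) f = ((\<forall>x. f differentiable (at x)) \<and>
      (\<forall>i\<in>Basis. Ck n (\<lambda>x. frechet_derivative f (at x) i)))"

definition smooth :: "('a::euclidean_space \<Rightarrow> real) \<Rightarrow> bool" where
  "smooth f \<longleftrightarrow> (\<forall>n. Ck n f)"

definition test_fun :: "'a::euclidean_space set \<Rightarrow> ('a \<Rightarrow> real) \<Rightarrow> bool" where
  "test_fun \<Omega> \<phi> \<longleftrightarrow> smooth \<phi> \<and> compact (closure {x. \<phi> x \<noteq> 0})
      \<and> closure {x. \<phi> x \<noteq> 0} \<subseteq> \<Omega>"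

definition Lp :: "'a::euclidean_space set \<Rightarrow> real \<Rightarrow> ('a \<Rightarrow> 'b::euclidean_space) \<Rightarrow> bool" where
  "Lp \<Omega> p f \<longleftrightarrow> f \<in> borel_measurable (lebesgue_on \<Omega>) \<and>
      (\<integral>\<^sup>+ x. ennreal (norm (f x) powr p) \<partial>lebesgue_on \<Omega>) < \<infinity>"

definition Lp_norm :: "'a::euclidean_space set \<Rightarrow> real \<Rightarrow> ('a \<Rightarrow> 'b::euclidean_space) \<Rightarrow> real" where
  "Lp_norm \<Omega> p f = enn2real (\<integral>\<^sup>+ x. ennreal (norm (f x) powr p) \<partial>lebesgue_on \<Omega>) powr (1 / p)"

definition weak_grad :: "'a::euclidean_space set \<Rightarrow> ('a \<Rightarrow> real) \<Rightarrow> ('a \<Rightarrow> 'a) \<Rightarrow> bool" where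
  "weak_grad \<Omega> u g \<longleftrightarrow> (\<forall>\<phi>. test_fun \<Omega> \<phi> \<longrightarrow> (\<forall>i\<in>Basis.
      integrable (lebesgue_on \<Omega>) (\<lambda>x. u x * frechet_derivative \<phi> (at x) i) \<and>
      integrable (lebesgue_on \<Omega>) (\<lambda>x. (g x \<bullet> i) * \<phi> x) \<and>
      (\<integral>x. u x * frechet_derivative \<phi> (at x) i \<partial>lebesgue_on \<Omega>)
        = - (\<integral>x. (g x \<bullet> i) * \<phi> x \<partial>lebesgue_on \<Omega>)))"

text \<open>The (a.e. unique) weak gradient.\<close>
definition wgrad :: "'a::euclidean_space set \<Rightarrow> ('a \<Rightarrow> real) \<Rightarrow> 'a \<Rightarrow> 'a" where
  "wgrad \<Omega> u = (SOME g. weak_grad \<Omega> u g)"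

definition W1p :: "'a::euclidean_space set \<Rightarrow> real \<Rightarrow> ('a \<Rightarrow> real) \<Rightarrow> bool" where
  "W1p \<Omega> p u \<longleftrightarrow> Lp \<Omega> p u \<and> (\<exists>g. weak_grad \<Omega> u g \<and> Lp \<Omega> p g)"

definition W01p :: "'a::euclidean_space set \<Rightarrow> real \<Rightarrow> ('a \<Rightarrow> real) \<Rightarrow> bool" where
  "W01p \<Omega> p u \<longleftrightarrow> W1p \<Omega> p u \<and> (\<exists>\<phi>. (\<forall>n. test_fun \<Omega> (\<phi> n)) \<and>
      (\<lambda>n. Lp_norm \<Omega> p (\<lambda>x. \<phi> n x - u x)
           + Lp_norm \<Omega> p (\<lambda>x. wgrad \<Omega> (\<phi> n) x - wgrad \<Omega> u x)) \<longlonglongrightarrow> 0)"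

definition W01p_vec :: "'a::euclidean_space set \<Rightarrow> ('d::finite \<Rightarrow> real) \<Rightarrow> ('d \<Rightarrow> 'a \<Rightarrow> real) \<Rightarrow> bool" where
  "W01p_vec \<Omega> p u \<longleftrightarrow> (\<forall>k. W01p \<Omega> (p k) (u k))"

definition sob_norm :: "'a::euclidean_space set \<Rightarrow> ('d::finite \<Rightarrow> real) \<Rightarrow> ('d \<Rightarrow> 'a \<Rightarrow> real) \<Rightarrow> real" where
  "sob_norm \<Omega> p u = (\<Sum>k\<in>UNIV. Lp_norm \<Omega> (p k) (wgrad \<Omega> (u k)))"

definition gpart :: "('a \<Rightarrow> real^'d::finite \<Rightarrow> real) \<Rightarrow> 'd \<Rightarrow> 'a \<Rightarrow> real^'d \<Rightarrow> real" where
  "gpart G k x s = frechet_derivative (G x) (at s) (axis k 1)"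

definition energy :: "'a::euclidean_space set \<Rightarrow> ('d::finite \<Rightarrow> 'a \<Rightarrow> real \<Rightarrow> real)
    \<Rightarrow> ('a \<Rightarrow> real^'d \<Rightarrow> real) \<Rightarrow> ('d \<Rightarrow> real) \<Rightarrow> ('d \<Rightarrow> 'a \<Rightarrow> real) \<Rightarrow> real" where
  "energy \<Omega> A G p u =
     (\<Sum>k\<in>UNIV. 1 / p k * (\<integral>x. A k x (u k x) * norm (wgrad \<Omega> (u k) x) powr p k \<partial>lebesgue_on \<Omega>))
     - (\<integral>x. G x (\<chi> j. u j x) \<partial>lebesgue_on \<Omega>)"

definition omega :: "'a::euclidean_space set \<Rightarrow> ('d::finite \<Rightarrow> 'a \<Rightarrow> real \<Rightarrow> real)
    \<Rightarrow> ('a \<Rightarrow> real^'d \<Rightarrow> real) \<Rightarrow> ('d \<Rightarrow> real) \<Rightarrow> ('d \<Rightarrow> 'a \<Rightarrow> real) \<Rightarrow> 'd \<Rightarrow> ('a \<Rightarrow> real) \<Rightarrow> real" where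
  "omega \<Omega> A G p u k \<phi> =
     (\<integral>x. A k x (u k x) * norm (wgrad \<Omega> (u k) x) powr (p k - 2)
            * (wgrad \<Omega> (u k) x \<bullet> wgrad \<Omega> \<phi> x) \<partial>lebesgue_on \<Omega>)
   + (\<integral>x. 1 / p k * deriv (A k x) (u k x) * norm (wgrad \<Omega> (u k) x) powr p k * \<phi> x \<partial>lebesgue_on \<Omega>)
   - (\<integral>x. gpart G k x (\<chi> j. u j x) * \<phi> x \<partial>lebesgue_on \<Omega>)"

text \<open>(CPS)_c-sequence. The last clause says: omega_k(u_n) lies in W^{-1,p_k'} for n large
  and its dual norm sup{ |<omega,phi>| : phi test, ||grad phi||_{p_k} \<le> 1 } tends to 0.\<close>
definition CPS_seq :: "'a::euclidean_space set \<Rightarrow> ('d::finite \<Rightarrow> 'a \<Rightarrow> real \<Rightarrow> real)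
    \<Rightarrow> ('a \<Rightarrow> real^'d \<Rightarrow> real) \<Rightarrow> ('d \<Rightarrow> real) \<Rightarrow> real \<Rightarrow> (nat \<Rightarrow> 'd \<Rightarrow> 'a \<Rightarrow> real) \<Rightarrow> bool" where
  "CPS_seq \<Omega> A G p c un \<longleftrightarrow>
     (\<forall>n. W01p_vec \<Omega> p (un n)) \<and>
     (\<lambda>n. energy \<Omega> A G p (un n)) \<longlonglongrightarrow> c \<and>
     (\<forall>k. \<forall>\<epsilon>>0. eventually (\<lambda>n. \<forall>\<phi>. test_fun \<Omega> \<phi> \<longrightarrow>
         \<bar>omega \<Omega> A G p (un n) k \<phi>\<bar> \<le> \<epsilon> * Lp_norm \<Omega> (p k) (wgrad \<Omega> \<phi>)) sequentially)"

definition CPS_condition :: "'a::euclidean_space set \<Rightarrow> ('d::finite \<Rightarrow> 'a \<Rightarrow> real \<Rightarrow> real)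
    \<Rightarrow> ('a \<Rightarrow> real^'d \<Rightarrow> real) \<Rightarrow> ('d \<Rightarrow> real) \<Rightarrow> real \<Rightarrow> bool" where
  "CPS_condition \<Omega> A G p c \<longleftrightarrow>
     (\<forall>un. CPS_seq \<Omega> A G p c un \<longrightarrow>
        (\<exists>r u. strict_mono r \<and> W01p_vec \<Omega> p u \<and>
           (\<lambda>n. sob_norm \<Omega> p (\<lambda>k x. un (r n) k x - u k x)) \<longlonglongrightarrow> 0))"

end

(* A convergent sequence is bounded, and an unbounded (CPS)_c-sequence has a (CPS)_c-subsequence
   whose norms tend to infinity; this is one direction.  Conversely let (u_n) be a bounded
   (CPS)_c-sequence.  By compactness of the subcritical Sobolev embeddings, along a subsequence the
   components converge almost everywhere and g_k(x, u_n), g_k(x, u_n) u_{n,k} are dominated in L^1,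
   so the components can be treated one at a time, with g as a right-hand side.

   Three families of test functions give strong convergence of the gradients:
   epsilon arctan((u_n - u_m) / epsilon), with the monotonicity of xi -> |xi|^{p-2} xi, makes the
   gradients Cauchy in L^1, hence convergent almost everywhere along a subsequence;
   u_n - arctan(epsilon u_n) / epsilon, by the sign condition (a.3), makes the energy on {|u_n| large}
   uniformly small; and sinh(mu (tanh(theta u_n) - tanh(theta u_m))), n -> infinity before
   m -> infinity, bounds the energy on {|u_n| <= K} from above by its limit, since for suitable
   theta, mu the coefficient of |grad u_n|^p is bounded below by a positive function of u_n despite
   the natural growth term.  These test functions are smooth functions of the u_n vanishing at 0,
   hence limits of test functions, and no chain rule for Sobolev functions is needed. *)

theory Submission
  imports Defs "HOL-Complex_Analysis.Great_Picard"
begin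

section \<open>Smooth functions\<close>

text \<open>The obstacle is the natural growth term: D_sA_k(x,u)|grad u|^p lies only in L^1, so u_n
  - u_m, or any other unbounded function, cannot be put into the equation directly. Every admissible
  pair (function, gradient) is therefore carried together with an interval that contains the values
  of its approximating test functions; uniform boundedness of the approximants is what lets the L^1
  term pass to the limit. For |s| < R this term has no sign, so it must be absorbed into the
  elliptic part, and the constants \<theta> and \<mu> are dictated by the ratio C0/\<nu>. A weak
  limit is never formed. In place of a limit function, u_m with m large enters the test functions,
  because the candidate limit is at first known only almost everywhere; it is recognised as an
  element of the Sobolev space only at the end, by closedness under L^p limits of functions and
  gradients. Sobolev's inequality and compactness are proved for smooth test functions, through
  Riesz potentials and mollification, and then carried over by approximation.\<close>

lemma Ck_SucI:
  assumes "\<And>x. (f has_derivative f' x) (at x)"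
    and "\<And>i. i \<in> Basis \<Longrightarrow> Ck n (\<lambda>x. f' x i)"
  shows "Ck (Suc n) f"
proof -
  have "frechet_derivative f (at x) = f' x" for x
    by (rule frechet_derivative_at[OF assms(1), symmetric])
  moreover have "f differentiable at x" for x
    using assms(1) by (rule differentiableI)
  ultimately show ?thesis using assms(2) by simp
qed

lemma Ck_SucD:
  assumes "Ck (Suc n) f"
  shows "(f has_derivative frechet_derivative f (at x)) (at x)"
    and "i \<in> Basis \<Longrightarrow> Ck n (\<lambda>x. frechet_derivative f (at x) i)"
  using assms by (auto simp: frechet_derivative_works)

lemma Ck_continuous: "Ck n f \<Longrightarrow> continuous_on UNIV f"
proof (cases n)
  case (Suc m)
  assume "Ck n f"
  then have "f differentiable at x" for x using Suc by simp
  then show ?thesis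
    by (intro continuous_at_imp_continuous_on ballI differentiable_imp_continuous_within)
qed simp

lemma Ck_pred: "Ck (Suc n) f \<Longrightarrow> Ck n f"
proof (induction n arbitrary: f)
  case 0
  show ?case using Ck_continuous[OF 0] by simp
next
  case (Suc n)
  then have "Ck n (\<lambda>x. frechet_derivative f (at x) i)" if "i \<in> Basis" for i
    using that by (intro Suc.IH) simp
  with Suc.prems show ?case by simp
qed

lemma Ck_const: "Ck n (\<lambda>x. c)"
proof (induction n arbitrary: c)
  case (Suc n)
  show ?case by (rule Ck_SucI[OF has_derivative_const Suc])
qed simp

lemma Ck_bounded_linear: "bounded_linear f \<Longrightarrow> Ck n f"
proof (cases n)
  case 0
  assume "bounded_linear f"
  then show ?thesis using 0 by (simp add: linear_continuous_on)
next
  case (Suc m)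
  assume "bounded_linear f"
  then show ?thesis
    unfolding Suc by (intro Ck_SucI[of f "\<lambda>_. f"] bounded_linear_imp_has_derivative Ck_const)
qed

lemma Ck_add: "Ck n f \<Longrightarrow> Ck n g \<Longrightarrow> Ck n (\<lambda>x. f x + g x)"
proof (induction n arbitrary: f g)
  case 0
  then show ?case by (simp add: continuous_on_add)
next
  case (Suc n)
  show ?case
    by (rule Ck_SucI[OF has_derivative_add[OF Ck_SucD(1)[OF Suc.prems(1)] Ck_SucD(1)[OF Suc.prems(2)]]])
      (intro Suc.IH Ck_SucD(2)[OF Suc.prems(1)] Ck_SucD(2)[OF Suc.prems(2)])
qed

lemma Ck_mult: "Ck n f \<Longrightarrow> Ck n g \<Longrightarrow> Ck n (\<lambda>x. f x * g x)"
proof (induction n arbitrary: f g)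
  case 0
  then show ?case by (simp add: continuous_on_mult)
next
  case (Suc n)
  note fg = Ck_pred[OF Suc.prems(1)] Ck_pred[OF Suc.prems(2)]
  show ?case
    by (rule Ck_SucI[OF has_derivative_mult[OF Ck_SucD(1)[OF Suc.prems(1)] Ck_SucD(1)[OF Suc.prems(2)]]])
      (intro Ck_add Suc.IH fg Ck_SucD(2)[OF Suc.prems(1)] Ck_SucD(2)[OF Suc.prems(2)])
qed

text \<open>The chain rule replaces h by its derivative, so the induction must leave both functions
  free. A derivative on the real line is multiplication by its value at 1, which turns each partial
  derivative of the composite into a product covered by \<open>Ck_mult\<close>.\<close>

lemma Ck_compose:
  fixes h :: "real \<Rightarrow> real"
  shows "Ck n h \<Longrightarrow> Ck n f \<Longrightarrow> Ck n (\<lambda>x. h (f x))"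
proof (induction n arbitrary: h f)
  case 0
  then show ?case
    by (auto intro: continuous_on_compose2)
next
  case (Suc n)
  have *: "frechet_derivative h (at y) t = t * frechet_derivative h (at y) 1" for y t
    using linear_scale[OF linear_frechet_derivative[of h "at y"], of t 1] Suc.prems(1) by simp
  have 1: "Ck n (\<lambda>x. frechet_derivative h (at (f x)) 1)"
    using Suc.IH[of "\<lambda>y. frechet_derivative h (at y) 1" f] Suc.prems Ck_pred[OF Suc.prems(2)] by simp
  show ?case
  proof (rule Ck_SucI)
    show "((\<lambda>x. h (f x)) has_derivative
        (\<lambda>v. frechet_derivative f (at x) v * frechet_derivative h (at (f x)) 1)) (at x)" for x
      using diff_chain_at[OF Ck_SucD(1)[OF Suc.prems(2)] Ck_SucD(1)[OF Suc.prems(1)], of x]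
      by (subst *[symmetric]) (simp add: o_def)
    show "Ck n (\<lambda>x. frechet_derivative f (at x) i * frechet_derivative h (at (f x)) 1)" if "i \<in> Basis" for i
      using Suc.prems(2) that by (intro Ck_mult 1) simp
  qed
qed

lemma Ck_Suc_realI:
  fixes h :: "real \<Rightarrow> real"
  assumes "\<And>x. (h has_real_derivative h' x) (at x)" "Ck n h'"
  shows "Ck (Suc n) h"
  by (rule Ck_SucI[of _ "\<lambda>x. (*) (h' x)"]) (use assms in \<open>auto simp: has_field_derivative_def\<close>)

lemma smooth_const: "smooth (\<lambda>x. c)"
  and smooth_add: "smooth f \<Longrightarrow> smooth g \<Longrightarrow> smooth (\<lambda>x. f x + g x)"
  and smooth_mult: "smooth f \<Longrightarrow> smooth g \<Longrightarrow> smooth (\<lambda>x. f x * g x)"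
  and smooth_bounded_linear: "bounded_linear l \<Longrightarrow> smooth l"
  by (simp_all add: smooth_def Ck_const Ck_add Ck_mult Ck_bounded_linear)

lemma smooth_compose:
  fixes h :: "real \<Rightarrow> real"
  shows "smooth h \<Longrightarrow> smooth f \<Longrightarrow> smooth (\<lambda>x. h (f x))"
  by (simp add: smooth_def Ck_compose)

lemma smooth_minus: "smooth f \<Longrightarrow> smooth (\<lambda>x. - f x)"
  using smooth_mult[OF smooth_const[of "-1"], of f] by simp

lemma smooth_diff: "smooth f \<Longrightarrow> smooth g \<Longrightarrow> smooth (\<lambda>x. f x - g x)"
  using smooth_add[OF _ smooth_minus, of f g] by simp

lemma smooth_ident: "smooth (\<lambda>x::real. x)"
  by (rule smooth_bounded_linear) (rule bounded_linear_ident)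

lemma smooth_prod: "finite I \<Longrightarrow> (\<And>i. i \<in> I \<Longrightarrow> smooth (f i)) \<Longrightarrow> smooth (\<lambda>x. \<Prod>i\<in>I. f i x)"
  by (induction I rule: finite_induct) (auto intro: smooth_const smooth_mult)

lemma smooth_exp: "smooth (exp :: real \<Rightarrow> real)"
proof -
  have "Ck n (exp :: real \<Rightarrow> real)" for n
  proof (induction n)
    case (Suc n)
    show ?case by (rule Ck_Suc_realI[OF DERIV_exp Suc])
  qed (simp add: continuous_on_exp)
  then show ?thesis by (simp add: smooth_def)
qed

text \<open>The derivative 1 - tanh^2 is a polynomial in tanh, so the induction hypothesis about
  tanh itself already gives the regularity of the derivative. The same device serves the next lemma,
  whose derivative is a polynomial in x and in the function itself.\<close>

lemma smooth_tanh: "smooth (tanh :: real \<Rightarrow> real)"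
proof -
  have "Ck n (tanh :: real \<Rightarrow> real)" for n
  proof (induction n)
    case (Suc n)
    have "Ck n (\<lambda>x::real. 1 + (-1) * (tanh x * tanh x))"
      by (intro Ck_add Ck_mult Ck_const Suc)
    moreover have "(tanh has_real_derivative 1 + (-1) * (tanh x * tanh x)) (at x)" for x :: real
      by (rule derivative_eq_intros refl | simp add: power2_eq_square)+
    ultimately show ?case by (intro Ck_Suc_realI)
  qed (simp add: continuous_on_tanh)
  then show ?thesis by (simp add: smooth_def)
qed

lemma smooth_inverse_1_plus_square: "smooth (\<lambda>x::real. inverse (1 + x\<^sup>2))"
proof -
  have pos: "1 + x\<^sup>2 \<noteq> 0" for x :: real
    by (metis add_pos_nonneg less_irrefl zero_le_power2 zero_less_one)
  have "Ck n (\<lambda>x::real. inverse (1 + x\<^sup>2))" for n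
  proof (induction n)
    case (Suc n)
    have "Ck n (\<lambda>x::real. (- 2 * x) * (inverse (1 + x\<^sup>2) * inverse (1 + x\<^sup>2)))"
      by (intro Ck_mult Ck_const Suc Ck_bounded_linear bounded_linear_ident)
    moreover have "((\<lambda>x. inverse (1 + x\<^sup>2)) has_real_derivative
        (- 2 * x) * (inverse (1 + x\<^sup>2) * inverse (1 + x\<^sup>2))) (at x)" for x :: real
      by (rule derivative_eq_intros refl pos | simp)+
    ultimately show ?case by (intro Ck_Suc_realI)
  qed (simp add: continuous_on_inverse pos continuous_intros)
  then show ?thesis by (simp add: smooth_def)
qed

lemma smooth_arctan: "smooth arctan"
proof -
  have "Ck n arctan" for n
  proof (cases n)
    case (Suc m)
    then show ?thesis
      using smooth_inverse_1_plus_square Ck_Suc_realI[OF DERIV_arctan] by (simp add: smooth_def del: Ck.simps(2))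
  qed (auto intro!: continuous_intros)
  then show ?thesis by (simp add: smooth_def)
qed

lemma smooth_scale: "smooth (\<lambda>x::real. h x) \<Longrightarrow> smooth (\<lambda>x. b * h (a * x))"
  by (rule smooth_mult[OF smooth_const smooth_compose[OF _ smooth_mult[OF smooth_const smooth_ident]]])

lemma smooth_sinh: "smooth (sinh :: real \<Rightarrow> real)"
proof -
  have "smooth (\<lambda>x::real. (1/2) * (exp x - exp (-1 * x)))"
    by (intro smooth_mult smooth_const smooth_diff smooth_exp
        smooth_compose[OF smooth_exp smooth_mult[OF smooth_const smooth_ident]])
  then show ?thesis by (simp add: sinh_def[abs_def])
qed

section \<open>Smooth bump functions of boxes\<close>

definition exp_recip :: "real poly \<Rightarrow> real \<Rightarrow> real" where
  "exp_recip P x = (if x > 0 then poly P (inverse x) * exp (- inverse x) else 0)"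

text \<open>\<open>exp_recip P x / x\<close> is the difference quotient at 0. With y = 1/x, division
  by x is multiplication by y, that is \<open>pCons 0 P\<close>, and the exponential outgrows every
  polynomial.\<close>

lemma exp_recip_tendsto_0: "((\<lambda>x. exp_recip P x / x) \<longlongrightarrow> 0) (at 0)"
proof -
  have "((\<lambda>y::real. poly (pCons 0 P) y / exp y) \<longlongrightarrow> 0) at_top"
  proof -
    have "((\<lambda>y::real. \<Sum>i\<le>degree (pCons 0 P). coeff (pCons 0 P) i * (y ^ i / exp y)) \<longlongrightarrow> 0) at_top"
      by (rule tendsto_null_sum, rule tendsto_mult_right_zero, rule tendsto_power_div_exp_0)
    then show ?thesis by (simp add: poly_altdef sum_divide_distrib)
  qed
  from filterlim_compose[OF this filterlim_inverse_at_top_right]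
  have "((\<lambda>x. poly (pCons 0 P) (inverse x) / exp (inverse x)) \<longlongrightarrow> 0) (at_right (0::real))" .
  then have 1: "((\<lambda>x. exp_recip P x / x) \<longlongrightarrow> 0) (at_right 0)"
    by (rule Lim_transform_eventually)
      (auto simp: eventually_at_right_field exp_recip_def exp_minus field_simps intro!: exI[of _ 1])
  have "((\<lambda>x. exp_recip P x / x) \<longlongrightarrow> 0) (at_left 0)"
    by (rule Lim_transform_eventually[OF tendsto_const])
      (auto simp: eventually_at_left_field exp_recip_def intro!: exI[of _ "-1"])
  with 1 show ?thesis by (simp add: filterlim_split_at)
qed

text \<open>With y = 1/x one has dy/dx = -y^2, whence the new polynomial y^2 (P - P'). The family is
  closed under differentiation; the polynomial is a parameter so that the induction for smoothness
  can run, and the bumps take P = 1.\<close>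

lemma exp_recip_has_derivative:
  "(exp_recip P has_real_derivative exp_recip ([:0, 0, 1:] * (P - pderiv P)) x) (at x)"
proof (cases x "0::real" rule: linorder_cases)
  case less
  have "((\<lambda>x. 0) has_real_derivative exp_recip ([:0, 0, 1:] * (P - pderiv P)) x) (at x)"
    using less by (simp add: exp_recip_def)
  then show ?thesis
    by (rule DERIV_cong_ev[THEN iffD1, rotated -1])
      (use less in \<open>auto simp: exp_recip_def eventually_nhds intro!: exI[of _ "{..<0}"]\<close>)
next
  case equal
  have "((\<lambda>h. (exp_recip P (0 + h) - exp_recip P 0) / h) \<longlongrightarrow> 0) (at 0)"
    using exp_recip_tendsto_0[of P] by (simp add: exp_recip_def[of _ 0])
  then show ?thesis using equal by (simp add: DERIV_def exp_recip_def[of _ 0])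
next
  case greater
  have "((\<lambda>x. poly P (inverse x) * exp (- inverse x)) has_real_derivative
      exp_recip ([:0, 0, 1:] * (P - pderiv P)) x) (at x)"
    using greater
    by (auto intro!: derivative_eq_intros DERIV_chain2[of "poly P"] poly_DERIV
        simp: exp_recip_def power2_eq_square field_simps)
  then show ?thesis
    by (rule DERIV_cong_ev[THEN iffD1, rotated -1])
      (use greater in \<open>auto simp: exp_recip_def eventually_nhds intro!: exI[of _ "{0<..}"]\<close>)
qed

lemma smooth_exp_recip: "smooth (exp_recip P)"
proof -
  have "Ck n (exp_recip P)" for n
  proof (induction n arbitrary: P)
    case 0
    show ?case
      by (simp, intro continuous_at_imp_continuous_on ballI DERIV_isCont[OF exp_recip_has_derivative])
  next
    case (Suc n)
    show ?case by (rule Ck_Suc_realI[OF exp_recip_has_derivative Suc])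
  qed
  then show ?thesis by (simp add: smooth_def)
qed

text \<open>Each face of the box contributes one factor that vanishes to infinite order there, so
  the product is smooth on the whole space and positive exactly inside the box.\<close>

definition box_bump :: "'a::euclidean_space \<Rightarrow> 'a \<Rightarrow> 'a \<Rightarrow> real" where
  "box_bump a b x = (\<Prod>i\<in>Basis. exp_recip 1 ((x - a) \<bullet> i) * exp_recip 1 ((b - x) \<bullet> i))"

lemma exp_recip_1_pos_iff: "0 < exp_recip 1 x \<longleftrightarrow> 0 < x"
  and exp_recip_1_eq_0_iff: "exp_recip 1 x = 0 \<longleftrightarrow> x \<le> 0"
  by (auto simp: exp_recip_def)

lemma box_bump_pos: "x \<in> box a b \<Longrightarrow> 0 < box_bump a b x"
  unfolding box_bump_def mem_box
  by (intro prod_pos mult_pos_pos) (auto simp: exp_recip_1_pos_iff inner_diff_left)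

lemma box_bump_zero: "x \<notin> box a b \<Longrightarrow> box_bump a b x = 0"
  unfolding box_bump_def mem_box
  by (auto simp: prod_zero_iff exp_recip_1_eq_0_iff inner_diff_left not_less)

lemma smooth_box_bump: "smooth (box_bump a b)"
proof -
  have *: "smooth (\<lambda>x::'a. (x - a) \<bullet> i)" "smooth (\<lambda>x::'a. (b - x) \<bullet> i)" for i a b
    unfolding inner_diff_left
    by (intro smooth_diff smooth_const smooth_bounded_linear bounded_linear_inner_left)+
  show ?thesis
    unfolding box_bump_def[abs_def]
    by (intro smooth_prod smooth_mult smooth_compose[OF smooth_exp_recip] *) simp
qed

section \<open>Gradients and test functions\<close>

text \<open>The vector that represents the Frechet derivative at each point. In contrast,
  \<open>wgrad\<close> is a choice determined only up to null sets; for test functions the two are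
  identified almost everywhere by \<open>wgrad_test_fun\<close>.\<close>

definition grad :: "('a::euclidean_space \<Rightarrow> real) \<Rightarrow> 'a \<Rightarrow> 'a" where
  "grad \<phi> x = (\<Sum>i\<in>Basis. frechet_derivative \<phi> (at x) i *\<^sub>R i)"

lemma grad_inner: "i \<in> Basis \<Longrightarrow> grad \<phi> x \<bullet> i = frechet_derivative \<phi> (at x) i"
  by (simp add: grad_def inner_sum_left inner_Basis if_distrib[of "\<lambda>t. _ * t"] cong: if_cong)

lemma grad_eqI:
  assumes "(\<phi> has_derivative (\<lambda>h. g \<bullet> h)) (at x)"
  shows "grad \<phi> x = g"
proof -
  have "frechet_derivative \<phi> (at x) = (\<lambda>h. g \<bullet> h)"
    by (rule frechet_derivative_at[OF assms, symmetric])
  then show ?thesis by (simp add: grad_def euclidean_representation)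
qed

lemma smooth_has_grad:
  assumes "smooth \<phi>"
  shows "(\<phi> has_derivative (\<lambda>h. grad \<phi> x \<bullet> h)) (at x)"
proof -
  have "Ck (Suc 0) \<phi>" using assms unfolding smooth_def by blast
  then have d: "(\<phi> has_derivative frechet_derivative \<phi> (at x)) (at x)" by (rule Ck_SucD)
  then have lin: "linear (frechet_derivative \<phi> (at x))"
    by (rule has_derivative_linear)
  have "frechet_derivative \<phi> (at x) h = grad \<phi> x \<bullet> h" for h
  proof -
    have "frechet_derivative \<phi> (at x) h = frechet_derivative \<phi> (at x) (\<Sum>i\<in>Basis. (h \<bullet> i) *\<^sub>R i)"
      by (simp add: euclidean_representation)
    also have "\<dots> = (\<Sum>i\<in>Basis. (h \<bullet> i) * frechet_derivative \<phi> (at x) i)"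
      by (simp add: linear_sum[OF lin] linear_scale[OF lin])
    also have "\<dots> = grad \<phi> x \<bullet> h"
      by (simp add: grad_def inner_sum_left mult.commute inner_commute[of h])
    finally show ?thesis .
  qed
  then have "frechet_derivative \<phi> (at x) = (\<lambda>h. grad \<phi> x \<bullet> h)" by (rule ext)
  with d show ?thesis by simp
qed

lemma smooth_continuous: "smooth \<phi> \<Longrightarrow> continuous_on S \<phi>"
  unfolding smooth_def using Ck_continuous continuous_on_subset by blast

lemma smooth_continuous_grad: "smooth \<phi> \<Longrightarrow> continuous_on S (grad \<phi>)"
proof -
  assume s: "smooth \<phi>"
  have "continuous_on S (\<lambda>x. frechet_derivative \<phi> (at x) i)" if "i \<in> Basis" for i
  proof -
    have "Ck (Suc 0) \<phi>" using s unfolding smooth_def by blast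
    from Ck_SucD(2)[OF this that] show ?thesis using Ck_continuous continuous_on_subset by blast
  qed
  then show ?thesis unfolding grad_def[abs_def] by (intro continuous_intros) auto
qed

lemma smooth_deriv:
  fixes h :: "real \<Rightarrow> real"
  assumes "smooth h"
  shows "(h has_real_derivative deriv h x) (at x)" "continuous_on S (deriv h)"
proof -
  have *: "(h has_real_derivative grad h x) (at x)" for x
    using smooth_has_grad[OF assms, of x] by (simp add: has_field_derivative_def)
  then have "grad h = deriv h" by (intro ext DERIV_imp_deriv[symmetric])
  then show "(h has_real_derivative deriv h x) (at x)" "continuous_on S (deriv h)"
    using * smooth_continuous_grad[OF assms] by auto
qed

lemma grad_compose:
  assumes "smooth h" "smooth \<phi>"
  shows "grad (\<lambda>x. h (\<phi> x)) x = deriv h (\<phi> x) *\<^sub>R grad \<phi> x"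
proof (rule grad_eqI)
  have "(h has_derivative (\<lambda>t. deriv h (\<phi> x) * t)) (at (\<phi> x))"
    using smooth_deriv(1)[OF assms(1)] by (simp add: has_field_derivative_def)
  from diff_chain_at[OF smooth_has_grad[OF assms(2)] this]
  show "((\<lambda>x. h (\<phi> x)) has_derivative (\<lambda>k. (deriv h (\<phi> x) *\<^sub>R grad \<phi> x) \<bullet> k)) (at x)"
    by (simp add: o_def)
qed

lemma grad_diff:
  assumes "smooth \<phi>" "smooth \<psi>"
  shows "grad (\<lambda>x. \<phi> x - \<psi> x) x = grad \<phi> x - grad \<psi> x"
  by (rule grad_eqI) (use has_derivative_diff[OF smooth_has_grad[OF assms(1)] smooth_has_grad[OF assms(2)]]
    in \<open>simp add: inner_diff_left\<close>)

lemma grad_mult: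
  assumes "smooth \<phi>" "smooth \<psi>"
  shows "grad (\<lambda>x. \<phi> x * \<psi> x) x = \<phi> x *\<^sub>R grad \<psi> x + \<psi> x *\<^sub>R grad \<phi> x"
  by (rule grad_eqI,
      rule has_derivative_eq_rhs[OF has_derivative_mult[OF smooth_has_grad[OF assms(1)] smooth_has_grad[OF assms(2)]]])
    (auto simp: inner_add_left)

lemma test_fun_smooth: "test_fun \<Omega> \<phi> \<Longrightarrow> smooth \<phi>"
  by (simp add: test_fun_def)

lemma test_fun_supportE:
  assumes "test_fun \<Omega> \<phi>"
  obtains K where "compact K" "K \<subseteq> \<Omega>" "\<And>x. x \<notin> K \<Longrightarrow> \<phi> x = 0" "\<And>x. x \<notin> K \<Longrightarrow> grad \<phi> x = 0"
proof
  let ?K = "closure {x. \<phi> x \<noteq> 0}"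
  show "compact ?K" "?K \<subseteq> \<Omega>" using assms by (auto simp: test_fun_def)
  show z: "\<phi> x = 0" if "x \<notin> ?K" for x
    using that closure_subset[of "{x. \<phi> x \<noteq> 0}"] by auto
  show "grad \<phi> x = 0" if "x \<notin> ?K" for x
  proof (rule grad_eqI)
    have "((\<lambda>x. 0) has_derivative (\<lambda>h. 0 \<bullet> h)) (at x)" by simp
    then show "(\<phi> has_derivative (\<lambda>h. 0 \<bullet> h)) (at x)"
    proof (rule has_derivative_transform_within_open)
      show "open (- ?K)" "x \<in> - ?K" using that by auto
      show "0 = \<phi> y" if "y \<in> - ?K" for y using z[of y] that by simp
    qed
  qed
qed

lemma test_funI:
  assumes "smooth \<phi>" "compact K" "K \<subseteq> \<Omega>" "\<And>x. x \<notin> K \<Longrightarrow> \<phi> x = 0"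
  shows "test_fun \<Omega> \<phi>"
proof -
  have "closure {x. \<phi> x \<noteq> 0} \<subseteq> K"
    using assms(2,4) by (intro closure_minimal compact_imp_closed) auto
  then show ?thesis unfolding test_fun_def
    using assms(1,2,3) compact_Int_closed[OF assms(2), of "closure {x. \<phi> x \<noteq> 0}"]
    by (auto simp: Int_absorb1)
qed

lemma test_fun_diff:
  assumes "test_fun \<Omega> \<phi>" "test_fun \<Omega> \<psi>"
  shows "test_fun \<Omega> (\<lambda>x. \<phi> x - \<psi> x)"
proof -
  obtain K L where "compact K" "K \<subseteq> \<Omega>" "\<And>x. x \<notin> K \<Longrightarrow> \<phi> x = 0"
    "compact L" "L \<subseteq> \<Omega>" "\<And>x. x \<notin> L \<Longrightarrow> \<psi> x = 0"
    using assms test_fun_supportE by metis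
  then show ?thesis
    using assms by (intro test_funI[where K="K \<union> L"] smooth_diff) (auto simp: test_fun_smooth)
qed

lemma test_fun_mult:
  assumes "test_fun \<Omega> \<phi>" "smooth \<psi>"
  shows "test_fun \<Omega> (\<lambda>x. \<phi> x * \<psi> x)"
proof -
  obtain K where "compact K" "K \<subseteq> \<Omega>" "\<And>x. x \<notin> K \<Longrightarrow> \<phi> x = 0"
    using assms(1) test_fun_supportE by metis
  then show ?thesis
    by (intro test_funI[where K=K] smooth_mult[OF test_fun_smooth[OF assms(1)] assms(2)]) auto
qed

lemma test_fun_compose:
  assumes "test_fun \<Omega> \<phi>" "smooth h" "h 0 = 0"
  shows "test_fun \<Omega> (\<lambda>x. h (\<phi> x))"
proof -
  obtain K where "compact K" "K \<subseteq> \<Omega>" "\<And>x. x \<notin> K \<Longrightarrow> \<phi> x = 0"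
    using assms(1) test_fun_supportE by metis
  then show ?thesis
    using assms(3)
    by (intro test_funI[where K=K] smooth_compose[OF assms(2) test_fun_smooth[OF assms(1)]]) auto
qed

lemma test_fun_box_bump: "cbox a b \<subseteq> \<Omega> \<Longrightarrow> test_fun \<Omega> (box_bump a b)"
  using box_subset_cbox box_bump_zero
  by (intro test_funI[where K="cbox a b"] smooth_box_bump compact_cbox) blast+

section \<open>Integration by parts for test functions\<close>

lemma integrable_lborel_compact_support:
  fixes f :: "'a::euclidean_space \<Rightarrow> 'b::euclidean_space"
  assumes "continuous_on UNIV f" "compact K" "\<And>x. x \<notin> K \<Longrightarrow> f x = 0"
  shows "integrable lborel f"
proof -
  have "integrable lborel (\<lambda>x. indicator K x *\<^sub>R f x)"
    using assms by (intro borel_integrable_compact) (auto intro: continuous_on_subset)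
  also have "(\<lambda>x. indicator K x *\<^sub>R f x) = f"
    using assms(3) by (auto simp: indicator_def)
  finally show ?thesis .
qed

lemma bounded_compact_support:
  fixes f :: "'a::euclidean_space \<Rightarrow> 'b::euclidean_space"
  assumes "continuous_on UNIV f" "compact K" "\<And>x. x \<notin> K \<Longrightarrow> f x = 0"
  obtains B where "B > 0" "\<And>x. norm (f x) \<le> B"
proof -
  have "bounded (f ` K)"
    using assms by (intro compact_imp_bounded compact_continuous_image) (auto intro: continuous_on_subset)
  then obtain B where "B > 0" "\<And>x. x \<in> K \<Longrightarrow> norm (f x) \<le> B" by (auto simp: bounded_pos)
  then have "norm (f x) \<le> B" for x using assms(3)[of x] by (cases "x \<in> K") auto
  with \<open>B > 0\<close> show ?thesis by (rule that)
qed

text \<open>Test functions vanish off \<Omega>, so their integrals may be moved to the whole space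
  with the Borel-Lebesgue measure, where translation, scaling and Fubini apply.\<close>

lemma
  fixes f :: "'a::euclidean_space \<Rightarrow> 'b::euclidean_space"
  assumes "open \<Omega>" "f \<in> borel_measurable borel" "\<And>x. x \<notin> \<Omega> \<Longrightarrow> f x = 0"
  shows integrable_lebesgue_on_iff_lborel: "integrable (lebesgue_on \<Omega>) f \<longleftrightarrow> integrable lborel f"
    and integral_lebesgue_on_eq_lborel: "(\<integral>x. f x \<partial>lebesgue_on \<Omega>) = (\<integral>x. f x \<partial>lborel)"
proof -
  have "(\<lambda>x. indicator \<Omega> x *\<^sub>R f x) = f" using assms(3) by (auto simp: indicator_def)
  moreover have "\<Omega> \<inter> space lebesgue \<in> sets lebesgue" using assms(1) by auto
  ultimately show "integrable (lebesgue_on \<Omega>) f \<longleftrightarrow> integrable lborel f"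
    "(\<integral>x. f x \<partial>lebesgue_on \<Omega>) = (\<integral>x. f x \<partial>lborel)"
    using assms(2) by (simp_all add: integrable_restrict_space integral_restrict_space
        integrable_completion integral_completion)
qed

lemma nn_integral_lebesgue_on_eq_lborel:
  fixes f :: "'a::euclidean_space \<Rightarrow> ennreal"
  assumes "open \<Omega>" "\<And>x. x \<notin> \<Omega> \<Longrightarrow> f x = 0"
  shows "(\<integral>\<^sup>+x. f x \<partial>lebesgue_on \<Omega>) = (\<integral>\<^sup>+x. f x \<partial>lborel)"
proof -
  have "(\<lambda>x. f x * indicator \<Omega> x) = f" using assms(2) by (auto simp: indicator_def)
  then show ?thesis using assms(1)
    by (subst nn_integral_restrict_space) (auto simp: nn_integral_completion)
qed

text \<open>By translation invariance every difference quotient has integral 0. The quotients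
  converge pointwise to the directional derivative and are dominated by a Lipschitz bound on one
  fixed compact set.\<close>

lemma integral_partial_eq_0:
  fixes f :: "'a::euclidean_space \<Rightarrow> real"
  assumes "test_fun \<Omega> f"
  shows "(\<integral>x. grad f x \<bullet> i \<partial>lborel) = 0"
proof -
  obtain K where K: "compact K" "\<And>x. x \<notin> K \<Longrightarrow> f x = 0" "\<And>x. x \<notin> K \<Longrightarrow> grad f x = 0"
    using assms test_fun_supportE by metis
  note sm = test_fun_smooth[OF assms]
  note cont = smooth_continuous[OF sm] smooth_continuous_grad[OF sm]
  have meas: "f \<in> borel_measurable borel" "grad f \<in> borel_measurable borel"
    using cont by (auto intro: borel_measurable_continuous_onI)
  obtain B where B: "\<And>x. norm (grad f x) \<le> B"
    using bounded_compact_support[OF cont(2) K(1,3)] by metis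
  define t where "t n = inverse (real (Suc n))" for n
  have t: "t n > 0" "t n \<le> 1" for n by (auto simp: t_def field_simps)
  define D where "D n x = (f (x + t n *\<^sub>R i) - f x) / t n" for n x
  \<comment> \<open>All points from which a step s i with 0 \<le> s \<le> 1 can reach the support;
    since \<open>t n\<close> \<le> 1, this one compact set carries every \<open>D n\<close>.\<close>
  define K' where "K' = (\<lambda>(x, s). x - s *\<^sub>R i) ` (K \<times> {0..1})"
  have K': "compact K'" unfolding K'_def split_def
    by (intro compact_continuous_image compact_Times K(1) continuous_intros compact_Icc)
  have lip: "\<bar>f (x + s *\<^sub>R i) - f x\<bar> \<le> B * norm (s *\<^sub>R i)" for x s
  proof -
    have "norm (f (x + s *\<^sub>R i) - f x) \<le> B * norm (x + s *\<^sub>R i - x)"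
    proof (rule differentiable_bound[where S=UNIV])
      show "onorm (\<lambda>h. grad f y \<bullet> h) \<le> B" for y
      proof (rule onorm_bound)
        show "0 \<le> B" using order_trans[OF norm_ge_zero B] .
        show "norm (grad f y \<bullet> h) \<le> B * norm h" for h
          using order_trans[OF Cauchy_Schwarz_ineq2 mult_right_mono[OF B[of y] norm_ge_zero[of h]]] by simp
      qed
    qed (use smooth_has_grad[OF sm] in auto)
    then show ?thesis by simp
  qed
  have D_bound: "\<bar>D n x\<bar> \<le> indicator K' x * (B * norm i)" for n x
  proof (cases "x \<in> K'")
    case True
    then show ?thesis using lip[of x "t n"] t[of n] by (simp add: D_def field_simps)
  next
    case False
    have "x + s *\<^sub>R i \<notin> K" if "0 \<le> s" "s \<le> 1" for s
    proof
      assume "x + s *\<^sub>R i \<in> K"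
      then have "x \<in> K'" unfolding K'_def by (rule rev_image_eqI[OF SigmaI[of _ _ s]]) (use that in auto)
      with False show False by simp
    qed
    from this[of 0] this[of "t n"] have "f x = 0" "f (x + t n *\<^sub>R i) = 0"
      using K(2) t[of n] by (auto simp: less_imp_le)
    then show ?thesis using False by (simp add: D_def)
  qed
  have "(\<lambda>n. \<integral>x. D n x \<partial>lborel) \<longlonglongrightarrow> (\<integral>x. grad f x \<bullet> i \<partial>lborel)"
  proof (rule integral_dominated_convergence[where w="\<lambda>x. indicator K' x * (B * norm i)"])
    show "(\<lambda>x. grad f x \<bullet> i) \<in> borel_measurable lborel" "D n \<in> borel_measurable lborel" for n
      using meas by (auto simp: D_def[abs_def])
    show "integrable lborel (\<lambda>x. indicator K' x * (B * norm i))"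
      using emeasure_compact_finite[OF K'] K' by (intro integrable_mult_left integrable_real_indicator) (auto simp: compact_imp_closed)
    have "(\<lambda>n. D n x) \<longlonglongrightarrow> grad f x \<bullet> i" for x
    proof -
      have "((\<lambda>s. f (x + s *\<^sub>R i)) has_derivative (\<lambda>s. grad f x \<bullet> (s *\<^sub>R i))) (at 0)"
        by (rule has_derivative_compose[of "\<lambda>s. x + s *\<^sub>R i", where g=f])
          (auto intro!: derivative_eq_intros smooth_has_grad[OF sm, of x])
      then have "((\<lambda>s. f (x + s *\<^sub>R i)) has_real_derivative grad f x \<bullet> i) (at 0)"
        by (simp add: has_field_derivative_def mult.commute[of _ "grad f x \<bullet> i"])
      then have "((\<lambda>s. (f (x + s *\<^sub>R i) - f x) / s) \<longlongrightarrow> grad f x \<bullet> i) (at 0)"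
        by (simp add: DERIV_def)
      moreover have "filterlim t (at 0) sequentially"
        unfolding filterlim_at t_def using LIMSEQ_inverse_real_of_nat by auto
      ultimately show ?thesis unfolding D_def by (rule filterlim_compose)
    qed
    then show "AE x in lborel. (\<lambda>n. D n x) \<longlonglongrightarrow> grad f x \<bullet> i" by simp
    show "AE x in lborel. norm (D n x) \<le> indicator K' x * (B * norm i)" for n
      using D_bound by auto
  qed
  moreover have "(\<integral>x. D n x \<partial>lborel) = 0" for n
  proof -
    have int: "integrable lborel f"
      by (rule integrable_lborel_compact_support[OF cont(1) K(1,2)])
    have eq: "(\<integral>x. f (t n *\<^sub>R i + x) \<partial>lborel) = (\<integral>x. f x \<partial>lborel)"
      "integrable lborel (\<lambda>x. f (t n *\<^sub>R i + x))"
      using int meas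
        integral_distr[of "(+) (t n *\<^sub>R i)" lborel borel f] integrable_distr_eq[of "(+) (t n *\<^sub>R i)" lborel borel f]
      by (auto simp: lborel_distr_plus)
    then show ?thesis using int by (simp add: D_def add.commute[of _ "t n *\<^sub>R i"])
  qed
  ultimately show ?thesis by (simp add: LIMSEQ_const_iff)
qed

text \<open>The product of two test functions is a test function, so its partial derivatives
  integrate to 0, and the product rule splits that integral into the two sides.\<close>

lemma weak_grad_test_fun:
  assumes "open \<Omega>" "test_fun \<Omega> u"
  shows "weak_grad \<Omega> u (grad u)"
  unfolding weak_grad_def
proof (intro allI impI ballI)
  fix \<phi> and i :: 'a assume \<phi>: "test_fun \<Omega> \<phi>" and i: "i \<in> Basis"
  note sm = test_fun_smooth[OF assms(2)] test_fun_smooth[OF \<phi>]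
  obtain K where K: "compact K" "K \<subseteq> \<Omega>" "\<And>x. x \<notin> K \<Longrightarrow> u x = 0" "\<And>x. x \<notin> K \<Longrightarrow> grad u x = 0"
    using assms(2) test_fun_supportE by metis
  note cont = smooth_continuous[OF sm(1)] smooth_continuous[OF sm(2)]
    smooth_continuous_grad[OF sm(1)] smooth_continuous_grad[OF sm(2)]
  let ?f = "\<lambda>x. u x * (grad \<phi> x \<bullet> i)" and ?g = "\<lambda>x. (grad u x \<bullet> i) * \<phi> x"
  have c: "continuous_on UNIV ?f" "continuous_on UNIV ?g"
    by (intro continuous_intros cont)+
  have int: "integrable lborel ?f" "integrable lborel ?g"
    using K by (auto intro!: integrable_lborel_compact_support c)
  have m: "?f \<in> borel_measurable borel" "?g \<in> borel_measurable borel"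
    using c by (auto intro: borel_measurable_continuous_onI)
  have z: "?f x = 0" "?g x = 0" if "x \<notin> \<Omega>" for x
  proof -
    have "x \<notin> K" using that K(2) by blast
    then show "?f x = 0" "?g x = 0" using K(3,4) by simp_all
  qed
  have "(\<integral>x. ?f x + ?g x \<partial>lborel) = 0"
    using integral_partial_eq_0[OF test_fun_mult[OF assms(2) sm(2)], of i]
    by (simp add: grad_mult[OF sm] inner_add_left mult.commute[of "\<phi> _"])
  then have "(\<integral>x. ?f x \<partial>lborel) = - (\<integral>x. ?g x \<partial>lborel)"
    using int by simp
  then show "integrable (lebesgue_on \<Omega>) (\<lambda>x. u x * frechet_derivative \<phi> (at x) i) \<and>
      integrable (lebesgue_on \<Omega>) (\<lambda>x. (grad u x \<bullet> i) * \<phi> x) \<and>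
      (\<integral>x. u x * frechet_derivative \<phi> (at x) i \<partial>lebesgue_on \<Omega>)
        = - (\<integral>x. (grad u x \<bullet> i) * \<phi> x \<partial>lebesgue_on \<Omega>)"
    unfolding grad_inner[OF i, symmetric]
    using integrable_lebesgue_on_iff_lborel[OF assms(1) m(1) z(1)] integral_lebesgue_on_eq_lborel[OF assms(1) m(1) z(1)]
      integrable_lebesgue_on_iff_lborel[OF assms(1) m(2) z(2)] integral_lebesgue_on_eq_lborel[OF assms(1) m(2) z(2)] int
    by simp
qed

section \<open>The fundamental lemma of the calculus of variations and uniqueness of weak
  gradients\<close>

lemma integral_boxes_zero_imp_AE_zero:
  fixes w :: "'a::euclidean_space \<Rightarrow> real"
  assumes w: "integrable lebesgue w"
    and box: "\<And>a b. (\<integral>x. indicator (box a b) x * w x \<partial>lebesgue) = 0"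
  shows "AE x in lebesgue. w x = 0"
proof -
  have wm: "w \<in> borel_measurable lebesgue" using w by simp
  have w': "set_integrable lebesgue E w" if "E \<in> sets borel" for E
    using that w unfolding set_integrable_def by (intro integrable_mult_indicator) auto
  let ?B = "range (\<lambda>(a, b). box a b :: 'a set)"
  \<comment> \<open>Boxes are an intersection-stable generator of the Borel sets, so the vanishing
    of the integral over boxes spreads to all Borel sets by a Dynkin system argument.\<close>
  have *: "(LINT x:E|lebesgue. w x) = 0" if "E \<in> sigma_sets UNIV ?B" for E
  proof -
    have "Int_stable ?B" by (auto simp: Int_stable_def box_Int_box)
    moreover have "?B \<subseteq> Pow UNIV" by auto
    ultimately show ?thesis using that
    proof (induction rule: sigma_sets_induct_disjoint)
      case (basic A)
      then show ?case using box by (auto simp: set_lebesgue_integral_def)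
    next
      case empty
      then show ?case by (simp add: set_lebesgue_integral_def)
    next
      case (compl A)
      \<comment> \<open>Complements require the integral over the whole space, which is exhausted by
        the boxes with all coordinates in (-n, n).\<close>
      have UN: "(LINT x|lebesgue. w x) = 0"
      proof -
        have "(\<lambda>n. \<integral>x. indicator (box (- real n *\<^sub>R One) (real n *\<^sub>R One)) x * w x \<partial>lebesgue) \<longlonglongrightarrow> (\<integral>x. w x \<partial>lebesgue)"
        proof (rule integral_dominated_convergence[where w="\<lambda>x. \<bar>w x\<bar>"])
          show "AE x in lebesgue. (\<lambda>n. indicator (box (- real n *\<^sub>R One) (real n *\<^sub>R One)) x * w x) \<longlonglongrightarrow> w x"
          proof (rule AE_I2, rule tendsto_eventually)
            fix x :: 'a
            obtain N :: nat where N: "norm x < real N" using reals_Archimedean2 by blast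
            have "x \<in> box (- real n *\<^sub>R One) (real n *\<^sub>R One)" if "n \<ge> N" for n
              unfolding mem_box
            proof
              fix i :: 'a assume i: "i \<in> Basis"
              have "\<bar>x \<bullet> i\<bar> < real n" using Basis_le_norm[OF i, of x] N that by (simp add: inner_commute)
              then show "- real n *\<^sub>R One \<bullet> i < x \<bullet> i \<and> x \<bullet> i < real n *\<^sub>R One \<bullet> i"
                using i by (auto simp: inner_sum_left inner_Basis)
            qed
            then show "\<forall>\<^sub>F n in sequentially. indicator (box (- real n *\<^sub>R One) (real n *\<^sub>R One)) x * w x = w x"
              by (auto simp: eventually_sequentially intro!: exI[of _ N])
          qed
          show "(\<lambda>x. indicator (box (- real n *\<^sub>R One) (real n *\<^sub>R One)) x * w x) \<in> borel_measurable lebesgue" for n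
            using wm by (intro borel_measurable_times borel_measurable_indicator) auto
        qed (use w wm in \<open>auto simp: indicator_def\<close>)
        then show ?thesis using box by (simp add: LIMSEQ_const_iff)
      qed
      have "A \<in> sets borel" using compl by (simp add: borel_eq_box)
      then have "(LINT x:A \<union> (UNIV - A)|lebesgue. w x) = (LINT x:A|lebesgue. w x) + (LINT x:UNIV - A|lebesgue. w x)"
        by (intro set_integral_Un w') auto
      also have "A \<union> (UNIV - A) = UNIV" by auto
      finally show ?case using UN compl.IH by (simp add: set_lebesgue_integral_def)
    next
      case (union F)
      have F: "F i \<in> sets borel" for i
        using union.hyps(2) unfolding borel_eq_box by auto
      have "(LINT x:(\<Union>i. F i)|lebesgue. w x) = (\<Sum>i. (LINT x:(F i)|lebesgue. w x))"
        using union.hyps(1) F by (intro lebesgue_integral_countable_add w') (auto simp: disjoint_family_on_def)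
      then show ?case using union.IH by simp
    qed
  qed
  \<comment> \<open>The sets {w > 0} and {w < 0} are only Lebesgue measurable; with a Borel
    representative v they become Borel, and the vanishing just proved applies to them.\<close>
  obtain v where v: "v \<in> borel_measurable lborel" "AE x in lborel. w x = v x"
    using completion_ex_borel_measurable_real[of w lborel] w by auto
  have ae: "AE x in lebesgue. w x = v x" using v(2) by (simp add: AE_completion_iff)
  have vi: "integrable lborel v"
    using w ae v(1) integrable_cong_AE[OF wm _ ae] by (simp add: integrable_completion measurable_completion)
  have "AE x in lborel. s * v x \<le> 0" if "s = 1 \<or> s = -1" for s :: real
  proof -
    let ?E = "{x. 0 < s * v x}"
    have E: "?E \<in> sets borel" using v(1) by measurable
    have "(LINT x:?E|lebesgue. w x) = 0"
      using * E by (simp add: borel_eq_box)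
    moreover have "(LINT x:?E|lebesgue. w x) = (LINT x:?E|lebesgue. v x)"
      unfolding set_lebesgue_integral_def
    proof (rule integral_cong_AE)
      have E': "?E \<in> sets lebesgue" using E by simp
      show "(\<lambda>x. indicator ?E x *\<^sub>R w x) \<in> borel_measurable lebesgue"
        "(\<lambda>x. indicator ?E x *\<^sub>R v x) \<in> borel_measurable lebesgue"
        using wm v(1) E' by (intro borel_measurable_scaleR borel_measurable_indicator; simp add: measurable_completion)+
      show "AE x in lebesgue. indicat_real ?E x *\<^sub>R w x = indicat_real ?E x *\<^sub>R v x"
        using ae by eventually_elim simp
    qed
    moreover have "(LINT x:?E|lebesgue. v x) = (LINT x:?E|lborel. v x)"
      unfolding set_lebesgue_integral_def
      using v(1) E by (intro integral_completion) simp
    ultimately have "s * (\<integral>x. indicator ?E x * v x \<partial>lborel) = 0"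
      by (simp add: set_lebesgue_integral_def)
    also have "s * (\<integral>x. indicator ?E x * v x \<partial>lborel) = (\<integral>x. indicator ?E x * (s * v x) \<partial>lborel)"
      by (subst integral_mult_right_zero[symmetric]) (simp only: mult.left_commute)
    finally have 0: "(\<integral>x. indicator ?E x * (s * v x) \<partial>lborel) = 0" .
    have "integrable lborel (\<lambda>x. indicator ?E x * (s * v x))"
      using integrable_mult_indicator[of ?E lborel "\<lambda>x. s * v x"] vi E by simp
    then have "AE x in lborel. indicator ?E x * (s * v x) = 0"
      using 0 by (intro integral_nonneg_eq_0_iff_AE[THEN iffD1]) (auto simp: indicator_def)
    then show ?thesis by eventually_elim (auto simp: indicator_def split: if_splits)
  qed
  note this[OF disjI1[OF refl]] this[OF disjI2[OF refl]]
  with v(2) have "AE x in lborel. w x = 0"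
    by eventually_elim linarith
  then show ?thesis by (simp add: AE_completion_iff)
qed

text \<open>Integrability of f is known only against test functions, so f is first multiplied by the
  bump of a closed box inside \<Omega>, which gives an integrable w. Multiplying further by the
  smooth functions \<open>h n\<close> stays within test functions and yields all box integrals of w
  in the limit. The bump is positive on the open box, so f vanishes there almost everywhere;
  countably many closed boxes, with null boundaries, cover \<Omega>.\<close>

lemma fundamental_lemma:
  fixes f :: "'a::euclidean_space \<Rightarrow> real"
  assumes "open \<Omega>"
    and int: "\<And>\<phi>. test_fun \<Omega> \<phi> \<Longrightarrow> integrable (lebesgue_on \<Omega>) (\<lambda>x. f x * \<phi> x)"
    and zero: "\<And>\<phi>. test_fun \<Omega> \<phi> \<Longrightarrow> (\<integral>x. f x * \<phi> x \<partial>lebesgue_on \<Omega>) = 0"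
  shows "AE x in lebesgue_on \<Omega>. f x = 0"
proof -
  have \<Omega>: "\<Omega> \<inter> space lebesgue \<in> sets lebesgue" using assms(1) by auto
  obtain D where D: "countable D" "\<And>X. X \<in> D \<Longrightarrow> X \<subseteq> \<Omega> \<and> (\<exists>a b. X = cbox a b)" "\<Union>D = \<Omega>"
    using open_countable_Union_open_cbox[OF assms(1)] by (metis PowD subsetD)
  have "AE x in lebesgue. x \<in> cbox a b \<longrightarrow> f x = 0" if ab: "cbox a b \<subseteq> \<Omega>" for a b
  proof -
    let ?\<beta> = "box_bump a b"
    define w where "w x = indicator \<Omega> x * (f x * ?\<beta> x)" for x
    note \<beta> = test_fun_box_bump[OF ab]
    have w: "integrable lebesgue w"
      using int[OF \<beta>] \<Omega> by (simp add: integrable_restrict_space w_def[abs_def])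
    have "(\<integral>x. indicator (box c d) x * w x \<partial>lebesgue) = 0" for c d
    proof -
      \<comment> \<open>With b the bump of the box (c, d), 1 - exp(-n b) is smooth, lies between 0
        and 1, vanishes off the box and tends to 1 inside it: a smooth approximation of the
        indicator.\<close>
      define h where "h n x = 1 - exp (- real n * box_bump c d x)" for n x
      have sm: "smooth (h n)" for n unfolding h_def
        by (intro smooth_diff smooth_const smooth_compose[OF smooth_exp] smooth_mult smooth_box_bump)
      have bump_nonneg: "0 \<le> box_bump c d x" for x
        using box_bump_pos[of x c d] box_bump_zero[of x c d] by (cases "x \<in> box c d") auto
      have h01: "0 \<le> h n x" "h n x \<le> 1" for n x
        using bump_nonneg by (auto simp: h_def)
      have "(\<lambda>n. \<integral>x. h n x * w x \<partial>lebesgue) \<longlonglongrightarrow> (\<integral>x. indicator (box c d) x * w x \<partial>lebesgue)"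
      proof (rule integral_dominated_convergence[where w="\<lambda>x. \<bar>w x\<bar>"])
        show "AE x in lebesgue. (\<lambda>n. h n x * w x) \<longlonglongrightarrow> indicator (box c d) x * w x"
        proof (rule AE_I2, rule tendsto_mult_right)
          fix x
          show "(\<lambda>n. h n x) \<longlonglongrightarrow> indicator (box c d) x"
          proof (cases "x \<in> box c d")
            case True
            have "(\<lambda>n. exp (- real n * box_bump c d x)) \<longlonglongrightarrow> 0"
              using box_bump_pos[OF True]
              by (intro filterlim_compose[OF exp_at_bot])
                (simp add: filterlim_uminus_at_bot filterlim_at_top_mult_tendsto_pos[OF tendsto_const] filterlim_real_sequentially mult.commute)
            from tendsto_diff[OF tendsto_const this, of 1] show ?thesis using True by (simp add: h_def)
          next
            case False
            then show ?thesis by (simp add: h_def box_bump_zero)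
          qed
        qed
        show "AE x in lebesgue. norm (h n x * w x) \<le> \<bar>w x\<bar>" for n
          using h01 by (auto simp: abs_mult intro!: mult_left_le_one_le)
        have "h n \<in> borel_measurable borel" for n
          using smooth_continuous[OF sm] by (rule borel_measurable_continuous_onI)
        then show "(\<lambda>x. h n x * w x) \<in> borel_measurable lebesgue" for n
          using w by (intro borel_measurable_times) (auto intro: measurable_completion)
      qed (use w in \<open>auto intro!: borel_measurable_times borel_measurable_indicator\<close>)
      moreover have "(\<integral>x. h n x * w x \<partial>lebesgue) = 0" for n
        using zero[OF test_fun_mult[OF \<beta> sm, of n]] \<Omega>
        by (simp add: integral_restrict_space w_def[abs_def] mult_ac)
      ultimately show ?thesis by (simp add: LIMSEQ_const_iff)
    qed
    from integral_boxes_zero_imp_AE_zero[OF w this] have "AE x in lebesgue. w x = 0" .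
    moreover have "AE x in lebesgue. x \<notin> cbox a b - box a b"
    proof -
      have "negligible (cbox a b - box a b)" by (rule negligible_frontier_interval)
      then have "cbox a b - box a b \<in> null_sets lebesgue" by (simp add: negligible_iff_null_sets)
      then show ?thesis by (rule AE_not_in)
    qed
    ultimately show ?thesis
    proof eventually_elim
      case (elim x)
      show ?case
      proof
        assume "x \<in> cbox a b"
        with elim have x: "x \<in> box a b" "x \<in> \<Omega>" using ab by auto
        show "f x = 0" using elim x box_bump_pos[OF x(1)] by (simp add: w_def)
      qed
    qed
  qed
  then have "AE x in lebesgue. x \<in> X \<longrightarrow> f x = 0" if "X \<in> D" for X
    using D(2)[OF that] by auto
  then have "AE x in lebesgue. \<forall>X\<in>D. x \<in> X \<longrightarrow> f x = 0"
    using D(1) by (subst AE_ball_countable) auto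
  then have "AE x in lebesgue. x \<in> \<Omega> \<longrightarrow> f x = 0"
    by eventually_elim (use D(3) in auto)
  then show ?thesis by (subst AE_restrict_space_iff[OF \<Omega>])
qed

lemma weak_grad_diff:
  assumes "weak_grad \<Omega> u g" "weak_grad \<Omega> v h"
  shows "weak_grad \<Omega> (\<lambda>x. u x - v x) (\<lambda>x. g x - h x)"
  using assms unfolding weak_grad_def by (simp add: inner_diff_left left_diff_distrib)

lemma weak_grad_AE_unique:
  assumes "open \<Omega>" "weak_grad \<Omega> u g" "weak_grad \<Omega> u h"
  shows "AE x in lebesgue_on \<Omega>. g x = h x"
proof -
  have "AE x in lebesgue_on \<Omega>. (g x - h x) \<bullet> i = 0" if i: "i \<in> Basis" for i
    by (rule fundamental_lemma[OF assms(1)])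
      (use i weak_grad_diff[OF assms(2,3)] in \<open>auto simp: weak_grad_def\<close>)
  then have "AE x in lebesgue_on \<Omega>. \<forall>i\<in>Basis. (g x - h x) \<bullet> i = 0"
    by (intro AE_finite_allI) auto
  then show ?thesis
    by eventually_elim (auto intro: euclidean_eqI simp: inner_diff_left)
qed

text \<open>Whichever weak gradient is exhibited, the arbitrary choice made by \<open>wgrad\<close>
  agrees with it almost everywhere; this is how \<open>wgrad\<close> is evaluated later.\<close>

lemma wgrad_AE_eq:
  assumes "open \<Omega>" "weak_grad \<Omega> u g"
  shows "AE x in lebesgue_on \<Omega>. wgrad \<Omega> u x = g x"
  unfolding wgrad_def by (rule weak_grad_AE_unique[OF assms(1) someI[of "weak_grad \<Omega> u", OF assms(2)] assms(2)])

section \<open>Convergence in L^p\<close>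

lemma powr_add_le:
  fixes a b :: real
  assumes "0 \<le> a" "0 \<le> b" "0 \<le> p"
  shows "(a + b) powr p \<le> 2 powr p * (a powr p + b powr p)"
proof -
  have "(a + b) powr p \<le> (2 * max a b) powr p"
    using assms by (intro powr_mono2) auto
  also have "\<dots> = 2 powr p * max a b powr p"
    using assms by (simp add: powr_mult)
  also have "\<dots> \<le> 2 powr p * (a powr p + b powr p)"
    by (intro mult_left_mono) (auto simp: max_def)
  finally show ?thesis .
qed

lemma norm_diff_powr_le:
  fixes x y :: "'b::real_normed_vector"
  assumes "0 \<le> p"
  shows "norm (x - y) powr p \<le> 2 powr p * (norm x powr p + norm y powr p)"
  by (rule order_trans[OF powr_mono2[OF assms norm_ge_zero norm_triangle_ineq4] powr_add_le[OF norm_ge_zero norm_ge_zero assms]])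

lemma norm_powr_le_diff:
  fixes x y :: "'b::real_normed_vector"
  assumes "0 \<le> p"
  shows "norm x powr p \<le> 2 powr p * (norm (x - y) powr p + norm y powr p)"
  using norm_diff_powr_le[OF assms, of "x - y" "- y"] by simp

lemma powr_le_1_add_powr:
  fixes t :: real
  assumes "0 \<le> t" "0 \<le> a" "a \<le> b"
  shows "t powr a \<le> 1 + t powr b"
proof (cases "t \<le> 1")
  case True
  then show ?thesis using powr_le1[of a t] assms by (smt (verit) powr_ge_zero)
next
  case False
  then have "t powr a \<le> t powr b" using assms by (intro powr_mono) auto
  then show ?thesis by simp
qed

text \<open>Split at y = \<delta> x: below it y is replaced by \<delta> x, above it x is replaced by
  y / \<delta>. The constants are not optimal, but the small weight can be put on either factor by
  the choice of \<delta>.\<close>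

lemma powr_conj_young:
  fixes x y :: real
  assumes "0 \<le> x" "0 \<le> y" "1 < p" "0 < \<delta>"
  shows "x powr (p - 1) * y \<le> \<delta> * x powr p + \<delta> powr (1 - p) * y powr p"
proof (cases "y \<le> \<delta> * x")
  case True
  have "x powr (p - 1) * y \<le> x powr (p - 1) * (\<delta> * x)"
    using True by (intro mult_left_mono) auto
  also have "\<dots> = \<delta> * x powr p"
    using assms by (cases "x = 0") (auto simp: powr_diff)
  also have "\<dots> \<le> \<delta> * x powr p + \<delta> powr (1 - p) * y powr p"
    by simp
  finally show ?thesis .
next
  case False
  have "0 \<le> \<delta> * x" using assms by simp
  with False have y: "0 < y" by linarith
  have x: "x \<le> y / \<delta>" using False assms(4) by (simp add: pos_le_divide_eq mult.commute)
  have "x powr (p - 1) * y \<le> (y / \<delta>) powr (p - 1) * y"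
    using assms x by (intro mult_right_mono powr_mono2) auto
  also have "\<dots> = \<delta> powr (1 - p) * y powr p"
  proof -
    have "y powr (p - 1) * y = y powr p" using y by (simp add: powr_diff)
    moreover have "\<delta> powr (1 - p) = 1 / \<delta> powr (p - 1)"
      using powr_minus_divide[of \<delta> "p - 1"] by simp
    ultimately show ?thesis using assms y by (simp add: powr_divide)
  qed
  also have "\<dots> \<le> \<delta> * x powr p + \<delta> powr (1 - p) * y powr p"
    using assms by simp
  finally show ?thesis .
qed

lemma powr_conj_young1:
  fixes x y :: real
  assumes "0 \<le> x" "0 \<le> y" "1 < p"
  shows "x powr (p - 1) * y \<le> x powr p + y powr p"
  using powr_conj_young[OF assms, of 1] by simp

section \<open>Subsequences, majorants and convergence of integrals\<close>

lemma eventually_subseq_ex: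
  assumes "\<And>n. eventually (P n) sequentially"
  obtains r :: "nat \<Rightarrow> nat" where "strict_mono r" "\<And>n. P n (r n)"
proof -
  obtain N where N: "\<And>n m. m \<ge> N n \<Longrightarrow> P n m"
    using assms unfolding eventually_sequentially by metis
  \<comment> \<open>The maximum with \<open>Suc k\<close> forces strict growth, the other argument
    puts the next index beyond its own threshold.\<close>
  define r where "r = rec_nat (N 0) (\<lambda>n k. max (N (Suc n)) (Suc k))"
  have r: "r 0 = N 0" "\<And>n. r (Suc n) = max (N (Suc n)) (Suc (r n))"
    by (simp_all add: r_def)
  show ?thesis
  proof
    show "strict_mono r" by (subst strict_mono_Suc_iff) (simp add: r less_max_iff_disj)
    show "P n (r n)" for n by (rule N) (cases n, auto simp: r)
  qed
qed

lemma AE_summable_integrable_suminf: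
  fixes F :: "nat \<Rightarrow> 'b \<Rightarrow> real"
  assumes F: "\<And>n. integrable M (F n)" "\<And>n x. 0 \<le> F n x" and s: "summable (\<lambda>n. \<integral>x. F n x \<partial>M)"
  shows "AE x in M. summable (\<lambda>n. F n x)" "integrable M (\<lambda>x. \<Sum>n. F n x)"
proof -
  have "(\<integral>\<^sup>+x. (\<Sum>n. ennreal (F n x)) \<partial>M) = (\<Sum>n. \<integral>\<^sup>+x. ennreal (F n x) \<partial>M)"
    using F by (intro nn_integral_suminf) auto
  also have "\<dots> = (\<Sum>n. ennreal (\<integral>x. F n x \<partial>M))"
    using F by (intro suminf_cong nn_integral_eq_integral) auto
  also have "\<dots> = ennreal (\<Sum>n. \<integral>x. F n x \<partial>M)"
    using F by (intro suminf_ennreal2 s) auto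
  finally have "(\<integral>\<^sup>+x. (\<Sum>n. ennreal (F n x)) \<partial>M) \<noteq> \<infinity>" by simp
  then have "AE x in M. (\<Sum>n. ennreal (F n x)) \<noteq> \<infinity>"
    using F by (intro nn_integral_PInf_AE) auto
  then show 1: "AE x in M. summable (\<lambda>n. F n x)"
    by eventually_elim (use F(2) in \<open>auto intro: summable_suminf_not_top\<close>)
  show "integrable M (\<lambda>x. \<Sum>n. F n x)"
    using 1 s F by (intro integrable_suminf) auto
qed

text \<open>The majorant is imposed on the p-th powers, so that it controls the sequence and its
  limit alike. The bound |a - b|^p \<le> 2^p (|a|^p + |b|^p) holds for every p > 0 and takes the
  place of Minkowski's inequality, here and below.\<close>

lemma Lp_dominated_convergence:
  fixes f :: "nat \<Rightarrow> 'b \<Rightarrow> 'c::euclidean_space"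
  assumes p: "0 < p"
    and m: "\<And>n. f n \<in> borel_measurable M" "f' \<in> borel_measurable M"
    and W: "integrable M W" "\<And>n. AE x in M. norm (f n x) powr p \<le> W x"
    and lim: "AE x in M. (\<lambda>n. f n x) \<longlonglongrightarrow> f' x"
  shows "integrable M (\<lambda>x. norm (f' x) powr p)" "\<And>n. integrable M (\<lambda>x. norm (f n x - f' x) powr p)"
    "(\<lambda>n. \<integral>x. norm (f n x - f' x) powr p \<partial>M) \<longlonglongrightarrow> 0"
    "AE x in M. norm (f' x) powr p \<le> W x"
proof -
  have "AE x in M. \<forall>n. norm (f n x) powr p \<le> W x"
    using W(2) by (simp add: AE_all_countable)
  with lim show b: "AE x in M. norm (f' x) powr p \<le> W x"
  proof eventually_elim
    case (elim x)
    have "(\<lambda>n. norm (f n x) powr p) \<longlonglongrightarrow> norm (f' x) powr p"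
      using elim(1) p by (intro tendsto_powr' tendsto_norm tendsto_const) auto
    then show ?case by (rule LIMSEQ_le_const2) (use elim in auto)
  qed
  show "integrable M (\<lambda>x. norm (f' x) powr p)"
    by (rule Bochner_Integration.integrable_bound[OF W(1)]) (use b m in auto)
  have d: "AE x in M. norm (norm (f n x - f' x) powr p) \<le> 2 powr p * (2 * W x)" for n
    using W(2)[of n] b
  proof eventually_elim
    case (elim x)
    have "norm (f n x - f' x) powr p \<le> 2 powr p * (norm (f n x) powr p + norm (f' x) powr p)"
      using p by (intro norm_diff_powr_le) simp
    also have "\<dots> \<le> 2 powr p * (2 * W x)" using elim by (intro mult_left_mono) auto
    finally show ?case by simp
  qed
  have W2: "integrable M (\<lambda>x. 2 powr p * (2 * W x))" using W(1) by simp
  show "integrable M (\<lambda>x. norm (f n x - f' x) powr p)" for n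
    by (rule Bochner_Integration.integrable_bound[OF W2]) (use d[of n] m in auto)
  have "(\<lambda>n. \<integral>x. norm (f n x - f' x) powr p \<partial>M) \<longlonglongrightarrow> (\<integral>x. 0 \<partial>M)"
  proof (rule integral_dominated_convergence[OF _ _ W2 _ d])
    show "AE x in M. (\<lambda>n. norm (f n x - f' x) powr p) \<longlonglongrightarrow> 0"
      using lim
    proof eventually_elim
      case (elim x)
      have "(\<lambda>n. norm (f n x - f' x)) \<longlonglongrightarrow> 0"
        using elim by (simp add: tendsto_norm_zero LIM_zero)
      then show ?case using p by (intro tendsto_zero_powrI[OF _ tendsto_const]) auto
    qed
  qed (use m in auto)
  then show "(\<lambda>n. \<integral>x. norm (f n x - f' x) powr p \<partial>M) \<longlonglongrightarrow> 0" by simp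
qed

lemma integral_powr_Fatou:
  fixes f :: "nat \<Rightarrow> 'b \<Rightarrow> 'c::euclidean_space"
  assumes r: "0 < r" and m: "\<And>n. f n \<in> borel_measurable M" "f' \<in> borel_measurable M"
    and i: "\<And>n. integrable M (\<lambda>x. norm (f n x) powr r)" "\<And>n. (\<integral>x. norm (f n x) powr r \<partial>M) \<le> C"
    and lim: "AE x in M. (\<lambda>n. f n x) \<longlonglongrightarrow> f' x"
  shows "integrable M (\<lambda>x. norm (f' x) powr r)" "(\<integral>x. norm (f' x) powr r \<partial>M) \<le> C"
proof -
  have C: "0 \<le> C" by (rule order_trans[OF integral_nonneg_AE i(2)[of 0]]) simp
  have "(\<integral>\<^sup>+x. ennreal (norm (f' x) powr r) \<partial>M) = (\<integral>\<^sup>+x. liminf (\<lambda>n. ennreal (norm (f n x) powr r)) \<partial>M)"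
  proof (rule nn_integral_cong_AE)
    show "AE x in M. ennreal (norm (f' x) powr r) = liminf (\<lambda>n. ennreal (norm (f n x) powr r))"
      using lim
    proof eventually_elim
      case (elim x)
      have "(\<lambda>n. ennreal (norm (f n x) powr r)) \<longlonglongrightarrow> ennreal (norm (f' x) powr r)"
        using elim r by (intro tendsto_ennrealI tendsto_powr' tendsto_norm tendsto_const) auto
      then show ?case by (intro lim_imp_Liminf[symmetric]) auto
    qed
  qed
  also have "\<dots> \<le> liminf (\<lambda>n. \<integral>\<^sup>+x. ennreal (norm (f n x) powr r) \<partial>M)"
    by (rule nn_integral_liminf) (use m in simp)
  also have "\<dots> \<le> liminf (\<lambda>n. ennreal C)"
    by (rule Liminf_mono, rule always_eventually)
      (use i in \<open>auto simp: nn_integral_eq_integral intro!: ennreal_leI\<close>)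
  also have "\<dots> = ennreal C" by (simp add: Liminf_const)
  finally have fin: "(\<integral>\<^sup>+x. ennreal (norm (f' x) powr r) \<partial>M) \<le> ennreal C" .
  show i': "integrable M (\<lambda>x. norm (f' x) powr r)"
  proof (rule integrableI_bounded)
    show "(\<integral>\<^sup>+x. ennreal (norm (norm (f' x) powr r)) \<partial>M) < \<infinity>"
      using le_less_trans[OF fin] by simp
  qed (use m in simp)
  have "ennreal (\<integral>x. norm (f' x) powr r \<partial>M) \<le> ennreal C"
    using fin nn_integral_eq_integral[OF i'] by simp
  then show "(\<integral>x. norm (f' x) powr r \<partial>M) \<le> C"
    using C by (subst (asm) ennreal_le_iff) auto
qed

text \<open>The converse of dominated convergence, up to a subsequence: once the errors are below
  2^-n, their sum is integrable and supplies the majorant, and its summands tend to 0 almost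
  everywhere.\<close>

lemma Lp_tendsto_imp_dominated_subseq:
  fixes f :: "nat \<Rightarrow> 'b \<Rightarrow> 'c::euclidean_space"
  assumes p: "0 < p"
    and m: "\<And>n. f n \<in> borel_measurable M" "f' \<in> borel_measurable M"
    and i: "integrable M (\<lambda>x. norm (f' x) powr p)" "\<And>n. integrable M (\<lambda>x. norm (f n x - f' x) powr p)"
    and lim: "(\<lambda>n. \<integral>x. norm (f n x - f' x) powr p \<partial>M) \<longlonglongrightarrow> 0"
  obtains r W where "strict_mono r" "integrable M W" "\<And>n. AE x in M. norm (f (r n) x) powr p \<le> W x"
    "AE x in M. (\<lambda>n. f (r n) x) \<longlonglongrightarrow> f' x"
proof -
  have "eventually (\<lambda>m. (\<integral>x. norm (f m x - f' x) powr p \<partial>M) < (1/2) ^ n) sequentially" for n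
    using lim by (rule order_tendstoD) simp
  then obtain r where r: "strict_mono r" "\<And>n. (\<integral>x. norm (f (r n) x - f' x) powr p \<partial>M) < (1/2) ^ n"
    using eventually_subseq_ex[of "\<lambda>n m. (\<integral>x. norm (f m x - f' x) powr p \<partial>M) < (1/2) ^ n"] by blast
  define F where "F n x = norm (f (r n) x - f' x) powr p" for n x
  have s: "summable (\<lambda>n. \<integral>x. F n x \<partial>M)"
    by (rule summable_comparison_test'[OF summable_geometric[of "1/2"]])
      (use r(2) in \<open>auto simp: F_def intro!: less_imp_le\<close>)
  have F: "integrable M (F n)" "0 \<le> F n x" for n x
    using i(2) by (auto simp: F_def[abs_def])
  note S = AE_summable_integrable_suminf[of M F, OF F s]
  define W where "W x = 2 powr p * ((\<Sum>n. F n x) + norm (f' x) powr p)" for x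
  show ?thesis
  proof
    show "integrable M W" unfolding W_def using S(2) i(1) by simp
    show "AE x in M. norm (f (r n) x) powr p \<le> W x" for n
      using S(1)
    proof eventually_elim
      case (elim x)
      have "F n x \<le> (\<Sum>n. F n x)"
        using sum_le_suminf[OF elim, of "{n}"] F(2) by simp
      then have "2 powr p * (F n x + norm (f' x) powr p) \<le> W x"
        unfolding W_def by (intro mult_left_mono) auto
      moreover have "norm (f (r n) x) powr p \<le> 2 powr p * (F n x + norm (f' x) powr p)"
        unfolding F_def using p by (intro norm_powr_le_diff) simp
      ultimately show ?case by simp
    qed
    show "AE x in M. (\<lambda>n. f (r n) x) \<longlonglongrightarrow> f' x"
      using S(1)
    proof eventually_elim
      case (elim x)
      then have "(\<lambda>n. F n x) \<longlonglongrightarrow> 0" by (rule summable_LIMSEQ_zero)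
      then have "(\<lambda>n. F n x powr (1/p)) \<longlonglongrightarrow> 0"
        using p F(2) by (intro tendsto_zero_powrI[OF _ tendsto_const]) auto
      then have "(\<lambda>n. norm (f (r n) x - f' x)) \<longlonglongrightarrow> 0"
        using p by (simp add: F_def powr_powr)
      then show ?case by (simp add: LIM_zero_iff tendsto_norm_zero_iff)
    qed
  qed (rule r)
qed

text \<open>Completeness of L^p together with a common majorant for the p-th powers; applied to the
  u_n themselves, that majorant later dominates the coupling terms.\<close>

lemma Lp_Cauchy_imp_dominated_subseq:
  fixes f :: "nat \<Rightarrow> 'b \<Rightarrow> 'c::euclidean_space"
  assumes p: "0 < p"
    and m: "\<And>n. f n \<in> borel_measurable M"
    and i: "\<And>n. integrable M (\<lambda>x. norm (f n x) powr p)"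
    and C: "\<And>e. 0 < e \<Longrightarrow> \<exists>N. \<forall>m\<ge>N. \<forall>n\<ge>N. (\<integral>x. norm (f m x - f n x) powr p \<partial>M) < e"
  obtains r W f' where "strict_mono r" "integrable M W" "\<And>n. AE x in M. norm (f (r n) x) powr p \<le> W x"
    "f' \<in> borel_measurable M" "AE x in M. (\<lambda>n. f (r n) x) \<longlonglongrightarrow> f' x"
proof -
  \<comment> \<open>The divisor (2^n)^p leaves room for the weights in F. The sum V of (2^n)^p |d
    n|^p is then still integrable, so that |d n| \<le> 2^-n V^(1/p) pointwise, and the telescoping
    series is bounded by 2 V^(1/p).\<close>
  define e where "e n = (1/2) ^ n / (2 ^ n) powr p" for n :: nat
  have e: "0 < e n" for n by (simp add: e_def)
  have "eventually (\<lambda>m. \<forall>k\<ge>m. (\<integral>x. norm (f k x - f m x) powr p \<partial>M) < e n) sequentially" for n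
    using C[OF e[of n]] unfolding eventually_sequentially by (meson order_trans)
  then obtain r where r: "strict_mono r" "\<And>n k. k \<ge> r n \<Longrightarrow> (\<integral>x. norm (f k x - f (r n) x) powr p \<partial>M) < e n"
    using eventually_subseq_ex[of "\<lambda>n m. \<forall>k\<ge>m. (\<integral>x. norm (f k x - f m x) powr p \<partial>M) < e n"] by blast
  define d where "d n x = f (r (Suc n)) x - f (r n) x" for n x
  define F where "F n x = (2 ^ n) powr p * norm (d n x) powr p" for n x
  have di: "integrable M (\<lambda>x. norm (d n x) powr p)" for n
  proof (rule Bochner_Integration.integrable_bound)
    show "integrable M (\<lambda>x. 2 powr p * (norm (f (r (Suc n)) x) powr p + norm (f (r n) x) powr p))"
      using i by simp
    show "AE x in M. norm (norm (d n x) powr p)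
        \<le> norm (2 powr p * (norm (f (r (Suc n)) x) powr p + norm (f (r n) x) powr p))"
      unfolding d_def using norm_diff_powr_le[of p] p by (intro AE_I2) simp
  qed (use m in \<open>auto simp: d_def\<close>)
  have F: "integrable M (F n)" "0 \<le> F n x" for n x
    using di by (auto simp: F_def[abs_def])
  have s: "summable (\<lambda>n. \<integral>x. F n x \<partial>M)"
  proof (rule summable_comparison_test'[OF summable_geometric[of "1/2"]])
    fix n :: nat
    have "(\<integral>x. F n x \<partial>M) = (2 ^ n) powr p * (\<integral>x. norm (d n x) powr p \<partial>M)"
      by (simp add: F_def)
    also have "\<dots> \<le> (2 ^ n) powr p * e n"
      using r(2)[of n "r (Suc n)"] strict_monoD[OF r(1), of n "Suc n"]
      by (intro mult_left_mono) (auto simp: d_def)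
    also have "\<dots> = (1/2) ^ n" by (simp add: e_def)
    finally show "norm (\<integral>x. F n x \<partial>M) \<le> (1/2) ^ n"
      using F by (simp add: integral_nonneg_AE)
  qed simp
  note S = AE_summable_integrable_suminf[of M F, OF F s]
  define V where "V x = (\<Sum>n. F n x)" for x
  have V0: "AE x in M. \<forall>n. norm (d n x) \<le> (1/2) ^ n * V x powr (1/p)"
    using S(1)
  proof eventually_elim
    case (elim x)
    show ?case
    proof
      fix n
      have "F n x \<le> V x"
        unfolding V_def using sum_le_suminf[OF elim, of "{n}"] F(2) by simp
      then have "F n x powr (1/p) \<le> V x powr (1/p)"
        using p F(2) by (intro powr_mono2) auto
      moreover have "F n x powr (1/p) = 2 ^ n * norm (d n x)"
        using p by (simp add: F_def powr_mult powr_powr)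
      ultimately show "norm (d n x) \<le> (1/2) ^ n * V x powr (1/p)"
        by (simp add: field_simps power_divide)
    qed
  qed
  define W where "W x = 2 powr p * (norm (f (r 0) x) powr p + 2 powr p * V x)" for x
  have tele: "f (r n) x = f (r 0) x + (\<Sum>k<n. d k x)" for n x
    by (induction n) (auto simp: d_def)
  show ?thesis
  proof
    show "integrable M W" unfolding W_def V_def using S(2) i by simp
    show "AE x in M. norm (f (r n) x) powr p \<le> W x" for n
      using V0 S(1)
    proof eventually_elim
      case (elim x)
      have V: "0 \<le> V x" unfolding V_def using F(2) elim(2) by (intro suminf_nonneg) auto
      have "norm (\<Sum>k<n. d k x) \<le> (\<Sum>k<n. (1/2) ^ k * V x powr (1/p))"
        using elim by (intro sum_norm_le) auto
      also have "\<dots> = (\<Sum>k<n. (1/2) ^ k) * V x powr (1/p)" by (simp add: sum_distrib_right)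
      also have "\<dots> \<le> 2 * V x powr (1/p)"
      proof (intro mult_right_mono)
        have "(\<Sum>k<n. (1/2) ^ k) = 2 - 2 * (1/2 :: real) ^ n" by (induction n) auto
        then show "(\<Sum>k<n. (1/2) ^ k) \<le> (2::real)" by simp
      qed simp
      finally have "norm (\<Sum>k<n. d k x) powr p \<le> (2 * V x powr (1/p)) powr p"
        using p by (intro powr_mono2) auto
      also have "\<dots> = 2 powr p * V x" using p V by (simp add: powr_mult powr_powr)
      finally have 1: "norm (\<Sum>k<n. d k x) powr p \<le> 2 powr p * V x" .
      have "norm (f (r n) x) powr p \<le> 2 powr p * (norm (f (r 0) x) powr p + norm (\<Sum>k<n. d k x) powr p)"
        using norm_powr_le_diff[of p "f (r n) x" "\<Sum>k<n. d k x"] p by (simp add: tele[of n])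
      also have "\<dots> \<le> W x" unfolding W_def using 1 by (intro mult_left_mono) auto
      finally show ?case .
    qed
    show "(\<lambda>x. lim (\<lambda>n. f (r n) x)) \<in> borel_measurable M"
      using m by (intro borel_measurable_lim_metric) auto
    show "AE x in M. (\<lambda>n. f (r n) x) \<longlonglongrightarrow> lim (\<lambda>n. f (r n) x)"
      using V0
    proof eventually_elim
      case (elim x)
      have "summable (\<lambda>n. (1/2) ^ n * V x powr (1/p))"
        by (intro summable_mult2 summable_geometric) simp
      then have "summable (\<lambda>n. d n x)"
        by (rule summable_comparison_test'[where N=0]) (use elim in auto)
      then have "convergent (\<lambda>n. f (r 0) x + (\<Sum>k<n. d k x))"
        by (intro convergent_add convergent_const) (simp add: summable_iff_convergent)
      then show ?case by (simp add: tele[symmetric] convergent_LIMSEQ_iff)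
    qed
  qed (rule r)
qed

text \<open>A form of Vitali's theorem. F n need not be dominated, but it is so up to an arbitrarily
  small multiple of Q n, which is bounded in L^1. This is the situation of |grad u_n|^(p-1) paired
  with a fixed L^p function, after Young's inequality.\<close>

lemma integral_convergence_uniformly_small:
  fixes F :: "nat \<Rightarrow> 'b \<Rightarrow> real"
  assumes m: "\<And>n. F n \<in> borel_measurable M" "integrable M F'"
    and lim: "AE x in M. (\<lambda>n. F n x) \<longlonglongrightarrow> F' x"
    and Q: "\<And>n. integrable M (Q n)" "\<And>n x. 0 \<le> Q n x" "\<And>n. (\<integral>x. Q n x \<partial>M) \<le> B"
    and D: "\<And>\<delta>. 0 < \<delta> \<Longrightarrow> \<exists>D. integrable M D \<and> (\<forall>n. AE x in M. \<bar>F n x\<bar> \<le> \<delta> * Q n x + D x)"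
  shows "\<And>n. integrable M (F n)" "(\<lambda>n. \<integral>x. F n x \<partial>M) \<longlonglongrightarrow> (\<integral>x. F' x \<partial>M)"
proof -
  show int: "integrable M (F n)" for n
  proof -
    obtain D where "integrable M D" "AE x in M. \<bar>F n x\<bar> \<le> 1 * Q n x + D x"
      using D[of 1] by auto
    then show ?thesis using m Q(1)
      by (intro Bochner_Integration.integrable_bound[of M "\<lambda>x. 1 * Q n x + D x" "F n"]) auto
  qed
  have B: "0 \<le> B" using Q(3)[of 0] Q(2) by (smt (verit) integral_nonneg_AE AE_I2)
  show "(\<lambda>n. \<integral>x. F n x \<partial>M) \<longlonglongrightarrow> (\<integral>x. F' x \<partial>M)"
  proof (rule LIMSEQ_I)
    fix e :: real assume e: "0 < e"
    define \<delta> where "\<delta> = e / (2 * (B + 1))"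
    have \<delta>: "0 < \<delta>" "\<delta> * B \<le> e / 2" using e B by (auto simp: \<delta>_def field_simps)
    obtain D where D: "integrable M D" "\<And>n. AE x in M. \<bar>F n x\<bar> \<le> \<delta> * Q n x + D x"
      using D[OF \<delta>(1)] by auto
    \<comment> \<open>The part of |F n - F'| that exceeds \<delta> Q n. It is dominated by |D| +
      |F'| and tends to 0 almost everywhere, while the part cut off contributes at most \<delta>
      B.\<close>
    define H where "H n x = max 0 (\<bar>F n x - F' x\<bar> - \<delta> * Q n x)" for n x
    have mQ: "Q n \<in> borel_measurable M" "F' \<in> borel_measurable M" for n using Q(1) m(2) by auto
    have Hm: "H n \<in> borel_measurable M" for n
      unfolding H_def[abs_def] using m mQ by measurable
    have DF: "integrable M (\<lambda>x. \<bar>D x\<bar> + \<bar>F' x\<bar>)" using D m by simp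
    have Hb: "AE x in M. norm (H n x) \<le> \<bar>D x\<bar> + \<bar>F' x\<bar>" for n
      using D(2)[of n] by eventually_elim (auto simp: H_def)
    have Hi: "integrable M (H n)" for n
      by (rule Bochner_Integration.integrable_bound[OF DF Hm]) (use Hb[of n] in auto)
    have "(\<lambda>n. \<integral>x. H n x \<partial>M) \<longlonglongrightarrow> (\<integral>x. 0 \<partial>M)"
    proof (rule integral_dominated_convergence[OF _ Hm DF _ Hb])
      show "AE x in M. (\<lambda>n. H n x) \<longlonglongrightarrow> 0"
        using lim
      proof eventually_elim
        case (elim x)
        have "(\<lambda>n. \<bar>F n x - F' x\<bar>) \<longlonglongrightarrow> 0" using elim by (simp add: tendsto_rabs_zero LIM_zero)
        then show ?case
          by (rule Lim_null_comparison[rotated])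
            (use \<delta>(1) Q(2) in \<open>auto simp: H_def\<close>)
      qed
    qed simp
    then have "eventually (\<lambda>n. (\<integral>x. H n x \<partial>M) < e / 2) sequentially"
      using e by (intro order_tendstoD) auto
    then obtain N where N: "\<And>n. n \<ge> N \<Longrightarrow> (\<integral>x. H n x \<partial>M) < e / 2"
      by (auto simp: eventually_sequentially)
    have "norm ((\<integral>x. F n x \<partial>M) - (\<integral>x. F' x \<partial>M)) < e" if "n \<ge> N" for n
    proof -
      have "norm ((\<integral>x. F n x \<partial>M) - (\<integral>x. F' x \<partial>M)) = norm (\<integral>x. F n x - F' x \<partial>M)"
        using int m by simp
      also have "\<dots> \<le> (\<integral>x. norm (F n x - F' x) \<partial>M)"
        by (rule integral_norm_bound)
      also have "\<dots> \<le> (\<integral>x. H n x + \<delta> * Q n x \<partial>M)"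
        using int m Hi Q(1) by (intro integral_mono) (auto simp: H_def)
      also have "\<dots> = (\<integral>x. H n x \<partial>M) + \<delta> * (\<integral>x. Q n x \<partial>M)"
        using Hi Q(1) by simp
      also have "\<dots> \<le> (\<integral>x. H n x \<partial>M) + \<delta> * B"
        using \<delta>(1) Q(3) by (intro add_left_mono mult_left_mono) auto
      also have "\<dots> < e" using N[OF that] \<delta>(2) by linarith
      finally show ?thesis .
    qed
    then show "\<exists>no. \<forall>n\<ge>no. norm ((\<integral>x. F n x \<partial>M) - (\<integral>x. F' x \<partial>M)) < e" by blast
  qed
qed

section \<open>The closure of the test functions\<close>

lemma Lp_iff_integrable:
  "Lp \<Omega> p f \<longleftrightarrow> f \<in> borel_measurable (lebesgue_on \<Omega>) \<and> integrable (lebesgue_on \<Omega>) (\<lambda>x. norm (f x) powr p)"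
  by (auto simp: Lp_def integrable_iff_bounded)

lemma Lp_norm_eq:
  assumes "integrable (lebesgue_on \<Omega>) (\<lambda>x. norm (f x) powr p)"
  shows "Lp_norm \<Omega> p f = (\<integral>x. norm (f x) powr p \<partial>lebesgue_on \<Omega>) powr (1 / p)"
  using assms by (simp add: Lp_norm_def nn_integral_eq_integral)

lemma Lp_norm_cong_AE:
  assumes "AE x in lebesgue_on \<Omega>. norm (f x) = norm (g x)"
  shows "Lp_norm \<Omega> p f = Lp_norm \<Omega> p g"
proof -
  have "(\<integral>\<^sup>+x. ennreal (norm (f x) powr p) \<partial>lebesgue_on \<Omega>) = (\<integral>\<^sup>+x. ennreal (norm (g x) powr p) \<partial>lebesgue_on \<Omega>)"
    by (rule nn_integral_cong_AE) (use assms in \<open>auto elim!: eventually_mono\<close>)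
  then show ?thesis by (simp add: Lp_norm_def)
qed

lemma Lp_norm_nonneg: "0 \<le> Lp_norm \<Omega> p f"
  by (simp add: Lp_norm_def)

text \<open>Completeness of the Lebesgue measure: a change on a null set keeps measurability. It is
  needed because weak gradients and superpositions with Caratheodory functions are controlled only
  almost everywhere.\<close>

lemma AE_measurable_lebesgue_on:
  fixes f g :: "'a::euclidean_space \<Rightarrow> 'b::euclidean_space"
  assumes "f \<in> borel_measurable (lebesgue_on \<Omega>)" "AE x in lebesgue_on \<Omega>. g x = f x" "\<Omega> \<in> sets lebesgue"
  shows "g \<in> borel_measurable (lebesgue_on \<Omega>)"
proof -
  have \<Omega>: "\<Omega> \<inter> space lebesgue \<in> sets lebesgue" using assms(3) by simp
  have "AE x in lebesgue. indicator \<Omega> x *\<^sub>R g x = indicator \<Omega> x *\<^sub>R f x"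
    using assms(2) by (subst (asm) AE_restrict_space_iff[OF \<Omega>]) (auto elim!: eventually_mono simp: indicator_def)
  note ae = this
  have f: "(\<lambda>x. indicator \<Omega> x *\<^sub>R f x) \<in> borel_measurable lebesgue"
    using assms(1) by (subst (asm) borel_measurable_restrict_space_iff[OF \<Omega>])
  have "(\<lambda>x. indicator \<Omega> x *\<^sub>R g x) \<in> borel_measurable lebesgue"
  proof (rule measurableI)
    fix S :: "'b set" assume "S \<in> sets borel"
    then have S: "(\<lambda>x. indicator \<Omega> x *\<^sub>R f x) -` S \<inter> space lebesgue \<in> sets lebesgue"
      by (rule measurable_sets[OF f])
    show "(\<lambda>x. indicator \<Omega> x *\<^sub>R g x) -` S \<inter> space lebesgue \<in> sets lebesgue"
      by (rule completion.in_sets_AE[OF _ S]) (use ae in \<open>auto elim!: eventually_mono\<close>)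
  qed simp
  then show ?thesis by (subst borel_measurable_restrict_space_iff[OF \<Omega>])
qed

text \<open>Pairs (v, \<eta>) arising as limits, almost everywhere and dominated in L^p, of test functions with
  values in I and of their gradients; for I = UNIV this is W_0^{1,p}.\<close>

definition test_closure :: "'a::euclidean_space set \<Rightarrow> real \<Rightarrow> real set \<Rightarrow> ('a \<Rightarrow> real) \<Rightarrow> ('a \<Rightarrow> 'a) \<Rightarrow> bool" where
  "test_closure \<Omega> p I v \<eta> \<longleftrightarrow>
     v \<in> borel_measurable (lebesgue_on \<Omega>) \<and> \<eta> \<in> borel_measurable (lebesgue_on \<Omega>) \<and>
     (\<exists>\<phi> W. integrable (lebesgue_on \<Omega>) W \<and> (\<forall>n. test_fun \<Omega> (\<phi> n)) \<and> (\<forall>n x. \<phi> n x \<in> I) \<and>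
        (\<forall>n. AE x in lebesgue_on \<Omega>. norm (\<phi> n x) powr p \<le> W x) \<and>
        (\<forall>n. AE x in lebesgue_on \<Omega>. norm (grad (\<phi> n) x) powr p \<le> W x) \<and>
        (AE x in lebesgue_on \<Omega>. (\<lambda>n. \<phi> n x) \<longlonglongrightarrow> v x) \<and>
        (AE x in lebesgue_on \<Omega>. (\<lambda>n. grad (\<phi> n) x) \<longlonglongrightarrow> \<eta> x))"

section \<open>Stability of the closure of the test functions on a bounded open set\<close>

locale bounded_open =
  fixes \<Omega> :: "'a::euclidean_space set"
  assumes open_domain: "open \<Omega>" and bounded_domain: "bounded \<Omega>"
begin

abbreviation "M \<equiv> lebesgue_on \<Omega>"

lemma sets_domain: "\<Omega> \<in> sets lebesgue"
  using open_domain by simp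

lemma finite_measure_domain: "finite_measure M"
  by (rule finite_measure_lebesgue_on) (use open_domain bounded_domain in \<open>simp add: lmeasurable_open\<close>)

lemma integrable_const_domain: "integrable M (\<lambda>x. c :: real)"
  using finite_measure_domain by (rule finite_measure.integrable_const)

lemma continuous_measurable: "continuous_on UNIV f \<Longrightarrow> f \<in> borel_measurable M"
  by (intro measurable_restrict_space1 measurable_completion) (auto intro: borel_measurable_continuous_onI)

lemma test_fun_measurable:
  assumes "test_fun \<Omega> \<phi>"
  shows "\<phi> \<in> borel_measurable M" "grad \<phi> \<in> borel_measurable M"
  using smooth_continuous[OF test_fun_smooth[OF assms]] smooth_continuous_grad[OF test_fun_smooth[OF assms]]
  by (auto intro: continuous_measurable)

lemma test_fun_bounded:
  assumes "test_fun \<Omega> \<phi>"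
  obtains B where "0 < B" "\<And>x. norm (\<phi> x) \<le> B" "\<And>x. norm (grad \<phi> x) \<le> B"
proof -
  obtain K where K: "compact K" "\<And>x. x \<notin> K \<Longrightarrow> \<phi> x = 0" "\<And>x. x \<notin> K \<Longrightarrow> grad \<phi> x = 0"
    using assms test_fun_supportE by metis
  obtain B1 where B1: "B1 > 0" "\<And>x. norm (\<phi> x) \<le> B1"
    using bounded_compact_support[OF smooth_continuous[OF test_fun_smooth[OF assms]] K(1,2)] by metis
  obtain B2 where B2: "B2 > 0" "\<And>x. norm (grad \<phi> x) \<le> B2"
    using bounded_compact_support[OF smooth_continuous_grad[OF test_fun_smooth[OF assms]] K(1,3)] by metis
  show ?thesis
  proof (rule that[of "max B1 B2"])
    show "norm (\<phi> x) \<le> max B1 B2" "norm (grad \<phi> x) \<le> max B1 B2" for x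
      using B1(2)[of x] B2(2)[of x] by linarith+
  qed (use B1(1) in simp)
qed

lemma bounded_powr_integrable:
  fixes f :: "'a \<Rightarrow> 'b::euclidean_space"
  assumes "f \<in> borel_measurable M" "\<And>x. norm (f x) \<le> B" "0 \<le> p"
  shows "integrable M (\<lambda>x. norm (f x) powr p)"
  using assms by (intro Bochner_Integration.integrable_bound[OF integrable_const_domain[of "B powr p"]])
    (auto intro!: powr_mono2)

lemma test_fun_powr_integrable:
  assumes "test_fun \<Omega> \<phi>" "0 \<le> p"
  shows "integrable M (\<lambda>x. norm (\<phi> x) powr p)" "integrable M (\<lambda>x. norm (grad \<phi> x) powr p)"
proof -
  obtain B where "\<And>x. norm (\<phi> x) \<le> B" "\<And>x. norm (grad \<phi> x) \<le> B"
    using test_fun_bounded[OF assms(1)] by metis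
  from bounded_powr_integrable[OF test_fun_measurable(1)[OF assms(1)] this(1) assms(2)]
    bounded_powr_integrable[OF test_fun_measurable(2)[OF assms(1)] this(2) assms(2)]
  show "integrable M (\<lambda>x. norm (\<phi> x) powr p)" "integrable M (\<lambda>x. norm (grad \<phi> x) powr p)" .
qed

lemma wgrad_test_fun: "test_fun \<Omega> \<phi> \<Longrightarrow> AE x in M. wgrad \<Omega> \<phi> x = grad \<phi> x"
  by (rule wgrad_AE_eq[OF open_domain weak_grad_test_fun[OF open_domain]])

lemma integrable_diff_powr:
  fixes f g :: "'a \<Rightarrow> 'b::euclidean_space"
  assumes "f \<in> borel_measurable M" "g \<in> borel_measurable M" "0 \<le> p"
    "integrable M (\<lambda>x. norm (f x) powr p)" "integrable M (\<lambda>x. norm (g x) powr p)"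
  shows "integrable M (\<lambda>x. norm (f x - g x) powr p)"
proof (rule Bochner_Integration.integrable_bound)
  show "integrable M (\<lambda>x. 2 powr p * (norm (f x) powr p + norm (g x) powr p))"
    using assms by simp
  show "AE x in M. norm (norm (f x - g x) powr p) \<le> norm (2 powr p * (norm (f x) powr p + norm (g x) powr p))"
    using norm_diff_powr_le[OF assms(3)] by (intro AE_I2) simp
qed (use assms in simp)

lemma test_closure_integrable:
  assumes "test_closure \<Omega> p I v \<eta>" "0 < p"
  shows "v \<in> borel_measurable M" "\<eta> \<in> borel_measurable M"
    "integrable M (\<lambda>x. norm (v x) powr p)" "integrable M (\<lambda>x. norm (\<eta> x) powr p)"
proof -
  show m: "v \<in> borel_measurable M" "\<eta> \<in> borel_measurable M"
    using assms(1) by (auto simp: test_closure_def)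
  obtain \<phi> W where W: "integrable M W" "\<And>n. test_fun \<Omega> (\<phi> n)"
    "\<And>n. AE x in M. norm (\<phi> n x) powr p \<le> W x" "\<And>n. AE x in M. norm (grad (\<phi> n) x) powr p \<le> W x"
    "AE x in M. (\<lambda>n. \<phi> n x) \<longlonglongrightarrow> v x" "AE x in M. (\<lambda>n. grad (\<phi> n) x) \<longlonglongrightarrow> \<eta> x"
    using assms(1) unfolding test_closure_def by blast
  show "integrable M (\<lambda>x. norm (v x) powr p)"
    by (rule Lp_dominated_convergence(1)[OF assms(2) _ m(1) W(1,3,5)]) (rule test_fun_measurable[OF W(2)])
  show "integrable M (\<lambda>x. norm (\<eta> x) powr p)"
    by (rule Lp_dominated_convergence(1)[OF assms(2) _ m(2) W(1,4,6)]) (rule test_fun_measurable[OF W(2)])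
qed

lemma test_closure_approx:
  assumes "test_closure \<Omega> p I v \<eta>" "0 < p" "0 < e"
  obtains \<phi> where "test_fun \<Omega> \<phi>" "\<And>x. \<phi> x \<in> I"
    "(\<integral>x. norm (\<phi> x - v x) powr p \<partial>M) < e" "(\<integral>x. norm (grad \<phi> x - \<eta> x) powr p \<partial>M) < e"
proof -
  obtain \<phi> W where W: "integrable M W" "\<And>n. test_fun \<Omega> (\<phi> n)"
    "\<And>n. AE x in M. norm (\<phi> n x) powr p \<le> W x" "\<And>n. AE x in M. norm (grad (\<phi> n) x) powr p \<le> W x"
    "AE x in M. (\<lambda>n. \<phi> n x) \<longlonglongrightarrow> v x" "AE x in M. (\<lambda>n. grad (\<phi> n) x) \<longlonglongrightarrow> \<eta> x" and I: "\<And>n x. \<phi> n x \<in> I"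
    using assms(1) unfolding test_closure_def by blast
  note m = test_closure_integrable(1,2)[OF assms(1,2)]
  have "(\<lambda>n. \<integral>x. norm (\<phi> n x - v x) powr p \<partial>M) \<longlonglongrightarrow> 0"
    by (rule Lp_dominated_convergence(3)[OF assms(2) _ m(1) W(1,3,5)]) (rule test_fun_measurable[OF W(2)])
  then have 1: "eventually (\<lambda>n. (\<integral>x. norm (\<phi> n x - v x) powr p \<partial>M) < e) sequentially"
    using assms(3) by (rule order_tendstoD)
  have "(\<lambda>n. \<integral>x. norm (grad (\<phi> n) x - \<eta> x) powr p \<partial>M) \<longlonglongrightarrow> 0"
    by (rule Lp_dominated_convergence(3)[OF assms(2) _ m(2) W(1,4,6)]) (rule test_fun_measurable[OF W(2)])
  then have "eventually (\<lambda>n. (\<integral>x. norm (grad (\<phi> n) x - \<eta> x) powr p \<partial>M) < e) sequentially"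
    using assms(3) by (rule order_tendstoD)
  with 1 have "eventually (\<lambda>n. (\<integral>x. norm (\<phi> n x - v x) powr p \<partial>M) < e \<and>
      (\<integral>x. norm (grad (\<phi> n) x - \<eta> x) powr p \<partial>M) < e) sequentially"
    by (rule eventually_conj)
  then obtain n where "(\<integral>x. norm (\<phi> n x - v x) powr p \<partial>M) < e" "(\<integral>x. norm (grad (\<phi> n) x - \<eta> x) powr p \<partial>M) < e"
    using eventually_happens'[OF sequentially_bot] by blast
  with W(2) I show ?thesis by (intro that[of "\<phi> n"])
qed

text \<open>Norm convergence is traded for dominated convergence almost everywhere by two successive
  extractions, one for the functions and one for their gradients; the larger of the two majorants
  serves both.\<close>

lemma test_closureI:
  assumes p: "0 < p" and m: "v \<in> borel_measurable M" "\<eta> \<in> borel_measurable M"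
    and i: "integrable M (\<lambda>x. norm (v x) powr p)" "integrable M (\<lambda>x. norm (\<eta> x) powr p)"
    and t: "\<And>n. test_fun \<Omega> (\<phi> n)" "\<And>n x. \<phi> n x \<in> I"
    and lim: "(\<lambda>n. \<integral>x. norm (\<phi> n x - v x) powr p \<partial>M) \<longlonglongrightarrow> 0"
      "(\<lambda>n. \<integral>x. norm (grad (\<phi> n) x - \<eta> x) powr p \<partial>M) \<longlonglongrightarrow> 0"
  shows "test_closure \<Omega> p I v \<eta>"
proof -
  note tm = test_fun_measurable[OF t(1)]
  note ti = test_fun_powr_integrable[OF t(1) less_imp_le[OF p]]
  note di = integrable_diff_powr[OF tm(1) m(1) less_imp_le[OF p] ti(1) i(1)]
    integrable_diff_powr[OF tm(2) m(2) less_imp_le[OF p] ti(2) i(2)]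
  obtain r W where r: "strict_mono r" "integrable M W" "\<And>n. AE x in M. norm (\<phi> (r n) x) powr p \<le> W x"
    "AE x in M. (\<lambda>n. \<phi> (r n) x) \<longlonglongrightarrow> v x"
    using Lp_tendsto_imp_dominated_subseq[of p \<phi> M v, OF p tm(1) m(1) i(1) di(1) lim(1)] by blast
  have lim': "(\<lambda>n. \<integral>x. norm (grad (\<phi> (r n)) x - \<eta> x) powr p \<partial>M) \<longlonglongrightarrow> 0"
    using LIMSEQ_subseq_LIMSEQ[OF lim(2) r(1)] by (simp add: o_def)
  obtain s V where s: "strict_mono s" "integrable M V" "\<And>n. AE x in M. norm (grad (\<phi> (r (s n))) x) powr p \<le> V x"
    "AE x in M. (\<lambda>n. grad (\<phi> (r (s n))) x) \<longlonglongrightarrow> \<eta> x"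
    using Lp_tendsto_imp_dominated_subseq[of p "\<lambda>n. grad (\<phi> (r n))" M \<eta>, OF p tm(2) m(2) i(2) di(2) lim'] by blast
  show ?thesis
    unfolding test_closure_def
  proof (intro conjI exI[of _ "\<lambda>n. \<phi> (r (s n))"] exI[of _ "\<lambda>x. max (W x) (V x)"] allI m t)
    show "integrable M (\<lambda>x. max (W x) (V x))" using r(2) s(2) by simp
    show "AE x in M. norm (\<phi> (r (s n)) x) powr p \<le> max (W x) (V x)" for n
      using r(3)[of "s n"] by eventually_elim simp
    show "AE x in M. norm (grad (\<phi> (r (s n))) x) powr p \<le> max (W x) (V x)" for n
      using s(3)[of n] by eventually_elim simp
    show "AE x in M. (\<lambda>n. \<phi> (r (s n)) x) \<longlonglongrightarrow> v x"
      using r(4)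
    proof eventually_elim
      case (elim x)
      from LIMSEQ_subseq_LIMSEQ[OF this s(1)] show ?case by (simp add: o_def)
    qed
  qed (rule s(4))
qed

text \<open>The closure is itself closed: each pair (w n, \<zeta> n) is replaced by a test function
  whose p-th power errors are below 1/(n+1). This is what finally places the limit of a
  (CPS)_c-sequence in the Sobolev space and identifies its gradient.\<close>

lemma test_closure_limit:
  assumes p: "0 < p" and m: "v \<in> borel_measurable M" "\<eta> \<in> borel_measurable M"
    and i: "integrable M (\<lambda>x. norm (v x) powr p)" "integrable M (\<lambda>x. norm (\<eta> x) powr p)"
    and t: "\<And>n. test_closure \<Omega> p I (w n) (\<zeta> n)"
    and lim: "(\<lambda>n. \<integral>x. norm (w n x - v x) powr p \<partial>M) \<longlonglongrightarrow> 0"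
      "(\<lambda>n. \<integral>x. norm (\<zeta> n x - \<eta> x) powr p \<partial>M) \<longlonglongrightarrow> 0"
  shows "test_closure \<Omega> p I v \<eta>"
proof -
  have "\<exists>\<phi>. test_fun \<Omega> \<phi> \<and> (\<forall>x. \<phi> x \<in> I) \<and> (\<integral>x. norm (\<phi> x - w n x) powr p \<partial>M) < inverse (real (Suc n)) \<and>
      (\<integral>x. norm (grad \<phi> x - \<zeta> n x) powr p \<partial>M) < inverse (real (Suc n))" for n
  proof -
    have pos: "0 < inverse (real (Suc n))" by simp
    show ?thesis by (rule test_closure_approx[OF t p pos, of n]) blast
  qed
  then have "\<exists>\<phi>. \<forall>n. test_fun \<Omega> (\<phi> n) \<and> (\<forall>x. \<phi> n x \<in> I) \<and> (\<integral>x. norm (\<phi> n x - w n x) powr p \<partial>M) < inverse (real (Suc n)) \<and>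
      (\<integral>x. norm (grad (\<phi> n) x - \<zeta> n x) powr p \<partial>M) < inverse (real (Suc n))"
    by (intro choice allI)
  then obtain \<phi> where \<phi>: "\<And>n. test_fun \<Omega> (\<phi> n)" "\<And>n x. \<phi> n x \<in> I"
    "\<And>n. (\<integral>x. norm (\<phi> n x - w n x) powr p \<partial>M) < inverse (real (Suc n))"
    "\<And>n. (\<integral>x. norm (grad (\<phi> n) x - \<zeta> n x) powr p \<partial>M) < inverse (real (Suc n))"
    by blast
  \<comment> \<open>The codomain is left free because the estimate is applied once to the functions
    and once to the gradients.\<close>
  have key: "(\<lambda>n. \<integral>x. norm (f n x - h x) powr p \<partial>M) \<longlonglongrightarrow> 0"
    if "\<And>n. f n \<in> borel_measurable M" "\<And>n. g n \<in> borel_measurable M" "h \<in> borel_measurable M"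
      "\<And>n. integrable M (\<lambda>x. norm (f n x) powr p)" "\<And>n. integrable M (\<lambda>x. norm (g n x) powr p)"
      "integrable M (\<lambda>x. norm (h x) powr p)"
      "\<And>n. (\<integral>x. norm (f n x - g n x) powr p \<partial>M) < inverse (real (Suc n))"
      "(\<lambda>n. \<integral>x. norm (g n x - h x) powr p \<partial>M) \<longlonglongrightarrow> 0"
    for f g :: "nat \<Rightarrow> 'a \<Rightarrow> 'c::euclidean_space" and h
  proof -
    have le: "(\<integral>x. norm (f n x - h x) powr p \<partial>M) \<le> 2 powr p * (inverse (real (Suc n)) + (\<integral>x. norm (g n x - h x) powr p \<partial>M))" for n
    proof -
      have di: "integrable M (\<lambda>x. norm (f n x - g n x) powr p)" "integrable M (\<lambda>x. norm (g n x - h x) powr p)"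
        "integrable M (\<lambda>x. norm (f n x - h x) powr p)"
        using that p by (auto intro!: integrable_diff_powr)
      have "(\<integral>x. norm (f n x - h x) powr p \<partial>M) \<le> (\<integral>x. 2 powr p * (norm (f n x - g n x) powr p + norm (g n x - h x) powr p) \<partial>M)"
      proof (rule integral_mono)
        show "norm (f n x - h x) powr p \<le> 2 powr p * (norm (f n x - g n x) powr p + norm (g n x - h x) powr p)" for x
          using norm_powr_le_diff[of p "f n x - h x" "g n x - h x"] p by simp
      qed (use di in auto)
      also have "\<dots> = 2 powr p * ((\<integral>x. norm (f n x - g n x) powr p \<partial>M) + (\<integral>x. norm (g n x - h x) powr p \<partial>M))"
        using di by simp
      also have "\<dots> \<le> 2 powr p * (inverse (real (Suc n)) + (\<integral>x. norm (g n x - h x) powr p \<partial>M))"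
        using that(7)[of n] by (intro mult_left_mono add_right_mono) auto
      finally show ?thesis .
    qed
    have "(\<lambda>n. 2 powr p * (inverse (real (Suc n)) + (\<integral>x. norm (g n x - h x) powr p \<partial>M))) \<longlonglongrightarrow> 2 powr p * (0 + 0)"
      by (intro tendsto_mult tendsto_add tendsto_const LIMSEQ_inverse_real_of_nat that(8))
    then have "(\<lambda>n. 2 powr p * (inverse (real (Suc n)) + (\<integral>x. norm (g n x - h x) powr p \<partial>M))) \<longlonglongrightarrow> 0"
      by simp
    moreover have "norm (\<integral>x. norm (f n x - h x) powr p \<partial>M)
        \<le> 2 powr p * (inverse (real (Suc n)) + (\<integral>x. norm (g n x - h x) powr p \<partial>M))" for n
      using le[of n] by simp
    ultimately show ?thesis
      by (rule Lim_null_comparison[OF always_eventually[OF allI] _, rotated])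
  qed
  note tm = test_fun_measurable[OF \<phi>(1)]
  note ti = test_fun_powr_integrable[OF \<phi>(1) less_imp_le[OF p]]
  note wi = test_closure_integrable[OF t p]
  show ?thesis
    by (rule test_closureI[OF p m i \<phi>(1,2)])
      (rule key[of \<phi> w, OF tm(1) wi(1) m(1) ti(1) wi(3) i(1) \<phi>(3) lim(1)],
       rule key[of "\<lambda>n. grad (\<phi> n)" \<zeta>, OF tm(2) wi(2) m(2) ti(2) wi(4) i(2) \<phi>(4) lim(2)])
qed

text \<open>The norms in \<open>W01p\<close> are p-th roots; raising them to the power p gives the
  integrals that \<open>test_closureI\<close> expects, and the \<open>wgrad\<close> of each
  approximating test function may be exchanged for its pointwise gradient.\<close>

lemma W01p_imp_test_closure:
  assumes "W01p \<Omega> p u" "0 < p"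
  shows "test_closure \<Omega> p UNIV u (wgrad \<Omega> u)"
proof -
  obtain g where g: "weak_grad \<Omega> u g" "Lp \<Omega> p g" and u: "Lp \<Omega> p u"
    using assms(1) by (auto simp: W01p_def W1p_def)
  note ae = wgrad_AE_eq[OF open_domain g(1)]
  have gm: "wgrad \<Omega> u \<in> borel_measurable M"
    by (rule AE_measurable_lebesgue_on[OF _ ae sets_domain]) (use g(2) in \<open>simp add: Lp_def\<close>)
  have "integrable M (\<lambda>x. norm (wgrad \<Omega> u x) powr p) \<longleftrightarrow> integrable M (\<lambda>x. norm (g x) powr p)"
    by (rule integrable_cong_AE) (use gm g(2) ae in \<open>auto simp: Lp_iff_integrable\<close>)
  then have gi: "integrable M (\<lambda>x. norm (wgrad \<Omega> u x) powr p)"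
    using g(2) by (simp add: Lp_iff_integrable)
  have um: "u \<in> borel_measurable M" and ui: "integrable M (\<lambda>x. norm (u x) powr p)"
    using u by (simp_all add: Lp_iff_integrable)
  obtain \<phi> where \<phi>: "\<And>n. test_fun \<Omega> (\<phi> n)"
    and lim: "(\<lambda>n. Lp_norm \<Omega> p (\<lambda>x. \<phi> n x - u x) + Lp_norm \<Omega> p (\<lambda>x. wgrad \<Omega> (\<phi> n) x - wgrad \<Omega> u x)) \<longlonglongrightarrow> 0"
    using assms(1) by (auto simp: W01p_def)
  note tm = test_fun_measurable[OF \<phi>]
  note ti = test_fun_powr_integrable[OF \<phi> less_imp_le[OF assms(2)]]
  have 0: "(\<lambda>n. Lp_norm \<Omega> p (\<lambda>x. \<phi> n x - u x)) \<longlonglongrightarrow> 0"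
    "(\<lambda>n. Lp_norm \<Omega> p (\<lambda>x. wgrad \<Omega> (\<phi> n) x - wgrad \<Omega> u x)) \<longlonglongrightarrow> 0"
    by (rule tendsto_sandwich[OF _ _ tendsto_const lim]; simp add: Lp_norm_nonneg)+
  have "Lp_norm \<Omega> p (\<lambda>x. wgrad \<Omega> (\<phi> n) x - wgrad \<Omega> u x) = Lp_norm \<Omega> p (\<lambda>x. grad (\<phi> n) x - wgrad \<Omega> u x)" for n
    by (rule Lp_norm_cong_AE) (use wgrad_test_fun[OF \<phi>, of n] in \<open>auto elim!: eventually_mono\<close>)
  then have 1: "(\<lambda>n. Lp_norm \<Omega> p (\<lambda>x. grad (\<phi> n) x - wgrad \<Omega> u x)) \<longlonglongrightarrow> 0"
    using 0(2) by simp
  have pow: "(\<lambda>n. J n) \<longlonglongrightarrow> 0" if "(\<lambda>n. J n powr (1/p)) \<longlonglongrightarrow> 0" "\<And>n. 0 \<le> J n" for J :: "nat \<Rightarrow> real"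
  proof -
    have "(\<lambda>n. (J n powr (1/p)) powr p) \<longlonglongrightarrow> 0"
      by (rule tendsto_zero_powrI[OF that(1) tendsto_const]) (use assms(2) in auto)
    moreover have "(J n powr (1/p)) powr p = J n" for n using that(2)[of n] assms(2) by (simp add: powr_powr)
    ultimately show ?thesis by simp
  qed
  have "(\<lambda>n. \<integral>x. norm (\<phi> n x - u x) powr p \<partial>M) \<longlonglongrightarrow> 0"
    by (rule pow, rule 0(1)[unfolded Lp_norm_eq[OF integrable_diff_powr[OF tm(1) um less_imp_le[OF assms(2)] ti(1) ui]]]) simp
  moreover have "(\<lambda>n. \<integral>x. norm (grad (\<phi> n) x - wgrad \<Omega> u x) powr p \<partial>M) \<longlonglongrightarrow> 0"
    by (rule pow, rule 1[unfolded Lp_norm_eq[OF integrable_diff_powr[OF tm(2) gm less_imp_le[OF assms(2)] ti(2) gi]]]) simp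
  ultimately show ?thesis
    by (intro test_closureI[of p u "wgrad \<Omega> u" \<phi>] assms um gm ui gi \<phi>) auto
qed

text \<open>Integration by parts holds for the approximating test functions and passes to the limit
  by dominated convergence. Since p \<ge> 1, the majorant W of the p-th powers gives 1 + W as a
  majorant of the functions and gradients themselves.\<close>

lemma test_closure_imp_weak_grad:
  assumes "test_closure \<Omega> p I u \<xi>" "1 \<le> p"
  shows "weak_grad \<Omega> u \<xi>"
proof -
  obtain \<phi> W where W: "integrable M W" "\<And>n. test_fun \<Omega> (\<phi> n)"
    "\<And>n. AE x in M. norm (\<phi> n x) powr p \<le> W x" "\<And>n. AE x in M. norm (grad (\<phi> n) x) powr p \<le> W x"
    "AE x in M. (\<lambda>n. \<phi> n x) \<longlonglongrightarrow> u x" "AE x in M. (\<lambda>n. grad (\<phi> n) x) \<longlonglongrightarrow> \<xi> x"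
    using assms(1) unfolding test_closure_def by blast
  have m: "u \<in> borel_measurable M" "\<xi> \<in> borel_measurable M"
    using assms(1) by (auto simp: test_closure_def)
  note tm = test_fun_measurable[OF W(2)]
  show ?thesis
    unfolding weak_grad_def
  proof (intro allI impI ballI)
    fix \<psi> and i :: 'a assume \<psi>: "test_fun \<Omega> \<psi>" and i: "i \<in> Basis"
    obtain B where B: "0 < B" "\<And>x. norm (\<psi> x) \<le> B" "\<And>x. norm (grad \<psi> x) \<le> B"
      using test_fun_bounded[OF \<psi>] by metis
    have W': "integrable M (\<lambda>x. (1 + W x) * B)"
      using W(1) integrable_const_domain[of 1] by simp
    have b1: "AE x in M. norm (\<phi> n x * (grad \<psi> x \<bullet> i)) \<le> (1 + W x) * B" for n
      using W(3)[of n]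
    proof eventually_elim
      case (elim x)
      have "\<bar>grad \<psi> x \<bullet> i\<bar> \<le> B" using Basis_le_norm[OF i, of "grad \<psi> x"] B(3)[of x] by linarith
      moreover have "norm (\<phi> n x) \<le> 1 + W x" using powr_le_1_add_powr[of "norm (\<phi> n x)" 1 p] assms(2) elim by simp
      ultimately show ?case using B(1) by (simp add: abs_mult mult_mono)
    qed
    have b2: "AE x in M. norm ((grad (\<phi> n) x \<bullet> i) * \<psi> x) \<le> (1 + W x) * B" for n
      using W(4)[of n]
    proof eventually_elim
      case (elim x)
      have "norm (grad (\<phi> n) x) \<le> 1 + W x" using powr_le_1_add_powr[of "norm (grad (\<phi> n) x)" 1 p] assms(2) elim by simp
      then have "\<bar>grad (\<phi> n) x \<bullet> i\<bar> \<le> 1 + W x" using Basis_le_norm[OF i, of "grad (\<phi> n) x"] by linarith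
      then show ?case using B(1) B(2)[of x] by (simp add: abs_mult mult_mono)
    qed
    have l1: "AE x in M. (\<lambda>n. \<phi> n x * (grad \<psi> x \<bullet> i)) \<longlonglongrightarrow> u x * (grad \<psi> x \<bullet> i)"
      using W(5) by eventually_elim (intro tendsto_mult tendsto_const)
    have l2: "AE x in M. (\<lambda>n. (grad (\<phi> n) x \<bullet> i) * \<psi> x) \<longlonglongrightarrow> (\<xi> x \<bullet> i) * \<psi> x"
      using W(6) by eventually_elim (intro tendsto_mult tendsto_inner tendsto_const)
    have mm: "(\<lambda>x. u x * (grad \<psi> x \<bullet> i)) \<in> borel_measurable M" "(\<lambda>x. \<phi> n x * (grad \<psi> x \<bullet> i)) \<in> borel_measurable M"
      "(\<lambda>x. (\<xi> x \<bullet> i) * \<psi> x) \<in> borel_measurable M" "(\<lambda>x. (grad (\<phi> n) x \<bullet> i) * \<psi> x) \<in> borel_measurable M" for n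
      using m tm test_fun_measurable[OF \<psi>] by (intro borel_measurable_times borel_measurable_inner borel_measurable_const; simp)+
    note I1 = integrable_dominated_convergence[OF mm(1) mm(2) W' l1 b1]
      integrable_dominated_convergence[OF mm(3) mm(4) W' l2 b2]
    note D1 = integral_dominated_convergence[OF mm(1) mm(2) W' l1 b1]
    note D2 = integral_dominated_convergence[OF mm(3) mm(4) W' l2 b2]
    have "(\<integral>x. \<phi> n x * (grad \<psi> x \<bullet> i) \<partial>M) = - (\<integral>x. (grad (\<phi> n) x \<bullet> i) * \<psi> x \<partial>M)" for n
      using weak_grad_test_fun[OF open_domain W(2)[of n]] \<psi> i by (simp add: weak_grad_def grad_inner)
    then have "(\<integral>x. u x * (grad \<psi> x \<bullet> i) \<partial>M) = - (\<integral>x. (\<xi> x \<bullet> i) * \<psi> x \<partial>M)"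
      using D1 tendsto_minus[OF D2] LIMSEQ_unique by simp
    with I1 show "integrable M (\<lambda>x. u x * frechet_derivative \<psi> (at x) i) \<and>
        integrable M (\<lambda>x. (\<xi> x \<bullet> i) * \<psi> x) \<and>
        (\<integral>x. u x * frechet_derivative \<psi> (at x) i \<partial>M) = - (\<integral>x. (\<xi> x \<bullet> i) * \<psi> x \<partial>M)"
      using i by (simp add: grad_inner)
  qed
qed

lemma test_closure_imp_W01p:
  assumes "test_closure \<Omega> p UNIV u \<xi>" "1 \<le> p"
  shows "W01p \<Omega> p u" "AE x in M. wgrad \<Omega> u x = \<xi> x"
proof -
  note wg = test_closure_imp_weak_grad[OF assms]
  have p: "0 < p" using assms(2) by simp
  note ti = test_closure_integrable[OF assms(1) p]
  show ae: "AE x in M. wgrad \<Omega> u x = \<xi> x" by (rule wgrad_AE_eq[OF open_domain wg])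
  obtain \<phi> W where W: "integrable M W" "\<And>n. test_fun \<Omega> (\<phi> n)"
    "\<And>n. AE x in M. norm (\<phi> n x) powr p \<le> W x" "\<And>n. AE x in M. norm (grad (\<phi> n) x) powr p \<le> W x"
    "AE x in M. (\<lambda>n. \<phi> n x) \<longlonglongrightarrow> u x" "AE x in M. (\<lambda>n. grad (\<phi> n) x) \<longlonglongrightarrow> \<xi> x"
    using assms(1) unfolding test_closure_def by blast
  note tm = test_fun_measurable[OF W(2)]
  note L1 = Lp_dominated_convergence[of p \<phi> M u, OF p tm(1) ti(1) W(1,3,5)]
  note L2 = Lp_dominated_convergence[of p "\<lambda>n. grad (\<phi> n)" M \<xi>, OF p tm(2) ti(2) W(1,4,6)]
  have "Lp_norm \<Omega> p (\<lambda>x. wgrad \<Omega> (\<phi> n) x - wgrad \<Omega> u x) = Lp_norm \<Omega> p (\<lambda>x. grad (\<phi> n) x - \<xi> x)" for n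
    by (rule Lp_norm_cong_AE) (use wgrad_test_fun[OF W(2), of n] ae in eventually_elim, simp)
  then have "Lp_norm \<Omega> p (\<lambda>x. \<phi> n x - u x) + Lp_norm \<Omega> p (\<lambda>x. wgrad \<Omega> (\<phi> n) x - wgrad \<Omega> u x)
      = (\<integral>x. norm (\<phi> n x - u x) powr p \<partial>M) powr (1/p) + (\<integral>x. norm (grad (\<phi> n) x - \<xi> x) powr p \<partial>M) powr (1/p)" for n
    using Lp_norm_eq[OF L1(2)] Lp_norm_eq[OF L2(2)] by simp
  moreover have "(\<lambda>n. (\<integral>x. norm (\<phi> n x - u x) powr p \<partial>M) powr (1/p) + (\<integral>x. norm (grad (\<phi> n) x - \<xi> x) powr p \<partial>M) powr (1/p)) \<longlonglongrightarrow> 0 + 0"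
    using p by (intro tendsto_add tendsto_zero_powrI[OF L1(3) tendsto_const] tendsto_zero_powrI[OF L2(3) tendsto_const]) auto
  ultimately have "(\<lambda>n. Lp_norm \<Omega> p (\<lambda>x. \<phi> n x - u x) + Lp_norm \<Omega> p (\<lambda>x. wgrad \<Omega> (\<phi> n) x - wgrad \<Omega> u x)) \<longlonglongrightarrow> 0"
    by simp
  then show "W01p \<Omega> p u"
    unfolding W01p_def W1p_def Lp_iff_integrable using ti wg W(2) by blast
qed

lemma test_closure_diff:
  assumes u: "test_closure \<Omega> p I u \<xi>" and w: "test_closure \<Omega> p J w \<zeta>" and p: "0 < p"
    and IJ: "\<And>s t. s \<in> I \<Longrightarrow> t \<in> J \<Longrightarrow> s - t \<in> K"
  shows "test_closure \<Omega> p K (\<lambda>x. u x - w x) (\<lambda>x. \<xi> x - \<zeta> x)"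
proof -
  obtain \<phi> W where W: "integrable M W" "\<And>n. test_fun \<Omega> (\<phi> n)"
    "\<And>n. AE x in M. norm (\<phi> n x) powr p \<le> W x" "\<And>n. AE x in M. norm (grad (\<phi> n) x) powr p \<le> W x"
    "AE x in M. (\<lambda>n. \<phi> n x) \<longlonglongrightarrow> u x" "AE x in M. (\<lambda>n. grad (\<phi> n) x) \<longlonglongrightarrow> \<xi> x" and I: "\<And>n x. \<phi> n x \<in> I"
    using u unfolding test_closure_def by blast
  obtain \<psi> V where V: "integrable M V" "\<And>n. test_fun \<Omega> (\<psi> n)"
    "\<And>n. AE x in M. norm (\<psi> n x) powr p \<le> V x" "\<And>n. AE x in M. norm (grad (\<psi> n) x) powr p \<le> V x"
    "AE x in M. (\<lambda>n. \<psi> n x) \<longlonglongrightarrow> w x" "AE x in M. (\<lambda>n. grad (\<psi> n) x) \<longlonglongrightarrow> \<zeta> x" and J: "\<And>n x. \<psi> n x \<in> J"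
    using w unfolding test_closure_def by blast
  note gd = grad_diff[OF test_fun_smooth[OF W(2)] test_fun_smooth[OF V(2)]]
  have le: "norm (a - b) powr p \<le> 2 powr p * (s + t)" if "norm a powr p \<le> s" "norm b powr p \<le> t"
    for a b :: "'c::real_normed_vector" and s t
    using norm_diff_powr_le[of p a b] p that by (smt (verit) mult_left_mono powr_ge_zero)
  show ?thesis
    unfolding test_closure_def
  proof (intro conjI exI[of _ "\<lambda>n x. \<phi> n x - \<psi> n x"] exI[of _ "\<lambda>x. 2 powr p * (W x + V x)"] allI)
    show "(\<lambda>x. u x - w x) \<in> borel_measurable M" "(\<lambda>x. \<xi> x - \<zeta> x) \<in> borel_measurable M"
      using test_closure_integrable(1,2)[OF u p] test_closure_integrable(1,2)[OF w p] by simp_all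
    show "integrable M (\<lambda>x. 2 powr p * (W x + V x))" using W(1) V(1) by simp
    show "test_fun \<Omega> (\<lambda>x. \<phi> n x - \<psi> n x)" for n by (rule test_fun_diff[OF W(2) V(2)])
    show "\<phi> n x - \<psi> n x \<in> K" for n x by (rule IJ[OF I J])
    show "AE x in M. norm (\<phi> n x - \<psi> n x) powr p \<le> 2 powr p * (W x + V x)" for n
      using W(3)[of n] V(3)[of n] by eventually_elim (rule le)
    show "AE x in M. norm (grad (\<lambda>x. \<phi> n x - \<psi> n x) x) powr p \<le> 2 powr p * (W x + V x)" for n
      using W(4)[of n] V(4)[of n] unfolding gd by eventually_elim (rule le)
    show "AE x in M. (\<lambda>n. \<phi> n x - \<psi> n x) \<longlonglongrightarrow> u x - w x"
      using W(5) V(5) by eventually_elim (rule tendsto_diff)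
    show "AE x in M. (\<lambda>n. grad (\<lambda>x. \<phi> n x - \<psi> n x) x) \<longlonglongrightarrow> \<xi> x - \<zeta> x"
      using W(6) V(6) unfolding gd by eventually_elim (rule tendsto_diff)
  qed
qed

text \<open>Composition is applied to the approximating test functions, where it is the classical
  chain rule, and only the result is sent to the limit. Convexity of I and h 0 = 0 turn the
  derivative bound into |h s| \<le> L |s|, which supplies the new majorant. The bound is asked for
  on I alone, so that sinh may be applied after tanh has confined the values.\<close>

lemma test_closure_compose:
  assumes v: "test_closure \<Omega> p I v \<eta>" and p: "0 < p" and h: "smooth h" "h 0 = 0"
    and I: "convex I" "0 \<in> I" "\<And>s. s \<in> I \<Longrightarrow> \<bar>deriv h s\<bar> \<le> L" "\<And>s. s \<in> I \<Longrightarrow> h s \<in> J"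
  shows "test_closure \<Omega> p J (\<lambda>x. h (v x)) (\<lambda>x. deriv h (v x) *\<^sub>R \<eta> x)"
proof -
  obtain \<phi> W where W: "integrable M W" "\<And>n. test_fun \<Omega> (\<phi> n)"
    "\<And>n. AE x in M. norm (\<phi> n x) powr p \<le> W x" "\<And>n. AE x in M. norm (grad (\<phi> n) x) powr p \<le> W x"
    "AE x in M. (\<lambda>n. \<phi> n x) \<longlonglongrightarrow> v x" "AE x in M. (\<lambda>n. grad (\<phi> n) x) \<longlonglongrightarrow> \<eta> x" and \<phi>I: "\<And>n x. \<phi> n x \<in> I"
    using v unfolding test_closure_def by blast
  note gc = grad_compose[OF h(1) test_fun_smooth[OF W(2)]]
  have L: "0 \<le> L" using I(2,3) abs_ge_zero order_trans by blast
  have lip: "\<bar>h s\<bar> \<le> L * \<bar>s\<bar>" if "s \<in> I" for s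
    using field_differentiable_bound[OF I(1), of h "deriv h" L 0 s] smooth_deriv(1)[OF h(1)] I(2,3) that h(2)
    by (auto intro: has_field_derivative_at_within)
  have isc: "isCont h t" "isCont (deriv h) t" for t
    using smooth_continuous[OF h(1), of UNIV] smooth_deriv(2)[OF h(1), of UNIV] by (simp_all add: continuous_on_eq_continuous_at)
  show ?thesis
    unfolding test_closure_def
  proof (intro conjI exI[of _ "\<lambda>n x. h (\<phi> n x)"] exI[of _ "\<lambda>x. L powr p * W x"] allI)
    have hm: "h \<in> borel_measurable borel" "deriv h \<in> borel_measurable borel"
      using smooth_continuous[OF h(1)] smooth_deriv(2)[OF h(1)] by (auto intro: borel_measurable_continuous_onI)
    note vm = test_closure_integrable(1,2)[OF v p]
    show "(\<lambda>x. h (v x)) \<in> borel_measurable M" "(\<lambda>x. deriv h (v x) *\<^sub>R \<eta> x) \<in> borel_measurable M"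
      using measurable_compose[OF vm(1) hm(1)] measurable_compose[OF vm(1) hm(2)] vm(2) by simp_all
    show "integrable M (\<lambda>x. L powr p * W x)" using W(1) by simp
    show "test_fun \<Omega> (\<lambda>x. h (\<phi> n x))" for n by (rule test_fun_compose[OF W(2) h])
    show "h (\<phi> n x) \<in> J" for n x by (rule I(4)[OF \<phi>I])
    show "AE x in M. norm (h (\<phi> n x)) powr p \<le> L powr p * W x" for n
      using W(3)[of n]
    proof eventually_elim
      case (elim x)
      have "norm (h (\<phi> n x)) powr p \<le> (L * \<bar>\<phi> n x\<bar>) powr p"
        using lip[OF \<phi>I] p by (intro powr_mono2) auto
      also have "\<dots> = L powr p * norm (\<phi> n x) powr p" using L by (simp add: powr_mult)
      also have "\<dots> \<le> L powr p * W x" using elim by (intro mult_left_mono) auto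
      finally show ?case .
    qed
    show "AE x in M. norm (grad (\<lambda>x. h (\<phi> n x)) x) powr p \<le> L powr p * W x" for n
      using W(4)[of n]
    proof eventually_elim
      case (elim x)
      have "norm (grad (\<lambda>x. h (\<phi> n x)) x) powr p \<le> (L * norm (grad (\<phi> n) x)) powr p"
        using I(3)[OF \<phi>I] p unfolding gc by (intro powr_mono2) (auto intro: mult_right_mono)
      also have "\<dots> = L powr p * norm (grad (\<phi> n) x) powr p" using L by (simp add: powr_mult)
      also have "\<dots> \<le> L powr p * W x" using elim by (intro mult_left_mono) auto
      finally show ?case .
    qed
    show "AE x in M. (\<lambda>n. h (\<phi> n x)) \<longlonglongrightarrow> h (v x)"
      using W(5) by eventually_elim (rule isCont_tendsto_compose[OF isc(1)])
    show "AE x in M. (\<lambda>n. grad (\<lambda>x. h (\<phi> n x)) x) \<longlonglongrightarrow> deriv h (v x) *\<^sub>R \<eta> x"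
      using W(5) W(6) unfolding gc
      by eventually_elim (intro tendsto_scaleR isCont_tendsto_compose[OF isc(2)])
  qed
qed

text \<open>H is merely integrable, hence the values of the approximating test functions must stay
  in a fixed interval: then |H| B dominates H \<phi>. The flux term is dominated through Young's
  inequality by C (|\<xi>|^p + W). The right-hand side converges because the gradients converge in
  L^p.\<close>

lemma test_inequality_closure:
  fixes F :: "'a \<Rightarrow> 'a" and H \<xi> :: "'a \<Rightarrow> _"
  assumes p: "1 < p" and F: "F \<in> borel_measurable M" "AE x in M. norm (F x) \<le> C * norm (\<xi> x :: 'a) powr (p - 1)"
    and \<xi>: "integrable M (\<lambda>x. norm (\<xi> x) powr p)" and H: "integrable M (H :: 'a \<Rightarrow> real)" and C: "0 \<le> C"
    and t: "\<And>\<phi>. test_fun \<Omega> \<phi> \<Longrightarrow> \<bar>(\<integral>x. F x \<bullet> grad \<phi> x \<partial>M) + (\<integral>x. H x * \<phi> x \<partial>M)\<bar> \<le> e * Lp_norm \<Omega> p (grad \<phi>)"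
    and v: "test_closure \<Omega> p {-B..B} v \<eta>"
  shows "integrable M (\<lambda>x. F x \<bullet> \<eta> x)" "integrable M (\<lambda>x. H x * v x)"
    "\<bar>(\<integral>x. F x \<bullet> \<eta> x \<partial>M) + (\<integral>x. H x * v x \<partial>M)\<bar> \<le> e * Lp_norm \<Omega> p \<eta>"
proof -
  obtain \<phi> W where W: "integrable M W" "\<And>n. test_fun \<Omega> (\<phi> n)"
    "\<And>n. AE x in M. norm (\<phi> n x) powr p \<le> W x" "\<And>n. AE x in M. norm (grad (\<phi> n) x) powr p \<le> W x"
    "AE x in M. (\<lambda>n. \<phi> n x) \<longlonglongrightarrow> v x" "AE x in M. (\<lambda>n. grad (\<phi> n) x) \<longlonglongrightarrow> \<eta> x" and I: "\<And>n x. \<phi> n x \<in> {-B..B}"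
    using v unfolding test_closure_def by blast
  note tm = test_fun_measurable[OF W(2)]
  have p0: "0 < p" using p by simp
  note vm = test_closure_integrable[OF v p0]
  have W1: "integrable M (\<lambda>x. C * (norm (\<xi> x) powr p + W x))" "integrable M (\<lambda>x. \<bar>H x\<bar> * B)"
    using W(1) \<xi> H by simp_all
  have b1: "AE x in M. norm (F x \<bullet> grad (\<phi> n) x) \<le> C * (norm (\<xi> x) powr p + W x)" for n
    using F(2) W(4)[of n]
  proof eventually_elim
    case (elim x)
    have "norm (F x \<bullet> grad (\<phi> n) x) \<le> norm (F x) * norm (grad (\<phi> n) x)"
      by (simp add: Cauchy_Schwarz_ineq2)
    also have "\<dots> \<le> C * norm (\<xi> x) powr (p - 1) * norm (grad (\<phi> n) x)"
      using elim by (intro mult_right_mono) auto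
    also have "\<dots> \<le> C * (norm (\<xi> x) powr p + norm (grad (\<phi> n) x) powr p)"
      unfolding mult.assoc using powr_conj_young1[of "norm (\<xi> x)" "norm (grad (\<phi> n) x)" p] p C
      by (intro mult_left_mono) auto
    also have "\<dots> \<le> C * (norm (\<xi> x) powr p + W x)" using elim C by (intro mult_left_mono) auto
    finally show ?case .
  qed
  have b2: "AE x in M. norm (H x * \<phi> n x) \<le> \<bar>H x\<bar> * B" for n
  proof (rule AE_I2)
    fix x
    have "\<bar>\<phi> n x\<bar> \<le> B" using I[of n x] by auto
    then show "norm (H x * \<phi> n x) \<le> \<bar>H x\<bar> * B" by (simp add: abs_mult mult_left_mono)
  qed
  have l1: "AE x in M. (\<lambda>n. F x \<bullet> grad (\<phi> n) x) \<longlonglongrightarrow> F x \<bullet> \<eta> x"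
    using W(6) by eventually_elim (intro tendsto_inner tendsto_const)
  have l2: "AE x in M. (\<lambda>n. H x * \<phi> n x) \<longlonglongrightarrow> H x * v x"
    using W(5) by eventually_elim (intro tendsto_mult tendsto_const)
  have Hm: "H \<in> borel_measurable M" using H by simp
  have mm: "(\<lambda>x. F x \<bullet> \<eta> x) \<in> borel_measurable M" "(\<lambda>x. F x \<bullet> grad (\<phi> n) x) \<in> borel_measurable M"
    "(\<lambda>x. H x * v x) \<in> borel_measurable M" "(\<lambda>x. H x * \<phi> n x) \<in> borel_measurable M" for n
    using F(1) Hm tm vm(1,2) by (intro borel_measurable_times borel_measurable_inner; simp)+
  show "integrable M (\<lambda>x. F x \<bullet> \<eta> x)" "integrable M (\<lambda>x. H x * v x)"
    by (rule integrable_dominated_convergence[OF mm(1) mm(2) W1(1) l1 b1],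
        rule integrable_dominated_convergence[OF mm(3) mm(4) W1(2) l2 b2])
  have lhs: "(\<lambda>n. \<bar>(\<integral>x. F x \<bullet> grad (\<phi> n) x \<partial>M) + (\<integral>x. H x * \<phi> n x \<partial>M)\<bar>)
      \<longlonglongrightarrow> \<bar>(\<integral>x. F x \<bullet> \<eta> x \<partial>M) + (\<integral>x. H x * v x \<partial>M)\<bar>"
    by (intro tendsto_rabs tendsto_add integral_dominated_convergence[OF mm(1) mm(2) W1(1) l1 b1]
        integral_dominated_convergence[OF mm(3) mm(4) W1(2) l2 b2])
  have "(\<lambda>n. \<integral>x. norm (grad (\<phi> n) x) powr p \<partial>M) \<longlonglongrightarrow> (\<integral>x. norm (\<eta> x) powr p \<partial>M)"
  proof (rule integral_dominated_convergence[OF _ _ W(1)])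
    show "AE x in M. (\<lambda>n. norm (grad (\<phi> n) x) powr p) \<longlonglongrightarrow> norm (\<eta> x) powr p"
      using W(6) by eventually_elim (use p in \<open>auto intro!: tendsto_powr' tendsto_norm\<close>)
    show "AE x in M. norm (norm (grad (\<phi> n) x) powr p) \<le> W x" for n using W(4)[of n] by simp
  qed (use tm vm in auto)
  then have "(\<lambda>n. (\<integral>x. norm (grad (\<phi> n) x) powr p \<partial>M) powr (1/p)) \<longlonglongrightarrow> (\<integral>x. norm (\<eta> x) powr p \<partial>M) powr (1/p)"
    using p by (intro tendsto_powr' tendsto_const) auto
  then have "(\<lambda>n. e * Lp_norm \<Omega> p (grad (\<phi> n))) \<longlonglongrightarrow> e * Lp_norm \<Omega> p \<eta>"
    unfolding Lp_norm_eq[OF test_fun_powr_integrable(2)[OF W(2) less_imp_le[OF p0]]] Lp_norm_eq[OF vm(4)]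
    by (intro tendsto_mult tendsto_const)
  then show "\<bar>(\<integral>x. F x \<bullet> \<eta> x \<partial>M) + (\<integral>x. H x * v x \<partial>M)\<bar> \<le> e * Lp_norm \<Omega> p \<eta>"
    by (rule LIMSEQ_le[OF lhs]) (use t[OF W(2)] in auto)
qed

end

section \<open>The Sobolev inequality and compactness\<close>

lemma nn_integral_lborel_affine:
  fixes f :: "'a::euclidean_space \<Rightarrow> ennreal"
  assumes [measurable]: "f \<in> borel_measurable borel" and s: "s \<noteq> 0"
  shows "(\<integral>\<^sup>+x. f x \<partial>lborel) = ennreal (\<bar>s\<bar> ^ DIM('a)) * (\<integral>\<^sup>+x. f (t + s *\<^sub>R x) \<partial>lborel)"
  by (subst lborel_affine[OF s, of t])
    (simp add: nn_integral_density nn_integral_distr nn_integral_cmult)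

lemma nn_integral_lborel_translate:
  fixes f :: "'a::euclidean_space \<Rightarrow> ennreal"
  assumes "f \<in> borel_measurable borel"
  shows "(\<integral>\<^sup>+x. f (t + x) \<partial>lborel) = (\<integral>\<^sup>+x. f x \<partial>lborel)"
  using nn_integral_lborel_affine[OF assms, of 1 t] by simp

text \<open>The fundamental theorem of calculus along a segment issuing from x. The parameter length
  S is kept free: S = 1 gives the translation estimate, and S so large that the endpoint leaves the
  support gives a bound for \<phi>(x) itself.\<close>

lemma smooth_increment_le_nn_integral:
  assumes "smooth \<phi>" "0 \<le> S"
  shows "ennreal \<bar>\<phi> (x + S *\<^sub>R z) - \<phi> x\<bar>
    \<le> (\<integral>\<^sup>+s. ennreal (indicator {0..S} s * (norm (grad \<phi> (x + s *\<^sub>R z)) * norm z)) \<partial>lborel)"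
proof -
  let ?f = "\<lambda>s. grad \<phi> (x + s *\<^sub>R z) \<bullet> z"
  have c: "continuous_on {0..S} ?f"
    by (intro continuous_intros continuous_on_compose2[OF smooth_continuous_grad[OF assms(1), of UNIV]]) auto
  have d: "((\<lambda>s. \<phi> (x + s *\<^sub>R z)) has_vector_derivative ?f s) (at s within {0..S})" for s
  proof -
    have "((\<lambda>s. \<phi> (x + s *\<^sub>R z)) has_derivative (\<lambda>t. grad \<phi> (x + s *\<^sub>R z) \<bullet> (t *\<^sub>R z))) (at s within {0..S})"
      by (rule has_derivative_compose[of "\<lambda>s. x + s *\<^sub>R z", where g=\<phi>])
        (auto intro!: derivative_eq_intros smooth_has_grad[OF assms(1)])
    then show ?thesis by (simp add: has_vector_derivative_def)
  qed
  have "(\<integral>s. indicator {0..S} s *\<^sub>R ?f s \<partial>lborel) = \<phi> (x + S *\<^sub>R z) - \<phi> (x + 0 *\<^sub>R z)"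
    by (rule integral_FTC_atLeastAtMost[OF assms(2) d c])
  then have "ennreal \<bar>\<phi> (x + S *\<^sub>R z) - \<phi> x\<bar> = ennreal (norm (\<integral>s. indicator {0..S} s *\<^sub>R ?f s \<partial>lborel))"
    by simp
  also have "\<dots> \<le> (\<integral>\<^sup>+s. norm (indicator {0..S} s *\<^sub>R ?f s) \<partial>lborel)"
    using borel_integrable_atLeastAtMost'[OF c] unfolding set_integrable_def
    by (rule integral_norm_bound_ennreal)
  also have "\<dots> \<le> (\<integral>\<^sup>+s. ennreal (indicator {0..S} s * (norm (grad \<phi> (x + s *\<^sub>R z)) * norm z)) \<partial>lborel)"
    by (intro nn_integral_mono ennreal_leI) (auto simp: indicator_def Cauchy_Schwarz_ineq2)
  finally show ?thesis .
qed

lemma smooth_grad_borel: "smooth \<phi> \<Longrightarrow> grad \<phi> \<in> borel_measurable borel"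
  and smooth_borel: "smooth \<phi> \<Longrightarrow> \<phi> \<in> borel_measurable borel"
  using smooth_continuous smooth_continuous_grad by (blast intro: borel_measurable_continuous_onI)+

text \<open>The increment bound is integrated over x and the order of integration exchanged; every
  translate of the gradient has the same integral.\<close>

lemma translation_nn_integral_le:
  fixes \<phi> :: "'a::euclidean_space \<Rightarrow> real"
  assumes "smooth \<phi>"
  shows "(\<integral>\<^sup>+x. ennreal \<bar>\<phi> (x + h) - \<phi> x\<bar> \<partial>lborel) \<le> ennreal (norm h) * (\<integral>\<^sup>+x. ennreal (norm (grad \<phi> x)) \<partial>lborel)"
proof -
  note [measurable] = smooth_grad_borel[OF assms]
  have "(\<integral>\<^sup>+x. ennreal \<bar>\<phi> (x + h) - \<phi> x\<bar> \<partial>lborel)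
      \<le> (\<integral>\<^sup>+x. (\<integral>\<^sup>+s. ennreal (indicator {0..1::real} s * (norm (grad \<phi> (x + s *\<^sub>R h)) * norm h)) \<partial>lborel) \<partial>lborel)"
    using smooth_increment_le_nn_integral[OF assms, of 1] by (intro nn_integral_mono) simp
  also have "\<dots> = (\<integral>\<^sup>+s. (\<integral>\<^sup>+x. ennreal (indicator {0..1::real} s * (norm (grad \<phi> (x + s *\<^sub>R h)) * norm h)) \<partial>lborel) \<partial>lborel)"
    by (rule lborel_pair.Fubini'[symmetric]) measurable
  also have "\<dots> = (\<integral>\<^sup>+s. indicator {0..1::real} s * (ennreal (norm h) * (\<integral>\<^sup>+x. ennreal (norm (grad \<phi> x)) \<partial>lborel)) \<partial>lborel)"
  proof (rule nn_integral_cong)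
    fix s :: real
    have "(\<integral>\<^sup>+x. ennreal (indicator {0..1::real} s * (norm (grad \<phi> (x + s *\<^sub>R h)) * norm h)) \<partial>lborel)
        = (\<integral>\<^sup>+x. ennreal (indicator {0..1::real} s * norm h) * ennreal (norm (grad \<phi> (s *\<^sub>R h + x))) \<partial>lborel)"
      by (intro nn_integral_cong) (simp add: ennreal_mult[symmetric] mult_ac add.commute)
    also have "\<dots> = ennreal (indicator {0..1::real} s * norm h) * (\<integral>\<^sup>+x. ennreal (norm (grad \<phi> (s *\<^sub>R h + x))) \<partial>lborel)"
      by (rule nn_integral_cmult) measurable
    also have "(\<integral>\<^sup>+x. ennreal (norm (grad \<phi> (s *\<^sub>R h + x))) \<partial>lborel) = (\<integral>\<^sup>+x. ennreal (norm (grad \<phi> x)) \<partial>lborel)"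
      by (rule nn_integral_lborel_translate) measurable
    finally show "(\<integral>\<^sup>+x. ennreal (indicator {0..1::real} s * (norm (grad \<phi> (x + s *\<^sub>R h)) * norm h)) \<partial>lborel)
        = indicator {0..1::real} s * (ennreal (norm h) * (\<integral>\<^sup>+x. ennreal (norm (grad \<phi> x)) \<partial>lborel))"
      by (auto simp: indicator_def)
  qed
  also have "\<dots> = ennreal (norm h) * (\<integral>\<^sup>+x. ennreal (norm (grad \<phi> x)) \<partial>lborel)"
    by (simp add: nn_integral_multc)
  finally show ?thesis .
qed

lemma shell_emeasure:
  obtains m where "0 < m" "emeasure lborel {z :: 'a::euclidean_space. 1 \<le> norm z \<and> norm z \<le> 2} = ennreal m"
proof -
  let ?V = "unit_ball_vol (real DIM('a))"
  have "{z :: 'a. 1 \<le> norm z \<and> norm z \<le> 2} = cball 0 2 - ball 0 1" by auto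
  also have "emeasure lborel (cball 0 2 - ball 0 1 :: 'a set) = emeasure lborel (cball 0 2 :: 'a set) - emeasure lborel (ball 0 1 :: 'a set)"
    by (intro emeasure_Diff) (auto simp: emeasure_ball)
  also have "\<dots> = ennreal (?V * 2 ^ DIM('a) - ?V)"
    by (simp add: emeasure_ball emeasure_cball ennreal_minus)
  finally have "emeasure lborel {z :: 'a. 1 \<le> norm z \<and> norm z \<le> 2} = ennreal (?V * 2 ^ DIM('a) - ?V)" .
  moreover have "0 < ?V * 2 ^ DIM('a) - ?V"
  proof -
    have "(1::real) < 2 ^ DIM('a)" by (rule one_less_power) auto
    then show ?thesis using unit_ball_vol_pos[of "real DIM('a)"] by simp
  qed
  ultimately show ?thesis by (rule that[rotated])
qed

text \<open>For y at distance \<rho> > 0 from x the shell condition confines s to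
  [\<rho>/2, \<rho>]. There the integrand is at most (2/\<rho>)^N 2G, with N the dimension, and the
  interval has length \<rho>/2, which leaves 2^N G \<rho>^(1-N).\<close>

lemma riesz_potential_radial_integral:
  fixes x y :: "'a::euclidean_space"
  assumes "0 \<le> G"
  shows "(\<integral>\<^sup>+s. ennreal (indicator {0<..} s * (1 / s ^ DIM('a) * (indicator ({z. 1 \<le> norm z \<and> norm z \<le> 2}) ((1/s) *\<^sub>R (y - x)) * (G * (norm (y - x) / s))))) \<partial>lborel)
    \<le> ennreal (2 ^ DIM('a) * (G * norm (y - x) powr (1 - real DIM('a))))"
proof (cases "y = x")
  case True
  then show ?thesis by simp
next
  case False
  define \<rho> where "\<rho> = norm (y - x)"
  have \<rho>: "0 < \<rho>" using False by (simp add: \<rho>_def)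
  have "(\<integral>\<^sup>+s. ennreal (indicator {0<..} s * (1 / s ^ DIM('a) * (indicator ({z. 1 \<le> norm z \<and> norm z \<le> 2}) ((1/s) *\<^sub>R (y - x)) * (G * (norm (y - x) / s))))) \<partial>lborel)
    \<le> (\<integral>\<^sup>+s. ennreal ((2/\<rho>) ^ DIM('a) * (G * 2)) * indicator {\<rho>/2..\<rho>} s \<partial>lborel)"
  proof (rule nn_integral_mono)
    fix s :: real
    show "ennreal (indicator {0<..} s * (1 / s ^ DIM('a) * (indicator ({z. 1 \<le> norm z \<and> norm z \<le> 2}) ((1/s) *\<^sub>R (y - x)) * (G * (norm (y - x) / s)))))
      \<le> ennreal ((2/\<rho>) ^ DIM('a) * (G * 2)) * indicator {\<rho>/2..\<rho>} s"
    proof (cases "0 < s \<and> (1/s) *\<^sub>R (y - x) \<in> {z. 1 \<le> norm z \<and> norm z \<le> 2}")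
      case True
      then have s: "0 < s" "\<rho> / s \<le> 2" "1 \<le> \<rho> / s"
        by (auto simp: \<rho>_def dist_norm norm_minus_commute[of x y])
      then have s': "\<rho>/2 \<le> s" "s \<le> \<rho>" by (auto simp: field_simps)
      have "1 / s \<le> 2 / \<rho>" using s s' \<rho> by (simp add: field_simps)
      then have "(1 / s) ^ DIM('a) \<le> (2/\<rho>) ^ DIM('a)" using s by (intro power_mono) auto
      then have "1 / s ^ DIM('a) * (G * (\<rho> / s)) \<le> (2/\<rho>) ^ DIM('a) * (G * 2)"
        using s assms \<rho> by (intro mult_mono) (auto simp: power_divide intro: mult_left_mono)
      with True s' show ?thesis by (simp add: \<rho>_def[symmetric] ennreal_leI)
    next
      case False
      then show ?thesis by (auto simp: indicator_def)
    qed
  qed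
  also have "\<dots> = ennreal ((2/\<rho>) ^ DIM('a) * (G * 2)) * ennreal (\<rho>/2)"
    using \<rho> by (simp add: nn_integral_cmult_indicator)
  also have "\<dots> = ennreal (2 ^ DIM('a) * (G * (\<rho> / \<rho> ^ DIM('a))))"
    using \<rho> assms by (simp add: ennreal_mult[symmetric] power_divide field_simps)
  also have "\<rho> / \<rho> ^ DIM('a) = \<rho> powr (1 - real DIM('a))"
    using \<rho> by (simp add: powr_diff powr_realpow)
  finally show ?thesis by (simp add: \<rho>_def)
qed

text \<open>Integrate the gradient along the rays from x through a point z of the shell 1 \<le> |z| \<le> 2,
  average over z, and substitute y = x + s z.\<close>

lemma riesz_potential_bound:
  obtains c where "0 \<le> c" "\<And>\<phi> \<Omega> x. test_fun \<Omega> (\<phi> :: 'a::euclidean_space \<Rightarrow> real) \<Longrightarrow>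
    ennreal \<bar>\<phi> x\<bar> \<le> ennreal c * (\<integral>\<^sup>+y. ennreal (norm (grad \<phi> y) * norm (y - x) powr (1 - real DIM('a))) \<partial>lborel)"
proof -
  let ?S = "{z. 1 \<le> norm z \<and> norm z \<le> 2} :: 'a set"
  obtain m where m: "0 < m" "emeasure lborel ?S = ennreal m" by (rule shell_emeasure)
  show ?thesis
  proof (rule that[of "2 ^ DIM('a) / m"])
    fix \<phi> :: "'a \<Rightarrow> real" and \<Omega> :: "'a set" and x :: 'a assume \<phi>: "test_fun \<Omega> \<phi>"
    note sm = test_fun_smooth[OF \<phi>]
    note [measurable] = smooth_grad_borel[OF sm]
    obtain K where K: "compact K" "\<And>x. x \<notin> K \<Longrightarrow> \<phi> x = 0"
      using \<phi> test_fun_supportE by metis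
    obtain \<rho> where \<rho>: "0 < \<rho>" "\<And>y. y \<in> K \<Longrightarrow> norm y \<le> \<rho>"
      using compact_imp_bounded[OF K(1)] by (auto simp: bounded_pos)
    \<comment> \<open>Since |z| \<ge> 1, a step of length T along z reaches a point of norm greater
      than \<rho>, hence outside the support.\<close>
    define T where "T = \<rho> + norm x + 1"
    have T: "0 \<le> T" using \<rho>(1) by (simp add: T_def)
    define g where "g y = norm (grad \<phi> y)" for y
    have [measurable]: "g \<in> borel_measurable borel" unfolding g_def[abs_def] by measurable
    have g0: "0 \<le> g y" for y by (simp add: g_def)
    have ray: "ennreal \<bar>\<phi> x\<bar> \<le> (\<integral>\<^sup>+s. ennreal (indicator {0<..} s * (g (x + s *\<^sub>R z) * norm z)) \<partial>lborel)"
      if z: "z \<in> ?S" for z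
    proof -
      have "T * 1 \<le> T * norm z" using z T by (intro mult_left_mono) auto
      then have "\<rho> < norm (x + T *\<^sub>R z)"
        using norm_triangle_ineq4[of "x + T *\<^sub>R z" x] T by (simp add: T_def)
      then have "\<phi> (x + T *\<^sub>R z) = 0" using \<rho>(2) K(2) by (meson not_le)
      then have "ennreal \<bar>\<phi> x\<bar> \<le> (\<integral>\<^sup>+s. ennreal (indicator {0..T} s * (g (x + s *\<^sub>R z) * norm z)) \<partial>lborel)"
        using smooth_increment_le_nn_integral[OF sm T, of x z] by (simp add: g_def)
      also have "\<dots> \<le> (\<integral>\<^sup>+s. ennreal (indicator {0<..} s * (g (x + s *\<^sub>R z) * norm z)) \<partial>lborel)"
      proof (rule nn_integral_mono_AE)
        show "AE s in lborel. ennreal (indicator {0..T} s * (g (x + s *\<^sub>R z) * norm z))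
            \<le> ennreal (indicator {0<..} s * (g (x + s *\<^sub>R z) * norm z))"
          using AE_lborel_singleton[of "0::real"]
          by eventually_elim (auto simp: indicator_def g0 intro!: ennreal_leI)
      qed
      finally show ?thesis .
    qed
    have "ennreal m * ennreal \<bar>\<phi> x\<bar> = (\<integral>\<^sup>+z. ennreal \<bar>\<phi> x\<bar> * indicator ?S z \<partial>lborel)"
      by (simp add: nn_integral_cmult_indicator m mult.commute)
    also have "\<dots> \<le> (\<integral>\<^sup>+z. (\<integral>\<^sup>+s. ennreal (indicator ?S z * (indicator {0<..} s * (g (x + s *\<^sub>R z) * norm z))) \<partial>lborel) \<partial>lborel)"
    proof (rule nn_integral_mono)
      fix z
      show "ennreal \<bar>\<phi> x\<bar> * indicator ?S z \<le> (\<integral>\<^sup>+s. ennreal (indicator ?S z * (indicator {0<..} s * (g (x + s *\<^sub>R z) * norm z))) \<partial>lborel)"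
        using ray[of z] by (cases "z \<in> ?S") auto
    qed
    also have "\<dots> = (\<integral>\<^sup>+s. (\<integral>\<^sup>+z. ennreal (indicator ?S z * (indicator {0<..} s * (g (x + s *\<^sub>R z) * norm z))) \<partial>lborel) \<partial>lborel)"
      by (rule lborel_pair.Fubini'[symmetric]) measurable
    \<comment> \<open>For fixed s > 0 the substitution y = x + s z has Jacobian s^N, and |z| becomes
      |y - x| / s.\<close>
    also have "\<dots> = (\<integral>\<^sup>+s. (\<integral>\<^sup>+y. ennreal (indicator {0<..} s * (1 / s ^ DIM('a) * (indicator ?S ((1/s) *\<^sub>R (y - x)) * (g y * (norm (y - x) / s))))) \<partial>lborel) \<partial>lborel)"
    proof (rule nn_integral_cong)
      fix s :: real
      show "(\<integral>\<^sup>+z. ennreal (indicator ?S z * (indicator {0<..} s * (g (x + s *\<^sub>R z) * norm z))) \<partial>lborel)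
        = (\<integral>\<^sup>+y. ennreal (indicator {0<..} s * (1 / s ^ DIM('a) * (indicator ?S ((1/s) *\<^sub>R (y - x)) * (g y * (norm (y - x) / s))))) \<partial>lborel)"
      proof (cases "0 < s")
        case True
        have "(\<integral>\<^sup>+y. ennreal (indicator {0<..} s * (1 / s ^ DIM('a) * (indicator ?S ((1/s) *\<^sub>R (y - x)) * (g y * (norm (y - x) / s))))) \<partial>lborel)
          = ennreal (\<bar>s\<bar> ^ DIM('a)) * (\<integral>\<^sup>+z. ennreal (indicator {0<..} s * (1 / s ^ DIM('a) * (indicator ?S ((1/s) *\<^sub>R ((x + s *\<^sub>R z) - x)) * (g (x + s *\<^sub>R z) * (norm ((x + s *\<^sub>R z) - x) / s))))) \<partial>lborel)"
          using True by (intro nn_integral_lborel_affine) auto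
        also have "\<dots> = (\<integral>\<^sup>+z. ennreal (\<bar>s\<bar> ^ DIM('a)) * ennreal (indicator {0<..} s * (1 / s ^ DIM('a) * (indicator ?S ((1/s) *\<^sub>R ((x + s *\<^sub>R z) - x)) * (g (x + s *\<^sub>R z) * (norm ((x + s *\<^sub>R z) - x) / s))))) \<partial>lborel)"
          by (rule nn_integral_cmult[symmetric]) measurable
        also have "\<dots> = (\<integral>\<^sup>+z. ennreal (indicator ?S z * (indicator {0<..} s * (g (x + s *\<^sub>R z) * norm z))) \<partial>lborel)"
          using True g0 by (intro nn_integral_cong) (simp add: ennreal_mult[symmetric])
        finally show ?thesis by simp
      qed simp
    qed
    also have "\<dots> = (\<integral>\<^sup>+y. (\<integral>\<^sup>+s. ennreal (indicator {0<..} s * (1 / s ^ DIM('a) * (indicator ?S ((1/s) *\<^sub>R (y - x)) * (g y * (norm (y - x) / s))))) \<partial>lborel) \<partial>lborel)"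
      by (rule lborel_pair.Fubini') measurable
    also have "\<dots> \<le> (\<integral>\<^sup>+y. ennreal (2 ^ DIM('a) * (g y * norm (y - x) powr (1 - real DIM('a)))) \<partial>lborel)"
      by (intro nn_integral_mono riesz_potential_radial_integral g0)
    also have "\<dots> = ennreal (2 ^ DIM('a)) * (\<integral>\<^sup>+y. ennreal (g y * norm (y - x) powr (1 - real DIM('a))) \<partial>lborel)"
      using g0 by (subst nn_integral_cmult[symmetric]) (auto simp: ennreal_mult)
    finally have "ennreal m * ennreal \<bar>\<phi> x\<bar> \<le> ennreal (2 ^ DIM('a)) * (\<integral>\<^sup>+y. ennreal (g y * norm (y - x) powr (1 - real DIM('a))) \<partial>lborel)" .
    then have "ennreal (1/m) * (ennreal m * ennreal \<bar>\<phi> x\<bar>)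
        \<le> ennreal (1/m) * (ennreal (2 ^ DIM('a)) * (\<integral>\<^sup>+y. ennreal (g y * norm (y - x) powr (1 - real DIM('a))) \<partial>lborel))"
      by (rule mult_left_mono) simp
    then show "ennreal \<bar>\<phi> x\<bar> \<le> ennreal (2 ^ DIM('a) / m) * (\<integral>\<^sup>+y. ennreal (norm (grad \<phi> y) * norm (y - x) powr (1 - real DIM('a))) \<partial>lborel)"
      using m(1) by (simp add: mult.assoc[symmetric] ennreal_mult[symmetric] g_def)
  qed (use m in auto)
qed

text \<open>Dyadic decomposition: on D / 2^(j+1) < |w| \<le> D / 2^j the kernel is at most
  \<open>c j\<close>, and the ball of radius D / 2^j has volume proportional to 2^(-jN). The sum is
  geometric with ratio 2^(a-N) < 1.\<close>

lemma riesz_kernel_integrable: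
  fixes a D :: real
  assumes a: "0 \<le> a" "a < real DIM('a)" and D: "0 < D"
  shows "(\<integral>\<^sup>+w. ennreal (indicator {w. norm w \<le> D} w * norm (w :: 'a::euclidean_space) powr (- a)) \<partial>lborel) < \<infinity>"
proof -
  let ?V = "unit_ball_vol (real DIM('a))"
  define c where "c j = (D / 2 ^ Suc j) powr (- a)" for j :: nat
  have "(\<integral>\<^sup>+w. ennreal (indicator {w. norm w \<le> D} w * norm (w :: 'a) powr (- a)) \<partial>lborel)
    \<le> (\<integral>\<^sup>+w. (\<Sum>j. ennreal (c j) * indicator {w. norm w \<le> D / 2 ^ j} (w :: 'a)) \<partial>lborel)"
  proof (rule nn_integral_mono)
    fix w :: 'a
    show "ennreal (indicator {w. norm w \<le> D} w * norm w powr (- a)) \<le> (\<Sum>j. ennreal (c j) * indicator {w. norm w \<le> D / 2 ^ j} w)"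
    proof (cases "w \<noteq> 0 \<and> norm w \<le> D")
      case True
      have "(\<lambda>j. D / 2 ^ Suc j) \<longlonglongrightarrow> 0"
        by (rule LIMSEQ_Suc[OF LIMSEQ_divide_realpow_zero]) simp
      then have "eventually (\<lambda>j. D / 2 ^ Suc j < norm w) sequentially"
        using True by (intro order_tendstoD) auto
      then have ex: "\<exists>j. D / 2 ^ Suc j < norm w" by (rule eventually_happens'[OF sequentially_bot])
      \<comment> \<open>The dyadic index with D / 2^(j+1) < |w| \<le> D / 2^j; minimality gives the
        second inequality, and for j = 0 it is the restriction |w| \<le> D.\<close>
      define j where "j = (LEAST j. D / 2 ^ Suc j < norm w)"
      have j: "D / 2 ^ Suc j < norm w" unfolding j_def by (rule LeastI_ex[OF ex])
      have "norm w \<le> D / 2 ^ j"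
      proof (cases j)
        case 0
        then show ?thesis using True by simp
      next
        case (Suc i)
        then show ?thesis using not_less_Least[of i "\<lambda>j. D / 2 ^ Suc j < norm w"] by (simp add: j_def not_less)
      qed
      then have "ennreal (c j) = ennreal (c j) * indicator {w. norm w \<le> D / 2 ^ j} w" by simp
      also have "\<dots> \<le> (\<Sum>j. ennreal (c j) * indicator {w. norm w \<le> D / 2 ^ j} w)"
      proof -
        define F where "F = (\<lambda>i. ennreal (c i) * indicator {w. norm w \<le> D / 2 ^ i} w)"
        have "F j \<le> suminf F" using sum_le_suminf[of F "{j}"] by simp
        then show ?thesis by (simp only: F_def)
      qed
      finally have "ennreal (c j) \<le> (\<Sum>j. ennreal (c j) * indicator {w. norm w \<le> D / 2 ^ j} w)" .
      moreover have "norm w powr (- a) \<le> c j"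
        unfolding c_def using j a(1) D by (intro powr_mono2') auto
      ultimately show ?thesis
        by (auto simp: indicator_def intro: order_trans ennreal_leI)
    next
      case False
      then show ?thesis by (auto simp: indicator_def)
    qed
  qed
  also have "\<dots> = (\<Sum>j. \<integral>\<^sup>+w. ennreal (c j) * indicator {w. norm w \<le> D / 2 ^ j} (w :: 'a) \<partial>lborel)"
    by (rule nn_integral_suminf) measurable
  also have "\<dots> = (\<Sum>j. ennreal (?V * D ^ DIM('a) * (D / 2) powr (- a) * (2 powr (a - real DIM('a))) ^ j))"
  proof (rule suminf_cong)
    fix j :: nat
    have 1: "(\<integral>\<^sup>+w. ennreal (c j) * indicator {w. norm w \<le> D / 2 ^ j} (w :: 'a) \<partial>lborel) = ennreal (c j * (?V * (D / 2 ^ j) ^ DIM('a)))"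
    proof -
      have "{w :: 'a. norm w \<le> D / 2 ^ j} = cball 0 (D / 2 ^ j)" by auto
      then show ?thesis using D by (simp add: nn_integral_cmult_indicator emeasure_cball c_def ennreal_mult)
    qed
    have 2: "c j = (D / 2) powr (- a) * (2 powr a) ^ j"
    proof -
      have "c j = (D / 2) powr (- a) / (2 ^ j) powr (- a)"
      proof -
        have "D / 2 ^ Suc j = (D / 2) / 2 ^ j" by simp
        then show ?thesis unfolding c_def by (simp only: powr_divide)
      qed
      also have "(2 ^ j) powr (- a) = (2 powr real j) powr (- a)" by (subst powr_realpow) auto
      also have "\<dots> = inverse ((2 powr a) ^ j)" by (simp add: powr_powr powr_minus powr_power mult.commute)
      finally show ?thesis by (simp only: divide_inverse inverse_inverse_eq)
    qed
    have 3: "(D / 2 ^ j) ^ DIM('a) = D ^ DIM('a) / (2 powr real DIM('a)) ^ j"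
      by (simp add: power_divide power_mult[symmetric] powr_realpow mult.commute)
    have 4: "(2 powr (a - real DIM('a))) ^ j = (2 powr a) ^ j / (2 powr real DIM('a)) ^ j"
      by (simp only: powr_diff power_divide)
    show "(\<integral>\<^sup>+w. ennreal (c j) * indicator {w. norm w \<le> D / 2 ^ j} (w :: 'a) \<partial>lborel)
      = ennreal (?V * D ^ DIM('a) * (D / 2) powr (- a) * (2 powr (a - real DIM('a))) ^ j)"
      by (subst 1) (simp only: 2 3 4 times_divide_eq_left times_divide_eq_right mult_ac)
  qed
  also have "\<dots> = ennreal (\<Sum>j. ?V * D ^ DIM('a) * (D / 2) powr (- a) * (2 powr (a - real DIM('a))) ^ j)"
  proof (rule suminf_ennreal2)
    have "2 powr (a - real DIM('a)) < 1" using a(2) powr_less_mono[of "a - real DIM('a)" 0 2] by simp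
    then show "summable (\<lambda>j. ?V * D ^ DIM('a) * (D / 2) powr (- a) * (2 powr (a - real DIM('a))) ^ j)"
      by (intro summable_mult summable_geometric) simp
    show "0 \<le> ?V * D ^ DIM('a) * (D / 2) powr (- a) * (2 powr (a - real DIM('a))) ^ i" for i
      using D by (intro mult_nonneg_nonneg zero_le_power powr_ge_zero) simp_all
  qed
  finally show ?thesis by (rule le_less_trans) simp
qed

section \<open>The subcritical Sobolev inequality through Young's convolution inequality\<close>

lemma young_pointwise:
  fixes k g t p r s :: real
  assumes "0 \<le> k" "0 \<le> g" "0 < t" "1 \<le> p" "p \<le> r" "0 < s" "1/s = 1 + 1/r - 1/p"
  shows "k * g \<le> t powr (1/r) * (k powr s * g powr p / t + k powr s + g powr p)"
proof (cases "k = 0 \<or> g = 0")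
  case False
  then have kg: "0 < k" "0 < g" using assms by auto
  \<comment> \<open>The three-exponent Hoelder weights in the usual proof of Young's convolution
    inequality. Up to the factor t^(1/r), k g is the geometric mean with these weights of k^s g^p /
    t, k^s and g^p, and a geometric mean is at most the sum. The scale t remains free until the
    value of the convolution at a point is known.\<close>
  define \<alpha> \<beta> \<gamma> where "\<alpha> = 1/r" "\<beta> = 1 - 1/p" "\<gamma> = 1/p - 1/r"
  have abc: "0 \<le> \<alpha>" "0 \<le> \<beta>" "0 \<le> \<gamma>" "\<alpha> + \<beta> + \<gamma> = 1"
    using assms by (auto simp: \<alpha>_\<beta>_\<gamma>_def frac_le)
  define a b c where "a = k powr s * g powr p / t" "b = k powr s" "c = g powr p"
  have pos: "0 < a" "0 < b" "0 < c" using kg assms by (auto simp: a_b_c_def)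
  define m where "m = a + b + c"
  have m: "a \<le> m" "b \<le> m" "c \<le> m" "0 < m" using pos by (auto simp: m_def)
  have e1: "s * \<alpha> + s * \<beta> = 1"
  proof -
    have "s * (\<alpha> + \<beta>) = s * (1/s)" using assms(7) by (simp add: \<alpha>_\<beta>_\<gamma>_def)
    then show ?thesis using assms(6) by (simp add: distrib_left)
  qed
  have e2: "p * \<alpha> + p * \<gamma> = 1" using assms by (simp add: \<alpha>_\<beta>_\<gamma>_def right_diff_distrib)
  have "a powr \<alpha> * b powr \<beta> * c powr \<gamma> = (k powr (s * \<alpha>) * k powr (s * \<beta>)) * (g powr (p * \<alpha>) * g powr (p * \<gamma>)) / t powr \<alpha>"
    using kg assms by (simp add: a_b_c_def powr_divide powr_mult powr_powr)
  also have "\<dots> = k * g / t powr \<alpha>"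
    using kg e1 e2 by (simp add: powr_add[symmetric])
  finally have "k * g = t powr (1/r) * (a powr \<alpha> * b powr \<beta> * c powr \<gamma>)"
    using assms by (simp add: \<alpha>_\<beta>_\<gamma>_def)
  also have "a powr \<alpha> * b powr \<beta> * c powr \<gamma> \<le> m powr \<alpha> * m powr \<beta> * m powr \<gamma>"
    using pos m abc by (intro mult_mono powr_mono2) auto
  also have "\<dots> = m" using m(4) abc(4) by (simp add: powr_add[symmetric])
  finally show ?thesis using assms by (simp add: m_def a_b_c_def)
qed (use assms in \<open>auto intro!: mult_nonneg_nonneg add_nonneg_nonneg divide_nonneg_nonneg\<close>)

text \<open>Subcriticality of r says n/p - n/r < 1, and this is the condition under which the s-th
  power of the kernel |w|^(1-n) is integrable near 0, s being the exponent that Young's inequality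
  assigns to the kernel.\<close>

lemma subcritical_young_exponent:
  fixes n p r :: real
  assumes "2 \<le> n" "1 \<le> p" "p < r" and crit: "p < n \<Longrightarrow> r < n * p / (n - p)"
  defines "s \<equiv> 1 / (1 + 1/r - 1/p)"
  shows "0 < s" "1/s = 1 + 1/r - 1/p" "s * (n - 1) < n"
proof -
  have "1/p \<le> 1" "0 < 1/r" using assms by auto
  then have pos: "0 < 1 + 1/r - 1/p" by linarith
  then show "0 < s" "1/s = 1 + 1/r - 1/p" by (auto simp: s_def)
  have "n / p - n / r < 1"
  proof (cases "p < n")
    case True
    then have "r * (n - p) < n * p" using crit by (simp add: pos_less_divide_eq)
    then have "n * r - n * p < p * r" by (simp add: algebra_simps)
    then have "(n * r - n * p) / (p * r) < 1" using assms by simp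
    moreover have "(n * r - n * p) / (p * r) = n / p - n / r" using assms by (simp add: diff_divide_distrib)
    ultimately show ?thesis by simp
  next
    case False
    then have "n / p \<le> 1" "0 < n / r" using assms by auto
    then show ?thesis by linarith
  qed
  then have "n - 1 < n * (1 + 1/r - 1/p)" by (simp add: algebra_simps)
  then show "s * (n - 1) < n" using pos by (simp add: s_def pos_divide_less_eq)
qed

text \<open>The scale t in \<open>young_pointwise\<close> must be positive, while the convolution P
  may vanish; so t is taken strictly above P and lowered to it afterwards.\<close>

lemma le_mult_if_le_mult_greater:
  fixes a C P :: real
  assumes "0 < C" "\<And>t. P < t \<Longrightarrow> a \<le> C * t"
  shows "a \<le> C * P"
proof -
  have "a / C \<le> P"
    by (rule dense_ge) (use assms in \<open>simp add: pos_divide_le_eq mult.commute\<close>)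
  then show ?thesis using assms(1) by (simp add: pos_divide_le_eq mult.commute)
qed

context bounded_open
begin

text \<open>The Riesz potential bounds |\<phi>| by the kernel convolved with |grad \<phi>|. Young's
  inequality then bounds |\<phi>|^r pointwise by a multiple of P, the convolution of the s-th power
  of the kernel with |grad \<phi>|^p, and Fubini gives the integral of P as a product. A constant
  depending on B in an inhomogeneous way is enough, because only boundedness is wanted.\<close>

lemma sobolev_bound:
  assumes N: "2 \<le> DIM('a)" and p: "1 \<le> p" "p < r"
    and crit: "p < real DIM('a) \<Longrightarrow> r < real DIM('a) * p / (real DIM('a) - p)" and B: "0 \<le> B"
  obtains C where "\<And>\<phi>. test_fun \<Omega> \<phi> \<Longrightarrow> (\<integral>x. norm (grad \<phi> x) powr p \<partial>M) \<le> B \<Longrightarrow> (\<integral>x. norm (\<phi> x) powr r \<partial>M) \<le> C"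
proof -
  define n where "n = real DIM('a)"
  define s where "s = 1 / (1 + 1/r - 1/p)"
  have s: "0 < s" "1/s = 1 + 1/r - 1/p" "s * (n - 1) < n"
    using subcritical_young_exponent[of n p r] N p crit by (auto simp: s_def n_def)
  have n2: "2 \<le> n" using N by (simp add: n_def)
  obtain D where D: "0 < D" "\<And>x y. x \<in> \<Omega> \<Longrightarrow> y \<in> \<Omega> \<Longrightarrow> norm (y - x) \<le> D"
  proof -
    obtain b where b: "0 < b" "\<And>x. x \<in> \<Omega> \<Longrightarrow> norm x \<le> b"
      using bounded_domain by (auto simp: bounded_pos)
    show ?thesis
    proof (rule that[of "2 * b"])
      show "norm (y - x) \<le> 2 * b" if "x \<in> \<Omega>" "y \<in> \<Omega>" for x y
        using b(2)[OF that(1)] b(2)[OF that(2)] norm_triangle_ineq4[of y x] by linarith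
    qed (use b in simp)
  qed
  \<comment> \<open>The gradient vanishes off \<Omega>, so for x in \<Omega> the kernel may be cut
    off at the bound D for distances in \<Omega>; only its singularity at 0 then matters.\<close>
  define \<kappa> where "\<kappa> w = indicator {w. norm w \<le> D} w * norm w powr (1 - n)" for w :: 'a
  have \<kappa>0: "0 \<le> \<kappa> w" for w by (simp add: \<kappa>_def)
  have [measurable]: "\<kappa> \<in> borel_measurable borel" unfolding \<kappa>_def[abs_def] by measurable
  have \<kappa>s: "\<kappa> w powr s = indicator {w. norm w \<le> D} w * norm w powr (- (s * (n - 1)))" for w
    using s(1) by (simp add: \<kappa>_def powr_powr indicator_def algebra_simps)
  have Kfin: "(\<integral>\<^sup>+w. ennreal (\<kappa> w powr s) \<partial>lborel) < \<infinity>"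
    unfolding \<kappa>s using s n2 D(1) by (intro riesz_kernel_integrable) (auto simp: n_def)
  define K where "K = enn2real (\<integral>\<^sup>+w. ennreal (\<kappa> w powr s) \<partial>lborel)"
  have K: "(\<integral>\<^sup>+w. ennreal (\<kappa> w powr s) \<partial>lborel) = ennreal K" "0 \<le> K"
    using Kfin by (auto simp: K_def)
  obtain c where c: "0 \<le> c" "\<And>\<phi> \<Omega> x. test_fun \<Omega> (\<phi> :: 'a \<Rightarrow> real) \<Longrightarrow>
    ennreal \<bar>\<phi> x\<bar> \<le> ennreal c * (\<integral>\<^sup>+y. ennreal (norm (grad \<phi> y) * norm (y - x) powr (1 - real DIM('a))) \<partial>lborel)"
    by (rule riesz_potential_bound[where 'a='a]) blast
  \<comment> \<open>The summands 1, K and B bound the integrals of the three terms of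
    \<open>young_pointwise\<close>, and c is the constant of the Riesz potential bound; the last + 1
    only secures positivity.\<close>
  define C1 where "C1 = (c * (1 + K + B) + 1) powr r"
  have "0 < c * (1 + K + B) + 1"
    using c(1) K(2) B by (intro add_nonneg_pos mult_nonneg_nonneg) auto
  then have C1: "0 < C1" by (simp add: C1_def)
  show ?thesis
  proof (rule that[of "C1 * (K * B)"])
    fix \<phi> assume \<phi>: "test_fun \<Omega> \<phi>" and le: "(\<integral>x. norm (grad \<phi> x) powr p \<partial>M) \<le> B"
    note sm = test_fun_smooth[OF \<phi>]
    note [measurable] = smooth_grad_borel[OF sm] smooth_borel[OF sm]
    define g where "g y = norm (grad \<phi> y)" for y
    have [measurable]: "g \<in> borel_measurable borel" unfolding g_def[abs_def] by measurable
    have g0: "0 \<le> g y" for y by (simp add: g_def)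
    obtain L where L: "L \<subseteq> \<Omega>" "\<And>x. x \<notin> L \<Longrightarrow> \<phi> x = 0" "\<And>x. x \<notin> L \<Longrightarrow> grad \<phi> x = 0"
      using \<phi> test_fun_supportE by metis
    have out: "\<phi> x = 0" "g x = 0" if "x \<notin> \<Omega>" for x
      using that L by (auto simp: g_def)
    have p0: "0 \<le> p" "0 < r" using p by auto
    have \<Gamma>: "(\<integral>\<^sup>+y. ennreal (g y powr p) \<partial>lborel) \<le> ennreal B"
    proof -
      have "(\<integral>\<^sup>+y. ennreal (g y powr p) \<partial>lborel) = (\<integral>\<^sup>+y. ennreal (g y powr p) \<partial>M)"
        by (rule nn_integral_lebesgue_on_eq_lborel[OF open_domain, symmetric]) (simp add: out)
      also have "\<dots> = ennreal (\<integral>x. g x powr p \<partial>M)"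
        using test_fun_powr_integrable(2)[OF \<phi> p0(1)] by (intro nn_integral_eq_integral) (auto simp: g_def)
      also have "\<dots> \<le> ennreal B" using le by (simp add: g_def ennreal_leI)
      finally show ?thesis .
    qed
    define P where "P x = (\<integral>\<^sup>+y. ennreal (\<kappa> (y - x) powr s * g y powr p) \<partial>lborel)" for x
    have shift: "(\<integral>\<^sup>+y. ennreal (\<kappa> (y - x) powr s) \<partial>lborel) = ennreal K" for x
      using nn_integral_lborel_translate[of "\<lambda>w. ennreal (\<kappa> w powr s)" "- x"] K(1) by (simp add: algebra_simps)
    have refl: "(\<integral>\<^sup>+x. ennreal (\<kappa> (y - x) powr s) \<partial>lborel) = ennreal K" for y
      using nn_integral_lborel_affine[of "\<lambda>w. ennreal (\<kappa> w powr s)" "-1" y] K(1) by simp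
    have pw: "ennreal (norm (\<phi> x) powr r) \<le> ennreal C1 * P x" for x
    proof (cases "x \<in> \<Omega> \<and> P x < \<infinity>")
      case True
      then obtain P' where P': "P x = ennreal P'" "0 \<le> P'"
        by (cases "P x") auto
      have pot: "ennreal \<bar>\<phi> x\<bar> \<le> ennreal c * (\<integral>\<^sup>+y. ennreal (\<kappa> (y - x) * g y) \<partial>lborel)"
      proof -
        have "norm (grad \<phi> y) * norm (y - x) powr (1 - real DIM('a)) = \<kappa> (y - x) * g y" for y
          using True D(2)[of x y] out(2)[of y] by (cases "y \<in> \<Omega>") (auto simp: \<kappa>_def g_def n_def)
        then show ?thesis using c(2)[OF \<phi>, of x] by simp
      qed
      \<comment> \<open>With the scale t above P x, the first term of \<open>young_pointwise\<close>
        integrates to P x / t \<le> 1, the other two to at most K and B.\<close>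
      have "\<bar>\<phi> x\<bar> powr r \<le> C1 * t" if t: "P' < t" for t
      proof -
        have t0: "0 < t" using P'(2) t by linarith
        have "(\<integral>\<^sup>+y. ennreal (\<kappa> (y - x) * g y) \<partial>lborel)
          \<le> (\<integral>\<^sup>+y. ennreal (t powr (1/r)) * (ennreal (1/t) * ennreal (\<kappa> (y - x) powr s * g y powr p) + ennreal (\<kappa> (y - x) powr s) + ennreal (g y powr p)) \<partial>lborel)"
        proof (rule nn_integral_mono)
          fix y
          have "\<kappa> (y - x) * g y \<le> t powr (1/r) * (\<kappa> (y - x) powr s * g y powr p / t + \<kappa> (y - x) powr s + g y powr p)"
            using \<kappa>0 g0 t0 p s by (intro young_pointwise) auto
          then show "ennreal (\<kappa> (y - x) * g y) \<le> ennreal (t powr (1/r)) * (ennreal (1/t) * ennreal (\<kappa> (y - x) powr s * g y powr p) + ennreal (\<kappa> (y - x) powr s) + ennreal (g y powr p))"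
            using t0 by (simp add: ennreal_mult[symmetric] ennreal_plus[symmetric] ennreal_leI del: ennreal_plus)
        qed
        also have "\<dots> = ennreal (t powr (1/r)) * (ennreal (1/t) * P x + ennreal K + (\<integral>\<^sup>+y. ennreal (g y powr p) \<partial>lborel))"
          by (simp add: nn_integral_cmult nn_integral_add P_def shift)
        also have "\<dots> \<le> ennreal (t powr (1/r)) * (ennreal 1 + ennreal K + ennreal B)"
        proof (intro mult_left_mono add_mono \<Gamma> order_refl)
          have "ennreal (1/t) * P x = ennreal (P' / t)"
            using P' t0 by (simp add: ennreal_mult[symmetric])
          also have "\<dots> \<le> ennreal 1" using t t0 by (intro ennreal_leI) simp
          finally show "ennreal (1/t) * P x \<le> ennreal 1" .
        qed simp
        also have "\<dots> = ennreal (t powr (1/r) * (1 + K + B))"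
          using K(2) B by (simp add: ennreal_mult ennreal_plus[symmetric] del: ennreal_plus ennreal_1)
        finally have 1: "(\<integral>\<^sup>+y. ennreal (\<kappa> (y - x) * g y) \<partial>lborel) \<le> ennreal (t powr (1/r) * (1 + K + B))" .
        have "ennreal \<bar>\<phi> x\<bar> \<le> ennreal c * ennreal (t powr (1/r) * (1 + K + B))"
          by (rule order_trans[OF pot mult_left_mono[OF 1]]) simp
        then have "\<bar>\<phi> x\<bar> \<le> c * (t powr (1/r) * (1 + K + B))"
          using c(1) K(2) B by (simp add: ennreal_mult[symmetric])
        also have "\<dots> = (c * (1 + K + B)) * t powr (1/r)" by simp
        also have "\<dots> \<le> (c * (1 + K + B) + 1) * t powr (1/r)" by (intro mult_right_mono) auto
        finally have "\<bar>\<phi> x\<bar> powr r \<le> ((c * (1 + K + B) + 1) * t powr (1/r)) powr r"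
          using p0 by (intro powr_mono2) auto
        also have "\<dots> = C1 * t"
          using c(1) K(2) B t0 p0 by (simp add: powr_mult powr_powr C1_def)
        finally show ?thesis .
      qed
      then have "\<bar>\<phi> x\<bar> powr r \<le> C1 * P'" by (rule le_mult_if_le_mult_greater[OF C1])
      then show ?thesis using P' C1 by (simp add: ennreal_mult[symmetric] ennreal_leI)
    next
      case False
      show ?thesis
      proof (cases "x \<in> \<Omega>")
        case True
        with False have "P x = \<infinity>" by (simp add: less_top[symmetric])
        then show ?thesis using C1 by (simp add: ennreal_mult_top)
      next
        case False
        then show ?thesis by (simp add: out)
      qed
    qed
    have "ennreal (\<integral>x. norm (\<phi> x) powr r \<partial>M) = (\<integral>\<^sup>+x. ennreal (norm (\<phi> x) powr r) \<partial>M)"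
      using test_fun_powr_integrable(1)[OF \<phi>, of r] p0 by (intro nn_integral_eq_integral[symmetric]) auto
    also have "\<dots> = (\<integral>\<^sup>+x. ennreal (norm (\<phi> x) powr r) \<partial>lborel)"
      by (rule nn_integral_lebesgue_on_eq_lborel[OF open_domain]) (simp add: out)
    also have "\<dots> \<le> (\<integral>\<^sup>+x. ennreal C1 * P x \<partial>lborel)"
      by (rule nn_integral_mono) (rule pw)
    also have "\<dots> = ennreal C1 * (\<integral>\<^sup>+x. P x \<partial>lborel)"
      unfolding P_def by (rule nn_integral_cmult) measurable
    also have "(\<integral>\<^sup>+x. P x \<partial>lborel) = (\<integral>\<^sup>+y. (\<integral>\<^sup>+x. ennreal (\<kappa> (y - x) powr s * g y powr p) \<partial>lborel) \<partial>lborel)"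
      unfolding P_def by (rule lborel_pair.Fubini') measurable
    also have "\<dots> = (\<integral>\<^sup>+y. ennreal K * ennreal (g y powr p) \<partial>lborel)"
    proof (rule nn_integral_cong)
      fix y
      have "(\<integral>\<^sup>+x. ennreal (\<kappa> (y - x) powr s * g y powr p) \<partial>lborel) = (\<integral>\<^sup>+x. ennreal (\<kappa> (y - x) powr s) * ennreal (g y powr p) \<partial>lborel)"
        by (simp add: ennreal_mult)
      also have "\<dots> = (\<integral>\<^sup>+x. ennreal (\<kappa> (y - x) powr s) \<partial>lborel) * ennreal (g y powr p)"
        by (rule nn_integral_multc) measurable
      finally show "(\<integral>\<^sup>+x. ennreal (\<kappa> (y - x) powr s * g y powr p) \<partial>lborel) = ennreal K * ennreal (g y powr p)"
        by (simp add: refl)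
    qed
    also have "\<dots> = ennreal K * (\<integral>\<^sup>+y. ennreal (g y powr p) \<partial>lborel)"
      by (rule nn_integral_cmult) measurable
    also have "ennreal C1 * (ennreal K * (\<integral>\<^sup>+y. ennreal (g y powr p) \<partial>lborel)) \<le> ennreal C1 * (ennreal K * ennreal B)"
      by (intro mult_left_mono \<Gamma>) auto
    also have "\<dots> = ennreal (C1 * (K * B))" using C1 K(2) B by (simp add: ennreal_mult)
    finally show "(\<integral>x. norm (\<phi> x) powr r \<partial>M) \<le> C1 * (K * B)"
      using C1 K(2) B by (subst (asm) ennreal_le_iff) auto
  qed
qed

section \<open>Rellich compactness by smoothing, first in L^1 and then in subcritical L^q\<close>

lemma test_fun_L1_compact:
  fixes \<phi> :: "nat \<Rightarrow> 'a \<Rightarrow> real"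
  assumes \<phi>: "\<And>n. test_fun \<Omega> (\<phi> n)" and B: "0 < B"
    and b: "\<And>n. (\<integral>x. norm (grad (\<phi> n) x) \<partial>M) \<le> B" "\<And>n. (\<integral>x. norm (\<phi> n x) \<partial>M) \<le> B"
  obtains r :: "nat \<Rightarrow> nat" where "strict_mono r"
    "\<And>e. 0 < e \<Longrightarrow> \<exists>N. \<forall>m\<ge>N. \<forall>n\<ge>N. (\<integral>x. norm (\<phi> (r m) x - \<phi> (r n) x) \<partial>M) < e"
proof -
  note sm = test_fun_smooth[OF \<phi>]
  note [measurable] = smooth_grad_borel[OF sm] smooth_borel[OF sm]
  have out: "\<phi> n x = 0" "grad (\<phi> n) x = 0" if "x \<notin> \<Omega>" for n x
  proof -
    obtain L where L: "L \<subseteq> \<Omega>" "\<And>x. x \<notin> L \<Longrightarrow> \<phi> n x = 0" "\<And>x. x \<notin> L \<Longrightarrow> grad (\<phi> n) x = 0"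
      using \<phi>[of n] test_fun_supportE by metis
    have "x \<notin> L" using that L(1) by blast
    then show "\<phi> n x = 0" "grad (\<phi> n) x = 0" using L by auto
  qed
  have int: "integrable lborel (\<phi> n)" for n
  proof -
    obtain L where "compact L" "\<And>x. x \<notin> L \<Longrightarrow> \<phi> n x = 0"
      using \<phi>[of n] test_fun_supportE by metis
    then show ?thesis by (rule integrable_lborel_compact_support[OF smooth_continuous[OF sm]])
  qed
  have absb: "(\<integral>x. \<bar>\<phi> n x\<bar> \<partial>lborel) \<le> B" for n
  proof -
    have "(\<integral>x. \<bar>\<phi> n x\<bar> \<partial>M) = (\<integral>x. \<bar>\<phi> n x\<bar> \<partial>lborel)"
      by (rule integral_lebesgue_on_eq_lborel[OF open_domain]) (auto simp: out)
    then show ?thesis using b(2)[of n] by simp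
  qed
  have gb: "(\<integral>\<^sup>+x. ennreal (norm (grad (\<phi> n) x)) \<partial>lborel) \<le> ennreal B" for n
  proof -
    have gi: "integrable M (\<lambda>x. norm (grad (\<phi> n) x))"
      using test_fun_powr_integrable(2)[OF \<phi>, of 1 n] by simp
    have "(\<integral>\<^sup>+x. ennreal (norm (grad (\<phi> n) x)) \<partial>lborel) = (\<integral>\<^sup>+x. ennreal (norm (grad (\<phi> n) x)) \<partial>M)"
      by (rule nn_integral_lebesgue_on_eq_lborel[OF open_domain, symmetric]) (simp add: out)
    also have "\<dots> = ennreal (\<integral>x. norm (grad (\<phi> n) x) \<partial>M)"
      using gi by (intro nn_integral_eq_integral) auto
    also have "\<dots> \<le> ennreal B" using b(1) by (rule ennreal_leI)
    finally show ?thesis .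
  qed
  define t where "t j = inverse (real (Suc j))" for j
  have t: "0 < t j" for j by (simp add: t_def)
  \<comment> \<open>A tent of radius \<open>t j\<close>. Lipschitz continuity of the kernel is
    enough, as the smoothed functions only have to be equicontinuous; its mass \<open>c j\<close> is
    carried along as a factor instead of being normalised.\<close>
  define \<kappa> where "\<kappa> j w = max 0 (1 - norm w / t j)" for j and w :: 'a
  have \<kappa>01: "0 \<le> \<kappa> j w" "\<kappa> j w \<le> 1" for j w
    using t[of j] by (auto simp: \<kappa>_def)
  have \<kappa>0: "\<kappa> j w = 0" if "t j \<le> norm w" for j w
    using t[of j] that by (auto simp: \<kappa>_def max_def field_simps)
  have \<kappa>lip: "\<bar>\<kappa> j w - \<kappa> j w'\<bar> \<le> norm (w - w') / t j" for j w w'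
  proof -
    have "\<bar>\<kappa> j w - \<kappa> j w'\<bar> \<le> \<bar>norm w / t j - norm w' / t j\<bar>" by (auto simp: \<kappa>_def)
    also have "\<dots> = \<bar>norm w - norm w'\<bar> / t j" using t[of j] by (simp add: diff_divide_distrib[symmetric])
    also have "\<dots> \<le> norm (w - w') / t j" using t[of j] norm_triangle_ineq3[of w w'] by (intro divide_right_mono) auto
    finally show ?thesis .
  qed
  have \<kappa>c: "continuous_on UNIV (\<kappa> j)" for j
    unfolding \<kappa>_def using t[of j] by (intro continuous_intros) auto
  have [measurable]: "\<kappa> j \<in> borel_measurable borel" for j
    using \<kappa>c by (rule borel_measurable_continuous_onI)
  have \<kappa>i: "integrable lborel (\<kappa> j)" for j
    by (rule integrable_lborel_compact_support[OF \<kappa>c compact_cball[of 0 "t j"]]) (auto intro: \<kappa>0)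
  define c where "c j = (\<integral>w. \<kappa> j w \<partial>lborel)" for j
  have c: "0 < c j" for j
  proof -
    have "0 < measure lborel (ball (0::'a) (t j / 2)) / 2"
      using t[of j] by (simp add: content_ball unit_ball_vol_pos)
    also have "\<dots> = (\<integral>w. indicator (ball 0 (t j / 2)) (w :: 'a) * (1/2) \<partial>lborel)"
      by simp
    also have "\<dots> \<le> c j"
      unfolding c_def
    proof (rule integral_mono[OF _ \<kappa>i])
      show "integrable lborel (\<lambda>w. indicator (ball 0 (t j / 2)) (w :: 'a) * (1/2 :: real))"
        using t[of j] by (intro integrable_mult_left integrable_real_indicator) (auto simp: emeasure_ball)
      show "indicator (ball 0 (t j / 2)) w * (1/2) \<le> \<kappa> j w" for w
        using t[of j] \<kappa>01(1)[of j w] by (auto simp: indicator_def \<kappa>_def field_simps)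
    qed
    finally show ?thesis .
  qed
  \<comment> \<open>\<phi> n smoothed at scale \<open>t j\<close>. For fixed j these functions are
    bounded by B and share the Lipschitz constant B / \<open>t j\<close>, uniformly in n.\<close>
  define J where "J n j x = (\<integral>y. \<phi> n y * \<kappa> j (y - x) \<partial>lborel)" for n j x
  have Ji: "integrable lborel (\<lambda>y. \<phi> n y * \<kappa> j (y - x))" for n j x
    by (rule Bochner_Integration.integrable_bound[OF int[of n]])
      (auto simp: abs_mult \<kappa>01 intro!: mult_right_le_one_le)
  have Jb: "\<bar>J n j x\<bar> \<le> B" for n j x
  proof -
    have "\<bar>J n j x\<bar> \<le> (\<integral>y. \<bar>\<phi> n y * \<kappa> j (y - x)\<bar> \<partial>lborel)"
      unfolding J_def by (rule integral_abs_bound)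
    also have "\<dots> \<le> (\<integral>y. \<bar>\<phi> n y\<bar> \<partial>lborel)"
      using integrable_norm[OF Ji[of n j x]] int
      by (intro integral_mono) (auto simp: abs_mult \<kappa>01 intro!: mult_right_le_one_le)
    finally show ?thesis using absb[of n] by simp
  qed
  have Jlip: "\<bar>J n j x - J n j x'\<bar> \<le> B / t j * norm (x - x')" for n j x x'
  proof -
    have "J n j x - J n j x' = (\<integral>y. \<phi> n y * (\<kappa> j (y - x) - \<kappa> j (y - x')) \<partial>lborel)"
      unfolding J_def using Ji by (simp add: right_diff_distrib)
    then have "\<bar>J n j x - J n j x'\<bar> \<le> (\<integral>y. \<bar>\<phi> n y * (\<kappa> j (y - x) - \<kappa> j (y - x'))\<bar> \<partial>lborel)"
      by (simp add: integral_abs_bound)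
    also have "\<dots> \<le> (\<integral>y. \<bar>\<phi> n y\<bar> * (norm (x - x') / t j) \<partial>lborel)"
    proof (rule integral_mono)
      show "integrable lborel (\<lambda>y. \<bar>\<phi> n y * (\<kappa> j (y - x) - \<kappa> j (y - x'))\<bar>)"
        using Ji[of n j x] Ji[of n j x'] by (simp add: right_diff_distrib)
      show "integrable lborel (\<lambda>y. \<bar>\<phi> n y\<bar> * (norm (x - x') / t j))" using int by simp
      fix y
      have "\<bar>\<kappa> j (y - x) - \<kappa> j (y - x')\<bar> \<le> norm (x - x') / t j"
        using \<kappa>lip[of j "y - x" "y - x'"] by (simp add: norm_minus_commute)
      then show "\<bar>\<phi> n y * (\<kappa> j (y - x) - \<kappa> j (y - x'))\<bar> \<le> \<bar>\<phi> n y\<bar> * (norm (x - x') / t j)"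
        unfolding abs_mult by (intro mult_left_mono) auto
    qed
    also have "\<dots> = (\<integral>y. \<bar>\<phi> n y\<bar> \<partial>lborel) * (norm (x - x') / t j)" by simp
    also have "\<dots> \<le> B * (norm (x - x') / t j)"
      using absb[of n] t[of j] by (intro mult_right_mono) auto
    finally show ?thesis by simp
  qed
  have Jc: "continuous_on UNIV (J n j)" for n j
  proof (rule continuous_onI)
    fix x and e :: real assume e: "0 < e"
    show "\<exists>d>0. \<forall>x'\<in>UNIV. dist x' x < d \<longrightarrow> dist (J n j x') (J n j x) \<le> e"
    proof (intro exI[of _ "e * t j / B"] conjI ballI impI)
      show "0 < e * t j / B" using e t[of j] B by simp
      fix x' assume "dist x' x < e * t j / B"
      then have "B / t j * norm (x' - x) \<le> e" using t[of j] B by (simp add: dist_norm field_simps)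
      then show "dist (J n j x') (J n j x) \<le> e" using Jlip[of n j x' x] by (simp add: dist_real_def)
    qed
  qed
  have [measurable]: "J n j \<in> borel_measurable borel" for n j
    using Jc by (rule borel_measurable_continuous_onI)
  \<comment> \<open>J - c \<phi> is a weighted integral of increments over shifts |w| \<le>
    \<open>t j\<close>, and each shift costs at most |w| times the L^1 norm of the gradient; hence a
    smoothing error that is uniform in n.\<close>
  have moll: "(\<integral>\<^sup>+x. ennreal \<bar>J n j x - c j * \<phi> n x\<bar> \<partial>lborel) \<le> ennreal (c j * t j * B)" for n j
  proof -
    have "(\<integral>\<^sup>+x. ennreal \<bar>J n j x - c j * \<phi> n x\<bar> \<partial>lborel)
      \<le> (\<integral>\<^sup>+x. (\<integral>\<^sup>+w. ennreal (\<kappa> j w * \<bar>\<phi> n (x + w) - \<phi> n x\<bar>) \<partial>lborel) \<partial>lborel)"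
    proof (rule nn_integral_mono)
      fix x
      have eq: "J n j x = (\<integral>w. \<phi> n (x + w) * \<kappa> j w \<partial>lborel)"
        and i: "integrable lborel (\<lambda>w. \<phi> n (x + w) * \<kappa> j w)"
        using integral_distr[of "(+) x" lborel borel "\<lambda>y. \<phi> n y * \<kappa> j (y - x)"]
          integrable_distr_eq[of "(+) x" lborel borel "\<lambda>y. \<phi> n y * \<kappa> j (y - x)"] Ji[of n j x]
        by (simp_all add: J_def lborel_distr_plus)
      have "J n j x - c j * \<phi> n x = (\<integral>w. \<kappa> j w * (\<phi> n (x + w) - \<phi> n x) \<partial>lborel)"
        unfolding eq c_def using i \<kappa>i[of j] by (simp add: right_diff_distrib mult.commute)
      then have "ennreal \<bar>J n j x - c j * \<phi> n x\<bar> = ennreal (norm (\<integral>w. \<kappa> j w * (\<phi> n (x + w) - \<phi> n x) \<partial>lborel))"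
        by simp
      also have "\<dots> \<le> (\<integral>\<^sup>+w. norm (\<kappa> j w * (\<phi> n (x + w) - \<phi> n x)) \<partial>lborel)"
        using i \<kappa>i[of j] by (intro integral_norm_bound_ennreal) (simp add: right_diff_distrib mult.commute)
      also have "\<dots> = (\<integral>\<^sup>+w. ennreal (\<kappa> j w * \<bar>\<phi> n (x + w) - \<phi> n x\<bar>) \<partial>lborel)"
        by (simp add: abs_mult \<kappa>01)
      finally show "ennreal \<bar>J n j x - c j * \<phi> n x\<bar> \<le> (\<integral>\<^sup>+w. ennreal (\<kappa> j w * \<bar>\<phi> n (x + w) - \<phi> n x\<bar>) \<partial>lborel)" .
    qed
    also have "\<dots> = (\<integral>\<^sup>+w. (\<integral>\<^sup>+x. ennreal (\<kappa> j w * \<bar>\<phi> n (x + w) - \<phi> n x\<bar>) \<partial>lborel) \<partial>lborel)"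
      by (rule lborel_pair.Fubini'[symmetric]) measurable
    also have "\<dots> \<le> (\<integral>\<^sup>+w. ennreal (\<kappa> j w) * ennreal (t j * B) \<partial>lborel)"
    proof (rule nn_integral_mono)
      fix w
      have "(\<integral>\<^sup>+x. ennreal (\<kappa> j w * \<bar>\<phi> n (x + w) - \<phi> n x\<bar>) \<partial>lborel) = (\<integral>\<^sup>+x. ennreal (\<kappa> j w) * ennreal \<bar>\<phi> n (x + w) - \<phi> n x\<bar> \<partial>lborel)"
        by (simp add: ennreal_mult \<kappa>01)
      also have "\<dots> = ennreal (\<kappa> j w) * (\<integral>\<^sup>+x. ennreal \<bar>\<phi> n (x + w) - \<phi> n x\<bar> \<partial>lborel)"
        by (rule nn_integral_cmult) measurable
      also have "\<dots> \<le> ennreal (\<kappa> j w) * (ennreal (norm w) * ennreal B)"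
        by (intro mult_left_mono order_trans[OF translation_nn_integral_le[OF sm]] gb) auto
      also have "\<dots> = ennreal (\<kappa> j w * (norm w * B))"
        using B \<kappa>01 by (simp add: ennreal_mult)
      also have "\<dots> \<le> ennreal (\<kappa> j w * (t j * B))"
      proof (cases "t j \<le> norm w")
        case False
        then show ?thesis using B \<kappa>01 by (intro ennreal_leI mult_left_mono mult_right_mono) auto
      qed (simp add: \<kappa>0)
      also have "\<dots> = ennreal (\<kappa> j w) * ennreal (t j * B)"
        using B t[of j] \<kappa>01 by (intro ennreal_mult) auto
      finally show "(\<integral>\<^sup>+x. ennreal (\<kappa> j w * \<bar>\<phi> n (x + w) - \<phi> n x\<bar>) \<partial>lborel) \<le> ennreal (\<kappa> j w) * ennreal (t j * B)" .
    qed
    also have "\<dots> = (\<integral>\<^sup>+w. ennreal (\<kappa> j w) \<partial>lborel) * ennreal (t j * B)"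
      by (rule nn_integral_multc) measurable
    also have "(\<integral>\<^sup>+w. ennreal (\<kappa> j w) \<partial>lborel) = ennreal (c j)"
      unfolding c_def using \<kappa>i \<kappa>01 by (intro nn_integral_eq_integral) auto
    also have "ennreal (c j) * ennreal (t j * B) = ennreal (c j * t j * B)"
      using c[of j] t[of j] B by (simp add: ennreal_mult mult.assoc)
    finally show ?thesis .
  qed
  have Jm: "J n j \<in> borel_measurable M" for n j by (rule continuous_measurable[OF Jc])
  have JM: "integrable M (J n j)" for n j
    by (rule Bochner_Integration.integrable_bound[OF integrable_const_domain[of B] Jm]) (use Jb B in auto)
  have \<phi>M: "integrable M (\<phi> n)" for n
    using test_fun_powr_integrable(1)[OF \<phi>, of 1 n] test_fun_measurable(1)[OF \<phi>, of n]
    using integrable_norm_iff[of "\<phi> n" M] by simp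
  have mollM: "(\<integral>x. \<bar>J n j x - c j * \<phi> n x\<bar> \<partial>M) \<le> c j * t j * B" for n j
  proof -
    have "ennreal (\<integral>x. \<bar>J n j x - c j * \<phi> n x\<bar> \<partial>M) = (\<integral>\<^sup>+x. ennreal \<bar>J n j x - c j * \<phi> n x\<bar> \<partial>M)"
      using JM \<phi>M by (intro nn_integral_eq_integral[symmetric]) auto
    also have "\<dots> = (\<integral>\<^sup>+x. ennreal \<bar>J n j x - c j * \<phi> n x\<bar> * indicator \<Omega> x \<partial>lebesgue)"
      using sets_domain by (intro nn_integral_restrict_space) simp
    also have "\<dots> = (\<integral>\<^sup>+x. ennreal \<bar>J n j x - c j * \<phi> n x\<bar> * indicator \<Omega> x \<partial>lborel)"
      by (rule nn_integral_completion)
    also have "\<dots> \<le> (\<integral>\<^sup>+x. ennreal \<bar>J n j x - c j * \<phi> n x\<bar> \<partial>lborel)"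
      by (intro nn_integral_mono) (auto simp: indicator_def)
    also note moll
    finally show ?thesis using c[of j] t[of j] B by (subst (asm) ennreal_le_iff) auto
  qed
  obtain X :: "'a set" where X: "countable X" "\<And>U. open U \<Longrightarrow> U \<noteq> {} \<Longrightarrow> \<exists>d\<in>X. d \<in> U"
    using countable_dense_exists by blast
  \<comment> \<open>One diagonal extraction over pairs (dense point, scale) serves all scales at
    once. The common Lipschitz bound then extends convergence from the dense set to every
    point.\<close>
  have "countable (X \<times> (UNIV :: nat set))" using X(1) by simp
  then obtain r :: "nat \<Rightarrow> nat" where r: "strict_mono r"
    "\<And>z. z \<in> X \<times> UNIV \<Longrightarrow> \<exists>l. (\<lambda>n. (\<lambda>n z. J n (snd z) (fst z)) (r n) z) \<longlonglongrightarrow> l"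
    by (rule function_convergent_subsequence[where M=B and f="\<lambda>n z. J n (snd z) (fst z)"]) (use Jb in auto)
  have conv: "convergent (\<lambda>n. J (r n) j x)" for j x
  proof (rule Cauchy_convergent, rule metric_CauchyI)
    fix e :: real assume e: "0 < e"
    obtain d where d: "d \<in> X" "dist x d < e * t j / (3 * B)"
    proof -
      have "0 < e * t j / (3 * B)" using e t[of j] B by simp
      then show ?thesis using X(2)[of "ball x (e * t j / (3 * B))"] that by auto
    qed
    have close: "\<bar>J n j x - J n j d\<bar> < e / 3" for n
    proof -
      have "B / t j * norm (x - d) < e / 3" using d(2) t[of j] B by (simp add: dist_norm field_simps)
      then show ?thesis using Jlip[of n j x d] by linarith
    qed
    have "Cauchy (\<lambda>n. J (r n) j d)" using r(2)[of "(d, j)"] d(1) by (auto intro: LIMSEQ_imp_Cauchy)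
    then obtain N where N: "\<And>m n. m \<ge> N \<Longrightarrow> n \<ge> N \<Longrightarrow> dist (J (r m) j d) (J (r n) j d) < e / 3"
      using metric_CauchyD[of _ "e / 3"] e by (metis divide_pos_pos zero_less_numeral)
    have "dist (J (r m) j x) (J (r n) j x) < e" if "m \<ge> N" "n \<ge> N" for m n
      using N[OF that] close[of "r m"] close[of "r n"] unfolding dist_real_def by linarith
    then show "\<exists>N. \<forall>m\<ge>N. \<forall>n\<ge>N. dist (J (r m) j x) (J (r n) j x) < e" by blast
  qed
  define l where "l j x = lim (\<lambda>n. J (r n) j x)" for j x
  have lim: "(\<lambda>n. J (r n) j x) \<longlonglongrightarrow> l j x" for j x
    using conv[of j x] by (simp add: l_def convergent_LIMSEQ_iff)
  have lm: "l j \<in> borel_measurable M" for j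
    unfolding l_def[abs_def] using Jm by (intro borel_measurable_lim_metric) auto
  have L0: "(\<lambda>n. \<integral>x. norm (J (r n) j x - l j x) powr 1 \<partial>M) \<longlonglongrightarrow> 0" for j
    by (rule Lp_dominated_convergence(3)[OF _ Jm lm integrable_const_domain[of B]])
      (use Jb lim in auto)
  have lM: "integrable M (l j)" for j
    by (rule integrable_dominated_convergence[of _ _ "\<lambda>n. J (r n) j", OF lm Jm integrable_const_domain[of B]]) (use Jb lim in auto)
  show ?thesis
  proof (rule that[OF r(1)])
    fix e :: real assume e: "0 < e"
    \<comment> \<open>The scale is fixed before the indices: the two smoothing errors take half of
      e, and the convergence of the smoothed functions at this one scale takes the rest.\<close>
    obtain j where j: "t j * B < e / 4"
    proof -
      obtain j where "inverse (real (Suc j)) < e / (4 * B)"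
        using reals_Archimedean[of "e / (4 * B)"] e B by auto
      then have "t j * B < e / 4" using B by (simp add: t_def field_simps)
      then show ?thesis by (rule that)
    qed
    have "eventually (\<lambda>n. (\<integral>x. norm (J (r n) j x - l j x) powr 1 \<partial>M) < e * c j / 4) sequentially"
      using L0[of j] e c[of j] by (intro order_tendstoD) auto
    then obtain N where N: "\<And>n. n \<ge> N \<Longrightarrow> (\<integral>x. \<bar>J (r n) j x - l j x\<bar> \<partial>M) < e * c j / 4"
      by (auto simp: eventually_sequentially)
    have "(\<integral>x. norm (\<phi> (r m) x - \<phi> (r n) x) \<partial>M) < e" if mn: "m \<ge> N" "n \<ge> N" for m n
    proof -
      have "c j * (\<integral>x. norm (\<phi> (r m) x - \<phi> (r n) x) \<partial>M) = (\<integral>x. c j * \<bar>\<phi> (r m) x - \<phi> (r n) x\<bar> \<partial>M)"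
        by simp
      also have "\<dots> \<le> (\<integral>x. (\<bar>J (r m) j x - c j * \<phi> (r m) x\<bar> + \<bar>J (r n) j x - c j * \<phi> (r n) x\<bar>)
          + (\<bar>J (r m) j x - l j x\<bar> + \<bar>J (r n) j x - l j x\<bar>) \<partial>M)"
      proof (rule integral_mono)
        fix x
        have "c j * \<bar>\<phi> (r m) x - \<phi> (r n) x\<bar> = \<bar>c j * \<phi> (r m) x - c j * \<phi> (r n) x\<bar>"
          using c[of j] by (simp add: abs_mult right_diff_distrib[symmetric])
        then show "c j * \<bar>\<phi> (r m) x - \<phi> (r n) x\<bar> \<le> (\<bar>J (r m) j x - c j * \<phi> (r m) x\<bar> + \<bar>J (r n) j x - c j * \<phi> (r n) x\<bar>)
          + (\<bar>J (r m) j x - l j x\<bar> + \<bar>J (r n) j x - l j x\<bar>)" by linarith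
      qed (use JM \<phi>M lM in auto)
      also have "\<dots> = ((\<integral>x. \<bar>J (r m) j x - c j * \<phi> (r m) x\<bar> \<partial>M) + (\<integral>x. \<bar>J (r n) j x - c j * \<phi> (r n) x\<bar> \<partial>M))
          + ((\<integral>x. \<bar>J (r m) j x - l j x\<bar> \<partial>M) + (\<integral>x. \<bar>J (r n) j x - l j x\<bar> \<partial>M))"
        using JM \<phi>M lM by simp
      also have "\<dots> < (c j * t j * B + c j * t j * B) + (e * c j / 4 + e * c j / 4)"
        using mollM[of "r m" j] mollM[of "r n" j] N[OF mn(1)] N[OF mn(2)] by linarith
      also have "\<dots> = c j * (2 * (t j * B) + e / 2)" by (simp add: algebra_simps)
      also have "\<dots> < c j * e" using j c[of j] by (intro mult_strict_left_mono) auto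
      finally show ?thesis using c[of j] by simp
    qed
    then show "\<exists>N. \<forall>m\<ge>N. \<forall>n\<ge>N. (\<integral>x. norm (\<phi> (r m) x - \<phi> (r n) x) \<partial>M) < e" by blast
  qed
qed

text \<open>On a set of finite measure t \<le> 1 + t^p turns an L^p majorant into an L^1 majorant.
  Compactness is obtained in L^1 and raised to L^q afterwards.\<close>

lemma test_closure_exponent_1:
  assumes "test_closure \<Omega> p I v \<eta>" "1 \<le> p"
  shows "test_closure \<Omega> 1 I v \<eta>"
proof -
  obtain \<phi> W where W: "integrable M W" "\<And>n. test_fun \<Omega> (\<phi> n)"
    "\<And>n. AE x in M. norm (\<phi> n x) powr p \<le> W x" "\<And>n. AE x in M. norm (grad (\<phi> n) x) powr p \<le> W x"
    "AE x in M. (\<lambda>n. \<phi> n x) \<longlonglongrightarrow> v x" "AE x in M. (\<lambda>n. grad (\<phi> n) x) \<longlonglongrightarrow> \<eta> x" and I: "\<And>n x. \<phi> n x \<in> I"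
    and m: "v \<in> borel_measurable M" "\<eta> \<in> borel_measurable M"
    using assms(1) unfolding test_closure_def by blast
  have le: "t powr 1 \<le> 1 + s" if "t powr p \<le> s" "0 \<le> t" for t s :: real
    using powr_le_1_add_powr[of t 1 p] that assms(2) by simp
  show ?thesis
    unfolding test_closure_def
  proof (intro conjI exI[of _ \<phi>] exI[of _ "\<lambda>x. 1 + W x"] allI m W(2) I W(5,6))
    show "integrable M (\<lambda>x. 1 + W x)" using W(1) integrable_const_domain[of 1] by simp
    show "AE x in M. norm (\<phi> n x) powr 1 \<le> 1 + W x" for n
      using W(3)[of n] by eventually_elim (rule le, auto)
    show "AE x in M. norm (grad (\<phi> n) x) powr 1 \<le> 1 + W x" for n
      using W(4)[of n] by eventually_elim (rule le, auto)
  qed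
qed

lemma sobolev_bound_closure:
  assumes N: "2 \<le> DIM('a)" and p: "1 \<le> p" "p < r"
    and crit: "p < real DIM('a) \<Longrightarrow> r < real DIM('a) * p / (real DIM('a) - p)" and B: "0 \<le> B"
  obtains C where "0 \<le> C" "\<And>u \<xi>. test_closure \<Omega> p UNIV u \<xi> \<Longrightarrow> (\<integral>x. norm (\<xi> x) powr p \<partial>M) \<le> B \<Longrightarrow>
    integrable M (\<lambda>x. norm (u x) powr r) \<and> (\<integral>x. norm (u x) powr r \<partial>M) \<le> C"
proof -
  \<comment> \<open>Test functions whose gradient error is at most 1 have gradient integrals below
    2^p (1 + B); the bound for the limit then follows from Fatou's lemma.\<close>
  have B': "0 \<le> 2 powr p * (1 + B)" using B by simp
  obtain C where C: "\<And>\<phi>. test_fun \<Omega> \<phi> \<Longrightarrow> (\<integral>x. norm (grad \<phi> x) powr p \<partial>M) \<le> 2 powr p * (1 + B) \<Longrightarrow> (\<integral>x. norm (\<phi> x) powr r \<partial>M) \<le> C"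
    by (rule sobolev_bound[OF N p crit B']) blast+
  show ?thesis
  proof (rule that[of "max 0 C"])
    fix u \<xi> assume u: "test_closure \<Omega> p UNIV u \<xi>" and le: "(\<integral>x. norm (\<xi> x) powr p \<partial>M) \<le> B"
    have p0: "0 < p" "0 \<le> p" "0 < r" using p by auto
    note ui = test_closure_integrable[OF u p0(1)]
    have "\<exists>\<phi>. test_fun \<Omega> \<phi> \<and> (\<integral>x. norm (\<phi> x - u x) powr p \<partial>M) < inverse (real (Suc n)) \<and>
      (\<integral>x. norm (grad \<phi> x - \<xi> x) powr p \<partial>M) < inverse (real (Suc n))" for n
    proof -
      have pos: "0 < inverse (real (Suc n))" by simp
      show ?thesis by (rule test_closure_approx[OF u p0(1) pos]) blast
    qed
    then have "\<exists>\<phi>. \<forall>n. test_fun \<Omega> (\<phi> n) \<and> (\<integral>x. norm (\<phi> n x - u x) powr p \<partial>M) < inverse (real (Suc n)) \<and>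
      (\<integral>x. norm (grad (\<phi> n) x - \<xi> x) powr p \<partial>M) < inverse (real (Suc n))"
      by (intro choice allI)
    then obtain \<phi> where \<phi>: "\<And>n. test_fun \<Omega> (\<phi> n)"
      "\<And>n. (\<integral>x. norm (\<phi> n x - u x) powr p \<partial>M) < inverse (real (Suc n))"
      "\<And>n. (\<integral>x. norm (grad (\<phi> n) x - \<xi> x) powr p \<partial>M) < inverse (real (Suc n))"
      by blast
    note tm = test_fun_measurable[OF \<phi>(1)]
    note ti = test_fun_powr_integrable[OF \<phi>(1) p0(2)]
    have g: "(\<integral>x. norm (grad (\<phi> n) x) powr p \<partial>M) \<le> 2 powr p * (1 + B)" for n
    proof -
      note di = integrable_diff_powr[OF tm(2)[of n] ui(2) p0(2) ti(2)[of n] ui(4)]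
      have "(\<integral>x. norm (grad (\<phi> n) x) powr p \<partial>M)
        \<le> (\<integral>x. 2 powr p * (norm (grad (\<phi> n) x - \<xi> x) powr p + norm (\<xi> x) powr p) \<partial>M)"
        using di ui(4) ti(2)[of n] norm_powr_le_diff[OF p0(2)] by (intro integral_mono) auto
      also have "\<dots> = 2 powr p * ((\<integral>x. norm (grad (\<phi> n) x - \<xi> x) powr p \<partial>M) + (\<integral>x. norm (\<xi> x) powr p \<partial>M))"
        using di ui(4) by simp
      also have "\<dots> \<le> 2 powr p * (1 + B)"
      proof (intro mult_left_mono add_mono le)
        have "inverse (real (Suc n)) \<le> 1" by (simp add: field_simps)
        then show "(\<integral>x. norm (grad (\<phi> n) x - \<xi> x) powr p \<partial>M) \<le> 1" using \<phi>(3)[of n] by linarith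
      qed simp
      finally show ?thesis .
    qed
    have "(\<lambda>n. \<integral>x. norm (\<phi> n x - u x) powr p \<partial>M) \<longlonglongrightarrow> 0"
      by (rule tendsto_sandwich[OF _ _ tendsto_const LIMSEQ_inverse_real_of_nat])
        (use \<phi>(2) in \<open>auto intro!: always_eventually less_imp_le\<close>)
    note * = Lp_tendsto_imp_dominated_subseq[of p \<phi> M u, OF p0(1) tm(1) ui(1,3) integrable_diff_powr[OF tm(1) ui(1) p0(2) ti(1) ui(3)] this]
    obtain s where s: "AE x in M. (\<lambda>n. \<phi> (s n) x) \<longlonglongrightarrow> u x" by (rule *) blast
    note fatou = integral_powr_Fatou[where f="\<lambda>n. \<phi> (s n)", OF p0(3) tm(1) ui(1)
      test_fun_powr_integrable(1)[OF \<phi>(1) less_imp_le[OF p0(3)]] order_trans[OF C[OF \<phi>(1) g] max.cobounded2] s]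
    show "integrable M (\<lambda>x. norm (u x) powr r) \<and> (\<integral>x. norm (u x) powr r \<partial>M) \<le> max 0 C"
      using fatou by blast
  qed simp
qed

text \<open>Split at L with L^(q-r) = \<delta>: beyond L the r-th power pays with the factor
  \<delta>, below L the linear term pays with the factor L^(q-1).\<close>

lemma powr_interpolation:
  fixes t \<delta> q r :: real
  assumes "0 \<le> t" "1 \<le> q" "q < r" "0 < \<delta>"
  shows "t powr q \<le> \<delta> * t powr r + \<delta> powr ((q - 1) / (q - r)) * t"
proof -
  define L where "L = \<delta> powr (1 / (q - r))"
  have L: "0 < L" using assms by (simp add: L_def)
  show ?thesis
  proof (cases "L \<le> t")
    case True
    then have t: "0 < t" using L by linarith
    have "t powr q = t powr (q - r) * t powr r" by (simp add: powr_add[symmetric])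
    also have "\<dots> \<le> L powr (q - r) * t powr r"
      using True L assms by (intro mult_right_mono powr_mono2') auto
    also have "L powr (q - r) = \<delta>" using assms by (simp add: L_def powr_powr)
    finally show ?thesis using assms by (smt (verit) mult_nonneg_nonneg powr_ge_zero)
  next
    case False
    have "t powr q = t powr (q - 1) * t" using assms by (cases "t = 0") (auto simp: powr_diff)
    also have "\<dots> \<le> L powr (q - 1) * t"
      using False assms by (intro mult_right_mono powr_mono2) auto
    also have "L powr (q - 1) = \<delta> powr ((q - 1) / (q - r))" by (simp add: L_def powr_powr)
    finally show ?thesis using assms by (smt (verit) mult_nonneg_nonneg powr_ge_zero)
  qed
qed

text \<open>An exponent q' strictly between q and the critical one is inserted. The sequence is
  bounded in L^q' by the Sobolev inequality and has a subsequence that is Cauchy in L^1, hence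
  Cauchy in L^q by interpolation; completeness then provides the limit and the majorant of the q-th
  powers.\<close>

lemma sobolev_compact:
  fixes u :: "nat \<Rightarrow> 'a \<Rightarrow> real"
  assumes N: "2 \<le> DIM('a)" and p: "1 \<le> p" "p < q"
    and crit: "p < real DIM('a) \<Longrightarrow> q < real DIM('a) * p / (real DIM('a) - p)"
    and u: "\<And>n. test_closure \<Omega> p UNIV (u n) (\<xi> n)" and B: "\<And>n. (\<integral>x. norm (\<xi> n x) powr p \<partial>M) \<le> B"
  obtains r :: "nat \<Rightarrow> nat" and W v where "strict_mono r" "integrable M W" "\<And>n. AE x in M. \<bar>u (r n) x\<bar> powr q \<le> W x"
    "v \<in> borel_measurable M" "AE x in M. (\<lambda>n. u (r n) x) \<longlonglongrightarrow> v x"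
proof -
  have B0: "0 \<le> B" by (rule order_trans[OF integral_nonneg_AE B[of 0]]) simp
  obtain q' where q': "q < q'" "p < real DIM('a) \<Longrightarrow> q' < real DIM('a) * p / (real DIM('a) - p)"
  proof (cases "p < real DIM('a)")
    case True
    obtain q' where "q < q'" "q' < real DIM('a) * p / (real DIM('a) - p)" using dense[OF crit[OF True]] by blast
    then show ?thesis by (intro that) auto
  next
    case False
    then show ?thesis by (intro that[of "q + 1"]) auto
  qed
  have pq': "p < q'" using p q' by linarith
  obtain C where C: "0 \<le> C" "\<And>u \<xi>. test_closure \<Omega> p UNIV u \<xi> \<Longrightarrow> (\<integral>x. norm (\<xi> x) powr p \<partial>M) \<le> B \<Longrightarrow>
    integrable M (\<lambda>x. norm (u x) powr q') \<and> (\<integral>x. norm (u x) powr q' \<partial>M) \<le> C"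
    by (rule sobolev_bound_closure[OF N p(1) pq' q'(2) B0]) blast+
  note uq = C(2)[OF u B, THEN conjunct1] C(2)[OF u B, THEN conjunct2]
  have p0: "0 < p" using p by simp
  note ui = test_closure_integrable[OF u p0]
  note u1 = test_closure_exponent_1[OF u p(1)]
  note u1i = test_closure_integrable[OF u1 zero_less_one]
  define V where "V = (\<integral>x. 1 \<partial>M) + C + B + 1"
  have vol: "0 \<le> (\<integral>x. (1::real) \<partial>M)" by (rule integral_nonneg_AE) simp
  have V: "0 < V" using C(1) B0 vol unfolding V_def by linarith
  have "\<exists>\<phi>. test_fun \<Omega> \<phi> \<and> (\<integral>x. norm (\<phi> x - u n x) powr 1 \<partial>M) < inverse (real (Suc n)) \<and>
    (\<integral>x. norm (grad \<phi> x - \<xi> n x) powr 1 \<partial>M) < inverse (real (Suc n))" for n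
  proof -
    have pos: "0 < inverse (real (Suc n))" by simp
    show ?thesis by (rule test_closure_approx[OF u1 zero_less_one pos, of n]) blast
  qed
  then have "\<exists>\<phi>. \<forall>n. test_fun \<Omega> (\<phi> n) \<and> (\<integral>x. norm (\<phi> n x - u n x) powr 1 \<partial>M) < inverse (real (Suc n)) \<and>
    (\<integral>x. norm (grad (\<phi> n) x - \<xi> n x) powr 1 \<partial>M) < inverse (real (Suc n))"
    by (intro choice allI)
  then obtain \<phi> where \<phi>: "\<And>n. test_fun \<Omega> (\<phi> n)"
    "\<And>n. (\<integral>x. norm (\<phi> n x - u n x) powr 1 \<partial>M) < inverse (real (Suc n))"
    "\<And>n. (\<integral>x. norm (grad (\<phi> n) x - \<xi> n x) powr 1 \<partial>M) < inverse (real (Suc n))"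
    by blast
  note tm = test_fun_measurable[OF \<phi>(1)]
  note ti = test_fun_powr_integrable[OF \<phi>(1) zero_le_one]
  note di = integrable_diff_powr[OF tm(1) u1i(1) zero_le_one ti(1) u1i(3)]
    integrable_diff_powr[OF tm(2) u1i(2) zero_le_one ti(2) u1i(4)]
  have inv1: "inverse (real (Suc n)) \<le> 1" for n by (simp add: field_simps)
  have bd: "(\<integral>x. norm (f x) \<partial>M) \<le> V"
    if f: "integrable M (\<lambda>x. norm (f x) powr 1)" "integrable M (\<lambda>x. norm (f x - h x) powr 1)"
      "integrable M (\<lambda>x. norm (h x) powr 1)" "integrable M (\<lambda>x. norm (h x) powr s)" "1 \<le> s"
      "(\<integral>x. norm (f x - h x) powr 1 \<partial>M) < inverse (real (Suc n))" "(\<integral>x. norm (h x) powr s \<partial>M) \<le> B + C"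
    for f h :: "'a \<Rightarrow> 'c::euclidean_space" and s n
  proof -
    have "(\<integral>x. norm (f x) \<partial>M) \<le> (\<integral>x. norm (f x - h x) + (1 + norm (h x) powr s) \<partial>M)"
    proof (rule integral_mono)
      fix x
      have "norm (h x) \<le> 1 + norm (h x) powr s" using powr_le_1_add_powr[of "norm (h x)" 1 s] that(5) by simp
      then show "norm (f x) \<le> norm (f x - h x) + (1 + norm (h x) powr s)"
        using norm_triangle_ineq[of "f x - h x" "h x"] by simp
    qed (use f integrable_const_domain in auto)
    also have "\<dots> = (\<integral>x. norm (f x - h x) \<partial>M) + ((\<integral>x. 1 \<partial>M) + (\<integral>x. norm (h x) powr s \<partial>M))"
      using f integrable_const_domain by simp
    also have "\<dots> \<le> V" using f(6,7) inv1[of n] unfolding V_def by simp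
    finally show ?thesis .
  qed
  have "(\<integral>x. norm (grad (\<phi> n) x) \<partial>M) \<le> V" for n
    by (rule bd[OF ti(2) di(2) u1i(4) ui(4) p(1) \<phi>(3)]) (use B[of n] C(1) in simp)
  moreover have "(\<integral>x. norm (\<phi> n x) \<partial>M) \<le> V" for n
    by (rule bd[OF ti(1) di(1) u1i(3) uq(1) _ \<phi>(2)]) (use uq(2)[of n] B0 p q' in simp_all)
  ultimately obtain r :: "nat \<Rightarrow> nat" where r: "strict_mono r"
    "\<And>e. 0 < e \<Longrightarrow> \<exists>N. \<forall>m\<ge>N. \<forall>n\<ge>N. (\<integral>x. norm (\<phi> (r m) x - \<phi> (r n) x) \<partial>M) < e"
    using test_fun_L1_compact[of \<phi> V, OF \<phi>(1) V] by blast
  have um: "u n \<in> borel_measurable M" for n by (rule ui(1))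
  have u1n: "integrable M (u n)" "integrable M (\<phi> n)" for n
    using u1i(3)[of n] um[of n] ti(1)[of n] tm(1)[of n] integrable_norm_iff[of "u n" M] integrable_norm_iff[of "\<phi> n" M] by simp_all
  have C1: "\<exists>N. \<forall>m\<ge>N. \<forall>n\<ge>N. (\<integral>x. \<bar>u (r m) x - u (r n) x\<bar> \<partial>M) < e" if e: "0 < e" for e
  proof -
    obtain N1 where N1: "\<And>m n. m \<ge> N1 \<Longrightarrow> n \<ge> N1 \<Longrightarrow> (\<integral>x. norm (\<phi> (r m) x - \<phi> (r n) x) \<partial>M) < e / 3"
      using r(2)[of "e / 3"] e by auto
    obtain N2 where N2: "inverse (real (Suc N2)) < e / 3" using reals_Archimedean[of "e / 3"] e by auto
    have app: "(\<integral>x. \<bar>\<phi> (r n) x - u (r n) x\<bar> \<partial>M) < e / 3" if "n \<ge> N2" for n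
    proof -
      have "N2 \<le> r n" using that seq_suble[OF r(1), of n] by linarith
      then have "inverse (real (Suc (r n))) \<le> inverse (real (Suc N2))" by (intro le_imp_inverse_le) auto
      moreover have "(\<integral>x. \<bar>\<phi> (r n) x - u (r n) x\<bar> \<partial>M) < inverse (real (Suc (r n)))"
        using \<phi>(2)[of "r n"] by simp
      ultimately show ?thesis using N2 by linarith
    qed
    have "(\<integral>x. \<bar>u (r m) x - u (r n) x\<bar> \<partial>M) < e" if mn: "m \<ge> max N1 N2" "n \<ge> max N1 N2" for m n
    proof -
      have "(\<integral>x. \<bar>u (r m) x - u (r n) x\<bar> \<partial>M) \<le> (\<integral>x. (\<bar>\<phi> (r m) x - u (r m) x\<bar> + \<bar>\<phi> (r n) x - u (r n) x\<bar>) + \<bar>\<phi> (r m) x - \<phi> (r n) x\<bar> \<partial>M)"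
        using u1n by (intro integral_mono) auto
      also have "\<dots> = ((\<integral>x. \<bar>\<phi> (r m) x - u (r m) x\<bar> \<partial>M) + (\<integral>x. \<bar>\<phi> (r n) x - u (r n) x\<bar> \<partial>M)) + (\<integral>x. \<bar>\<phi> (r m) x - \<phi> (r n) x\<bar> \<partial>M)"
        using u1n by simp
      also have "\<dots> < e" using app[of m] app[of n] N1[of m n] mn by simp
      finally show ?thesis .
    qed
    then show ?thesis by blast
  qed
  have q1: "1 \<le> q" "0 < q" "0 \<le> q'" using p q' by auto
  have uqi: "integrable M (\<lambda>x. norm (u n x) powr q)" for n
  proof (rule Bochner_Integration.integrable_bound[where f="\<lambda>x. 1 + norm (u n x) powr q'"])
    show "integrable M (\<lambda>x. 1 + norm (u n x) powr q')" using uq(1) integrable_const_domain by simp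
    show "AE x in M. norm (norm (u n x) powr q) \<le> norm (1 + norm (u n x) powr q')"
      using powr_le_1_add_powr[of _ q q'] q1 q' by (intro AE_I2) auto
  qed (use um in simp)
  have Cq: "\<exists>N. \<forall>m\<ge>N. \<forall>n\<ge>N. (\<integral>x. norm (u (r m) x - u (r n) x) powr q \<partial>M) < e" if e: "0 < e" for e
  proof -
    define E where "E = 2 powr q' * (2 * C) + 1"
    have E: "0 < E" using C(1) by (simp add: E_def add_nonneg_pos)
    define \<delta> where "\<delta> = e / (2 * E)"
    have \<delta>: "0 < \<delta>" using e E by (simp add: \<delta>_def)
    define H where "H = \<delta> powr ((q - 1) / (q - q'))"
    have H: "0 < H" using \<delta> by (simp add: H_def)
    obtain N where N': "\<And>m n. m \<ge> N \<Longrightarrow> n \<ge> N \<Longrightarrow> (\<integral>x. \<bar>u (r m) x - u (r n) x\<bar> \<partial>M) < e / (2 * H)"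
      using C1[of "e / (2 * H)"] e H by auto
    have "(\<integral>x. norm (u (r m) x - u (r n) x) powr q \<partial>M) < e" if mn: "m \<ge> N" "n \<ge> N" for m n
    proof -
      note dq = integrable_diff_powr[OF um[of "r m"] um[of "r n"]]
      have "(\<integral>x. norm (u (r m) x - u (r n) x) powr q \<partial>M)
        \<le> (\<integral>x. \<delta> * (2 powr q' * (norm (u (r m) x) powr q' + norm (u (r n) x) powr q')) + H * \<bar>u (r m) x - u (r n) x\<bar> \<partial>M)"
      proof (rule integral_mono)
        show "integrable M (\<lambda>x. norm (u (r m) x - u (r n) x) powr q)"
          using uqi q1 by (intro dq) auto
        show "integrable M (\<lambda>x. \<delta> * (2 powr q' * (norm (u (r m) x) powr q' + norm (u (r n) x) powr q')) + H * \<bar>u (r m) x - u (r n) x\<bar>)"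
          using uq(1) u1n by simp
        fix x
        have "norm (u (r m) x - u (r n) x) powr q \<le> \<delta> * norm (u (r m) x - u (r n) x) powr q' + H * norm (u (r m) x - u (r n) x)"
          unfolding H_def using q1 q' \<delta> by (intro powr_interpolation) auto
        also have "\<dots> \<le> \<delta> * (2 powr q' * (norm (u (r m) x) powr q' + norm (u (r n) x) powr q')) + H * norm (u (r m) x - u (r n) x)"
          using \<delta> q1 by (intro add_right_mono mult_left_mono norm_diff_powr_le) auto
        finally show "norm (u (r m) x - u (r n) x) powr q \<le> \<delta> * (2 powr q' * (norm (u (r m) x) powr q' + norm (u (r n) x) powr q')) + H * \<bar>u (r m) x - u (r n) x\<bar>"
          by simp
      qed
      also have "\<dots> = \<delta> * (2 powr q' * ((\<integral>x. norm (u (r m) x) powr q' \<partial>M) + (\<integral>x. norm (u (r n) x) powr q' \<partial>M))) + H * (\<integral>x. \<bar>u (r m) x - u (r n) x\<bar> \<partial>M)"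
        using uq(1) u1n by simp
      also have "\<dots> \<le> \<delta> * (2 powr q' * (C + C)) + H * (\<integral>x. \<bar>u (r m) x - u (r n) x\<bar> \<partial>M)"
        using \<delta> uq(2) by (intro add_right_mono mult_left_mono add_mono) auto
      also have "\<dots> < \<delta> * E + H * (e / (2 * H))"
        using \<delta> H N'[OF mn] by (intro add_strict_mono mult_strict_left_mono) (auto simp: E_def)
      also have "\<dots> = e" using E H by (simp add: \<delta>_def)
      finally show ?thesis .
    qed
    then show ?thesis by blast
  qed
  obtain s W v where s: "strict_mono s" "integrable M W" "\<And>n. AE x in M. norm (u (r (s n)) x) powr q \<le> W x"
    "v \<in> borel_measurable M" "AE x in M. (\<lambda>n. u (r (s n)) x) \<longlonglongrightarrow> v x"
    by (rule Lp_Cauchy_imp_dominated_subseq[of q "\<lambda>n. u (r n)" M, OF q1(2) um uqi Cq]) blast+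
  show ?thesis
    by (rule that[of "r \<circ> s" W v]) (use s r(1) in \<open>auto simp: strict_mono_o\<close>)
qed

end

section \<open>Caratheodory functions and the flux\<close>

text \<open>u is a pointwise limit of simple functions. For a simple function the superposition is a
  finite sum of measurable pieces, and continuity in the second variable carries measurability to
  the limit.\<close>

lemma Caratheodory_compose_measurable:
  fixes f :: "'a::euclidean_space \<Rightarrow> 'b::euclidean_space \<Rightarrow> real"
  assumes \<Omega>: "\<Omega> \<in> sets lebesgue"
    and m: "\<And>s. (\<lambda>x. f x s) \<in> borel_measurable (lebesgue_on \<Omega>)"
    and c: "AE x in lebesgue_on \<Omega>. continuous_on UNIV (f x)"
    and u: "u \<in> borel_measurable (lebesgue_on \<Omega>)"
  shows "(\<lambda>x. f x (u x)) \<in> borel_measurable (lebesgue_on \<Omega>)"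
proof -
  obtain F where F: "\<And>i. simple_function (lebesgue_on \<Omega>) (F i)"
    "\<And>x. x \<in> space (lebesgue_on \<Omega>) \<Longrightarrow> (\<lambda>i. F i x) \<longlonglongrightarrow> u x"
    using borel_measurable_implies_sequence_metric[OF u, of 0] by blast
  have Fm: "(\<lambda>x. f x (F i x)) \<in> borel_measurable (lebesgue_on \<Omega>)" for i
  proof -
    let ?R = "F i ` space (lebesgue_on \<Omega>)"
    have fin: "finite ?R" using F(1)[of i] by (simp add: simple_function_def)
    have "(\<lambda>x. \<Sum>y\<in>?R. indicator (F i -` {y} \<inter> space (lebesgue_on \<Omega>)) x * f x y) \<in> borel_measurable (lebesgue_on \<Omega>)"
      using F(1)[of i] m by (intro borel_measurable_sum borel_measurable_times borel_measurable_indicator) (auto simp: simple_function_def)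
    then show ?thesis
    proof (rule measurable_cong[THEN iffD1, rotated])
      fix x assume x: "x \<in> space (lebesgue_on \<Omega>)"
      have "(\<Sum>y\<in>?R. indicator (F i -` {y} \<inter> space (lebesgue_on \<Omega>)) x * f x y) = (\<Sum>y\<in>?R. if y = F i x then f x y else 0)"
        using x by (intro sum.cong) (auto simp: indicator_def)
      also have "\<dots> = f x (F i x)" using fin x by (subst sum.delta) auto
      finally show "(\<Sum>y\<in>?R. indicator (F i -` {y} \<inter> space (lebesgue_on \<Omega>)) x * f x y) = f x (F i x)" .
    qed
  qed
  have lm: "(\<lambda>x. lim (\<lambda>i. f x (F i x))) \<in> borel_measurable (lebesgue_on \<Omega>)"
    by (rule borel_measurable_lim_metric[OF Fm])
  have "AE x in lebesgue_on \<Omega>. f x (u x) = lim (\<lambda>i. f x (F i x))"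
    using c AE_space
  proof eventually_elim
    case (elim x)
    have "isCont (f x) (u x)" using elim(1) by (simp add: continuous_on_eq_continuous_at)
    from isCont_tendsto_compose[OF this F(2)[OF elim(2)]] show ?case by (rule limI[symmetric])
  qed
  then show ?thesis by (rule AE_measurable_lebesgue_on[OF lm _ \<Omega>])
qed

text \<open>The derivative at a fixed point is a limit of difference quotients that are measurable
  in x. This makes D_sA_k and g_k eligible for the preceding lemma.\<close>

lemma directional_derivative_measurable:
  fixes f :: "'a::euclidean_space \<Rightarrow> 'b::euclidean_space \<Rightarrow> real"
  assumes \<Omega>: "\<Omega> \<in> sets lebesgue"
    and m: "\<And>s. (\<lambda>x. f x s) \<in> borel_measurable (lebesgue_on \<Omega>)"
    and d: "AE x in lebesgue_on \<Omega>. (f x has_derivative D x) (at s)"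
  shows "(\<lambda>x. D x e) \<in> borel_measurable (lebesgue_on \<Omega>)"
proof -
  define q where "q n x = (f x (s + inverse (real (Suc n)) *\<^sub>R e) - f x s) / inverse (real (Suc n))" for n x
  have qm: "q n \<in> borel_measurable (lebesgue_on \<Omega>)" for n
    unfolding q_def[abs_def] using m by (intro borel_measurable_divide borel_measurable_diff) auto
  have lm: "(\<lambda>x. lim (\<lambda>n. q n x)) \<in> borel_measurable (lebesgue_on \<Omega>)"
    by (rule borel_measurable_lim_metric[OF qm])
  have "AE x in lebesgue_on \<Omega>. D x e = lim (\<lambda>n. q n x)"
    using d
  proof eventually_elim
    case (elim x)
    have lin: "linear (D x)" using elim by (rule has_derivative_linear)
    have "((\<lambda>t. f x (s + t *\<^sub>R e)) has_derivative (\<lambda>t. D x (t *\<^sub>R e))) (at 0)"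
      by (rule has_derivative_compose[of "\<lambda>t. s + t *\<^sub>R e", where g="f x"])
        (use elim in \<open>auto intro!: derivative_eq_intros\<close>)
    then have "((\<lambda>t. f x (s + t *\<^sub>R e)) has_real_derivative D x e) (at 0)"
      using linear_scale[OF lin] by (simp add: has_field_derivative_def mult.commute[of _ "D x e"])
    then have "((\<lambda>t. (f x (s + t *\<^sub>R e) - f x s) / t) \<longlongrightarrow> D x e) (at 0)"
      by (simp add: DERIV_def)
    moreover have "filterlim (\<lambda>n. inverse (real (Suc n))) (at 0) sequentially"
      unfolding filterlim_at using LIMSEQ_inverse_real_of_nat by auto
    ultimately have "(\<lambda>n. q n x) \<longlonglongrightarrow> D x e" unfolding q_def by (rule filterlim_compose)
    then show ?case by (rule limI[symmetric])
  qed
  then show ?thesis by (rule AE_measurable_lebesgue_on[OF lm _ \<Omega>])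
qed

section \<open>The p-Laplacian flux and its monotonicity\<close>

definition flux :: "real \<Rightarrow> 'a::euclidean_space \<Rightarrow> 'a" where
  "flux p \<xi> = norm \<xi> powr (p - 2) *\<^sub>R \<xi>"

lemma norm_flux: "norm (flux p \<xi>) = norm \<xi> powr (p - 1)"
proof -
  have "norm \<xi> powr (p - 2) * norm \<xi> powr 1 = norm \<xi> powr (p - 1)"
    by (subst powr_add[symmetric]) simp
  then show ?thesis by (simp add: flux_def)
qed

lemma flux_inner_self: "flux p \<xi> \<bullet> \<xi> = norm \<xi> powr p"
proof -
  have "norm \<xi> powr (p - 2) * (norm \<xi> powr 1 * norm \<xi> powr 1) = norm \<xi> powr p"
    by (simp only: powr_add[symmetric]) simp
  then show ?thesis by (simp add: flux_def power2_norm_eq_inner[symmetric] power2_eq_square)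
qed

lemma flux_inner_le: "1 < p \<Longrightarrow> \<bar>flux p \<xi> \<bullet> \<eta>\<bar> \<le> norm \<xi> powr p + norm \<eta> powr p"
  by (rule order_trans[OF Cauchy_Schwarz_ineq2], unfold norm_flux) (auto intro: powr_conj_young1)

lemma continuous_flux:
  assumes "1 < p"
  shows "continuous_on UNIV (flux p)"
proof (rule continuous_at_imp_continuous_on, rule ballI)
  fix \<xi> :: 'a
  show "isCont (flux p) \<xi>"
  proof (cases "\<xi> = 0")
    case True
    have "((\<lambda>\<xi>::'a. norm (flux p \<xi>)) \<longlongrightarrow> 0) (at 0)"
      unfolding norm_flux
      by (rule tendsto_zero_powrI[OF _ tendsto_const]) (use assms in \<open>auto intro: tendsto_norm_zero tendsto_ident_at\<close>)
    then have "((\<lambda>\<xi>::'a. flux p \<xi>) \<longlongrightarrow> 0) (at 0)" by (rule tendsto_norm_zero_cancel)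
    moreover have "flux p (0::'a) = 0" by (simp add: flux_def)
    ultimately show ?thesis using True by (simp add: isCont_def)
  next
    case False
    then show ?thesis unfolding flux_def by (intro continuous_intros) auto
  qed
qed

text \<open>The expression is the sum of \<gamma>, which measures the monotonicity of r^(p-1)
  between the two norms, and of \<alpha> \<beta>, where \<beta> is the defect in the Cauchy-Schwarz
  inequality. Equal norms and distinct vectors force \<beta> > 0, distinct norms force \<gamma> > 0.
  No distinction between p < 2 and p \<ge> 2 is required.\<close>

lemma flux_strict_mono:
  assumes p: "1 < p"
  shows "0 \<le> (flux p \<xi> - flux p \<eta>) \<bullet> (\<xi> - \<eta>)" and "\<xi> \<noteq> \<eta> \<Longrightarrow> 0 < (flux p \<xi> - flux p \<eta>) \<bullet> (\<xi> - \<eta>)"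
proof -
  define s t where "s = norm \<xi>" and "t = norm \<eta>"
  define \<alpha> where "\<alpha> = s powr (p - 2) + t powr (p - 2)"
  define \<beta> where "\<beta> = s * t - \<xi> \<bullet> \<eta>"
  define \<gamma> where "\<gamma> = (s powr (p - 1) - t powr (p - 1)) * (s - t)"
  have st: "0 \<le> s" "0 \<le> t" by (auto simp: s_def t_def)
  have pw: "r powr (p - 2) * r = r powr (p - 1)" "r powr (p - 1) * r = r powr p" if "0 \<le> r" for r :: real
    using that by (cases "r = 0"; simp add: powr_diff power2_eq_square field_simps)+
  have "(flux p \<xi> - flux p \<eta>) \<bullet> (\<xi> - \<eta>) = s powr p + t powr p - \<alpha> * (\<xi> \<bullet> \<eta>)"
    using flux_inner_self[of p \<xi>] flux_inner_self[of p \<eta>]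
    by (simp add: inner_diff_left inner_diff_right s_def t_def \<alpha>_def flux_def inner_commute algebra_simps)
  also have "\<dots> = \<gamma> + \<alpha> * \<beta>"
    using pw[OF st(1)] pw[OF st(2)] by (simp add: \<alpha>_def \<beta>_def \<gamma>_def algebra_simps)
  finally have D: "(flux p \<xi> - flux p \<eta>) \<bullet> (\<xi> - \<eta>) = \<gamma> + \<alpha> * \<beta>" .
  have \<alpha>: "0 \<le> \<alpha>" by (simp add: \<alpha>_def)
  have \<beta>: "0 \<le> \<beta>" using norm_cauchy_schwarz[of \<xi> \<eta>] by (simp add: \<beta>_def s_def t_def)
  have \<gamma>1: "0 < \<gamma>" if "s \<noteq> t"
  proof (cases "s < t")
    case True
    then have "s powr (p - 1) < t powr (p - 1)" using st p by (intro powr_less_mono2) auto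
    with True show ?thesis unfolding \<gamma>_def by (intro mult_neg_neg) auto
  next
    case False
    then have "t < s" using that by simp
    then have "t powr (p - 1) < s powr (p - 1)" using st p by (intro powr_less_mono2) auto
    with \<open>t < s\<close> show ?thesis unfolding \<gamma>_def by (intro mult_pos_pos) auto
  qed
  have \<gamma>: "0 \<le> \<gamma>" using \<gamma>1 by (cases "s = t") (auto simp: \<gamma>_def less_imp_le)
  show "0 \<le> (flux p \<xi> - flux p \<eta>) \<bullet> (\<xi> - \<eta>)" unfolding D using \<alpha> \<beta> \<gamma> by simp
  show "0 < (flux p \<xi> - flux p \<eta>) \<bullet> (\<xi> - \<eta>)" if ne: "\<xi> \<noteq> \<eta>"
  proof (cases "s = t")
    case False
    then show ?thesis unfolding D using \<alpha> \<beta> \<gamma>1 by (simp add: add_pos_nonneg)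
  next
    case True
    have "0 < s" using ne True st by (auto simp: s_def t_def less_le)
    then have "0 < \<alpha>" using True by (simp add: \<alpha>_def)
    have "0 < (norm (\<xi> - \<eta>))\<^sup>2" using ne by simp
    also have "\<dots> = 2 * \<beta>"
    proof -
      have "\<xi> \<bullet> \<xi> = s * t" "\<eta> \<bullet> \<eta> = s * t"
        using True by (simp_all add: s_def t_def power2_norm_eq_inner[symmetric] power2_eq_square)
      then show ?thesis
        by (simp add: power2_norm_eq_inner inner_diff_left inner_diff_right inner_commute \<beta>_def)
    qed
    finally have "0 < \<beta>" by simp
    with \<open>0 < \<alpha>\<close> \<gamma> show ?thesis unfolding D by (simp add: add_nonneg_pos)
  qed
qed

text \<open>Strict monotonicity made quantitative by compactness. Outside the ball of radius L the
  p-th powers pay for the difference; on pairs in the ball at distance at least \<delta> the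
  continuous monotonicity expression has a positive minimum; closer pairs are paid by \<delta>
  itself. The second estimate serves where u_n and u_m are close and the monotonicity expression is
  controlled, the first one where they are not.\<close>

lemma flux_gap:
  assumes p: "1 < p" and \<delta>: "0 < \<delta>"
  obtains C where "0 \<le> C"
    "\<And>\<xi> \<eta> :: 'a::euclidean_space. norm (\<xi> - \<eta>) \<le> \<delta> * (1 + norm \<xi> powr p + norm \<eta> powr p) + C"
    "\<And>\<xi> \<eta> :: 'a. norm (\<xi> - \<eta>) \<le> \<delta> * (1 + norm \<xi> powr p + norm \<eta> powr p) + C * ((flux p \<xi> - flux p \<eta>) \<bullet> (\<xi> - \<eta>))"
proof -
  \<comment> \<open>Chosen with L^(p-1) = 2/\<delta>, so that 2t \<le> \<delta> t^p for all t \<ge>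
    L.\<close>
  define L where "L = (2 / \<delta>) powr (1 / (p - 1))"
  have L: "0 < L" using \<delta> by (simp add: L_def)
  have large: "2 * t \<le> \<delta> * t powr p" if "L \<le> t" for t
  proof -
    have t: "0 < t" using that L by linarith
    have "2 / \<delta> = L powr (p - 1)" using p \<delta> by (simp add: L_def powr_powr)
    also have "\<dots> \<le> t powr (p - 1)" using that L p by (intro powr_mono2) auto
    finally have "2 \<le> \<delta> * t powr (p - 1)" using \<delta> by (simp add: field_simps)
    then have "2 * t \<le> \<delta> * t powr (p - 1) * t" using t by (intro mult_right_mono) auto
    then show ?thesis using t by (simp add: powr_diff)
  qed
  have far: "norm (\<xi> - \<eta>) \<le> \<delta> * (1 + norm \<xi> powr p + norm \<eta> powr p)" if "L < norm \<xi> \<or> L < norm \<eta>" for \<xi> \<eta> :: 'a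
  proof -
    have "norm (\<xi> - \<eta>) \<le> 2 * max (norm \<xi>) (norm \<eta>)" using norm_triangle_ineq4[of \<xi> \<eta>] by linarith
    also have "\<dots> \<le> \<delta> * max (norm \<xi>) (norm \<eta>) powr p" using that by (intro large) auto
    also have "\<dots> \<le> \<delta> * (1 + norm \<xi> powr p + norm \<eta> powr p)"
      using \<delta> by (intro mult_left_mono) (auto simp: max_def)
    finally show ?thesis .
  qed
  let ?D = "\<lambda>z :: 'a \<times> 'a. (flux p (fst z) - flux p (snd z)) \<bullet> (fst z - snd z)"
  define K where "K = {z \<in> cball (0::'a) L \<times> cball (0::'a) L. \<delta> \<le> norm (fst z - snd z)}"
  have cl: "closed {z :: 'a \<times> 'a. \<delta> \<le> norm (fst z - snd z)}"
    by (intro closed_Collect_le continuous_intros)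
  have "compact ((cball (0::'a) L \<times> cball (0::'a) L) \<inter> {z. \<delta> \<le> norm (fst z - snd z)})"
    by (intro compact_Int_closed cl compact_Times compact_cball)
  also have "(cball (0::'a) L \<times> cball (0::'a) L) \<inter> {z. \<delta> \<le> norm (fst z - snd z)} = K" by (auto simp: K_def)
  finally have K: "compact K" .
  have fc: "continuous_on UNIV (\<lambda>z::'a \<times> 'a. flux p (fst z))" "continuous_on UNIV (\<lambda>z::'a \<times> 'a. flux p (snd z))"
    by (rule continuous_on_compose2[OF continuous_flux[OF p]]; auto intro: continuous_intros)+
  have Dc: "continuous_on K ?D"
    by (rule continuous_on_subset[of UNIV]) (auto intro!: continuous_intros fc)
  obtain d where d: "0 < d" "\<And>z. z \<in> K \<Longrightarrow> d \<le> ?D z"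
  proof (cases "K = {}")
    case True
    then show ?thesis by (intro that[of 1]) auto
  next
    case False
    obtain z where z: "z \<in> K" "\<And>y. y \<in> K \<Longrightarrow> ?D z \<le> ?D y"
      using continuous_attains_inf[OF K False Dc] by blast
    have "fst z \<noteq> snd z" using z(1) \<delta> by (auto simp: K_def)
    then show ?thesis using flux_strict_mono(2)[OF p] z(2) by (intro that[of "?D z"])
  qed
  have pos: "0 \<le> \<delta> * (1 + norm \<xi> powr p + norm \<eta> powr p)" "\<delta> \<le> \<delta> * (1 + norm \<xi> powr p + norm \<eta> powr p)" for \<xi> \<eta> :: 'a
    using \<delta> by (auto intro!: mult_nonneg_nonneg add_nonneg_nonneg)
  show ?thesis
  proof (rule that[of "max (2 * L) (2 * L / d)"])
    show "0 \<le> max (2 * L) (2 * L / d)" using L by simp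
    fix \<xi> \<eta> :: 'a
    let ?E = "\<delta> * (1 + norm \<xi> powr p + norm \<eta> powr p)" and ?Z = "(flux p \<xi> - flux p \<eta>) \<bullet> (\<xi> - \<eta>)"
    have Z0: "0 \<le> ?Z" by (rule flux_strict_mono(1)[OF p])
    have M0: "0 \<le> max (2 * L) (2 * L / d) * ?Z" using L Z0 by (intro mult_nonneg_nonneg) auto
    show "norm (\<xi> - \<eta>) \<le> ?E + max (2 * L) (2 * L / d)"
    proof (cases "L < norm \<xi> \<or> L < norm \<eta>")
      case True
      then show ?thesis using far[OF True] L by (simp add: add_increasing2)
    next
      case False
      then have "norm (\<xi> - \<eta>) \<le> 2 * L" using norm_triangle_ineq4[of \<xi> \<eta>] by linarith
      then show ?thesis using pos(1)[of \<xi> \<eta>] by linarith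
    qed
    show "norm (\<xi> - \<eta>) \<le> ?E + max (2 * L) (2 * L / d) * ?Z"
    proof (cases "L < norm \<xi> \<or> L < norm \<eta>")
      case True
      then show ?thesis using far[OF True] M0 by linarith
    next
      case near: False
      show ?thesis
      proof (cases "\<delta> \<le> norm (\<xi> - \<eta>)")
        case True
        then have "d \<le> ?Z" using d(2)[of "(\<xi>, \<eta>)"] near by (auto simp: K_def)
        have "norm (\<xi> - \<eta>) \<le> 2 * L" using near norm_triangle_ineq4[of \<xi> \<eta>] by linarith
        also have "\<dots> = 2 * L / d * d" using d(1) by simp
        also have "\<dots> \<le> max (2 * L) (2 * L / d) * ?Z"
          using \<open>d \<le> ?Z\<close> d(1) L by (intro mult_mono) auto
        finally show ?thesis using pos(1)[of \<xi> \<eta>] by linarith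
      next
        case False
        then show ?thesis using pos(2)[of \<xi> \<eta>] M0 by linarith
      qed
    qed
  qed
qed

section \<open>A single quasilinear equation\<close>

text \<open>A smooth replacement for truncation at height \<epsilon>, so that test functions stay
  smooth. Its derivative k satisfies k(s) |s| \<le> \<epsilon>, which absorbs the Lipschitz error of
  the coefficient, and k \<ge> 1/2 on [-\<epsilon>, \<epsilon>], which recovers the untruncated
  integrand there.\<close>

lemma arctan_scale:
  fixes \<epsilon> s :: real
  assumes "0 < \<epsilon>"
  shows "smooth (\<lambda>x. \<epsilon> * arctan ((1/\<epsilon>) * x))"
    and "deriv (\<lambda>x. \<epsilon> * arctan ((1/\<epsilon>) * x)) s = inverse (1 + (s/\<epsilon>)\<^sup>2)"
    and "\<bar>\<epsilon> * arctan ((1/\<epsilon>) * s)\<bar> \<le> 2 * \<epsilon>"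
    and "0 < inverse (1 + (s/\<epsilon>)\<^sup>2)" "inverse (1 + (s/\<epsilon>)\<^sup>2) \<le> 1"
    and "inverse (1 + (s/\<epsilon>)\<^sup>2) * \<bar>s\<bar> \<le> \<epsilon>"
    and "\<bar>s\<bar> \<le> \<epsilon> \<Longrightarrow> 1 \<le> 2 * inverse (1 + (s/\<epsilon>)\<^sup>2)"
proof -
  show "smooth (\<lambda>x. \<epsilon> * arctan ((1/\<epsilon>) * x))" by (rule smooth_scale[OF smooth_arctan])
  have "((\<lambda>x. \<epsilon> * arctan ((1/\<epsilon>) * x)) has_real_derivative \<epsilon> * (inverse (1 + ((1/\<epsilon>) * s)\<^sup>2) * (1/\<epsilon>))) (at s)"
    by (intro DERIV_cmult DERIV_chain2[OF DERIV_arctan]) (use assms in \<open>auto intro!: derivative_eq_intros\<close>)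
  then show "deriv (\<lambda>x. \<epsilon> * arctan ((1/\<epsilon>) * x)) s = inverse (1 + (s/\<epsilon>)\<^sup>2)"
    using assms by (simp add: DERIV_imp_deriv)
  have "\<bar>arctan ((1/\<epsilon>) * s)\<bar> \<le> 2"
    using arctan_bounded[of "(1/\<epsilon>) * s"] pi_less_4 by linarith
  then show "\<bar>\<epsilon> * arctan ((1/\<epsilon>) * s)\<bar> \<le> 2 * \<epsilon>"
    using assms by (simp add: abs_mult mult.commute)
  have pos: "0 < 1 + (s/\<epsilon>)\<^sup>2" by (intro add_pos_nonneg) auto
  then show "0 < inverse (1 + (s/\<epsilon>)\<^sup>2)" "inverse (1 + (s/\<epsilon>)\<^sup>2) \<le> 1"
    by (auto simp: inverse_le_1_iff)
  have "\<bar>s\<bar> \<le> \<epsilon> * (1 + (s/\<epsilon>)\<^sup>2)"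
  proof -
    have "0 \<le> (\<bar>s/\<epsilon>\<bar> - 1)\<^sup>2" by simp
    also have "(\<bar>s/\<epsilon>\<bar> - 1)\<^sup>2 = 1 + (s/\<epsilon>)\<^sup>2 - 2 * \<bar>s/\<epsilon>\<bar>"
      by (simp only: power2_diff power2_abs) simp
    finally have "2 * \<bar>s/\<epsilon>\<bar> \<le> 1 + (s/\<epsilon>)\<^sup>2" by simp
    then have "\<bar>s/\<epsilon>\<bar> \<le> 1 + (s/\<epsilon>)\<^sup>2" by linarith
    then have "\<epsilon> * \<bar>s/\<epsilon>\<bar> \<le> \<epsilon> * (1 + (s/\<epsilon>)\<^sup>2)" using assms by (intro mult_left_mono) auto
    then show ?thesis using assms by (simp add: abs_divide)
  qed
  then show "inverse (1 + (s/\<epsilon>)\<^sup>2) * \<bar>s\<bar> \<le> \<epsilon>"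
    using pos by (simp add: inverse_eq_divide pos_divide_le_eq mult.commute)
  show "1 \<le> 2 * inverse (1 + (s/\<epsilon>)\<^sup>2)" if "\<bar>s\<bar> \<le> \<epsilon>"
  proof -
    have "\<bar>s/\<epsilon>\<bar> \<le> 1" using that assms by (simp add: abs_divide)
    then have "(s/\<epsilon>)\<^sup>2 \<le> 1" by (simp add: abs_square_le_1)
    then show ?thesis using pos by (simp add: inverse_eq_divide pos_le_divide_eq)
  qed
qed

lemma flux_diff_inner_le:
  assumes "1 < p"
  shows "\<bar>(flux p \<xi> - flux p \<eta>) \<bullet> (\<xi> - \<eta>)\<bar> \<le> 3 * (norm \<xi> powr p + norm \<eta> powr p)"
proof -
  have "(flux p \<xi> - flux p \<eta>) \<bullet> (\<xi> - \<eta>) = norm \<xi> powr p - flux p \<xi> \<bullet> \<eta> - flux p \<eta> \<bullet> \<xi> + norm \<eta> powr p"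
    using flux_inner_self[of p \<xi>] flux_inner_self[of p \<eta>] by (simp add: inner_diff_left inner_diff_right)
  then show ?thesis
    using flux_inner_le[OF assms, of \<xi> \<eta>] flux_inner_le[OF assms, of \<eta> \<xi>] powr_ge_zero[of "norm \<xi>" p] powr_ge_zero[of "norm \<eta>" p]
    by (auto simp: abs_le_iff)
qed

lemma Lp_norm_le:
  assumes "0 < p" "integrable (lebesgue_on \<Omega>) (\<lambda>x. norm (f x) powr p)" "(\<integral>x. norm (f x) powr p \<partial>lebesgue_on \<Omega>) \<le> K"
  shows "Lp_norm \<Omega> p f \<le> K powr (1/p)"
  unfolding Lp_norm_eq[OF assms(2)] using assms by (intro powr_mono2) auto

section \<open>One component of the system: setting and admissible test functions\<close>

locale quasilinear = bounded_open \<Omega> for \<Omega> :: "'a::euclidean_space set" +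
  fixes p :: real and a :: "'a \<Rightarrow> real \<Rightarrow> real" and C0 \<nu> R :: real
  assumes p_gt1: "1 < p" and C0_pos: "0 < C0" and \<nu>_pos: "0 < \<nu>" and R_pos: "0 < R"
    and a_meas: "\<And>u. u \<in> borel_measurable M \<Longrightarrow> (\<lambda>x. a x (u x)) \<in> borel_measurable M"
    and da_meas: "\<And>u. u \<in> borel_measurable M \<Longrightarrow> (\<lambda>x. deriv (a x) (u x)) \<in> borel_measurable M"
    and struct: "AE x in M. (\<forall>s. (a x has_real_derivative deriv (a x) s) (at s)) \<and>
      continuous_on UNIV (deriv (a x)) \<and> (\<forall>s. \<nu> \<le> a x s \<and> \<bar>a x s\<bar> \<le> C0 \<and> \<bar>deriv (a x) s\<bar> \<le> C0) \<and>
      (\<forall>s. R \<le> \<bar>s\<bar> \<longrightarrow> 0 \<le> s * deriv (a x) s)"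

text \<open>\<open>g n\<close> stands for the coupling g_k(x, u_n), of which only majorants are
  remembered. The bound on \<open>g n\<close> serves the bounded test functions, the bound on
  \<open>g n * u n\<close> the tail function, which grows like u_n. The limit \<open>u0\<close> is
  measurable, with no weak derivative attached to it yet.\<close>

locale quasilinear_sequence = quasilinear \<Omega> p a C0 \<nu> R
  for \<Omega> :: "'a::euclidean_space set" and p a C0 \<nu> R +
  fixes u :: "nat \<Rightarrow> 'a \<Rightarrow> real" and \<xi> :: "nat \<Rightarrow> 'a \<Rightarrow> 'a" and g :: "nat \<Rightarrow> 'a \<Rightarrow> real"
    and W :: "'a \<Rightarrow> real" and B :: real and u0 :: "'a \<Rightarrow> real"
  assumes u_closure: "\<And>n. test_closure \<Omega> p UNIV (u n) (\<xi> n)"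
    and \<xi>_bound: "\<And>n. (\<integral>x. norm (\<xi> n x) powr p \<partial>M) \<le> B"
    and g_meas: "\<And>n. g n \<in> borel_measurable M" and W_int: "integrable M W"
    and g_le: "\<And>n. AE x in M. \<bar>g n x\<bar> \<le> W x" and gu_le: "\<And>n. AE x in M. \<bar>g n x * u n x\<bar> \<le> W x"
    and u0_meas: "u0 \<in> borel_measurable M" and u_lim: "AE x in M. (\<lambda>n. u n x) \<longlonglongrightarrow> u0 x"
    and equation: "\<And>\<epsilon>. 0 < \<epsilon> \<Longrightarrow> \<forall>\<^sub>F n in sequentially. \<forall>\<phi>. test_fun \<Omega> \<phi> \<longrightarrow>
      \<bar>(\<integral>x. (a x (u n x) *\<^sub>R flux p (\<xi> n x)) \<bullet> grad \<phi> x \<partial>M)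
        + (\<integral>x. (1 / p * deriv (a x) (u n x) * norm (\<xi> n x) powr p - g n x) * \<phi> x \<partial>M)\<bar>
      \<le> \<epsilon> * Lp_norm \<Omega> p (grad \<phi>)"
begin

definition "Fl n x = a x (u n x) *\<^sub>R flux p (\<xi> n x)"

definition "Hl n x = 1 / p * deriv (a x) (u n x) * norm (\<xi> n x) powr p - g n x"

lemma p0: "0 < p" "0 \<le> p" using p_gt1 by auto

lemmas u_meas = test_closure_integrable(1)[OF u_closure p0(1)]
  and \<xi>_meas = test_closure_integrable(2)[OF u_closure p0(1)]
  and \<xi>_int = test_closure_integrable(4)[OF u_closure p0(1)]

lemma B_nonneg: "0 \<le> B"
  by (rule order_trans[OF integral_nonneg_AE \<xi>_bound[of 0]]) simp

lemma W_nonneg: "AE x in M. 0 \<le> W x"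
  using g_le[of 0] by eventually_elim linarith

lemma flux_meas: "\<eta> \<in> borel_measurable M \<Longrightarrow> (\<lambda>x. flux p (\<eta> x)) \<in> borel_measurable M"
  by (rule measurable_compose[OF _ borel_measurable_continuous_onI[OF continuous_flux[OF p_gt1]]])

lemma Fl_meas: "Fl n \<in> borel_measurable M"
  unfolding Fl_def[abs_def] using a_meas[OF u_meas] flux_meas[OF \<xi>_meas] by (intro borel_measurable_scaleR) auto

lemma Fl_le: "AE x in M. norm (Fl n x) \<le> C0 * norm (\<xi> n x) powr (p - 1)"
  using struct by eventually_elim (auto simp: Fl_def norm_flux intro!: mult_right_mono)

lemma Hl_meas: "Hl n \<in> borel_measurable M"
  unfolding Hl_def[abs_def] using da_meas[OF u_meas] \<xi>_meas g_meas
  by (intro borel_measurable_diff borel_measurable_times) auto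

lemma Hl_le: "AE x in M. \<bar>Hl n x\<bar> \<le> C0 * norm (\<xi> n x) powr p + W x"
  using struct g_le[of n]
proof eventually_elim
  case (elim x)
  have "\<bar>1 / p * deriv (a x) (u n x) * norm (\<xi> n x) powr p\<bar> \<le> (1 * C0) * norm (\<xi> n x) powr p"
    using elim p_gt1 unfolding abs_mult by (intro mult_mono) auto
  then show ?case using elim unfolding Hl_def by linarith
qed

lemma Hl_int: "integrable M (Hl n)"
  by (rule Bochner_Integration.integrable_bound[OF _ Hl_meas, of "\<lambda>x. C0 * norm (\<xi> n x) powr p + W x"])
    (use \<xi>_int W_int Hl_le[of n] in auto)

lemma Hl_integral_le: "(\<integral>x. \<bar>Hl n x\<bar> \<partial>M) \<le> C0 * B + (\<integral>x. W x \<partial>M)"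
proof -
  have "(\<integral>x. \<bar>Hl n x\<bar> \<partial>M) \<le> (\<integral>x. C0 * norm (\<xi> n x) powr p + W x \<partial>M)"
    using Hl_int \<xi>_int W_int Hl_le by (intro integral_mono_AE) auto
  also have "\<dots> = C0 * (\<integral>x. norm (\<xi> n x) powr p \<partial>M) + (\<integral>x. W x \<partial>M)"
    using \<xi>_int W_int by simp
  also have "\<dots> \<le> C0 * B + (\<integral>x. W x \<partial>M)"
    using C0_pos \<xi>_bound by (intro add_right_mono mult_left_mono) auto
  finally show ?thesis .
qed

lemma Fl_pair_int:
  assumes "\<eta> \<in> borel_measurable M" "integrable M (\<lambda>x. norm (\<eta> x) powr p)"
  shows "integrable M (\<lambda>x. Fl n x \<bullet> \<eta> x)"
proof (rule Bochner_Integration.integrable_bound)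
  show "integrable M (\<lambda>x. C0 * (norm (\<xi> n x) powr p + norm (\<eta> x) powr p))"
    using \<xi>_int assms by simp
  show "AE x in M. norm (Fl n x \<bullet> \<eta> x) \<le> norm (C0 * (norm (\<xi> n x) powr p + norm (\<eta> x) powr p))"
    using struct
  proof eventually_elim
    case (elim x)
    have "\<bar>a x (u n x)\<bar> * \<bar>flux p (\<xi> n x) \<bullet> \<eta> x\<bar> \<le> C0 * (norm (\<xi> n x) powr p + norm (\<eta> x) powr p)"
      using elim C0_pos flux_inner_le[OF p_gt1] by (intro mult_mono) auto
    then show ?case using C0_pos by (simp add: Fl_def abs_mult)
  qed
qed (use Fl_meas assms in simp)

lemma Hl_pair_int:
  assumes "v \<in> borel_measurable M" "AE x in M. \<bar>v x\<bar> \<le> L"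
  shows "integrable M (\<lambda>x. Hl n x * v x)"
proof (rule Bochner_Integration.integrable_bound)
  show "integrable M (\<lambda>x. \<bar>Hl n x\<bar> * L)" using Hl_int by simp
  show "AE x in M. norm (Hl n x * v x) \<le> norm (\<bar>Hl n x\<bar> * L)"
    using assms(2) by eventually_elim (auto simp: abs_mult intro!: mult_left_mono)
qed (use Hl_meas assms in simp)

text \<open>The threshold for n depends on \<epsilon> alone and not on the test function. Therefore
  test functions may be built from u_n itself and from u_m with arbitrary m.\<close>

lemma equation_closure:
  assumes "0 < \<epsilon>"
  shows "\<forall>\<^sub>F n in sequentially. \<forall>L v \<eta>. test_closure \<Omega> p {-L..L} v \<eta> \<longrightarrow>
    \<bar>(\<integral>x. Fl n x \<bullet> \<eta> x \<partial>M) + (\<integral>x. Hl n x * v x \<partial>M)\<bar> \<le> \<epsilon> * Lp_norm \<Omega> p \<eta>"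
  using equation[OF assms]
proof eventually_elim
  case (elim n)
  show ?case
  proof (intro allI impI)
    fix L v \<eta> assume v: "test_closure \<Omega> p {-L..L} v \<eta>"
    show "\<bar>(\<integral>x. Fl n x \<bullet> \<eta> x \<partial>M) + (\<integral>x. Hl n x * v x \<partial>M)\<bar> \<le> \<epsilon> * Lp_norm \<Omega> p \<eta>"
      by (rule test_inequality_closure(3)[OF p_gt1 Fl_meas Fl_le \<xi>_int Hl_int less_imp_le[OF C0_pos] _ v])
        (use elim in \<open>simp add: Fl_def Hl_def\<close>)
  qed
qed

section \<open>Gradients form a Cauchy sequence in L^1\<close>

lemma closure_diff: "test_closure \<Omega> p UNIV (\<lambda>x. u n x - u m x) (\<lambda>x. \<xi> n x - \<xi> m x)"
  by (rule test_closure_diff[OF u_closure u_closure p0(1)]) simp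

lemma \<xi>_diff_int: "integrable M (\<lambda>x. norm (\<xi> n x - \<xi> m x) powr p)"
  by (rule integrable_diff_powr[OF \<xi>_meas \<xi>_meas p0(2) \<xi>_int \<xi>_int])

text \<open>Testing the equations for n and m with \<epsilon> arctan ((u n - u m) / \<epsilon>), a smooth truncation of the
  difference at height \<epsilon>, makes the quadratic terms O(\<epsilon>), whatever their sign.\<close>

lemma monotonicity_estimate:
  assumes \<epsilon>: "0 < \<epsilon>" and e: "0 < e"
  shows "\<exists>N. \<forall>n\<ge>N. \<forall>m\<ge>N. \<nu> * (\<integral>x. inverse (1 + ((u n x - u m x)/\<epsilon>)\<^sup>2) * ((flux p (\<xi> n x) - flux p (\<xi> m x)) \<bullet> (\<xi> n x - \<xi> m x)) \<partial>M)
    \<le> 2 * e * (2 powr p * (2 * B)) powr (1/p) + \<epsilon> * (8 * C0 * B + 4 * (\<integral>x. W x \<partial>M))"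
proof -
  obtain N where N0: "\<forall>n\<ge>N. \<forall>L v \<eta>. test_closure \<Omega> p {-L..L} v \<eta> \<longrightarrow>
    \<bar>(\<integral>x. Fl n x \<bullet> \<eta> x \<partial>M) + (\<integral>x. Hl n x * v x \<partial>M)\<bar> \<le> e * Lp_norm \<Omega> p \<eta>"
    using equation_closure[OF e] unfolding eventually_sequentially by blast
  then have N: "\<And>n L v \<eta>. n \<ge> N \<Longrightarrow> test_closure \<Omega> p {-L..L} v \<eta> \<Longrightarrow>
    \<bar>(\<integral>x. Fl n x \<bullet> \<eta> x \<partial>M) + (\<integral>x. Hl n x * v x \<partial>M)\<bar> \<le> e * Lp_norm \<Omega> p \<eta>"
    by blast
  define L where "L = (2 powr p * (2 * B)) powr (1/p)"
  have "\<nu> * (\<integral>x. inverse (1 + ((u n x - u m x)/\<epsilon>)\<^sup>2) * ((flux p (\<xi> n x) - flux p (\<xi> m x)) \<bullet> (\<xi> n x - \<xi> m x)) \<partial>M)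
    \<le> 2 * e * L + \<epsilon> * (8 * C0 * B + 4 * (\<integral>x. W x \<partial>M))" if nm: "n \<ge> N" "m \<ge> N" for n m
  proof -
    define w where "w x = u n x - u m x" for x
    define h where "h x = \<epsilon> * arctan ((1/\<epsilon>) * x)" for x
    define k where "k x = inverse (1 + (w x/\<epsilon>)\<^sup>2)" for x
    define v where "v x = h (w x)" for x
    define \<eta> where "\<eta> x = k x *\<^sub>R (\<xi> n x - \<xi> m x)" for x
    define D where "D x = (flux p (\<xi> n x) - flux p (\<xi> m x)) \<bullet> (\<xi> n x - \<xi> m x)" for x
    define Q where "Q x = norm (\<xi> n x) powr p + norm (\<xi> m x) powr p" for x
    note at = arctan_scale[OF \<epsilon>]
    have hd: "deriv h s = inverse (1 + (s/\<epsilon>)\<^sup>2)" for s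
      using at(2)[of s] by (simp add: h_def[abs_def])
    have k01: "0 \<le> k x" "k x \<le> 1" for x
      using at(4,5)[of "w x"] by (auto simp: k_def)
    have cl: "test_closure \<Omega> p {-(2*\<epsilon>)..2*\<epsilon>} v \<eta>"
    proof -
      have "test_closure \<Omega> p {-(2*\<epsilon>)..2*\<epsilon>} (\<lambda>x. h (u n x - u m x)) (\<lambda>x. deriv h (u n x - u m x) *\<^sub>R (\<xi> n x - \<xi> m x))"
      proof (rule test_closure_compose[OF closure_diff p0(1), where L=1])
        show "smooth h" using at(1) by (simp add: h_def[abs_def])
        show "h 0 = 0" by (simp add: h_def)
        show "\<bar>deriv h s\<bar> \<le> 1" for s using at(4,5)[of s] by (simp add: hd)
        show "h s \<in> {-(2*\<epsilon>)..2*\<epsilon>}" for s using at(3)[of s] by (auto simp: h_def abs_le_iff)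
      qed auto
      then show ?thesis by (simp add: v_def[abs_def] \<eta>_def[abs_def] w_def k_def hd)
    qed
    note ci = test_closure_integrable[OF cl p0(1)]
    have vb: "AE x in M. \<bar>v x\<bar> \<le> 2 * \<epsilon>"
      using at(3) by (intro AE_I2) (simp add: v_def h_def)
    have \<eta>L: "Lp_norm \<Omega> p \<eta> \<le> L"
      unfolding L_def
    proof (rule Lp_norm_le[OF p0(1) ci(4)])
      have "(\<integral>x. norm (\<eta> x) powr p \<partial>M) \<le> (\<integral>x. 2 powr p * Q x \<partial>M)"
      proof (rule integral_mono[OF ci(4)])
        show "integrable M (\<lambda>x. 2 powr p * Q x)" using \<xi>_int by (simp add: Q_def)
        fix x
        have "norm (\<eta> x) \<le> norm (\<xi> n x - \<xi> m x)"
          using k01[of x] by (simp add: \<eta>_def mult_left_le_one_le)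
        then have "norm (\<eta> x) powr p \<le> norm (\<xi> n x - \<xi> m x) powr p" using p0 by (intro powr_mono2) auto
        also have "\<dots> \<le> 2 powr p * Q x" unfolding Q_def by (rule norm_diff_powr_le[OF p0(2)])
        finally show "norm (\<eta> x) powr p \<le> 2 powr p * Q x" .
      qed
      also have "\<dots> = 2 powr p * ((\<integral>x. norm (\<xi> n x) powr p \<partial>M) + (\<integral>x. norm (\<xi> m x) powr p \<partial>M))"
        using \<xi>_int by (simp add: Q_def)
      also have "\<dots> \<le> 2 powr p * (2 * B)"
        using \<xi>_bound[of n] \<xi>_bound[of m] by (intro mult_left_mono) auto
      finally show "(\<integral>x. norm (\<eta> x) powr p \<partial>M) \<le> 2 powr p * (2 * B)" .
    qed
    have Hv: "\<bar>\<integral>x. Hl j x * v x \<partial>M\<bar> \<le> 2 * \<epsilon> * (C0 * B + (\<integral>x. W x \<partial>M))" for j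
    proof -
      have "\<bar>\<integral>x. Hl j x * v x \<partial>M\<bar> \<le> (\<integral>x. \<bar>Hl j x * v x\<bar> \<partial>M)" by (rule integral_abs_bound)
      also have "\<dots> \<le> (\<integral>x. \<bar>Hl j x\<bar> * (2 * \<epsilon>) \<partial>M)"
      proof (rule integral_mono_AE)
        show "AE x in M. \<bar>Hl j x * v x\<bar> \<le> \<bar>Hl j x\<bar> * (2 * \<epsilon>)"
          using vb by eventually_elim (simp add: abs_mult mult_left_mono)
      qed (use Hl_int Hl_pair_int[OF ci(1) vb] in auto)
      also have "\<dots> = 2 * \<epsilon> * (\<integral>x. \<bar>Hl j x\<bar> \<partial>M)" by simp
      also have "\<dots> \<le> 2 * \<epsilon> * (C0 * B + (\<integral>x. W x \<partial>M))"
        using \<epsilon> Hl_integral_le by (intro mult_left_mono) auto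
      finally show ?thesis .
    qed
    note Fi = Fl_pair_int[OF ci(2,4)]
    have eN: "e * Lp_norm \<Omega> p \<eta> \<le> e * L" using e \<eta>L by (intro mult_left_mono) auto
    have Fle: "(\<integral>x. Fl n x \<bullet> \<eta> x \<partial>M) - (\<integral>x. Fl m x \<bullet> \<eta> x \<partial>M) \<le> 2 * e * L + 4 * \<epsilon> * (C0 * B + (\<integral>x. W x \<partial>M))"
      using N[OF nm(1) cl] N[OF nm(2) cl] Hv[of n] Hv[of m] eN by linarith
    have Qi: "integrable M Q" using \<xi>_int by (simp add: Q_def[abs_def])
    have Dm: "D \<in> borel_measurable M"
      unfolding D_def[abs_def] using \<xi>_meas flux_meas[OF \<xi>_meas] by (intro borel_measurable_inner borel_measurable_diff) auto
    have km: "k \<in> borel_measurable M"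
      unfolding k_def[abs_def] w_def using u_meas by (intro borel_measurable_inverse borel_measurable_add borel_measurable_power borel_measurable_divide borel_measurable_diff) auto
    have kD: "integrable M (\<lambda>x. k x * D x)"
    proof (rule Bochner_Integration.integrable_bound)
      show "integrable M (\<lambda>x. 3 * Q x)" using Qi by simp
      show "AE x in M. norm (k x * D x) \<le> norm (3 * Q x)"
      proof (rule AE_I2)
        fix x
        have "\<bar>k x * D x\<bar> \<le> 1 * (3 * Q x)"
          unfolding abs_mult using k01[of x] flux_diff_inner_le[OF p_gt1, of "\<xi> n x" "\<xi> m x"]
          by (intro mult_mono) (auto simp: D_def Q_def)
        then show "norm (k x * D x) \<le> norm (3 * Q x)" by simp
      qed
    qed (use km Dm in simp)
    have "\<nu> * (\<integral>x. k x * D x \<partial>M) = (\<integral>x. \<nu> * (k x * D x) \<partial>M)" by simp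
    also have "\<dots> \<le> (\<integral>x. (Fl n x \<bullet> \<eta> x - Fl m x \<bullet> \<eta> x) + 2 * C0 * \<epsilon> * Q x \<partial>M)"
    proof (rule integral_mono_AE)
      show "AE x in M. \<nu> * (k x * D x) \<le> (Fl n x \<bullet> \<eta> x - Fl m x \<bullet> \<eta> x) + 2 * C0 * \<epsilon> * Q x"
        using struct
      proof eventually_elim
        case (elim x)
        \<comment> \<open>The difference of the fluxes splits into the monotone part with the
          coefficient at u_n and the part A flux(\<xi> m). The latter is O(\<epsilon>) since |A|
          \<le> C0 |w| by the bound on D_sA, and k |w| \<le> \<epsilon>.\<close>
        define A where "A = a x (u n x) - a x (u m x)"
        have "\<bar>A\<bar> \<le> C0 * \<bar>w x\<bar>"
          using field_differentiable_bound[OF convex_UNIV, of "a x" "deriv (a x)" C0 "u n x" "u m x"] elim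
          by (auto simp: A_def w_def)
        then have "k x * \<bar>A\<bar> \<le> k x * (C0 * \<bar>w x\<bar>)" using k01 by (intro mult_left_mono) auto
        also have "\<dots> = C0 * (k x * \<bar>w x\<bar>)" by simp
        also have "\<dots> \<le> C0 * \<epsilon>" using at(6)[of "w x"] C0_pos by (intro mult_left_mono) (auto simp: k_def)
        finally have kA: "k x * \<bar>A\<bar> \<le> C0 * \<epsilon>" .
        define E where "E = flux p (\<xi> m x) \<bullet> (\<xi> n x - \<xi> m x)"
        have E: "\<bar>E\<bar> \<le> 2 * Q x"
        proof -
          have "\<bar>y - r\<bar> \<le> 2 * (s + r)" if "\<bar>y\<bar> \<le> r + s" "0 \<le> r" "0 \<le> s" for y r s :: real
            using that unfolding abs_le_iff by simp
          from this[OF flux_inner_le[OF p_gt1, of "\<xi> m x" "\<xi> n x"] powr_ge_zero powr_ge_zero] show ?thesis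
            by (simp only: E_def Q_def inner_diff_right flux_inner_self)
        qed
        have "\<bar>k x * A * E\<bar> \<le> (C0 * \<epsilon>) * (2 * Q x)"
        proof -
          have "\<bar>k x * A * E\<bar> = (k x * \<bar>A\<bar>) * \<bar>E\<bar>" using k01[of x] by (simp add: abs_mult)
          also have "\<dots> \<le> (C0 * \<epsilon>) * (2 * Q x)" using C0_pos \<epsilon> by (intro mult_mono[OF kA E]) auto
          finally show ?thesis .
        qed
        moreover have "Fl n x \<bullet> \<eta> x - Fl m x \<bullet> \<eta> x = a x (u n x) * (k x * D x) + k x * A * E"
          by (simp add: Fl_def \<eta>_def D_def A_def E_def inner_diff_left inner_diff_right algebra_simps)
        moreover have "\<nu> * (k x * D x) \<le> a x (u n x) * (k x * D x)"
          using elim k01[of x] flux_strict_mono(1)[OF p_gt1, of "\<xi> n x" "\<xi> m x"]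
          by (intro mult_right_mono) (auto simp: D_def)
        ultimately show ?case by (simp add: abs_le_iff)
      qed
    qed (use kD Qi Fi in auto)
    also have "\<dots> = ((\<integral>x. Fl n x \<bullet> \<eta> x \<partial>M) - (\<integral>x. Fl m x \<bullet> \<eta> x \<partial>M)) + 2 * C0 * \<epsilon> * (\<integral>x. Q x \<partial>M)"
      using Fi Qi by simp
    also have "\<dots> \<le> (2 * e * L + 4 * \<epsilon> * (C0 * B + (\<integral>x. W x \<partial>M))) + 2 * C0 * \<epsilon> * (2 * B)"
    proof (intro add_mono Fle mult_left_mono)
      show "(\<integral>x. Q x \<partial>M) \<le> 2 * B" using \<xi>_int \<xi>_bound[of n] \<xi>_bound[of m] by (simp add: Q_def)
    qed (use C0_pos \<epsilon> in auto)
    also have "\<dots> = 2 * e * L + \<epsilon> * (8 * C0 * B + 4 * (\<integral>x. W x \<partial>M))" by (simp add: algebra_simps)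
    finally show ?thesis by (simp add: k_def D_def w_def)
  qed
  then show ?thesis unfolding L_def by blast
qed

text \<open>Where |u_n - u_m| \<le> \<epsilon>, the weight k is at least 1/2 and the second bound of
  \<open>flux_gap\<close> is controlled by the monotonicity estimate. The remaining set has small
  measure, since u_n converges almost everywhere, and the first bound of \<open>flux_gap\<close>
  suffices on it. The choices are made in the order \<delta>, C, \<epsilon>, e', indices.\<close>

lemma gradients_L1_Cauchy:
  assumes e: "0 < e"
  shows "\<exists>N. \<forall>m\<ge>N. \<forall>n\<ge>N. (\<integral>x. norm (\<xi> m x - \<xi> n x) powr 1 \<partial>M) < e"
proof -
  define V where "V = (\<integral>x. 1 \<partial>M) + 2 * B + 1"
  have "0 \<le> (\<integral>x. (1::real) \<partial>M)" by (rule integral_nonneg_AE) simp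
  then have V: "0 < V" using B_nonneg unfolding V_def by linarith
  define \<delta> where "\<delta> = e / (4 * V)"
  have \<delta>: "0 < \<delta>" using e V by (simp add: \<delta>_def)
  obtain C where C: "0 \<le> C"
    "\<And>\<xi> \<eta> :: 'a. norm (\<xi> - \<eta>) \<le> \<delta> * (1 + norm \<xi> powr p + norm \<eta> powr p) + C"
    "\<And>\<xi> \<eta> :: 'a. norm (\<xi> - \<eta>) \<le> \<delta> * (1 + norm \<xi> powr p + norm \<eta> powr p) + C * ((flux p \<xi> - flux p \<eta>) \<bullet> (\<xi> - \<eta>))"
    by (rule flux_gap[OF p_gt1 \<delta>, where 'a='a]) blast
  define c1 where "c1 = C + 1"
  have c1: "0 < c1" "C \<le> c1" using C(1) by (auto simp: c1_def)
  have IW: "0 \<le> (\<integral>x. W x \<partial>M)" by (rule integral_nonneg_AE[OF W_nonneg])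
  define K1 where "K1 = 8 * C0 * B + 4 * (\<integral>x. W x \<partial>M) + 1"
  have K1: "0 < K1" using B_nonneg C0_pos IW by (simp add: K1_def add_nonneg_pos)
  define L where "L = (2 powr p * (2 * B)) powr (1/p) + 1"
  have L: "0 < L" by (simp add: L_def add_nonneg_pos)
  \<comment> \<open>\<epsilon> and e' are such that \<epsilon> K1 and 2 e' L both equal e \<nu> /
    (16 c1), the two contributions to the monotonicity estimate.\<close>
  define \<epsilon> where "\<epsilon> = e * \<nu> / (16 * c1 * K1)"
  have \<epsilon>: "0 < \<epsilon>" using e \<nu>_pos c1 K1 by (simp add: \<epsilon>_def)
  define e' where "e' = e * \<nu> / (32 * c1 * L)"
  have e': "0 < e'" using e \<nu>_pos c1 L by (simp add: e'_def)
  obtain N1 where N1: "\<And>n m. n \<ge> N1 \<Longrightarrow> m \<ge> N1 \<Longrightarrow> \<nu> * (\<integral>x. inverse (1 + ((u n x - u m x)/\<epsilon>)\<^sup>2) * ((flux p (\<xi> n x) - flux p (\<xi> m x)) \<bullet> (\<xi> n x - \<xi> m x)) \<partial>M)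
    \<le> 2 * e' * (2 powr p * (2 * B)) powr (1/p) + \<epsilon> * (8 * C0 * B + 4 * (\<integral>x. W x \<partial>M))"
    using monotonicity_estimate[OF \<epsilon> e'] by blast
  \<comment> \<open>A bounded integrable substitute for the indicator of {|u_n - u_m| > \<epsilon>}:
    on that set T n + T m \<ge> 1, while each T n tends to 0 in L^1 because it compares with
    \<open>u0\<close> only.\<close>
  define T where "T n x = min 1 (\<bar>u n x - u0 x\<bar> / \<epsilon>)" for n x
  have Tm: "T n \<in> borel_measurable M" for n
    unfolding T_def[abs_def] using u_meas u0_meas by (intro borel_measurable_min borel_measurable_divide borel_measurable_abs borel_measurable_diff borel_measurable_const)
  have T01: "0 \<le> T n x" "T n x \<le> 1" for n x using \<epsilon> by (auto simp: T_def)
  have Ti: "integrable M (T n)" for n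
    by (rule Bochner_Integration.integrable_bound[OF integrable_const_domain[of 1] Tm]) (use T01 in auto)
  have "(\<lambda>n. \<integral>x. T n x \<partial>M) \<longlonglongrightarrow> (\<integral>x. 0 \<partial>M)"
  proof (rule integral_dominated_convergence[OF _ Tm integrable_const_domain[of 1]])
    show "AE x in M. (\<lambda>n. T n x) \<longlonglongrightarrow> 0"
      using u_lim
    proof eventually_elim
      case (elim x)
      have "(\<lambda>n. min 1 (\<bar>u n x - u0 x\<bar> / \<epsilon>)) \<longlonglongrightarrow> min 1 (\<bar>u0 x - u0 x\<bar> / \<epsilon>)"
        using elim \<epsilon> by (intro tendsto_intros) auto
      then show ?case by (simp add: T_def)
    qed
  qed (use T01 in auto)
  then have "eventually (\<lambda>n. (\<integral>x. T n x \<partial>M) < e / (8 * c1)) sequentially"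
    using e c1 by (intro order_tendstoD) auto
  then obtain N2 where N2: "\<And>n. n \<ge> N2 \<Longrightarrow> (\<integral>x. T n x \<partial>M) < e / (8 * c1)"
    by (auto simp: eventually_sequentially)
  have "(\<integral>x. norm (\<xi> n x - \<xi> m x) \<partial>M) < e" if nm: "n \<ge> max N1 N2" "m \<ge> max N1 N2" for n m
  proof -
    define k where "k x = inverse (1 + ((u n x - u m x)/\<epsilon>)\<^sup>2)" for x
    define D where "D x = (flux p (\<xi> n x) - flux p (\<xi> m x)) \<bullet> (\<xi> n x - \<xi> m x)" for x
    define Q where "Q x = norm (\<xi> n x) powr p + norm (\<xi> m x) powr p" for x
    have D0: "0 \<le> D x" for x unfolding D_def by (rule flux_strict_mono(1)[OF p_gt1])
    have k01: "0 \<le> k x" "k x \<le> 1" for x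
      using arctan_scale(4,5)[OF \<epsilon>, of "u n x - u m x"] by (auto simp: k_def)
    have Qi: "integrable M Q" using \<xi>_int by (simp add: Q_def[abs_def])
    have Dm: "D \<in> borel_measurable M"
      unfolding D_def[abs_def] using \<xi>_meas flux_meas[OF \<xi>_meas] by (intro borel_measurable_inner borel_measurable_diff) auto
    have km: "k \<in> borel_measurable M"
      unfolding k_def[abs_def] using u_meas by (intro borel_measurable_inverse borel_measurable_add borel_measurable_power borel_measurable_divide borel_measurable_diff) auto
    have kD: "integrable M (\<lambda>x. k x * D x)"
    proof (rule Bochner_Integration.integrable_bound)
      show "integrable M (\<lambda>x. 3 * Q x)" using Qi by simp
      show "AE x in M. norm (k x * D x) \<le> norm (3 * Q x)"
      proof (rule AE_I2)
        fix x
        have "\<bar>k x * D x\<bar> \<le> 1 * (3 * Q x)"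
          unfolding abs_mult using k01[of x] flux_diff_inner_le[OF p_gt1, of "\<xi> n x" "\<xi> m x"]
          by (intro mult_mono) (auto simp: D_def Q_def)
        then show "norm (k x * D x) \<le> norm (3 * Q x)" by simp
      qed
    qed (use km Dm in simp)
    have di: "integrable M (\<lambda>x. norm (\<xi> n x - \<xi> m x))"
    proof (rule Bochner_Integration.integrable_bound)
      show "integrable M (\<lambda>x. 1 + norm (\<xi> n x - \<xi> m x) powr p)" using \<xi>_diff_int integrable_const_domain by simp
      show "AE x in M. norm (norm (\<xi> n x - \<xi> m x)) \<le> norm (1 + norm (\<xi> n x - \<xi> m x) powr p)"
        using powr_le_1_add_powr[of _ 1 p] p_gt1 by (intro AE_I2) simp
    qed (use \<xi>_meas in simp)
    have "(\<integral>x. norm (\<xi> n x - \<xi> m x) \<partial>M) \<le> (\<integral>x. \<delta> * (1 + Q x) + C * (2 * (k x * D x) + (T n x + T m x)) \<partial>M)"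
    proof (rule integral_mono[OF di])
      show "integrable M (\<lambda>x. \<delta> * (1 + Q x) + C * (2 * (k x * D x) + (T n x + T m x)))"
        using Qi kD Ti integrable_const_domain[of 1] by simp
      fix x
      have kD0: "0 \<le> k x * D x" using k01[of x] D0[of x] by simp
      show "norm (\<xi> n x - \<xi> m x) \<le> \<delta> * (1 + Q x) + C * (2 * (k x * D x) + (T n x + T m x))"
      proof (cases "\<bar>u n x - u m x\<bar> \<le> \<epsilon>")
        case True
        then have "1 \<le> 2 * k x" using arctan_scale(7)[OF \<epsilon>] by (simp add: k_def)
        then have "1 * D x \<le> (2 * k x) * D x" using D0 by (intro mult_right_mono) auto
        then have "D x \<le> 2 * (k x * D x) + (T n x + T m x)" using T01[of n x] T01[of m x] by linarith
        then have "C * D x \<le> C * (2 * (k x * D x) + (T n x + T m x))" using C(1) by (rule mult_left_mono)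
        then show ?thesis using C(3)[of "\<xi> n x" "\<xi> m x"] by (simp add: Q_def D_def add.assoc)
      next
        case False
        have "1 \<le> T n x + T m x"
        proof (rule ccontr)
          assume "\<not> ?thesis"
          then have "\<bar>u n x - u0 x\<bar> / \<epsilon> + \<bar>u m x - u0 x\<bar> / \<epsilon> < 1" using \<epsilon> T01[of n x] T01[of m x]
            by (auto simp: T_def min_def split: if_splits)
          then have "\<bar>u n x - u0 x\<bar> + \<bar>u m x - u0 x\<bar> < \<epsilon>" using \<epsilon> by (simp add: add_divide_distrib[symmetric])
          then show False using False by linarith
        qed
        then have "1 \<le> 2 * (k x * D x) + (T n x + T m x)" using kD0 by linarith
        then have "C * 1 \<le> C * (2 * (k x * D x) + (T n x + T m x))" using C(1) by (rule mult_left_mono)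
        then show ?thesis using C(2)[of "\<xi> n x" "\<xi> m x"] by (simp add: Q_def add.assoc)
      qed
    qed
    also have "\<dots> = \<delta> * ((\<integral>x. 1 \<partial>M) + (\<integral>x. Q x \<partial>M)) + C * (2 * (\<integral>x. k x * D x \<partial>M) + ((\<integral>x. T n x \<partial>M) + (\<integral>x. T m x \<partial>M)))"
      using Qi kD Ti integrable_const_domain[of 1] by simp
    also have "\<dots> \<le> e / 4 + (e / 4 + e / 4)"
    proof (rule add_mono)
      have "(\<integral>x. Q x \<partial>M) \<le> 2 * B" using \<xi>_int \<xi>_bound[of n] \<xi>_bound[of m] by (simp add: Q_def)
      then have "\<delta> * ((\<integral>x. 1 \<partial>M) + (\<integral>x. Q x \<partial>M)) \<le> \<delta> * V"
        using \<delta> unfolding V_def by (intro mult_left_mono) auto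
      also have "\<dots> = e / 4" using V by (simp add: \<delta>_def)
      finally show "\<delta> * ((\<integral>x. 1 \<partial>M) + (\<integral>x. Q x \<partial>M)) \<le> e / 4" .
      define I where "I = (\<integral>x. k x * D x \<partial>M)"
      have "\<nu> * I \<le> 2 * e' * (2 powr p * (2 * B)) powr (1/p) + \<epsilon> * (8 * C0 * B + 4 * (\<integral>x. W x \<partial>M))"
        using N1[of n m] nm by (simp add: I_def k_def D_def)
      also have "\<dots> \<le> 2 * e' * L + \<epsilon> * K1"
        using e' \<epsilon> by (intro add_mono mult_left_mono) (auto simp: L_def K1_def)
      also have "2 * e' * L = e * \<nu> / (16 * c1)" using L by (simp add: e'_def)
      also have "\<epsilon> * K1 = e * \<nu> / (16 * c1)" using K1 by (simp add: \<epsilon>_def)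
      also have "e * \<nu> / (16 * c1) + e * \<nu> / (16 * c1) = \<nu> * (e / (8 * c1))"
        using c1 by (simp add: field_simps)
      finally have "\<nu> * I \<le> \<nu> * (e / (8 * c1))" .
      then have I: "I \<le> e / (8 * c1)" using \<nu>_pos by (rule mult_left_le_imp_le)
      have I0: "0 \<le> I" unfolding I_def using k01 D0 by (intro integral_nonneg_AE) simp
      have "2 * I + ((\<integral>x. T n x \<partial>M) + (\<integral>x. T m x \<partial>M)) \<le> e / (2 * c1)"
      proof -
        have "e / (2 * c1) = 2 * (e / (8 * c1)) + (e / (8 * c1) + e / (8 * c1))" using c1 by (simp add: field_simps)
        then show ?thesis using I N2[of n] N2[of m] nm by linarith
      qed
      then have "C * (2 * I + ((\<integral>x. T n x \<partial>M) + (\<integral>x. T m x \<partial>M))) \<le> C * (e / (2 * c1))"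
        using C(1) by (rule mult_left_mono)
      also have "\<dots> \<le> c1 * (e / (2 * c1))" using c1 e by (intro mult_right_mono) auto
      also have "\<dots> = e / 4 + e / 4" using c1 by (simp add: field_simps)
      finally show "C * (2 * (\<integral>x. k x * D x \<partial>M) + ((\<integral>x. T n x \<partial>M) + (\<integral>x. T m x \<partial>M))) \<le> e / 4 + e / 4"
        by (simp add: I_def)
    qed
    also have "\<dots> < e" using e by simp
    finally show ?thesis .
  qed
  then show ?thesis by (auto intro!: exI[of _ "max N1 N2"])
qed

end

section \<open>Scalar inequalities behind the tail function and the sinh-tanh test function\<close>

lemma abs_arctan_le: "\<bar>arctan x\<bar> \<le> \<bar>x\<bar>"
proof -
  have "\<bar>arctan x - arctan 0\<bar> \<le> 1 * \<bar>x - 0\<bar>"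
  proof -
    have "norm (inverse (1 + y\<^sup>2)) \<le> 1" for y :: real
      using arctan_scale(4,5)[of 1 y] by simp
    then have "norm (arctan x - arctan 0) \<le> 1 * norm (x - 0)"
      by (intro field_differentiable_bound[OF convex_UNIV, of arctan "\<lambda>y. inverse (1 + y\<^sup>2)"])
        (auto intro: DERIV_arctan)
    then show ?thesis by simp
  qed
  then show ?thesis by simp
qed

lemma abs_tanh_le: "\<bar>tanh x\<bar> \<le> \<bar>x :: real\<bar>"
proof -
  have sq: "(tanh y)\<^sup>2 \<le> 1" for y :: real
    using tanh_real_bounds[of y] by (auto simp: abs_square_le_1 abs_le_iff)
  have "norm (tanh x - tanh 0) \<le> 1 * norm (x - 0)"
  proof (rule field_differentiable_bound[OF convex_UNIV])
    show "(tanh has_real_derivative 1 - (tanh y)\<^sup>2) (at y within UNIV)" for y :: real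
      by (rule derivative_eq_intros refl | simp)+
    show "norm (1 - (tanh y)\<^sup>2) \<le> 1" for y :: real using sq[of y] by simp
  qed auto
  then show ?thesis by simp
qed

lemma abs_sinh_le_cosh: "\<bar>sinh x\<bar> \<le> cosh (x :: real)"
  using sinh_le_cosh_real[of x] sinh_le_cosh_real[of "-x"] by (simp add: abs_le_iff)

lemma abs_sinh_le_mult_cosh: "\<bar>sinh x\<bar> \<le> \<bar>x\<bar> * cosh (x :: real)"
proof -
  have "\<bar>sinh x\<bar> = \<bar>tanh x\<bar> * cosh x" by (simp add: tanh_def abs_divide)
  also have "\<dots> \<le> \<bar>x\<bar> * cosh x" by (intro mult_right_mono abs_tanh_le) (simp add: cosh_real_nonneg)
  finally show ?thesis .
qed

lemma cosh_le_cosh: "\<bar>x\<bar> \<le> y \<Longrightarrow> cosh x \<le> cosh (y :: real)"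
proof -
  assume "\<bar>x\<bar> \<le> y"
  then have "cosh \<bar>x\<bar> \<le> cosh y"
    using cosh_real_strict_mono[of "\<bar>x\<bar>" y] by (cases "\<bar>x\<bar> = y") auto
  then show ?thesis by (simp add: abs_if split: if_splits)
qed

text \<open>\<psi> is the identity minus its smooth truncation at height of order 1/\<epsilon>. Near
  0 it is cubic with a factor \<epsilon>^2, hence negligible on bounded sets as \<epsilon> tends to
  0, while its derivative \<kappa> is at least 1/2 for |s| \<ge> 1/\<epsilon>. The factor min 1
  ((\<epsilon> s)^2) makes the tested lower-order term vanish with \<epsilon> by dominated
  convergence.\<close>

lemma tail_function:
  fixes \<epsilon> :: real
  assumes \<epsilon>: "0 < \<epsilon>"
  defines "\<psi> \<equiv> \<lambda>s. s - (1/\<epsilon>) * arctan (\<epsilon> * s)" and "\<kappa> \<equiv> \<lambda>s. 1 - inverse (1 + (\<epsilon> * s)\<^sup>2)"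
  shows "smooth \<psi>" "\<psi> 0 = 0" "deriv \<psi> = \<kappa>" "0 \<le> \<kappa> s" "\<kappa> s \<le> 1"
    and "\<bar>\<psi> s\<bar> \<le> \<bar>s\<bar> * min 1 ((\<epsilon> * s)\<^sup>2)" and "0 \<le> s * \<psi> s" and "1 \<le> \<epsilon> * \<bar>s\<bar> \<Longrightarrow> 1 \<le> 2 * \<kappa> s"
proof -
  show "smooth \<psi>" unfolding \<psi>_def by (intro smooth_diff smooth_ident smooth_scale smooth_arctan)
  show "\<psi> 0 = 0" by (simp add: \<psi>_def)
  have d: "(\<psi> has_real_derivative \<kappa> t) (at t)" for t
  proof -
    have "(\<psi> has_real_derivative 1 - (1/\<epsilon>) * (inverse (1 + (\<epsilon> * t)\<^sup>2) * \<epsilon>)) (at t)"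
      unfolding \<psi>_def
      by (intro DERIV_diff DERIV_ident DERIV_cmult DERIV_chain2[OF DERIV_arctan]) (auto intro!: derivative_eq_intros)
    then show ?thesis using \<epsilon> by (simp add: \<kappa>_def)
  qed
  show "deriv \<psi> = \<kappa>" by (intro ext DERIV_imp_deriv d)
  have i01: "0 < inverse (1 + (\<epsilon> * t)\<^sup>2)" "inverse (1 + (\<epsilon> * t)\<^sup>2) \<le> 1" for t
    using arctan_scale(4,5)[of 1 "\<epsilon> * t"] by auto
  show k: "0 \<le> \<kappa> t" "\<kappa> t \<le> 1" for t using i01[of t] by (simp_all add: \<kappa>_def)
  have pos: "0 < 1 + (\<epsilon> * t)\<^sup>2" for t by (intro add_pos_nonneg) auto
  have ksq: "\<kappa> t \<le> (\<epsilon> * t)\<^sup>2" for t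
  proof -
    have "1 - (\<epsilon> * t)\<^sup>2 \<le> inverse (1 + (\<epsilon> * t)\<^sup>2)"
    proof -
      have "(1 - (\<epsilon> * t)\<^sup>2) * (1 + (\<epsilon> * t)\<^sup>2) = 1 - ((\<epsilon> * t)\<^sup>2)\<^sup>2"
        by (simp only: power2_eq_square[of "(\<epsilon> * t)\<^sup>2"] algebra_simps) simp
      also have "\<dots> \<le> 1" by simp
      finally show ?thesis using pos[of t] by (simp add: inverse_eq_divide pos_le_divide_eq)
    qed
    then show ?thesis by (simp add: \<kappa>_def)
  qed
  show "\<bar>\<psi> s\<bar> \<le> \<bar>s\<bar> * min 1 ((\<epsilon> * s)\<^sup>2)"
  proof -
    have "norm (\<psi> s - \<psi> 0) \<le> min 1 ((\<epsilon> * s)\<^sup>2) * norm (s - 0)"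
    proof (rule field_differentiable_bound[of "{-\<bar>s\<bar>..\<bar>s\<bar>}"])
      show "(\<psi> has_real_derivative \<kappa> t) (at t within {-\<bar>s\<bar>..\<bar>s\<bar>})" for t
        using d by (rule has_field_derivative_at_within)
      show "norm (\<kappa> t) \<le> min 1 ((\<epsilon> * s)\<^sup>2)" if "t \<in> {-\<bar>s\<bar>..\<bar>s\<bar>}" for t
      proof -
        have "\<bar>t\<bar> \<le> \<bar>s\<bar>" using that by auto
        then have "t\<^sup>2 \<le> s\<^sup>2" by (rule abs_le_square_iff[THEN iffD1])
        then have "(\<epsilon> * t)\<^sup>2 \<le> (\<epsilon> * s)\<^sup>2" by (simp add: power_mult_distrib mult_left_mono)
        then show ?thesis using k[of t] ksq[of t] by simp
      qed
    qed auto
    then show ?thesis by (simp add: \<psi>_def mult.commute)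
  qed
  have mono: "\<psi> x \<le> \<psi> y" if "x \<le> y" for x y
    by (rule DERIV_nonneg_imp_nondecreasing[OF that]) (use d k in blast)
  show "0 \<le> s * \<psi> s"
    using mono[of 0 s] mono[of s 0] \<open>\<psi> 0 = 0\<close> by (cases "0 \<le> s") (auto intro: mult_nonneg_nonneg mult_nonpos_nonpos)
  show "1 \<le> 2 * \<kappa> s" if "1 \<le> \<epsilon> * \<bar>s\<bar>"
  proof -
    have "1 \<le> (\<epsilon> * \<bar>s\<bar>)\<^sup>2" using that by (rule one_le_power)
    then have "1 \<le> (\<epsilon> * s)\<^sup>2" by (simp add: power_mult_distrib)
    then have "2 * inverse (1 + (\<epsilon> * s)\<^sup>2) \<le> 1" using pos[of s] by (simp add: inverse_eq_divide pos_divide_le_eq)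
    then show ?thesis by (simp add: \<kappa>_def)
  qed
qed

text \<open>The exponent \<theta> absorbs the natural growth term where it has the wrong sign (there
  |r| \<le> 1 - |tanh (\<theta> s)|, which is comparable with the derivative of tanh), and \<mu> absorbs it
  where |s| \<le> R.\<close>

lemma natural_growth_absorbed:
  fixes A d c s t \<nu> C0 R \<theta> \<mu> :: real
  assumes pos: "0 < \<nu>" "0 < C0" "0 < R" and A: "\<nu> \<le> A" and d: "\<bar>d\<bar> \<le> C0" and c: "0 \<le> c" "c \<le> 1"
    and sgn: "R \<le> \<bar>s\<bar> \<Longrightarrow> 0 \<le> s * d"
    and \<theta>: "\<theta> = 2 * C0 / \<nu>" and \<mu>: "\<mu> = 2 * C0 / (\<nu> * (\<theta> * (1 - (tanh (\<theta> * R))\<^sup>2)))"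
  defines "r \<equiv> tanh (\<theta> * s) - tanh (\<theta> * t)" and "T \<equiv> \<theta> * (1 - (tanh (\<theta> * s))\<^sup>2)"
  shows "\<nu> * \<mu> / 2 * T \<le> A * (\<mu> * cosh (\<mu> * r) * T) + c * d * sinh (\<mu> * r)"
proof -
  have sq: "(tanh y)\<^sup>2 < 1" for y :: real
    using tanh_real_bounds[of y] by (auto simp: abs_square_less_1 abs_less_iff)
  have \<theta>0: "0 < \<theta>" using \<theta> pos by simp
  have \<tau>: "0 < \<theta> * (1 - (tanh (\<theta> * R))\<^sup>2)" using \<theta>0 sq by simp
  define \<tau> where "\<tau> = \<theta> * (1 - (tanh (\<theta> * R))\<^sup>2)"
  have \<tau>0: "0 < \<tau>" and \<mu>\<tau>: "\<mu> = 2 * C0 / (\<nu> * \<tau>)" using \<tau> \<mu> by (simp_all only: \<tau>_def)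
  have \<mu>0: "0 < \<mu>" unfolding \<mu>\<tau> using pos \<tau>0 by simp
  \<comment> \<open>The origin of \<mu>: for |s| \<le> R the derivative T is at least \<tau>, so
    \<mu> T is at least 2 C0/\<nu>, and there |sinh| \<le> cosh is all that is needed.\<close>
  have C0_eq: "C0 = \<nu> / 2 * (\<mu> * \<tau>)" unfolding \<mu>\<tau> using pos \<tau>0 by simp
  have T0: "0 < T" unfolding T_def using \<theta>0 sq by simp
  define ch where "ch = cosh (\<mu> * r)"
  have ch: "1 \<le> ch" by (simp add: ch_def cosh_real_ge_1)
  define X where "X = \<mu> * ch * T"
  have X0: "0 < X" using \<mu>0 ch T0 by (simp add: X_def)
  have TX: "\<mu> * T \<le> X"
    using ch \<mu>0 T0 mult_right_mono[OF ch, of "\<mu> * T"] by (simp add: X_def mult_ac)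
  have AX: "\<nu> * X \<le> A * X" using A X0 by (intro mult_right_mono) auto
  \<comment> \<open>If |s| \<ge> R and r has the sign of s, the sign condition makes d sinh(\<mu> r)
    nonnegative. In the remaining cases C0 |sinh(\<mu> r)| is at most half of the elliptic lower
    bound \<nu> X.\<close>
  have key: "- (\<nu> / 2 * X) \<le> c * d * sinh (\<mu> * r)"
  proof (cases "R \<le> \<bar>s\<bar> \<and> 0 \<le> s * r")
    case True
    then have "s \<noteq> 0" using pos(3) by auto
    have "0 \<le> d * sinh (\<mu> * r)"
    proof (cases "0 < s")
      case True
      then have "0 \<le> d" "0 \<le> r" using \<open>R \<le> \<bar>s\<bar> \<and> 0 \<le> s * r\<close> sgn by (auto simp: zero_le_mult_iff)
      then show ?thesis using \<mu>0 by simp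
    next
      case False
      then have "s < 0" using \<open>s \<noteq> 0\<close> by simp
      then have "d \<le> 0" "r \<le> 0" using \<open>R \<le> \<bar>s\<bar> \<and> 0 \<le> s * r\<close> sgn by (auto simp: zero_le_mult_iff)
      then show ?thesis using \<mu>0 by (intro mult_nonpos_nonpos) (auto intro: mult_nonneg_nonpos)
    qed
    then have "0 \<le> c * d * sinh (\<mu> * r)" using c by (simp add: mult.assoc)
    moreover have "0 \<le> \<nu> / 2 * X" using pos X0 by simp
    ultimately show ?thesis by linarith
  next
    case False
    have "C0 * \<bar>sinh (\<mu> * r)\<bar> \<le> \<nu> / 2 * X"
    proof (cases "R \<le> \<bar>s\<bar>")
      case True
      with False have sr: "s * r < 0" by simp
      \<comment> \<open>Here tanh(\<theta> t) lies beyond tanh(\<theta> s) on the side away from 0,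
        and it stays within (-1, 1); their distance is thus at most the room left to 1.\<close>
      have "\<bar>r\<bar> \<le> 1 - \<bar>tanh (\<theta> * s)\<bar>"
      proof (cases "0 < s")
        case True
        then have "r < 0" using sr by (simp add: mult_less_0_iff)
        moreover have "0 < tanh (\<theta> * s)" using True \<theta>0 by simp
        ultimately show ?thesis using tanh_real_lt_1[of "\<theta> * t"] by (simp add: r_def)
      next
        case False
        then have "s < 0" "0 < r" using sr by (auto simp: mult_less_0_iff)
        moreover have "tanh (\<theta> * s) < 0" using \<open>s < 0\<close> \<theta>0 by (simp add: mult_pos_neg)
        ultimately show ?thesis using tanh_real_gt_neg1[of "\<theta> * t"] by (simp add: r_def)
      qed
      also have "\<dots> \<le> (1 - \<bar>tanh (\<theta> * s)\<bar>) * (1 + \<bar>tanh (\<theta> * s)\<bar>)"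
      proof -
        have "\<bar>tanh (\<theta> * s)\<bar> \<le> 1" using sq[of "\<theta> * s"] by (simp add: abs_square_less_1 less_imp_le)
        then show ?thesis using mult_left_mono[of 1 "1 + \<bar>tanh (\<theta> * s)\<bar>" "1 - \<bar>tanh (\<theta> * s)\<bar>"] by simp
      qed
      also have "\<dots> = 1 - (tanh (\<theta> * s))\<^sup>2"
        by (simp add: algebra_simps power2_eq_square del: tanh_real_abs)
      finally have r: "\<bar>r\<bar> \<le> 1 - (tanh (\<theta> * s))\<^sup>2" .
      have "\<bar>sinh (\<mu> * r)\<bar> \<le> \<mu> * \<bar>r\<bar> * ch"
        using abs_sinh_le_mult_cosh[of "\<mu> * r"] \<mu>0 by (simp add: abs_mult ch_def)
      also have "\<dots> \<le> \<mu> * (1 - (tanh (\<theta> * s))\<^sup>2) * ch"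
        using r \<mu>0 ch by (intro mult_right_mono mult_left_mono) auto
      finally have "C0 * \<bar>sinh (\<mu> * r)\<bar> \<le> C0 * (\<mu> * (1 - (tanh (\<theta> * s))\<^sup>2) * ch)"
        using pos by (intro mult_left_mono) auto
      \<comment> \<open>The origin of \<theta>: C0 = \<nu> \<theta> / 2 turns 1 - tanh^2 into the
        derivative T with exactly the factor \<nu>/2.\<close>
      also have "C0 * (\<mu> * (1 - (tanh (\<theta> * s))\<^sup>2) * ch) = \<nu> / 2 * \<theta> * (\<mu> * (1 - (tanh (\<theta> * s))\<^sup>2) * ch)"
        using \<theta> pos by simp
      also have "\<dots> = \<nu> / 2 * X" by (simp add: X_def T_def)
      finally show ?thesis .
    next
      case False
      have "\<bar>tanh (\<theta> * s)\<bar> \<le> tanh (\<theta> * R)"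
      proof -
        have "tanh \<bar>\<theta> * s\<bar> \<le> tanh (\<theta> * R)"
          unfolding tanh_real_le_iff using False \<theta>0 by (simp add: abs_mult)
        then show ?thesis by simp
      qed
      then have "(tanh (\<theta> * s))\<^sup>2 \<le> (tanh (\<theta> * R))\<^sup>2" using abs_le_square_iff by fastforce
      then have \<tau>T: "\<tau> \<le> T" unfolding T_def \<tau>_def using \<theta>0 by (intro mult_left_mono) auto
      have "C0 * \<bar>sinh (\<mu> * r)\<bar> \<le> C0 * ch"
        using pos abs_sinh_le_cosh by (intro mult_left_mono) (auto simp: ch_def)
      also have "C0 * ch = \<nu> / 2 * (\<mu> * \<tau>) * ch" using C0_eq by simp
      also have "\<dots> \<le> \<nu> / 2 * (\<mu> * T) * ch"
        using \<tau>T pos \<mu>0 ch by (intro mult_right_mono mult_left_mono) auto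
      also have "\<dots> = \<nu> / 2 * X" by (simp add: X_def)
      finally show ?thesis .
    qed
    moreover have "\<bar>c * d * sinh (\<mu> * r)\<bar> \<le> C0 * \<bar>sinh (\<mu> * r)\<bar>"
    proof -
      have "\<bar>c * d\<bar> \<le> 1 * C0" unfolding abs_mult using c d by (intro mult_mono) auto
      then show ?thesis unfolding abs_mult[of "c * d"] by (intro mult_right_mono) auto
    qed
    ultimately show ?thesis by (simp add: abs_le_iff)
  qed
  have "\<nu> * \<mu> / 2 * T = \<nu> / 2 * (\<mu> * T)" by simp
  also have "\<dots> \<le> \<nu> / 2 * X" using TX pos by (intro mult_left_mono) auto
  also have "\<dots> \<le> A * X + c * d * sinh (\<mu> * r)" using AX key by linarith
  finally show ?thesis by (simp add: X_def ch_def)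
qed

text \<open>Fatou's lemma for C h_n - G_n + D in quantitative form. Cutting C h_n - G_n off at C h'
  makes it dominated by |D| + C |h'|, so its integral converges to that of C h'. Any excess of the
  integrals of h_n over the integral of h' then bounds the integral of G_n in the limit.\<close>

lemma dominated_by_convergent_integrals:
  fixes G h :: "nat \<Rightarrow> 'b \<Rightarrow> real"
  assumes G: "\<And>n. G n \<in> borel_measurable M" "\<And>n x. 0 \<le> G n x" "AE x in M. (\<lambda>n. G n x) \<longlonglongrightarrow> 0"
    and h: "\<And>n. integrable M (h n)" "integrable M h'" "AE x in M. (\<lambda>n. h n x) \<longlonglongrightarrow> h' x"
    and le: "\<And>n. AE x in M. G n x \<le> C * h n x + D x" and C: "0 < C" and D: "integrable M D"
    and X: "\<forall>\<^sub>F n in sequentially. (\<integral>x. h n x \<partial>M) \<le> X" and \<kappa>: "0 < \<kappa>"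
  shows "\<And>n. integrable M (G n)" "\<forall>\<^sub>F n in sequentially. (\<integral>x. G n x \<partial>M) \<le> C * (X - (\<integral>x. h' x \<partial>M)) + \<kappa>"
proof -
  show Gi: "integrable M (G n)" for n
  proof (rule Bochner_Integration.integrable_bound[OF _ G(1)])
    show "integrable M (\<lambda>x. C * h n x + D x)" using h(1) D by simp
    show "AE x in M. norm (G n x) \<le> norm (C * h n x + D x)"
      using le[of n] by eventually_elim (use G(2) in auto)
  qed
  define k where "k n x = min (C * h n x - G n x) (C * h' x)" for n x
  have hm: "h n \<in> borel_measurable M" "h' \<in> borel_measurable M" for n using h by auto
  have km: "k n \<in> borel_measurable M" for n
    unfolding k_def[abs_def] using hm G(1) by (intro borel_measurable_min) auto
  have kb: "AE x in M. norm (k n x) \<le> \<bar>D x\<bar> + C * \<bar>h' x\<bar>" for n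
    using le[of n]
  proof eventually_elim
    case (elim x)
    have "\<bar>C * h' x\<bar> = C * \<bar>h' x\<bar>" using C by (simp add: abs_mult)
    then show ?case using elim unfolding k_def by (auto simp: min_def abs_le_iff)
  qed
  have Di: "integrable M (\<lambda>x. \<bar>D x\<bar> + C * \<bar>h' x\<bar>)" using D h by simp
  have ki: "integrable M (k n)" for n
    by (rule Bochner_Integration.integrable_bound[OF Di km]) (use kb[of n] in auto)
  have "(\<lambda>n. \<integral>x. k n x \<partial>M) \<longlonglongrightarrow> (\<integral>x. C * h' x \<partial>M)"
  proof (rule integral_dominated_convergence[OF _ km Di _ kb])
    show "AE x in M. (\<lambda>n. k n x) \<longlonglongrightarrow> C * h' x"
      using G(3) h(3)
    proof eventually_elim
      case (elim x)
      have "(\<lambda>n. min (C * h n x - G n x) (C * h' x)) \<longlonglongrightarrow> min (C * h' x - 0) (C * h' x)"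
        using elim by (intro tendsto_intros)
      then show ?case by (simp add: k_def)
    qed
  qed (use hm in simp)
  then have "\<forall>\<^sub>F n in sequentially. (\<integral>x. C * h' x \<partial>M) - \<kappa> < (\<integral>x. k n x \<partial>M)"
    using \<kappa> by (intro order_tendstoD) auto
  with X show "\<forall>\<^sub>F n in sequentially. (\<integral>x. G n x \<partial>M) \<le> C * (X - (\<integral>x. h' x \<partial>M)) + \<kappa>"
  proof eventually_elim
    case (elim n)
    have "(\<integral>x. G n x \<partial>M) \<le> (\<integral>x. C * h n x - k n x \<partial>M)"
    proof (rule integral_mono[OF Gi])
      show "integrable M (\<lambda>x. C * h n x - k n x)" using ki h(1) by simp
      show "G n x \<le> C * h n x - k n x" for x by (simp add: k_def)
    qed
    also have "\<dots> = C * (\<integral>x. h n x \<partial>M) - (\<integral>x. k n x \<partial>M)" using ki h(1) by simp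
    also have "\<dots> \<le> C * X - (C * (\<integral>x. h' x \<partial>M) - \<kappa>)"
    proof -
      have "C * (\<integral>x. h n x \<partial>M) \<le> C * X" using elim C by (intro mult_left_mono) auto
      moreover have "C * (\<integral>x. h' x \<partial>M) - \<kappa> < (\<integral>x. k n x \<partial>M)" using elim by simp
      ultimately show ?thesis by linarith
    qed
    finally show ?case by (simp add: algebra_simps)
  qed
qed

section \<open>From convergence of the gradients almost everywhere to convergence in L^p\<close>

locale quasilinear_limit = quasilinear_sequence \<Omega> p a C0 \<nu> R u \<xi> g W B u0
  for \<Omega> :: "'a::euclidean_space set" and p a C0 \<nu> R u \<xi> g W B u0 +
  fixes \<xi>0 :: "'a \<Rightarrow> 'a"
  assumes \<xi>0_meas: "\<xi>0 \<in> borel_measurable M" and \<xi>_lim: "AE x in M. (\<lambda>n. \<xi> n x) \<longlonglongrightarrow> \<xi>0 x"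
begin

text \<open>At this stage \<open>\<xi>0\<close> is only an almost everywhere limit, not yet the
  gradient of \<open>u0\<close>; its integrability comes from Fatou's lemma, and the test functions
  below are built from u_n and u_m alone.\<close>

lemma \<xi>0_int: "integrable M (\<lambda>x. norm (\<xi>0 x) powr p)"
  by (rule integral_powr_Fatou(1)[OF p0(1) \<xi>_meas \<xi>0_meas \<xi>_int \<xi>_bound \<xi>_lim])

lemma continuous_compose_meas: "continuous_on UNIV h \<Longrightarrow> w \<in> borel_measurable M \<Longrightarrow> (\<lambda>x. h (w x)) \<in> borel_measurable M"
  for h :: "real \<Rightarrow> real"
  by (rule measurable_compose[OF _ borel_measurable_continuous_onI])

lemma W_weight_tendsto:
  assumes "0 < \<epsilon>"
  shows "(\<lambda>n. \<integral>x. W x * min 1 ((\<epsilon> * u n x)\<^sup>2) \<partial>M) \<longlonglongrightarrow> (\<integral>x. W x * min 1 ((\<epsilon> * u0 x)\<^sup>2) \<partial>M)"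
    and "integrable M (\<lambda>x. W x * min 1 ((\<epsilon> * u n x)\<^sup>2))"
proof -
  have Wm: "W \<in> borel_measurable M" using W_int by simp
  have m: "(\<lambda>x. W x * min 1 ((\<epsilon> * w x)\<^sup>2)) \<in> borel_measurable M" if "w \<in> borel_measurable M" for w
    using Wm that by (intro borel_measurable_times borel_measurable_min borel_measurable_power) auto
  have b: "AE x in M. norm (W x * min 1 ((\<epsilon> * w x)\<^sup>2)) \<le> W x" for w
    using W_nonneg by eventually_elim (auto simp: abs_mult intro!: mult_left_le)
  have l: "AE x in M. (\<lambda>n. W x * min 1 ((\<epsilon> * u n x)\<^sup>2)) \<longlonglongrightarrow> W x * min 1 ((\<epsilon> * u0 x)\<^sup>2)"
    using u_lim by eventually_elim (intro tendsto_intros)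
  show "(\<lambda>n. \<integral>x. W x * min 1 ((\<epsilon> * u n x)\<^sup>2) \<partial>M) \<longlonglongrightarrow> (\<integral>x. W x * min 1 ((\<epsilon> * u0 x)\<^sup>2) \<partial>M)"
    by (rule integral_dominated_convergence[OF m[OF u0_meas] m[OF u_meas] W_int l b])
  show "integrable M (\<lambda>x. W x * min 1 ((\<epsilon> * u n x)\<^sup>2))"
    by (rule Bochner_Integration.integrable_bound[OF W_int m[OF u_meas]]) (use b[of "u n"] W_nonneg in eventually_elim, simp)
qed

lemma weight_cont: "continuous_on UNIV (\<lambda>s::real. 1 - inverse (1 + (\<epsilon> * s)\<^sup>2))"
proof (intro continuous_intros ballI)
  fix s :: real
  have "0 < 1 + (\<epsilon> * s)\<^sup>2" by (intro add_pos_nonneg) auto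
  then show "1 + (\<epsilon> * s)\<^sup>2 \<noteq> 0" by simp
qed

lemma weight_energy_int:
  assumes "w \<in> borel_measurable M" "\<zeta> \<in> borel_measurable M" "integrable M (\<lambda>x. norm (\<zeta> x) powr p)"
  shows "integrable M (\<lambda>x. (1 - inverse (1 + (\<epsilon> * w x)\<^sup>2)) * norm (\<zeta> x :: 'a) powr p)"
proof (rule Bochner_Integration.integrable_bound[OF assms(3)])
  have 01: "0 \<le> 1 - inverse (1 + (\<epsilon> * s)\<^sup>2)" "1 - inverse (1 + (\<epsilon> * s)\<^sup>2) \<le> 1" for s :: real
    using arctan_scale(4,5)[of 1 "\<epsilon> * s"] by simp_all
  show "AE x in M. norm ((1 - inverse (1 + (\<epsilon> * w x)\<^sup>2)) * norm (\<zeta> x) powr p) \<le> norm (norm (\<zeta> x) powr p)"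
    using 01 by (intro AE_I2) (auto simp: abs_mult intro!: mult_left_le_one_le)
  show "(\<lambda>x. (1 - inverse (1 + (\<epsilon> * w x)\<^sup>2)) * norm (\<zeta> x) powr p) \<in> borel_measurable M"
    using continuous_compose_meas[OF weight_cont assms(1)] assms(2) by (intro borel_measurable_times) auto
qed

lemma weight_energy_limit_tendsto:
  "(\<lambda>n. \<integral>x. (1 - inverse (1 + (\<epsilon> * u n x)\<^sup>2)) * norm (\<xi>0 x) powr p \<partial>M)
    \<longlonglongrightarrow> (\<integral>x. (1 - inverse (1 + (\<epsilon> * u0 x)\<^sup>2)) * norm (\<xi>0 x) powr p \<partial>M)"
proof (rule integral_dominated_convergence[OF _ _ \<xi>0_int])
  have 01: "0 \<le> 1 - inverse (1 + (\<epsilon> * s)\<^sup>2)" "1 - inverse (1 + (\<epsilon> * s)\<^sup>2) \<le> 1" for s :: real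
    using arctan_scale(4,5)[of 1 "\<epsilon> * s"] by simp_all
  show "AE x in M. norm ((1 - inverse (1 + (\<epsilon> * u n x)\<^sup>2)) * norm (\<xi>0 x) powr p) \<le> norm (\<xi>0 x) powr p" for n
    using 01 by (intro AE_I2) (auto simp: abs_mult intro!: mult_left_le_one_le)
  show "AE x in M. (\<lambda>n. (1 - inverse (1 + (\<epsilon> * u n x)\<^sup>2)) * norm (\<xi>0 x) powr p)
      \<longlonglongrightarrow> (1 - inverse (1 + (\<epsilon> * u0 x)\<^sup>2)) * norm (\<xi>0 x) powr p"
    using u_lim
  proof eventually_elim
    case (elim x)
    have "isCont (\<lambda>s::real. 1 - inverse (1 + (\<epsilon> * s)\<^sup>2)) (u0 x)"
      using weight_cont by (simp add: continuous_on_eq_continuous_at)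
    from isCont_tendsto_compose[OF this elim] show ?case by (intro tendsto_mult tendsto_const)
  qed
  have m: "(\<lambda>x. (1 - inverse (1 + (\<epsilon> * w x)\<^sup>2)) * norm (\<xi>0 x) powr p) \<in> borel_measurable M" if "w \<in> borel_measurable M" for w
    using continuous_compose_meas[OF weight_cont that] \<xi>0_meas by (intro borel_measurable_times) auto
  show "(\<lambda>x. (1 - inverse (1 + (\<epsilon> * u n x)\<^sup>2)) * norm (\<xi>0 x) powr p) \<in> borel_measurable M"
    "(\<lambda>x. (1 - inverse (1 + (\<epsilon> * u0 x)\<^sup>2)) * norm (\<xi>0 x) powr p) \<in> borel_measurable M" for n
    by (rule m[OF u_meas], rule m[OF u0_meas])
qed

text \<open>The test function s - arctan (\<epsilon> s) / \<epsilon> is of order \<epsilon>^2 on [-R, R], and for |s| \<ge> R the sign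
  condition makes the natural growth term nonnegative; L arctan (_ / L) truncates it at height L.\<close>

lemma tail_estimate:
  assumes \<epsilon>: "0 < \<epsilon>" and e: "0 < e"
  shows "\<forall>\<^sub>F n in sequentially. \<nu> * (\<integral>x. (1 - inverse (1 + (\<epsilon> * u n x)\<^sup>2)) * norm (\<xi> n x) powr p \<partial>M)
    \<le> e * B powr (1/p) + C0 * (\<epsilon>\<^sup>2 * R ^ 3) * B + (\<integral>x. W x * min 1 ((\<epsilon> * u n x)\<^sup>2) \<partial>M)"
  using equation_closure[OF e]
proof eventually_elim
  case (elim n)
  define \<psi> where "\<psi> = (\<lambda>s. s - (1/\<epsilon>) * arctan (\<epsilon> * s))"
  define \<kappa> where "\<kappa> = (\<lambda>s::real. 1 - inverse (1 + (\<epsilon> * s)\<^sup>2))"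
  have tf: "smooth \<psi>" "\<psi> 0 = 0" "deriv \<psi> = \<kappa>" "0 \<le> \<kappa> s" "\<kappa> s \<le> 1"
    "\<bar>\<psi> s\<bar> \<le> \<bar>s\<bar> * min 1 ((\<epsilon> * s)\<^sup>2)" "0 \<le> s * \<psi> s" for s
    unfolding \<psi>_def \<kappa>_def by (rule tail_function[OF \<epsilon>])+
  define k where "k j x = inverse (1 + (\<psi> (u n x) / real (Suc j))\<^sup>2)" for j x
  define Z where "Z = e * B powr (1/p) + C0 * (\<epsilon>\<^sup>2 * R ^ 3) * B + (\<integral>x. W x * min 1 ((\<epsilon> * u n x)\<^sup>2) \<partial>M)"
  have Ei: "integrable M (\<lambda>x. \<kappa> (u n x) * norm (\<xi> n x) powr p)"
    unfolding \<kappa>_def by (rule weight_energy_int[OF u_meas \<xi>_meas \<xi>_int])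
  have \<kappa>m: "(\<lambda>x. \<kappa> (u n x)) \<in> borel_measurable M"
    unfolding \<kappa>_def by (rule continuous_compose_meas[OF weight_cont u_meas])
  have \<psi>m: "(\<lambda>x. \<psi> (u n x)) \<in> borel_measurable M"
    by (rule continuous_compose_meas[OF smooth_continuous[OF tf(1)] u_meas])
  have k01: "0 < k j x" "k j x \<le> 1" for j x
    using arctan_scale(4,5)[of "real (Suc j)" "\<psi> (u n x)"] by (auto simp: k_def)
  have km: "k j \<in> borel_measurable M" for j
    unfolding k_def[abs_def] using \<psi>m by (intro borel_measurable_inverse borel_measurable_add borel_measurable_power borel_measurable_divide) auto
  have kEm: "(\<lambda>x. k j x * (\<kappa> (u n x) * norm (\<xi> n x) powr p)) \<in> borel_measurable M" for j
    by (intro borel_measurable_times[OF km] borel_measurable_integrable[OF Ei])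
  have kEb: "AE x in M. norm (k j x * (\<kappa> (u n x) * norm (\<xi> n x) powr p)) \<le> \<kappa> (u n x) * norm (\<xi> n x) powr p" for j
  proof (rule AE_I2)
    fix x
    have "0 \<le> \<kappa> (u n x) * norm (\<xi> n x) powr p" using tf(4) by simp
    then show "norm (k j x * (\<kappa> (u n x) * norm (\<xi> n x) powr p)) \<le> \<kappa> (u n x) * norm (\<xi> n x) powr p"
      using k01[of j x] by (subst real_norm_def, subst abs_of_nonneg) (auto intro: mult_left_le_one_le)
  qed
  have kEi: "integrable M (\<lambda>x. k j x * (\<kappa> (u n x) * norm (\<xi> n x) powr p))" for j
    by (rule Bochner_Integration.integrable_bound[OF Ei kEm]) (use kEb[of j] in eventually_elim, simp)
  \<comment> \<open>\<psi>(u n) is unbounded, whereas \<open>equation_closure\<close> admits bounded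
    values only; hence the truncation at height j + 1. The bound Z does not involve j, so the
    truncation is removed afterwards by dominated convergence.\<close>
  have step: "\<nu> * (\<integral>x. k j x * (\<kappa> (u n x) * norm (\<xi> n x) powr p) \<partial>M) \<le> Z" for j
  proof -
    define L where "L = real (Suc j)"
    have L: "0 < L" by (simp add: L_def)
    note at = arctan_scale[OF L]
    define h where "h s = L * arctan ((1/L) * s)" for s
    define v where "v x = h (\<psi> (u n x))" for x
    define \<eta> where "\<eta> x = k j x *\<^sub>R (\<kappa> (u n x) *\<^sub>R \<xi> n x)" for x
    have hd: "deriv h s = inverse (1 + (s/L)\<^sup>2)" for s
      using at(2)[of s] by (simp add: h_def[abs_def])
    have cl1: "test_closure \<Omega> p UNIV (\<lambda>x. \<psi> (u n x)) (\<lambda>x. \<kappa> (u n x) *\<^sub>R \<xi> n x)"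
      using test_closure_compose[OF u_closure[of n] p0(1) tf(1,2), where L=1 and J=UNIV] tf(4,5)
      by (simp add: tf(3))
    have cl: "test_closure \<Omega> p {-(2*L)..2*L} v \<eta>"
    proof -
      have "test_closure \<Omega> p {-(2*L)..2*L} (\<lambda>x. h (\<psi> (u n x))) (\<lambda>x. deriv h (\<psi> (u n x)) *\<^sub>R (\<kappa> (u n x) *\<^sub>R \<xi> n x))"
      proof (rule test_closure_compose[OF cl1 p0(1), where L=1])
        show "smooth h" using at(1) by (simp add: h_def[abs_def])
        show "h 0 = 0" by (simp add: h_def)
        show "\<bar>deriv h s\<bar> \<le> 1" for s using at(4,5)[of s] by (simp add: hd)
        show "h s \<in> {-(2*L)..2*L}" for s using at(3)[of s] by (auto simp: h_def abs_le_iff)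
      qed auto
      then show ?thesis by (simp add: v_def[abs_def] \<eta>_def[abs_def] k_def hd L_def)
    qed
    note ci = test_closure_integrable[OF cl p0(1)]
    have vb: "AE x in M. \<bar>v x\<bar> \<le> 2 * L"
      using at(3) by (intro AE_I2) (simp add: v_def h_def)
    have v\<psi>: "\<bar>v x\<bar> \<le> \<bar>\<psi> (u n x)\<bar>" for x
    proof -
      have "L * \<bar>arctan ((1/L) * \<psi> (u n x))\<bar> \<le> L * \<bar>(1/L) * \<psi> (u n x)\<bar>"
        using L by (intro mult_left_mono abs_arctan_le) simp
      then show ?thesis using L by (simp add: v_def h_def abs_mult)
    qed
    have vs: "0 \<le> u n x * v x" for x
    proof -
      have \<psi>: "0 \<le> u n x * \<psi> (u n x)" by (rule tf(7))
      consider "u n x = 0" | "0 < u n x" | "u n x < 0" by linarith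
      then show ?thesis
      proof cases
        case 2
        then have "0 \<le> \<psi> (u n x)" using \<psi> by (simp add: zero_le_mult_iff)
        then have "0 \<le> v x" using L by (simp add: v_def h_def)
        then show ?thesis using 2 by simp
      next
        case 3
        then have "\<psi> (u n x) \<le> 0" using \<psi> by (simp add: zero_le_mult_iff)
        then have "v x \<le> 0" using L by (simp add: v_def h_def mult_nonneg_nonpos divide_nonpos_pos)
        then show ?thesis using 3 by (simp add: mult_nonpos_nonpos)
      qed simp
    qed
    have v\<epsilon>: "\<bar>v x\<bar> \<le> \<bar>u n x\<bar> * min 1 ((\<epsilon> * u n x)\<^sup>2)" for x
      using v\<psi>[of x] tf(6)[of "u n x"] by linarith
    have \<eta>B: "Lp_norm \<Omega> p \<eta> \<le> B powr (1/p)"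
    proof (rule Lp_norm_le[OF p0(1) ci(4)])
      have "(\<integral>x. norm (\<eta> x) powr p \<partial>M) \<le> (\<integral>x. norm (\<xi> n x) powr p \<partial>M)"
      proof (rule integral_mono[OF ci(4) \<xi>_int])
        fix x
        have "k j x * \<kappa> (u n x) * norm (\<xi> n x) \<le> 1 * norm (\<xi> n x)"
          using k01[of j x] tf(4,5)[of "u n x"] by (intro mult_right_mono mult_le_one) auto
        then show "norm (\<eta> x) powr p \<le> norm (\<xi> n x) powr p"
          using p0 k01[of j x] tf(4)[of "u n x"] by (intro powr_mono2) (auto simp: \<eta>_def abs_mult)
      qed
      then show "(\<integral>x. norm (\<eta> x) powr p \<partial>M) \<le> B" using \<xi>_bound[of n] by linarith
    qed
    have ineq: "(\<integral>x. Fl n x \<bullet> \<eta> x \<partial>M) + (\<integral>x. Hl n x * v x \<partial>M) \<le> e * B powr (1/p)"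
    proof -
      have "\<bar>(\<integral>x. Fl n x \<bullet> \<eta> x \<partial>M) + (\<integral>x. Hl n x * v x \<partial>M)\<bar> \<le> e * Lp_norm \<Omega> p \<eta>"
        using elim cl by blast
      also have "\<dots> \<le> e * B powr (1/p)" using e \<eta>B by (intro mult_left_mono) auto
      finally show ?thesis by (simp add: abs_le_iff)
    qed
    have Fi: "integrable M (\<lambda>x. Fl n x \<bullet> \<eta> x)" by (rule Fl_pair_int[OF ci(2,4)])
    have Hi: "integrable M (\<lambda>x. Hl n x * v x)" by (rule Hl_pair_int[OF ci(1) vb])
    note Wi = W_weight_tendsto(2)[OF \<epsilon>, of n]
    have "\<nu> * (\<integral>x. k j x * (\<kappa> (u n x) * norm (\<xi> n x) powr p) \<partial>M) = (\<integral>x. \<nu> * (k j x * (\<kappa> (u n x) * norm (\<xi> n x) powr p)) \<partial>M)"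
      by simp
    also have "\<dots> \<le> (\<integral>x. (Fl n x \<bullet> \<eta> x + Hl n x * v x) + (C0 * (\<epsilon>\<^sup>2 * R ^ 3) * norm (\<xi> n x) powr p + W x * min 1 ((\<epsilon> * u n x)\<^sup>2)) \<partial>M)"
    proof (rule integral_mono_AE)
      show "AE x in M. \<nu> * (k j x * (\<kappa> (u n x) * norm (\<xi> n x) powr p))
        \<le> (Fl n x \<bullet> \<eta> x + Hl n x * v x) + (C0 * (\<epsilon>\<^sup>2 * R ^ 3) * norm (\<xi> n x) powr p + W x * min 1 ((\<epsilon> * u n x)\<^sup>2))"
        using struct gu_le[of n] W_nonneg
      proof eventually_elim
        case (elim x)
        define X where "X = norm (\<xi> n x) powr p"
        have X0: "0 \<le> X" by (simp add: X_def)
        have F: "Fl n x \<bullet> \<eta> x = a x (u n x) * (k j x * (\<kappa> (u n x) * X))"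
          by (simp add: Fl_def \<eta>_def flux_inner_self X_def)
        have 1: "\<nu> * (k j x * (\<kappa> (u n x) * X)) \<le> Fl n x \<bullet> \<eta> x"
          unfolding F using elim k01[of j x] tf(4)[of "u n x"] X0 by (intro mult_right_mono) auto
        have dv: "- (C0 * (\<epsilon>\<^sup>2 * R ^ 3)) \<le> 1/p * (deriv (a x) (u n x) * v x)"
        proof (cases "R \<le> \<bar>u n x\<bar>")
          case True
          have "u n x \<noteq> 0" using True R_pos by auto
          have "0 \<le> (u n x * deriv (a x) (u n x)) * (u n x * v x)"
            by (rule mult_nonneg_nonneg[OF _ vs]) (use elim True in blast)
          then have "0 \<le> (u n x)\<^sup>2 * (deriv (a x) (u n x) * v x)" by (simp add: power2_eq_square mult_ac)
          then have "0 \<le> deriv (a x) (u n x) * v x" using \<open>u n x \<noteq> 0\<close> by (simp add: zero_le_mult_iff)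
          then have "0 \<le> 1/p * (deriv (a x) (u n x) * v x)" using p0 by simp
          moreover have "0 \<le> C0 * (\<epsilon>\<^sup>2 * R ^ 3)" using C0_pos R_pos by simp
          ultimately show ?thesis by linarith
        next
          case False
          have "\<bar>v x\<bar> \<le> \<bar>u n x\<bar> * (\<epsilon> * u n x)\<^sup>2"
            using v\<epsilon>[of x] mult_left_mono[of "min 1 ((\<epsilon> * u n x)\<^sup>2)" "(\<epsilon> * u n x)\<^sup>2" "\<bar>u n x\<bar>"] by simp
          also have "\<dots> = \<epsilon>\<^sup>2 * \<bar>u n x\<bar> ^ 3" by (simp add: power_mult_distrib power2_eq_square power3_eq_cube)
          also have "\<dots> \<le> \<epsilon>\<^sup>2 * R ^ 3" using False by (intro mult_left_mono power_mono) auto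
          finally have v: "\<bar>v x\<bar> \<le> \<epsilon>\<^sup>2 * R ^ 3" .
          have "\<bar>1/p * (deriv (a x) (u n x) * v x)\<bar> \<le> 1 * (C0 * (\<epsilon>\<^sup>2 * R ^ 3))"
            unfolding abs_mult using p_gt1 elim C0_pos R_pos
            by (intro mult_mono[OF _ mult_mono[OF _ v]]) auto
          from abs_le_D2[OF this] show ?thesis by (simp only: minus_le_iff mult_1_left)
        qed
        \<comment> \<open>|v| is compared with |u n| and not with its own bound 2 L, which grows
          with j; this is where the majorant of \<open>g n * u n\<close> enters.\<close>
        have gv: "g n x * v x \<le> W x * min 1 ((\<epsilon> * u n x)\<^sup>2)"
        proof -
          have "g n x * v x \<le> \<bar>g n x\<bar> * \<bar>v x\<bar>" using abs_ge_self[of "g n x * v x"] by (simp add: abs_mult)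
          also have "\<dots> \<le> \<bar>g n x\<bar> * (\<bar>u n x\<bar> * min 1 ((\<epsilon> * u n x)\<^sup>2))" by (intro mult_left_mono v\<epsilon>) auto
          also have "\<dots> = \<bar>g n x * u n x\<bar> * min 1 ((\<epsilon> * u n x)\<^sup>2)" by (simp add: abs_mult)
          also have "\<dots> \<le> W x * min 1 ((\<epsilon> * u n x)\<^sup>2)" using elim by (intro mult_right_mono) auto
          finally show ?thesis .
        qed
        have "Hl n x * v x = 1/p * (deriv (a x) (u n x) * v x) * X - g n x * v x"
          by (simp add: Hl_def X_def algebra_simps)
        moreover have "- (C0 * (\<epsilon>\<^sup>2 * R ^ 3)) * X \<le> 1/p * (deriv (a x) (u n x) * v x) * X"
          using dv X0 by (rule mult_right_mono)
        ultimately show ?case using 1 gv by (simp add: X_def)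
      qed
    qed (use kEi Fi Hi Wi \<xi>_int in auto)
    also have "\<dots> = ((\<integral>x. Fl n x \<bullet> \<eta> x \<partial>M) + (\<integral>x. Hl n x * v x \<partial>M))
        + (C0 * (\<epsilon>\<^sup>2 * R ^ 3) * (\<integral>x. norm (\<xi> n x) powr p \<partial>M) + (\<integral>x. W x * min 1 ((\<epsilon> * u n x)\<^sup>2) \<partial>M))"
      using Fi Hi Wi \<xi>_int by simp
    also have "\<dots> \<le> e * B powr (1/p) + (C0 * (\<epsilon>\<^sup>2 * R ^ 3) * B + (\<integral>x. W x * min 1 ((\<epsilon> * u n x)\<^sup>2) \<partial>M))"
      using C0_pos R_pos \<xi>_bound by (intro add_mono ineq add_right_mono mult_left_mono) auto
    finally show ?thesis by (simp add: Z_def add.assoc)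
  qed
  have "(\<lambda>j. \<integral>x. k j x * (\<kappa> (u n x) * norm (\<xi> n x) powr p) \<partial>M) \<longlonglongrightarrow> (\<integral>x. \<kappa> (u n x) * norm (\<xi> n x) powr p \<partial>M)"
  proof (rule integral_dominated_convergence[OF _ kEm Ei _ kEb])
    show "AE x in M. (\<lambda>j. k j x * (\<kappa> (u n x) * norm (\<xi> n x) powr p)) \<longlonglongrightarrow> \<kappa> (u n x) * norm (\<xi> n x) powr p"
    proof (rule AE_I2)
      fix x
      have "(\<lambda>j. \<psi> (u n x) * inverse (real (Suc j))) \<longlonglongrightarrow> \<psi> (u n x) * 0"
        by (intro tendsto_mult tendsto_const LIMSEQ_inverse_real_of_nat)
      then have "(\<lambda>j. \<psi> (u n x) / real (Suc j)) \<longlonglongrightarrow> 0" by (simp add: divide_inverse)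
      then have "(\<lambda>j. inverse (1 + (\<psi> (u n x) / real (Suc j))\<^sup>2)) \<longlonglongrightarrow> inverse (1 + 0\<^sup>2)"
        by (intro tendsto_inverse tendsto_add tendsto_const tendsto_power) auto
      then have "(\<lambda>j. k j x) \<longlonglongrightarrow> 1" by (simp add: k_def)
      from tendsto_mult[OF this tendsto_const[of "\<kappa> (u n x) * norm (\<xi> n x) powr p"]]
      show "(\<lambda>j. k j x * (\<kappa> (u n x) * norm (\<xi> n x) powr p)) \<longlonglongrightarrow> \<kappa> (u n x) * norm (\<xi> n x) powr p" by simp
    qed
  qed (use Ei in simp)
  from tendsto_mult[OF tendsto_const[of \<nu>] this]
  have "\<nu> * (\<integral>x. \<kappa> (u n x) * norm (\<xi> n x) powr p \<partial>M) \<le> Z"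
    by (rule LIMSEQ_le_const2) (use step in auto)
  then show ?case by (simp add: Z_def \<kappa>_def)
qed

section \<open>The sinh-tanh test function: its coefficients and their limits\<close>

definition "\<theta> = 2 * C0 / \<nu>"

definition "\<mu> = 2 * C0 / (\<nu> * (\<theta> * (1 - (tanh (\<theta> * R))\<^sup>2)))"

text \<open>The derivative of tanh(\<theta> s); it is the degenerate but positive weight that the
  energy estimate leaves in front of |grad u_n|^p.\<close>

definition "Td s = \<theta> * (1 - (tanh (\<theta> * s))\<^sup>2)"

definition "rd s t = tanh (\<theta> * s) - tanh (\<theta> * t)"

text \<open>The full coefficient of |grad u_n|^p, with s = u_n and t = u_m, after testing with
  sinh(\<mu> \<open>rd\<close>): the coefficient of the flux times the derivative of the test
  function in s, plus the natural growth term.\<close>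

definition "\<Phi> x s t = a x s * (\<mu> * cosh (\<mu> * rd s t) * Td s) + 1 / p * deriv (a x) s * sinh (\<mu> * rd s t)"

text \<open>The part of the tested flux that falls on the gradient of u_m; \<open>S0 m\<close> is
  its limit as n tends to infinity with m fixed.\<close>

definition "S n m x = a x (u n x) * (\<mu> * cosh (\<mu> * rd (u n x) (u m x)) * Td (u m x)) * (flux p (\<xi> n x) \<bullet> \<xi> m x)"

definition "S0 m x = a x (u0 x) * (\<mu> * cosh (\<mu> * rd (u0 x) (u m x)) * Td (u m x)) * (flux p (\<xi>0 x) \<bullet> \<xi> m x)"

lemma \<theta>_pos: "0 < \<theta>"
  using C0_pos \<nu>_pos by (simp add: \<theta>_def)

lemma tanh_square_less_1: "(tanh (y :: real))\<^sup>2 < 1"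
  using tanh_real_bounds[of y] by (auto simp: abs_square_less_1 abs_less_iff)

lemma Td_bounds: "0 < Td s" "Td s \<le> \<theta>"
  using \<theta>_pos tanh_square_less_1[of "\<theta> * s"] by (auto simp: Td_def mult_left_le)

lemma \<mu>_pos: "0 < \<mu>"
  unfolding \<mu>_def using C0_pos \<nu>_pos \<theta>_pos tanh_square_less_1[of "\<theta> * R"] by simp

lemma Td_mono:
  assumes "\<bar>s\<bar> \<le> K"
  shows "Td K \<le> Td s"
proof -
  have "tanh \<bar>\<theta> * s\<bar> \<le> tanh (\<theta> * K)"
    unfolding tanh_real_le_iff using assms \<theta>_pos by (simp add: abs_mult)
  then have "\<bar>tanh (\<theta> * s)\<bar> \<le> \<bar>tanh (\<theta> * K)\<bar>" by simp
  then have "(tanh (\<theta> * s))\<^sup>2 \<le> (tanh (\<theta> * K))\<^sup>2" by (rule abs_le_square_iff[THEN iffD1])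
  then show ?thesis unfolding Td_def using \<theta>_pos by (intro mult_left_mono) auto
qed

lemma rd_bound: "\<bar>rd s t\<bar> \<le> 2"
  using tanh_real_bounds[of "\<theta> * s"] tanh_real_bounds[of "\<theta> * t"] by (auto simp: rd_def abs_le_iff)

lemma cosh_rd: "1 \<le> cosh (\<mu> * rd s t)" "cosh (\<mu> * rd s t) \<le> cosh (2 * \<mu>)" "\<bar>sinh (\<mu> * rd s t)\<bar> \<le> cosh (2 * \<mu>)"
proof -
  show "1 \<le> cosh (\<mu> * rd s t)" by (rule cosh_real_ge_1)
  show le: "cosh (\<mu> * rd s t) \<le> cosh (2 * \<mu>)"
    using rd_bound[of s t] \<mu>_pos by (intro cosh_le_cosh) (simp add: abs_mult mult.commute)
  show "\<bar>sinh (\<mu> * rd s t)\<bar> \<le> cosh (2 * \<mu>)"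
    using abs_sinh_le_cosh[of "\<mu> * rd s t"] le by linarith
qed

text \<open>The factor 1/p of the natural growth term plays the part of the constant c in [0, 1] of
  \<open>natural_growth_absorbed\<close>.\<close>

lemma \<Phi>_lower: "AE x in M. \<forall>s t. \<nu> * \<mu> / 2 * Td s \<le> \<Phi> x s t"
  using struct
proof eventually_elim
  case (elim x)
  show ?case
  proof (intro allI)
    fix s t
    show "\<nu> * \<mu> / 2 * Td s \<le> \<Phi> x s t"
      unfolding \<Phi>_def Td_def rd_def
      by (rule natural_growth_absorbed[OF \<nu>_pos C0_pos R_pos _ _ _ _ _ \<theta>_def \<mu>_def])
        (use elim p_gt1 in auto)
  qed
qed

lemma \<Phi>_upper: "AE x in M. \<forall>s t. \<bar>\<Phi> x s t\<bar> \<le> C0 * (\<mu> * cosh (2 * \<mu>) * \<theta>) + C0 * cosh (2 * \<mu>)"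
  using struct
proof eventually_elim
  case (elim x)
  show ?case
  proof (intro allI)
    fix s t
    have ch: "0 \<le> cosh (2 * \<mu>)" by (simp add: cosh_real_nonneg)
    have "\<bar>\<mu> * cosh (\<mu> * rd s t) * Td s\<bar> \<le> \<mu> * cosh (2 * \<mu>) * \<theta>"
      using \<mu>_pos cosh_rd[of s t] Td_bounds[of s] by (simp add: abs_mult mult_mono)
    then have "\<bar>a x s * (\<mu> * cosh (\<mu> * rd s t) * Td s)\<bar> \<le> C0 * (\<mu> * cosh (2 * \<mu>) * \<theta>)"
      unfolding abs_mult[of "a x s"] using elim C0_pos by (intro mult_mono) auto
    moreover have "\<bar>1 / p * deriv (a x) s * sinh (\<mu> * rd s t)\<bar> \<le> C0 * cosh (2 * \<mu>)"
    proof -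
      have "\<bar>1 / p * deriv (a x) s\<bar> \<le> 1 * C0" unfolding abs_mult using elim p_gt1 by (intro mult_mono) auto
      then show ?thesis unfolding abs_mult[of "1 / p * deriv (a x) s"] using cosh_rd(3) C0_pos by (intro mult_mono) auto
    qed
    ultimately show "\<bar>\<Phi> x s t\<bar> \<le> C0 * (\<mu> * cosh (2 * \<mu>) * \<theta>) + C0 * cosh (2 * \<mu>)"
      unfolding \<Phi>_def by (rule order_trans[OF abs_triangle_ineq add_mono])
  qed
qed

lemma Td_tendsto: "s \<longlonglongrightarrow> l \<Longrightarrow> (\<lambda>n. Td (s n)) \<longlonglongrightarrow> Td l"
  and rd_tendsto: "s \<longlonglongrightarrow> l \<Longrightarrow> t \<longlonglongrightarrow> k \<Longrightarrow> (\<lambda>n. rd (s n) (t n)) \<longlonglongrightarrow> rd l k"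
  unfolding Td_def rd_def by (auto intro!: tendsto_intros)

lemma cosh_rd_tendsto: "s \<longlonglongrightarrow> l \<Longrightarrow> t \<longlonglongrightarrow> k \<Longrightarrow> (\<lambda>n. cosh (\<mu> * rd (s n) (t n))) \<longlonglongrightarrow> cosh (\<mu> * rd l k)"
  and sinh_rd_tendsto: "s \<longlonglongrightarrow> l \<Longrightarrow> t \<longlonglongrightarrow> k \<Longrightarrow> (\<lambda>n. sinh (\<mu> * rd (s n) (t n))) \<longlonglongrightarrow> sinh (\<mu> * rd l k)"
  by (intro tendsto_cosh tendsto_sinh tendsto_mult tendsto_const rd_tendsto; assumption)+

lemma a_tendsto:
  "AE x in M. \<forall>s l. s \<longlonglongrightarrow> l \<longrightarrow> (\<lambda>n. a x (s n)) \<longlonglongrightarrow> a x l \<and> (\<lambda>n. deriv (a x) (s n)) \<longlonglongrightarrow> deriv (a x) l"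
  using struct
proof eventually_elim
  case (elim x)
  have "isCont (a x) l" for l using elim DERIV_isCont by blast
  moreover have "isCont (deriv (a x)) l" for l using elim by (simp add: continuous_on_eq_continuous_at)
  ultimately show ?case by (blast intro: isCont_tendsto_compose)
qed

lemma \<Phi>_tendsto: "AE x in M. \<forall>s t l k. s \<longlonglongrightarrow> l \<longrightarrow> t \<longlonglongrightarrow> k \<longrightarrow> (\<lambda>n. \<Phi> x (s n) (t n)) \<longlonglongrightarrow> \<Phi> x l k"
  using a_tendsto
proof eventually_elim
  case (elim x)
  show ?case
  proof (intro allI impI)
    fix s t :: "nat \<Rightarrow> real" and l k assume st: "s \<longlonglongrightarrow> l" "t \<longlonglongrightarrow> k"
    with elim have "(\<lambda>n. a x (s n)) \<longlonglongrightarrow> a x l" "(\<lambda>n. deriv (a x) (s n)) \<longlonglongrightarrow> deriv (a x) l" by blast+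
    then show "(\<lambda>n. \<Phi> x (s n) (t n)) \<longlonglongrightarrow> \<Phi> x l k"
      unfolding \<Phi>_def
      by (intro tendsto_add tendsto_mult tendsto_const Td_tendsto[OF st(1)] cosh_rd_tendsto[OF st] sinh_rd_tendsto[OF st])
  qed
qed

lemma Td_meas: "v \<in> borel_measurable M \<Longrightarrow> (\<lambda>x. Td (v x)) \<in> borel_measurable M"
  by (rule continuous_compose_meas) (auto simp: Td_def[abs_def] intro!: continuous_intros)

lemma rd_meas:
  assumes "v \<in> borel_measurable M" "w \<in> borel_measurable M"
  shows "(\<lambda>x. rd (v x) (w x)) \<in> borel_measurable M"
proof -
  have "continuous_on UNIV (\<lambda>s. tanh (\<theta> * s))" by (auto intro!: continuous_intros)
  from continuous_compose_meas[OF this assms(1)] continuous_compose_meas[OF this assms(2)]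
  show ?thesis unfolding rd_def by simp
qed

lemma cosh_rd_meas:
  assumes "v \<in> borel_measurable M" "w \<in> borel_measurable M"
  shows "(\<lambda>x. cosh (\<mu> * rd (v x) (w x))) \<in> borel_measurable M" "(\<lambda>x. sinh (\<mu> * rd (v x) (w x))) \<in> borel_measurable M"
proof -
  have "continuous_on UNIV (\<lambda>s. cosh (\<mu> * s))" "continuous_on UNIV (\<lambda>s. sinh (\<mu> * s))"
    by (auto intro!: continuous_intros)
  then show "(\<lambda>x. cosh (\<mu> * rd (v x) (w x))) \<in> borel_measurable M" "(\<lambda>x. sinh (\<mu> * rd (v x) (w x))) \<in> borel_measurable M"
    using continuous_compose_meas[OF _ rd_meas[OF assms]] by auto
qed

lemma \<Phi>_meas:
  assumes "v \<in> borel_measurable M" "w \<in> borel_measurable M"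
  shows "(\<lambda>x. \<Phi> x (v x) (w x)) \<in> borel_measurable M"
  unfolding \<Phi>_def
  by (intro borel_measurable_add borel_measurable_times borel_measurable_const a_meas da_meas assms Td_meas cosh_rd_meas)

lemma \<Phi>_energy_int:
  assumes "v \<in> borel_measurable M" "w \<in> borel_measurable M" "\<zeta> \<in> borel_measurable M" "integrable M (\<lambda>x. norm (\<zeta> x :: 'a) powr p)"
  shows "integrable M (\<lambda>x. \<Phi> x (v x) (w x) * norm (\<zeta> x) powr p)"
proof (rule Bochner_Integration.integrable_bound)
  show "integrable M (\<lambda>x. (C0 * (\<mu> * cosh (2 * \<mu>) * \<theta>) + C0 * cosh (2 * \<mu>)) * norm (\<zeta> x) powr p)" using assms by simp
  show "(\<lambda>x. \<Phi> x (v x) (w x) * norm (\<zeta> x) powr p) \<in> borel_measurable M"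
    using \<Phi>_meas[OF assms(1,2)] assms(3) by (intro borel_measurable_times) auto
  show "AE x in M. norm (\<Phi> x (v x) (w x) * norm (\<zeta> x) powr p)
      \<le> norm ((C0 * (\<mu> * cosh (2 * \<mu>) * \<theta>) + C0 * cosh (2 * \<mu>)) * norm (\<zeta> x) powr p)"
    using \<Phi>_upper
  proof eventually_elim
    case (elim x)
    then have "\<bar>\<Phi> x (v x) (w x)\<bar> \<le> \<bar>C0 * (\<mu> * cosh (2 * \<mu>) * \<theta>) + C0 * cosh (2 * \<mu>)\<bar>"
      using abs_ge_self order_trans by blast
    then show ?case unfolding real_norm_def abs_mult by (intro mult_right_mono) auto
  qed
qed

definition "K2 = C0 * (\<mu> * cosh (2 * \<mu>) * \<theta>)"

lemma K2_pos: "0 < K2"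
  unfolding K2_def using C0_pos \<mu>_pos \<theta>_pos by simp

lemma S_meas: "S n m \<in> borel_measurable M"
  unfolding S_def[abs_def]
  by (intro borel_measurable_times borel_measurable_const a_meas Td_meas cosh_rd_meas borel_measurable_inner flux_meas u_meas \<xi>_meas)

lemma S0_meas: "S0 m \<in> borel_measurable M"
  unfolding S0_def[abs_def]
  by (intro borel_measurable_times borel_measurable_const a_meas Td_meas cosh_rd_meas borel_measurable_inner flux_meas u_meas \<xi>_meas u0_meas \<xi>0_meas)

text \<open>The product of norms is left unsplit, because Young's inequality is applied to it with
  opposite weights in the limit in n and in the limit in m.\<close>

lemma cross_term_le:
  "AE x in M. \<forall>s t \<zeta> \<eta>. \<bar>a x s * (\<mu> * cosh (\<mu> * rd s t) * Td t) * (flux p \<zeta> \<bullet> \<eta>)\<bar> \<le> K2 * (norm (\<zeta> :: 'a) powr (p - 1) * norm \<eta>)"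
  using struct
proof eventually_elim
  case (elim x)
  show ?case
  proof (intro allI)
    fix s t and \<zeta> \<eta> :: 'a
    have "\<bar>\<mu> * cosh (\<mu> * rd s t) * Td t\<bar> \<le> \<mu> * cosh (2 * \<mu>) * \<theta>"
      using \<mu>_pos cosh_rd[of s t] Td_bounds[of t] by (simp add: abs_mult mult_mono)
    then have "\<bar>a x s * (\<mu> * cosh (\<mu> * rd s t) * Td t)\<bar> \<le> K2"
      unfolding abs_mult[of "a x s"] K2_def using elim C0_pos by (intro mult_mono) auto
    moreover have "\<bar>flux p \<zeta> \<bullet> \<eta>\<bar> \<le> norm \<zeta> powr (p - 1) * norm \<eta>"
      using Cauchy_Schwarz_ineq2[of "flux p \<zeta>" \<eta>] by (simp add: norm_flux)
    ultimately show "\<bar>a x s * (\<mu> * cosh (\<mu> * rd s t) * Td t) * (flux p \<zeta> \<bullet> \<eta>)\<bar> \<le> K2 * (norm \<zeta> powr (p - 1) * norm \<eta>)"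
      unfolding abs_mult[of "a x s * (\<mu> * cosh (\<mu> * rd s t) * Td t)"] using K2_pos by (intro mult_mono) auto
  qed
qed

lemma flux_tendsto: "f \<longlonglongrightarrow> l \<Longrightarrow> (\<lambda>n. flux p (f n)) \<longlonglongrightarrow> flux p l"
proof -
  assume lim: "f \<longlonglongrightarrow> l"
  have "isCont (flux p) l" using continuous_flux[OF p_gt1] continuous_on_eq_continuous_at[OF open_UNIV] by blast
  then show ?thesis using lim by (rule isCont_tendsto_compose)
qed

lemma S0_int: "integrable M (S0 m)"
proof (rule Bochner_Integration.integrable_bound[OF _ S0_meas])
  show "integrable M (\<lambda>x. K2 * (norm (\<xi>0 x) powr p + norm (\<xi> m x) powr p))" using \<xi>0_int \<xi>_int by simp
  show "AE x in M. norm (S0 m x) \<le> norm (K2 * (norm (\<xi>0 x) powr p + norm (\<xi> m x) powr p))"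
    using cross_term_le
  proof eventually_elim
    case (elim x)
    have "\<bar>S0 m x\<bar> \<le> K2 * (norm (\<xi>0 x) powr (p - 1) * norm (\<xi> m x))" unfolding S0_def using elim by blast
    also have "\<dots> \<le> K2 * (norm (\<xi>0 x) powr p + norm (\<xi> m x) powr p)"
      using K2_pos p_gt1 by (intro mult_left_mono powr_conj_young1) auto
    finally show ?case using abs_ge_self order_trans unfolding real_norm_def by blast
  qed
qed

text \<open>The \<xi> n are bounded in L^p and converge only almost everywhere. Young's inequality
  puts the small weight \<delta> on |\<xi> n|^p and the large one on the fixed function |\<xi> m|^p,
  as \<open>integral_convergence_uniformly_small\<close> requires.\<close>

lemma S_tendsto:
  "\<And>n. integrable M (S n m)" "(\<lambda>n. \<integral>x. S n m x \<partial>M) \<longlonglongrightarrow> (\<integral>x. S0 m x \<partial>M)"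
proof -
  have lim: "AE x in M. (\<lambda>n. S n m x) \<longlonglongrightarrow> S0 m x"
    using a_tendsto u_lim \<xi>_lim
  proof eventually_elim
    case (elim x)
    then have "(\<lambda>n. a x (u n x)) \<longlonglongrightarrow> a x (u0 x)" by blast
    then show ?case unfolding S_def S0_def
      by (intro tendsto_mult tendsto_inner tendsto_const flux_tendsto cosh_rd_tendsto elim)
  qed
  have D: "\<exists>D. integrable M D \<and> (\<forall>n. AE x in M. \<bar>S n m x\<bar> \<le> \<delta> * norm (\<xi> n x) powr p + D x)" if \<delta>: "0 < \<delta>" for \<delta>
  proof (intro exI conjI allI)
    show "integrable M (\<lambda>x. K2 * ((\<delta> / K2) powr (1 - p) * norm (\<xi> m x) powr p))" using \<xi>_int by simp
    fix n
    show "AE x in M. \<bar>S n m x\<bar> \<le> \<delta> * norm (\<xi> n x) powr p + K2 * ((\<delta> / K2) powr (1 - p) * norm (\<xi> m x) powr p)"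
      using cross_term_le
    proof eventually_elim
      case (elim x)
      have "\<bar>S n m x\<bar> \<le> K2 * (norm (\<xi> n x) powr (p - 1) * norm (\<xi> m x))" unfolding S_def using elim by blast
      also have "\<dots> \<le> K2 * ((\<delta> / K2) * norm (\<xi> n x) powr p + (\<delta> / K2) powr (1 - p) * norm (\<xi> m x) powr p)"
        using K2_pos p_gt1 \<delta> by (intro mult_left_mono powr_conj_young) auto
      also have "\<dots> = \<delta> * norm (\<xi> n x) powr p + K2 * ((\<delta> / K2) powr (1 - p) * norm (\<xi> m x) powr p)"
        using K2_pos by (simp add: distrib_left)
      finally show ?case .
    qed
  qed
  show "integrable M (S n m)" for n
    by (rule integral_convergence_uniformly_small(1)[OF S_meas S0_int lim \<xi>_int _ \<xi>_bound D]) auto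
  show "(\<lambda>n. \<integral>x. S n m x \<partial>M) \<longlonglongrightarrow> (\<integral>x. S0 m x \<partial>M)"
    by (rule integral_convergence_uniformly_small(2)[OF S_meas S0_int lim \<xi>_int _ \<xi>_bound D]) auto
qed

text \<open>Now |\<xi> m|^p varies and |\<xi>0|^p is fixed, so the weights are exchanged: \<delta>'
  solves \<delta>'^(1-p) = \<delta>/K2, which puts the small weight on the second factor.\<close>

lemma S0_tendsto:
  "(\<lambda>m. \<integral>x. S0 m x \<partial>M) \<longlonglongrightarrow> (\<integral>x. \<Phi> x (u0 x) (u0 x) * norm (\<xi>0 x) powr p \<partial>M)"
proof -
  have lim: "AE x in M. (\<lambda>m. S0 m x) \<longlonglongrightarrow> \<Phi> x (u0 x) (u0 x) * norm (\<xi>0 x) powr p"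
    using u_lim \<xi>_lim
  proof eventually_elim
    case (elim x)
    have "(\<lambda>m. S0 m x) \<longlonglongrightarrow> a x (u0 x) * (\<mu> * cosh (\<mu> * rd (u0 x) (u0 x)) * Td (u0 x)) * (flux p (\<xi>0 x) \<bullet> \<xi>0 x)"
      unfolding S0_def by (intro tendsto_mult tendsto_inner tendsto_const Td_tendsto cosh_rd_tendsto elim)
    \<comment> \<open>On the diagonal \<open>rd\<close> vanishes, so sinh gives 0 and the natural
      growth part of \<Phi> disappears; this is why the cross term and the energy have the same
      limit.\<close>
    then show ?case by (simp add: \<Phi>_def rd_def flux_inner_self)
  qed
  have D: "\<exists>D. integrable M D \<and> (\<forall>m. AE x in M. \<bar>S0 m x\<bar> \<le> \<delta> * norm (\<xi> m x) powr p + D x)" if \<delta>: "0 < \<delta>" for \<delta>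
  proof (intro exI conjI allI)
    define \<delta>' where "\<delta>' = (\<delta> / K2) powr (1 / (1 - p))"
    have \<delta>': "0 < \<delta>'" "\<delta>' powr (1 - p) = \<delta> / K2" using \<delta> K2_pos p_gt1 by (auto simp: \<delta>'_def powr_powr)
    show "integrable M (\<lambda>x. K2 * (\<delta>' * norm (\<xi>0 x) powr p))" using \<xi>0_int by simp
    fix m
    show "AE x in M. \<bar>S0 m x\<bar> \<le> \<delta> * norm (\<xi> m x) powr p + K2 * (\<delta>' * norm (\<xi>0 x) powr p)"
      using cross_term_le
    proof eventually_elim
      case (elim x)
      have "\<bar>S0 m x\<bar> \<le> K2 * (norm (\<xi>0 x) powr (p - 1) * norm (\<xi> m x))" unfolding S0_def using elim by blast
      also have "\<dots> \<le> K2 * (\<delta>' * norm (\<xi>0 x) powr p + \<delta>' powr (1 - p) * norm (\<xi> m x) powr p)"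
        using K2_pos p_gt1 \<delta>' by (intro mult_left_mono powr_conj_young) auto
      also have "\<dots> = \<delta> * norm (\<xi> m x) powr p + K2 * (\<delta>' * norm (\<xi>0 x) powr p)"
        using K2_pos \<delta>'(2) by (simp add: distrib_left)
      finally show ?case .
    qed
  qed
  show ?thesis
    by (rule integral_convergence_uniformly_small(2)[OF S0_meas \<Phi>_energy_int[OF u0_meas u0_meas \<xi>0_meas \<xi>0_int] lim \<xi>_int _ \<xi>_bound D]) auto
qed

lemma \<Phi>_energy_tendsto:
  "(\<lambda>m. \<integral>x. \<Phi> x (u0 x) (u m x) * norm (\<xi>0 x) powr p \<partial>M) \<longlonglongrightarrow> (\<integral>x. \<Phi> x (u0 x) (u0 x) * norm (\<xi>0 x) powr p \<partial>M)"
proof (rule integral_dominated_convergence)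
  show "integrable M (\<lambda>x. (C0 * (\<mu> * cosh (2 * \<mu>) * \<theta>) + C0 * cosh (2 * \<mu>)) * norm (\<xi>0 x) powr p)" using \<xi>0_int by simp
  show "(\<lambda>x. \<Phi> x (u0 x) (u m x) * norm (\<xi>0 x) powr p) \<in> borel_measurable M"
    "(\<lambda>x. \<Phi> x (u0 x) (u0 x) * norm (\<xi>0 x) powr p) \<in> borel_measurable M" for m
    using \<Phi>_energy_int[OF u0_meas u_meas \<xi>0_meas \<xi>0_int] \<Phi>_energy_int[OF u0_meas u0_meas \<xi>0_meas \<xi>0_int] by auto
  show "AE x in M. (\<lambda>m. \<Phi> x (u0 x) (u m x) * norm (\<xi>0 x) powr p) \<longlonglongrightarrow> \<Phi> x (u0 x) (u0 x) * norm (\<xi>0 x) powr p"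
    using \<Phi>_tendsto u_lim
  proof eventually_elim
    case (elim x)
    have "(\<lambda>m. \<Phi> x (u0 x) (u m x)) \<longlonglongrightarrow> \<Phi> x (u0 x) (u0 x)"
      using elim(1)[rule_format, OF tendsto_const elim(2)] .
    then show ?case by (intro tendsto_mult tendsto_const)
  qed
  show "AE x in M. norm (\<Phi> x (u0 x) (u m x) * norm (\<xi>0 x) powr p)
      \<le> (C0 * (\<mu> * cosh (2 * \<mu>) * \<theta>) + C0 * cosh (2 * \<mu>)) * norm (\<xi>0 x) powr p" for m
    using \<Phi>_upper
  proof eventually_elim
    case (elim x)
    then have "\<bar>\<Phi> x (u0 x) (u m x)\<bar> \<le> C0 * (\<mu> * cosh (2 * \<mu>) * \<theta>) + C0 * cosh (2 * \<mu>)" by blast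
    then show ?case unfolding real_norm_def abs_mult by (simp add: mult_right_mono)
  qed
qed

text \<open>Both arguments are sequences so that one statement covers n tending to infinity with u_m
  fixed and m tending to infinity with \<open>u0\<close> fixed.\<close>

lemma W_sinh_tendsto:
  assumes w: "\<And>n. w n \<in> borel_measurable M" "w' \<in> borel_measurable M" "AE x in M. (\<lambda>n. w n x) \<longlonglongrightarrow> w' x"
    and z: "\<And>n. z n \<in> borel_measurable M" "z' \<in> borel_measurable M" "AE x in M. (\<lambda>n. z n x) \<longlonglongrightarrow> z' x"
  shows "(\<lambda>n. \<integral>x. W x * \<bar>sinh (\<mu> * rd (w n x) (z n x))\<bar> \<partial>M) \<longlonglongrightarrow> (\<integral>x. W x * \<bar>sinh (\<mu> * rd (w' x) (z' x))\<bar> \<partial>M)"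
    and "\<And>n. integrable M (\<lambda>x. W x * \<bar>sinh (\<mu> * rd (w n x) (z n x))\<bar>)"
proof -
  have Wm: "W \<in> borel_measurable M" using W_int by simp
  have m: "(\<lambda>x. W x * \<bar>sinh (\<mu> * rd (v x) (y x))\<bar>) \<in> borel_measurable M" if "v \<in> borel_measurable M" "y \<in> borel_measurable M" for v y
    using Wm cosh_rd_meas[OF that] by (intro borel_measurable_times borel_measurable_abs)
  have b: "AE x in M. norm (W x * \<bar>sinh (\<mu> * rd (v x) (y x))\<bar>) \<le> W x * cosh (2 * \<mu>)" for v y
    using W_nonneg by eventually_elim (auto simp: abs_mult intro!: mult_left_mono cosh_rd)
  have i: "integrable M (\<lambda>x. W x * cosh (2 * \<mu>))" using W_int by simp
  have l: "AE x in M. (\<lambda>n. W x * \<bar>sinh (\<mu> * rd (w n x) (z n x))\<bar>) \<longlonglongrightarrow> W x * \<bar>sinh (\<mu> * rd (w' x) (z' x))\<bar>"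
    using w(3) z(3) by eventually_elim (intro tendsto_mult tendsto_const tendsto_rabs sinh_rd_tendsto)
  show "(\<lambda>n. \<integral>x. W x * \<bar>sinh (\<mu> * rd (w n x) (z n x))\<bar> \<partial>M) \<longlonglongrightarrow> (\<integral>x. W x * \<bar>sinh (\<mu> * rd (w' x) (z' x))\<bar> \<partial>M)"
    by (rule integral_dominated_convergence[OF m[OF w(2) z(2)] m[OF w(1) z(1)] i l b])
  show "integrable M (\<lambda>x. W x * \<bar>sinh (\<mu> * rd (w n x) (z n x))\<bar>)" for n
    by (rule integrable_dominated_convergence2[OF m[OF w(2) z(2)] m[OF w(1) z(1)] i l b])
qed

text \<open>A bound, uniform in n and m, for the L^p norm of the gradient of the sinh-tanh test
  function; it multiplies the dual norm of the residual of the equation.\<close>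

definition "L' = (2 powr p * (2 * ((\<mu> * cosh (2 * \<mu>) * \<theta>) powr p * B))) powr (1/p)"

text \<open>Test the equation for n with sinh (\<mu> (tanh (\<theta> u n) - tanh (\<theta> u m))), m fixed.\<close>

lemma sinh_tanh_test_estimate:
  assumes e: "0 < e"
  shows "\<forall>\<^sub>F n in sequentially. \<forall>m. (\<integral>x. \<Phi> x (u n x) (u m x) * norm (\<xi> n x) powr p \<partial>M)
    \<le> (\<integral>x. S n m x \<partial>M) + (\<integral>x. W x * \<bar>sinh (\<mu> * rd (u n x) (u m x))\<bar> \<partial>M) + e * L'"
  using equation_closure[OF e]
proof eventually_elim
  case (elim n)
  show ?case
  proof
    fix m
    have tanh_closure: "test_closure \<Omega> p {-1..1} (\<lambda>x. tanh (\<theta> * u j x)) (\<lambda>x. Td (u j x) *\<^sub>R \<xi> j x)" for j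
    proof -
      define h where "h s = 1 * tanh (\<theta> * s)" for s :: real
      have d: "deriv h s = Td s" for s
      proof -
        have "(h has_real_derivative (1 - (tanh (\<theta> * s))\<^sup>2) * \<theta>) (at s)"
          unfolding h_def mult_1_left
          by (rule DERIV_chain2[where f=tanh]) (auto intro!: derivative_eq_intros)
        then show ?thesis by (simp add: DERIV_imp_deriv Td_def mult.commute)
      qed
      have "test_closure \<Omega> p {-1..1} (\<lambda>x. h (u j x)) (\<lambda>x. deriv h (u j x) *\<^sub>R \<xi> j x)"
      proof (rule test_closure_compose[OF u_closure p0(1), where L=\<theta>])
        show "smooth h" unfolding h_def by (rule smooth_scale[OF smooth_tanh])
        show "h 0 = 0" by (simp add: h_def)
        show "\<bar>deriv h s\<bar> \<le> \<theta>" for s unfolding d using Td_bounds[of s] by simp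
        show "h s \<in> {-1..1}" for s using tanh_real_bounds[of "\<theta> * s"] by (auto simp: h_def)
      qed auto
      then show ?thesis unfolding d by (simp add: h_def)
    qed
    define v where "v x = sinh (\<mu> * rd (u n x) (u m x))" for x
    define \<eta> where "\<eta> x = (\<mu> * cosh (\<mu> * rd (u n x) (u m x))) *\<^sub>R (Td (u n x) *\<^sub>R \<xi> n x - Td (u m x) *\<^sub>R \<xi> m x)" for x
    have cl: "test_closure \<Omega> p {-cosh (2 * \<mu>)..cosh (2 * \<mu>)} v \<eta>"
    proof -
      define h where "h s = 1 * sinh (\<mu> * s)" for s :: real
      have d: "deriv h s = \<mu> * cosh (\<mu> * s)" for s
      proof -
        have "(h has_real_derivative cosh (\<mu> * s) * \<mu>) (at s)"
          unfolding h_def mult_1_left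
          by (rule DERIV_chain2[where f=sinh]) (auto intro!: derivative_eq_intros)
        then show ?thesis by (simp add: DERIV_imp_deriv mult.commute)
      qed
      \<comment> \<open>Differences of values in [-1, 1] lie in [-2, 2], the interval on which the
        derivative of sinh(\<mu> s) is bounded by \<mu> cosh(2 \<mu>).\<close>
      have "test_closure \<Omega> p {-2..2} (\<lambda>x. tanh (\<theta> * u n x) - tanh (\<theta> * u m x)) (\<lambda>x. Td (u n x) *\<^sub>R \<xi> n x - Td (u m x) *\<^sub>R \<xi> m x)"
        by (rule test_closure_diff[OF tanh_closure tanh_closure p0(1)]) auto
      then have "test_closure \<Omega> p {-cosh (2 * \<mu>)..cosh (2 * \<mu>)} (\<lambda>x. h (tanh (\<theta> * u n x) - tanh (\<theta> * u m x)))
          (\<lambda>x. deriv h (tanh (\<theta> * u n x) - tanh (\<theta> * u m x)) *\<^sub>R (Td (u n x) *\<^sub>R \<xi> n x - Td (u m x) *\<^sub>R \<xi> m x))"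
      proof (rule test_closure_compose[OF _ p0(1), where L="\<mu> * cosh (2 * \<mu>)"])
        show "smooth h" unfolding h_def by (rule smooth_scale[OF smooth_sinh])
        show "h 0 = 0" by (simp add: h_def)
        have c: "cosh (\<mu> * s) \<le> cosh (2 * \<mu>)" if "s \<in> {-2..2}" for s
        proof (rule cosh_le_cosh)
          have "\<bar>s\<bar> \<le> 2" using that by auto
          then show "\<bar>\<mu> * s\<bar> \<le> 2 * \<mu>" using \<mu>_pos by (simp add: abs_mult mult.commute)
        qed
        show "\<bar>deriv h s\<bar> \<le> \<mu> * cosh (2 * \<mu>)" if "s \<in> {-2..2}" for s
          unfolding d using c[OF that] \<mu>_pos by (simp add: abs_mult cosh_real_nonneg)
        show "h s \<in> {-cosh (2 * \<mu>)..cosh (2 * \<mu>)}" if "s \<in> {-2..2}" for s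
        proof -
          have "\<bar>h s\<bar> \<le> cosh (2 * \<mu>)" using abs_sinh_le_cosh[of "\<mu> * s"] c[OF that] by (simp add: h_def)
          then show ?thesis by (auto simp: abs_le_iff)
        qed
      qed auto
      then show ?thesis unfolding d by (simp add: h_def v_def[abs_def] \<eta>_def[abs_def] rd_def)
    qed
    note ci = test_closure_integrable[OF cl p0(1)]
    have vb: "AE x in M. \<bar>v x\<bar> \<le> cosh (2 * \<mu>)" unfolding v_def by (intro AE_I2 cosh_rd)
    have \<eta>L: "Lp_norm \<Omega> p \<eta> \<le> L'"
      unfolding L'_def
    proof (rule Lp_norm_le[OF p0(1) ci(4)])
      define k where "k = \<mu> * cosh (2 * \<mu>) * \<theta>"
      have k: "0 \<le> k" using \<mu>_pos \<theta>_pos by (simp add: k_def cosh_real_nonneg)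
      have "(\<integral>x. norm (\<eta> x) powr p \<partial>M) \<le> (\<integral>x. 2 powr p * (k powr p * norm (\<xi> n x) powr p + k powr p * norm (\<xi> m x) powr p) \<partial>M)"
      proof (rule integral_mono[OF ci(4)])
        show "integrable M (\<lambda>x. 2 powr p * (k powr p * norm (\<xi> n x) powr p + k powr p * norm (\<xi> m x) powr p))" using \<xi>_int by simp
        fix x
        define c where "c = \<mu> * cosh (\<mu> * rd (u n x) (u m x))"
        have c: "0 \<le> c" "c \<le> \<mu> * cosh (2 * \<mu>)" using \<mu>_pos cosh_rd[of "u n x" "u m x"] by (auto simp: c_def)
        have le: "norm (c *\<^sub>R (Td s *\<^sub>R \<zeta>)) powr p \<le> k powr p * norm \<zeta> powr p" for s and \<zeta> :: 'a
        proof -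
          have "c * Td s \<le> k" unfolding k_def using c Td_bounds[of s] by (intro mult_mono) auto
          then have "norm (c *\<^sub>R (Td s *\<^sub>R \<zeta>)) \<le> k * norm \<zeta>"
            using c Td_bounds[of s] by (simp add: mult.assoc[symmetric] mult_right_mono)
          then have "norm (c *\<^sub>R (Td s *\<^sub>R \<zeta>)) powr p \<le> (k * norm \<zeta>) powr p" using p0 by (intro powr_mono2) auto
          then show ?thesis using k by (simp add: powr_mult)
        qed
        have "norm (\<eta> x) powr p \<le> 2 powr p * (norm (c *\<^sub>R (Td (u n x) *\<^sub>R \<xi> n x)) powr p + norm (c *\<^sub>R (Td (u m x) *\<^sub>R \<xi> m x)) powr p)"
          unfolding \<eta>_def c_def[symmetric] scaleR_diff_right[of c] by (rule norm_diff_powr_le[OF p0(2)])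
        also have "\<dots> \<le> 2 powr p * (k powr p * norm (\<xi> n x) powr p + k powr p * norm (\<xi> m x) powr p)"
          by (intro mult_left_mono add_mono le) auto
        finally show "norm (\<eta> x) powr p \<le> 2 powr p * (k powr p * norm (\<xi> n x) powr p + k powr p * norm (\<xi> m x) powr p)" .
      qed
      also have "\<dots> = 2 powr p * (k powr p * (\<integral>x. norm (\<xi> n x) powr p \<partial>M) + k powr p * (\<integral>x. norm (\<xi> m x) powr p \<partial>M))"
        using \<xi>_int by simp
      also have "\<dots> \<le> 2 powr p * (k powr p * B + k powr p * B)"
        using \<xi>_bound by (intro mult_left_mono add_mono) auto
      finally show "(\<integral>x. norm (\<eta> x) powr p \<partial>M) \<le> 2 powr p * (2 * ((\<mu> * cosh (2 * \<mu>) * \<theta>) powr p * B))"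
        by (simp add: k_def mult_ac)
    qed
    have Fi: "integrable M (\<lambda>x. Fl n x \<bullet> \<eta> x)" by (rule Fl_pair_int[OF ci(2,4)])
    have Hi: "integrable M (\<lambda>x. Hl n x * v x)" by (rule Hl_pair_int[OF ci(1) vb])
    have Wi: "integrable M (\<lambda>x. W x * \<bar>v x\<bar>)"
      unfolding v_def by (rule W_sinh_tendsto(2)[of "\<lambda>_. u n" "u n" "\<lambda>_. u m" "u m"]) (auto simp: u_meas)
    note \<Phi>i = \<Phi>_energy_int[OF u_meas u_meas \<xi>_meas \<xi>_int]
    have "(\<integral>x. \<Phi> x (u n x) (u m x) * norm (\<xi> n x) powr p \<partial>M) \<le> (\<integral>x. (Fl n x \<bullet> \<eta> x + Hl n x * v x) + (S n m x + W x * \<bar>v x\<bar>) \<partial>M)"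
    proof (rule integral_mono_AE)
      show "AE x in M. \<Phi> x (u n x) (u m x) * norm (\<xi> n x) powr p \<le> (Fl n x \<bullet> \<eta> x + Hl n x * v x) + (S n m x + W x * \<bar>v x\<bar>)"
        using g_le[of n]
      proof eventually_elim
        case (elim x)
        have "g n x * v x \<le> \<bar>g n x\<bar> * \<bar>v x\<bar>" using abs_ge_self[of "g n x * v x"] by (simp add: abs_mult)
        also have "\<dots> \<le> W x * \<bar>v x\<bar>" using elim by (intro mult_right_mono) auto
        finally have gv: "g n x * v x \<le> W x * \<bar>v x\<bar>" .
        \<comment> \<open>The flux pairing splits into the self term, which joins the natural growth
          part to form \<Phi>, and the cross term \<open>S n m\<close>.\<close>
        have "Fl n x \<bullet> \<eta> x = a x (u n x) * (\<mu> * cosh (\<mu> * rd (u n x) (u m x)) * Td (u n x)) * norm (\<xi> n x) powr p - S n m x"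
          by (simp add: Fl_def \<eta>_def S_def inner_diff_right flux_inner_self algebra_simps)
        moreover have "Hl n x * v x = 1 / p * deriv (a x) (u n x) * sinh (\<mu> * rd (u n x) (u m x)) * norm (\<xi> n x) powr p - g n x * v x"
          by (simp add: Hl_def v_def algebra_simps)
        ultimately show ?case using gv by (simp add: \<Phi>_def distrib_right)
      qed
    qed (use \<Phi>i Fi Hi Wi S_tendsto(1) in auto)
    also have "\<dots> = ((\<integral>x. Fl n x \<bullet> \<eta> x \<partial>M) + (\<integral>x. Hl n x * v x \<partial>M)) + ((\<integral>x. S n m x \<partial>M) + (\<integral>x. W x * \<bar>v x\<bar> \<partial>M))"
      using Fi Hi Wi S_tendsto(1) by simp
    also have "(\<integral>x. Fl n x \<bullet> \<eta> x \<partial>M) + (\<integral>x. Hl n x * v x \<partial>M) \<le> e * L'"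
    proof -
      have "\<bar>(\<integral>x. Fl n x \<bullet> \<eta> x \<partial>M) + (\<integral>x. Hl n x * v x \<partial>M)\<bar> \<le> e * Lp_norm \<Omega> p \<eta>" using elim cl by blast
      also have "\<dots> \<le> e * L'" using e \<eta>L by (intro mult_left_mono) auto
      finally show ?thesis by (simp add: abs_le_iff)
    qed
    finally show "(\<integral>x. \<Phi> x (u n x) (u m x) * norm (\<xi> n x) powr p \<partial>M)
      \<le> (\<integral>x. S n m x \<partial>M) + (\<integral>x. W x * \<bar>sinh (\<mu> * rd (u n x) (u m x))\<bar> \<partial>M) + e * L'"
      by (simp add: v_def)
  qed
qed

section \<open>Strong convergence on bounded values and on the tails\<close>

lemma gradient_difference_int: "integrable M (\<lambda>x. norm (\<xi> n x - \<xi>0 x) powr p)"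
  by (rule integrable_diff_powr[OF \<xi>_meas \<xi>0_meas p0(2) \<xi>_int \<xi>0_int])

text \<open>On {|u n| \<le> K} the coefficient \<Phi> is at least c > 0, whence |\<xi> n - \<xi>0|^p
  \<le> C \<Phi> |\<xi> n|^p + 2^p |\<xi>0|^p there. Convergence almost everywhere, together with an
  upper bound for the weighted energies by their limit up to a small gap, then leaves only C times
  the gap for the integral of the left-hand side.\<close>

lemma truncated_gradients_tendsto:
  assumes K: "0 < K" and \<delta>: "0 < \<delta>"
  shows "\<forall>\<^sub>F n in sequentially. (\<integral>x. indicator {-K..K} (u n x) * norm (\<xi> n x - \<xi>0 x) powr p \<partial>M) \<le> \<delta>"
proof -
  define c where "c = \<nu> * \<mu> / 2 * Td K"
  have c: "0 < c" using \<nu>_pos \<mu>_pos Td_bounds(1) by (simp add: c_def)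
  define C where "C = 2 powr p / c"
  have C: "0 < C" using c by (simp add: C_def)
  \<comment> \<open>The gap between the upper bound for the weighted energies as n tends to infinity
    and the weighted energy of the limit, with u_m in place of \<open>u0\<close>. It tends to 0 in m
    because on the diagonal the cross term equals the energy and sinh vanishes.\<close>
  define Y where "Y m = (\<integral>x. S0 m x \<partial>M) + (\<integral>x. W x * \<bar>sinh (\<mu> * rd (u0 x) (u m x))\<bar> \<partial>M)
    - (\<integral>x. \<Phi> x (u0 x) (u m x) * norm (\<xi>0 x) powr p \<partial>M)" for m
  have W0: "(\<lambda>m. \<integral>x. W x * \<bar>sinh (\<mu> * rd (u0 x) (u m x))\<bar> \<partial>M) \<longlonglongrightarrow> (\<integral>x. W x * \<bar>sinh (\<mu> * rd (u0 x) (u0 x))\<bar> \<partial>M)"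
    by (rule W_sinh_tendsto(1)[OF u0_meas u0_meas _ u_meas u0_meas u_lim]) simp
  have "Y \<longlonglongrightarrow> (\<integral>x. \<Phi> x (u0 x) (u0 x) * norm (\<xi>0 x) powr p \<partial>M) + (\<integral>x. W x * \<bar>sinh (\<mu> * rd (u0 x) (u0 x))\<bar> \<partial>M)
    - (\<integral>x. \<Phi> x (u0 x) (u0 x) * norm (\<xi>0 x) powr p \<partial>M)"
    unfolding Y_def by (intro tendsto_add tendsto_diff S0_tendsto W0 \<Phi>_energy_tendsto)
  then have "Y \<longlonglongrightarrow> 0" by (simp add: rd_def)
  then have "\<forall>\<^sub>F m in sequentially. Y m < \<delta> / (3 * C)" using C \<delta> by (intro order_tendstoD(2)) auto
  then obtain m where m: "Y m < \<delta> / (3 * C)" using eventually_happens'[OF sequentially_bot] by blast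
  \<comment> \<open>C (Y m + \<kappa>) + \<kappa> has to stay below \<delta>: C times each of Y m
    and \<kappa> takes one third, and the last \<kappa> takes the remaining third.\<close>
  define \<kappa> where "\<kappa> = min (\<delta> / 3) (\<delta> / (3 * C))"
  have \<kappa>: "0 < \<kappa>" "\<kappa> \<le> \<delta> / 3" "\<kappa> \<le> \<delta> / (3 * C)" using \<delta> C by (auto simp: \<kappa>_def)
  define e where "e = \<kappa> / (3 * (L' + 1))"
  have L': "0 \<le> L'" by (simp add: L'_def)
  have e: "0 < e" "e * L' \<le> \<kappa> / 3"
    using L' \<kappa>(1) by (auto simp: e_def field_simps)
  have W1: "(\<lambda>n. \<integral>x. W x * \<bar>sinh (\<mu> * rd (u n x) (u m x))\<bar> \<partial>M) \<longlonglongrightarrow> (\<integral>x. W x * \<bar>sinh (\<mu> * rd (u0 x) (u m x))\<bar> \<partial>M)"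
    by (rule W_sinh_tendsto(1)[OF u_meas u0_meas u_lim u_meas u_meas]) simp
  have evS: "\<forall>\<^sub>F n in sequentially. (\<integral>x. S n m x \<partial>M) < (\<integral>x. S0 m x \<partial>M) + \<kappa> / 3"
    using \<kappa>(1) by (intro order_tendstoD(2)[OF S_tendsto(2)]) simp
  have evW: "\<forall>\<^sub>F n in sequentially. (\<integral>x. W x * \<bar>sinh (\<mu> * rd (u n x) (u m x))\<bar> \<partial>M)
      < (\<integral>x. W x * \<bar>sinh (\<mu> * rd (u0 x) (u m x))\<bar> \<partial>M) + \<kappa> / 3"
    using \<kappa>(1) by (intro order_tendstoD(2)[OF W1]) simp
  have ev: "\<forall>\<^sub>F n in sequentially. (\<integral>x. \<Phi> x (u n x) (u m x) * norm (\<xi> n x) powr p \<partial>M)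
      \<le> (\<integral>x. S0 m x \<partial>M) + (\<integral>x. W x * \<bar>sinh (\<mu> * rd (u0 x) (u m x))\<bar> \<partial>M) + \<kappa>"
    using sinh_tanh_test_estimate[OF e(1)] evS evW
  proof eventually_elim
    case (elim n)
    then have "(\<integral>x. \<Phi> x (u n x) (u m x) * norm (\<xi> n x) powr p \<partial>M)
      \<le> (\<integral>x. S n m x \<partial>M) + (\<integral>x. W x * \<bar>sinh (\<mu> * rd (u n x) (u m x))\<bar> \<partial>M) + e * L'" by blast
    then show ?case using elim(2,3) e(2) by linarith
  qed
  have "\<forall>\<^sub>F n in sequentially. (\<integral>x. indicator {-K..K} (u n x) * norm (\<xi> n x - \<xi>0 x) powr p \<partial>M)
    \<le> C * (((\<integral>x. S0 m x \<partial>M) + (\<integral>x. W x * \<bar>sinh (\<mu> * rd (u0 x) (u m x))\<bar> \<partial>M) + \<kappa>)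
      - (\<integral>x. \<Phi> x (u0 x) (u m x) * norm (\<xi>0 x) powr p \<partial>M)) + \<kappa>"
  proof (rule dominated_by_convergent_integrals(2)[where D = "\<lambda>x. 2 powr p * norm (\<xi>0 x) powr p"])
    show "(\<lambda>x. indicator {-K..K} (u n x) * norm (\<xi> n x - \<xi>0 x) powr p) \<in> borel_measurable M" for n
      using u_meas \<xi>_meas \<xi>0_meas
      by (intro borel_measurable_times measurable_compose[OF u_meas borel_measurable_indicator]) auto
    show "AE x in M. (\<lambda>n. indicator {-K..K} (u n x) * norm (\<xi> n x - \<xi>0 x) powr p) \<longlonglongrightarrow> 0"
      using \<xi>_lim
    proof eventually_elim
      case (elim x)
      then have "(\<lambda>n. norm (\<xi> n x - \<xi>0 x)) \<longlonglongrightarrow> 0" by (simp add: tendsto_norm_zero_iff LIM_zero_iff)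
      then have "(\<lambda>n. norm (\<xi> n x - \<xi>0 x) powr p) \<longlonglongrightarrow> 0"
        using tendsto_powr'[OF _ tendsto_const, of "\<lambda>n. norm (\<xi> n x - \<xi>0 x)" 0 sequentially p] p0 by simp
      then show ?case
        by (rule Lim_null_comparison[rotated]) (auto simp: abs_mult indicator_def)
    qed
    show "integrable M (\<lambda>x. \<Phi> x (u n x) (u m x) * norm (\<xi> n x) powr p)" for n
      by (rule \<Phi>_energy_int[OF u_meas u_meas \<xi>_meas \<xi>_int])
    show "integrable M (\<lambda>x. \<Phi> x (u0 x) (u m x) * norm (\<xi>0 x) powr p)"
      by (rule \<Phi>_energy_int[OF u0_meas u_meas \<xi>0_meas \<xi>0_int])
    show "AE x in M. (\<lambda>n. \<Phi> x (u n x) (u m x) * norm (\<xi> n x) powr p) \<longlonglongrightarrow> \<Phi> x (u0 x) (u m x) * norm (\<xi>0 x) powr p"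
      using \<Phi>_tendsto u_lim \<xi>_lim
    proof eventually_elim
      case (elim x)
      have "(\<lambda>n. \<Phi> x (u n x) (u m x)) \<longlonglongrightarrow> \<Phi> x (u0 x) (u m x)"
        using elim(1)[rule_format, OF elim(2) tendsto_const] .
      moreover have "(\<lambda>n. norm (\<xi> n x) powr p) \<longlonglongrightarrow> norm (\<xi>0 x) powr p"
        using elim(3) p0 by (intro tendsto_powr' tendsto_norm tendsto_const) auto
      ultimately show ?case by (rule tendsto_mult)
    qed
    show "AE x in M. indicator {-K..K} (u n x) * norm (\<xi> n x - \<xi>0 x) powr p
      \<le> C * (\<Phi> x (u n x) (u m x) * norm (\<xi> n x) powr p) + 2 powr p * norm (\<xi>0 x) powr p" for n
      using \<Phi>_lower
    proof eventually_elim
      case (elim x)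
      define X where "X = norm (\<xi> n x) powr p"
      have X: "0 \<le> X" by (simp add: X_def)
      define \<iota> :: real where "\<iota> = indicator {-K..K} (u n x)"
      have \<iota>: "0 \<le> \<iota>" "\<iota> \<le> 1" by (auto simp: \<iota>_def indicator_def)
      have \<Phi>: "\<nu> * \<mu> / 2 * Td (u n x) \<le> \<Phi> x (u n x) (u m x)" using elim by blast
      have "\<iota> * c \<le> \<Phi> x (u n x) (u m x)"
      proof (cases "u n x \<in> {-K..K}")
        case True
        then have "\<bar>u n x\<bar> \<le> K" by auto
        then have "c \<le> \<nu> * \<mu> / 2 * Td (u n x)" unfolding c_def
          using \<nu>_pos \<mu>_pos by (intro mult_left_mono Td_mono) auto
        with \<Phi> True show ?thesis by (simp add: \<iota>_def)
      next
        case False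
        have "0 \<le> \<nu> * \<mu> / 2 * Td (u n x)" using \<nu>_pos \<mu>_pos Td_bounds(1)[of "u n x"] by (intro mult_nonneg_nonneg) auto
        with \<Phi> False show ?thesis by (simp add: \<iota>_def)
      qed
      then have "\<iota> \<le> \<Phi> x (u n x) (u m x) / c" using c by (simp add: pos_le_divide_eq)
      from mult_right_mono[OF this X] have a: "\<iota> * X \<le> \<Phi> x (u n x) (u m x) / c * X" .
      have "\<iota> * norm (\<xi> n x - \<xi>0 x) powr p \<le> \<iota> * (2 powr p * (X + norm (\<xi>0 x) powr p))"
        unfolding X_def using \<iota> by (intro mult_left_mono norm_diff_powr_le p0)
      also have "\<dots> = 2 powr p * (\<iota> * X) + \<iota> * (2 powr p * norm (\<xi>0 x) powr p)" by (simp add: algebra_simps)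
      also have "\<dots> \<le> 2 powr p * (\<Phi> x (u n x) (u m x) / c * X) + 1 * (2 powr p * norm (\<xi>0 x) powr p)"
        by (rule add_mono[OF mult_left_mono[OF a] mult_right_mono[OF \<iota>(2)]]) auto
      finally show ?case by (simp add: C_def X_def \<iota>_def)
    qed
    show "integrable M (\<lambda>x. 2 powr p * norm (\<xi>0 x) powr p)" using \<xi>0_int by simp
  qed (use C \<kappa> ev in \<open>auto simp: indicator_def\<close>)
  then show ?thesis
  proof eventually_elim
    case (elim n)
    have "C * (Y m + \<kappa>) + \<kappa> \<le> \<delta>"
    proof -
      have "C * (Y m + \<kappa>) \<le> C * (\<delta> / (3 * C) + \<delta> / (3 * C))" using m \<kappa> C by (intro mult_left_mono) auto
      also have "\<dots> = 2 * \<delta> / 3" using C by (simp add: field_simps)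
      finally show ?thesis using \<kappa>(2) by simp
    qed
    then show ?case using elim by (simp add: Y_def algebra_simps)
  qed
qed

text \<open>Split at height 1/\<epsilon>: below it \<open>truncated_gradients_tendsto\<close>
  applies, above it the weight w of the tail function is at least 1/2, and both |\<xi> n|^p and
  |\<xi>0|^p carry little weighted mass.\<close>

lemma gradients_Lp_tendsto: "(\<lambda>n. \<integral>x. norm (\<xi> n x - \<xi>0 x) powr p \<partial>M) \<longlonglongrightarrow> 0"
proof -
  define w where "w \<epsilon> s = 1 - inverse (1 + (\<epsilon> * s)\<^sup>2)" for \<epsilon> s :: real
  define I where "I \<epsilon> v = (\<integral>x. W x * min 1 ((\<epsilon> * v x)\<^sup>2) \<partial>M)" for \<epsilon> v
  define J where "J \<epsilon> v = (\<integral>x. w \<epsilon> (v x) * norm (\<xi>0 x) powr p \<partial>M)" for \<epsilon> v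
  \<comment> \<open>The bound for the tail contribution, with 2^p from the p-th power of a
    difference and 2 from w \<ge> 1/2. It is kept as a functional of v because it is made small at v
    = \<open>u0\<close> and then compared with its value at u n.\<close>
  define P where "P e \<epsilon> v = 2 * 2 powr p * ((e * B powr (1/p) + C0 * (\<epsilon>\<^sup>2 * R ^ 3) * B + I \<epsilon> v) / \<nu> + J \<epsilon> v)" for e \<epsilon> v
  define \<epsilon> where "\<epsilon> j = inverse (real (Suc j))" for j
  have \<epsilon>: "0 < \<epsilon> j" for j by (simp add: \<epsilon>_def)
  have \<epsilon>0: "\<epsilon> \<longlonglongrightarrow> 0" unfolding \<epsilon>_def[abs_def] by (rule LIMSEQ_inverse_real_of_nat)
  have w01: "0 \<le> w \<epsilon> s" "w \<epsilon> s \<le> 1" for \<epsilon> s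
    using arctan_scale(4,5)[of 1 "\<epsilon> * s"] by (simp_all add: w_def)
  have w_meas: "(\<lambda>x. w \<epsilon> (v x)) \<in> borel_measurable M" if "v \<in> borel_measurable M" for v \<epsilon>
    unfolding w_def by (rule continuous_compose_meas[OF weight_cont that])
  have W_meas: "W \<in> borel_measurable M" using W_int by simp
  have Im: "(\<lambda>x. W x * min 1 ((\<epsilon> * u0 x)\<^sup>2)) \<in> borel_measurable M" for \<epsilon>
    using W_meas u0_meas by (intro borel_measurable_times borel_measurable_min borel_measurable_power) auto
  have I0: "(\<lambda>j. I (\<epsilon> j) u0) \<longlonglongrightarrow> (\<integral>x. 0 \<partial>M)"
    unfolding I_def
  proof (rule integral_dominated_convergence[OF _ Im W_int])
    show "AE x in M. (\<lambda>j. W x * min 1 ((\<epsilon> j * u0 x)\<^sup>2)) \<longlonglongrightarrow> 0"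
    proof (rule AE_I2)
      fix x
      have "(\<lambda>j. W x * min 1 ((\<epsilon> j * u0 x)\<^sup>2)) \<longlonglongrightarrow> W x * min 1 ((0 * u0 x)\<^sup>2)"
        by (intro tendsto_intros \<epsilon>0)
      then show "(\<lambda>j. W x * min 1 ((\<epsilon> j * u0 x)\<^sup>2)) \<longlonglongrightarrow> 0" by simp
    qed
    show "AE x in M. norm (W x * min 1 ((\<epsilon> j * u0 x)\<^sup>2)) \<le> W x" for j
      using W_nonneg by eventually_elim (auto simp: abs_mult intro!: mult_left_le)
  qed simp
  have J0: "(\<lambda>j. J (\<epsilon> j) u0) \<longlonglongrightarrow> (\<integral>x. 0 \<partial>M)"
    unfolding J_def
  proof (rule integral_dominated_convergence[OF _ _ \<xi>0_int])
    show "(\<lambda>x. w (\<epsilon> j) (u0 x) * norm (\<xi>0 x) powr p) \<in> borel_measurable M" for j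
      using w_meas[OF u0_meas] \<xi>0_meas by (intro borel_measurable_times) auto
    show "AE x in M. (\<lambda>j. w (\<epsilon> j) (u0 x) * norm (\<xi>0 x) powr p) \<longlonglongrightarrow> 0"
    proof (rule AE_I2)
      fix x
      have "(\<lambda>j. w (\<epsilon> j) (u0 x) * norm (\<xi>0 x) powr p) \<longlonglongrightarrow> (1 - inverse (1 + (0 * u0 x)\<^sup>2)) * norm (\<xi>0 x) powr p"
        unfolding w_def by (intro tendsto_intros \<epsilon>0) simp
      then show "(\<lambda>j. w (\<epsilon> j) (u0 x) * norm (\<xi>0 x) powr p) \<longlonglongrightarrow> 0" by simp
    qed
    show "AE x in M. norm (w (\<epsilon> j) (u0 x) * norm (\<xi>0 x) powr p) \<le> norm (\<xi>0 x) powr p" for j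
      using w01 by (intro AE_I2) (auto simp: abs_mult intro!: mult_left_le_one_le)
  qed simp
  have split_le: "\<forall>\<^sub>F n in sequentially. (\<integral>x. norm (\<xi> n x - \<xi>0 x) powr p \<partial>M) \<le> \<delta> + P e (\<epsilon> j) (u n)"
    if \<delta>: "0 < \<delta>" and e: "0 < e" for \<delta> e j
  proof -
    \<comment> \<open>The truncation height is the point from which on the tail weight is at least
      1/2, so the two regions cover everything.\<close>
    have K: "0 < inverse (\<epsilon> j)" using \<epsilon> by simp
    show ?thesis using truncated_gradients_tendsto[OF K \<delta>] tail_estimate[OF \<epsilon>[of j] e]
    proof eventually_elim
      case (elim n)
      have i1: "integrable M (\<lambda>x. indicator {-inverse (\<epsilon> j)..inverse (\<epsilon> j)} (u n x) * norm (\<xi> n x - \<xi>0 x) powr p)"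
        by (rule Bochner_Integration.integrable_bound[OF gradient_difference_int[of n]])
          (use u_meas \<xi>_meas \<xi>0_meas in \<open>auto intro!: borel_measurable_times measurable_compose[OF u_meas borel_measurable_indicator] simp: indicator_def\<close>)
      have i2: "integrable M (\<lambda>x. w (\<epsilon> j) (u n x) * norm (\<xi> n x) powr p)"
        unfolding w_def by (rule weight_energy_int[OF u_meas \<xi>_meas \<xi>_int])
      have i3: "integrable M (\<lambda>x. w (\<epsilon> j) (u n x) * norm (\<xi>0 x) powr p)"
        unfolding w_def by (rule weight_energy_int[OF u_meas \<xi>0_meas \<xi>0_int])
      have "(\<integral>x. norm (\<xi> n x - \<xi>0 x) powr p \<partial>M)
        \<le> (\<integral>x. indicator {-inverse (\<epsilon> j)..inverse (\<epsilon> j)} (u n x) * norm (\<xi> n x - \<xi>0 x) powr p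
          + 2 * 2 powr p * (w (\<epsilon> j) (u n x) * norm (\<xi> n x) powr p + w (\<epsilon> j) (u n x) * norm (\<xi>0 x) powr p) \<partial>M)"
      proof (rule integral_mono[OF gradient_difference_int])
        fix x
        define X where "X = norm (\<xi> n x - \<xi>0 x) powr p"
        define Z where "Z = norm (\<xi> n x) powr p + norm (\<xi>0 x) powr p"
        have XZ: "X \<le> 2 powr p * Z" unfolding X_def Z_def by (rule norm_diff_powr_le[OF p0(2)])
        have Z: "0 \<le> Z" by (simp add: Z_def)
        have wZ: "0 \<le> w (\<epsilon> j) (u n x) * Z" using w01(1) Z by (rule mult_nonneg_nonneg)
        have "X \<le> indicator {-inverse (\<epsilon> j)..inverse (\<epsilon> j)} (u n x) * X + 2 * 2 powr p * (w (\<epsilon> j) (u n x) * Z)"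
        proof (cases "u n x \<in> {-inverse (\<epsilon> j)..inverse (\<epsilon> j)}")
          case True
          then show ?thesis using wZ by simp
        next
          case False
          then have "inverse (\<epsilon> j) \<le> \<bar>u n x\<bar>" by auto
          then have "\<epsilon> j * inverse (\<epsilon> j) \<le> \<epsilon> j * \<bar>u n x\<bar>" using \<epsilon>[of j] by (intro mult_left_mono) auto
          then have "1 \<le> \<epsilon> j * \<bar>u n x\<bar>" using \<epsilon>[of j] by simp
          from tail_function(8)[OF \<epsilon>[of j] this] have "1 \<le> 2 * w (\<epsilon> j) (u n x)" by (simp add: w_def)
          from mult_right_mono[OF this Z] have "Z \<le> 2 * w (\<epsilon> j) (u n x) * Z" by simp
          then have "2 powr p * Z \<le> 2 powr p * (2 * w (\<epsilon> j) (u n x) * Z)" by (rule mult_left_mono) simp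
          with XZ False show ?thesis by (simp add: mult_ac)
        qed
        then show "norm (\<xi> n x - \<xi>0 x) powr p
          \<le> indicator {-inverse (\<epsilon> j)..inverse (\<epsilon> j)} (u n x) * norm (\<xi> n x - \<xi>0 x) powr p
          + 2 * 2 powr p * (w (\<epsilon> j) (u n x) * norm (\<xi> n x) powr p + w (\<epsilon> j) (u n x) * norm (\<xi>0 x) powr p)"
          by (simp add: X_def Z_def distrib_left)
      qed (use i1 i2 i3 in auto)
      also have "\<dots> = (\<integral>x. indicator {-inverse (\<epsilon> j)..inverse (\<epsilon> j)} (u n x) * norm (\<xi> n x - \<xi>0 x) powr p \<partial>M)
          + 2 * 2 powr p * ((\<integral>x. w (\<epsilon> j) (u n x) * norm (\<xi> n x) powr p \<partial>M) + J (\<epsilon> j) (u n))"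
        unfolding J_def using i1 i2 i3 by simp
      also have "\<dots> \<le> \<delta> + 2 * 2 powr p * ((e * B powr (1/p) + C0 * ((\<epsilon> j)\<^sup>2 * R ^ 3) * B + I (\<epsilon> j) (u n)) / \<nu> + J (\<epsilon> j) (u n))"
      proof (intro add_mono mult_left_mono)
        show "(\<integral>x. w (\<epsilon> j) (u n x) * norm (\<xi> n x) powr p \<partial>M) \<le> (e * B powr (1/p) + C0 * ((\<epsilon> j)\<^sup>2 * R ^ 3) * B + I (\<epsilon> j) (u n)) / \<nu>"
          using elim(2) \<nu>_pos by (simp add: pos_le_divide_eq w_def I_def mult.commute)
      qed (use elim in auto)
      finally show ?case by (simp add: P_def)
    qed
  qed
  show ?thesis
  proof (rule tendstoI)
    fix \<delta> :: real assume \<delta>: "0 < \<delta>"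
    define e where "e = \<delta> * \<nu> / (4 * (2 * 2 powr p) * (B powr (1/p) + 1))"
    have b: "0 < B powr (1/p) + 1" by (intro add_nonneg_pos) auto
    have e: "0 < e" using \<delta> \<nu>_pos b by (simp add: e_def)
    have e_le: "2 * 2 powr p * (e * B powr (1/p) / \<nu>) \<le> \<delta> / 4"
    proof -
      have "e * B powr (1/p) \<le> e * (B powr (1/p) + 1)" using e by simp
      then have "2 * 2 powr p * (e * B powr (1/p) / \<nu>) \<le> 2 * 2 powr p * (e * (B powr (1/p) + 1) / \<nu>)"
        using \<nu>_pos e by (intro mult_left_mono divide_right_mono) auto
      also have "\<dots> = \<delta> / 4" using \<nu>_pos b by (simp add: e_def)
      finally show ?thesis .
    qed
    have "(\<lambda>j. P e (\<epsilon> j) u0) \<longlonglongrightarrow> 2 * 2 powr p * ((e * B powr (1/p) + C0 * (0\<^sup>2 * R ^ 3) * B + (\<integral>x. 0 \<partial>M)) / \<nu> + (\<integral>x. 0 \<partial>M))"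
      unfolding P_def using \<nu>_pos by (intro tendsto_intros \<epsilon>0 I0 J0) auto
    then have "(\<lambda>j. P e (\<epsilon> j) u0) \<longlonglongrightarrow> 2 * 2 powr p * (e * B powr (1/p) / \<nu>)" by simp
    then have "\<forall>\<^sub>F j in sequentially. P e (\<epsilon> j) u0 < \<delta> / 2" using e_le \<delta> by (intro order_tendstoD(2)) auto
    \<comment> \<open>The parameter \<epsilon> j is fixed by means of \<open>u0\<close> alone; only
      afterwards is n sent to infinity.\<close>
    then obtain j where j: "P e (\<epsilon> j) u0 < \<delta> / 2" using eventually_happens'[OF sequentially_bot] by blast
    have "(\<lambda>n. P e (\<epsilon> j) (u n)) \<longlonglongrightarrow> P e (\<epsilon> j) u0"
      unfolding P_def I_def J_def w_def
      using \<nu>_pos W_weight_tendsto(1)[OF \<epsilon>] weight_energy_limit_tendsto by (intro tendsto_intros) auto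
    then have "\<forall>\<^sub>F n in sequentially. P e (\<epsilon> j) (u n) < \<delta> / 2" using j by (rule order_tendstoD(2))
    moreover have "\<forall>\<^sub>F n in sequentially. (\<integral>x. norm (\<xi> n x - \<xi>0 x) powr p \<partial>M) \<le> \<delta> / 4 + P e (\<epsilon> j) (u n)"
      using \<delta> by (intro split_le e) simp
    ultimately show "\<forall>\<^sub>F n in sequentially. dist (\<integral>x. norm (\<xi> n x - \<xi>0 x) powr p \<partial>M) 0 < \<delta>"
    proof eventually_elim
      case (elim n)
      have "0 \<le> (\<integral>x. norm (\<xi> n x - \<xi>0 x) powr p \<partial>M)" by (rule integral_nonneg_AE) simp
      then show ?case using elim \<delta> by (simp add: dist_real_def)
    qed
  qed
qed

end

context quasilinear_sequence
begin

lemma subsequence: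
  assumes r: "strict_mono r"
  shows "quasilinear_sequence \<Omega> p a C0 \<nu> R (\<lambda>n. u (r n)) (\<lambda>n. \<xi> (r n)) (\<lambda>n. g (r n)) W B u0"
proof
  show "AE x in M. (\<lambda>n. u (r n) x) \<longlonglongrightarrow> u0 x"
    using u_lim by eventually_elim (use LIMSEQ_subseq_LIMSEQ[OF _ r] in \<open>auto simp: o_def\<close>)
  show "\<forall>\<^sub>F n in sequentially. \<forall>\<phi>. test_fun \<Omega> \<phi> \<longrightarrow>
    \<bar>(\<integral>x. (a x (u (r n) x) *\<^sub>R flux p (\<xi> (r n) x)) \<bullet> grad \<phi> x \<partial>M)
      + (\<integral>x. (1 / p * deriv (a x) (u (r n) x) * norm (\<xi> (r n) x) powr p - g (r n) x) * \<phi> x \<partial>M)\<bar>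
    \<le> \<epsilon> * Lp_norm \<Omega> p (grad \<phi>)" if "0 < \<epsilon>" for \<epsilon>
    using eventually_subseq[OF r equation[OF that]] .
qed (use u_closure \<xi>_bound g_meas W_int g_le gu_le u0_meas in auto)

text \<open>The L^1 Cauchy property supplies the almost everywhere convergent subsequence that
  \<open>quasilinear_limit\<close> presupposes, and along it the gradients converge in L^p.\<close>

theorem gradients_Lp_compact:
  obtains r :: "nat \<Rightarrow> nat" and \<xi>0 where "strict_mono r" "\<xi>0 \<in> borel_measurable M" "integrable M (\<lambda>x. norm (\<xi>0 x) powr p)"
    "(\<lambda>n. \<integral>x. norm (\<xi> (r n) x - \<xi>0 x) powr p \<partial>M) \<longlonglongrightarrow> 0"
proof -
  have i1: "integrable M (\<lambda>x. norm (\<xi> n x) powr 1)" for n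
  proof (rule Bochner_Integration.integrable_bound)
    show "integrable M (\<lambda>x. 1 + norm (\<xi> n x) powr p)" using \<xi>_int integrable_const_domain by simp
    show "AE x in M. norm (norm (\<xi> n x) powr 1) \<le> norm (1 + norm (\<xi> n x) powr p)"
      using powr_le_1_add_powr[of _ 1 p] p_gt1 by (intro AE_I2) simp
  qed (use \<xi>_meas in simp)
  obtain r :: "nat \<Rightarrow> nat" and W' \<xi>0 where r: "strict_mono r" and \<xi>0: "\<xi>0 \<in> borel_measurable M" "AE x in M. (\<lambda>n. \<xi> (r n) x) \<longlonglongrightarrow> \<xi>0 x"
    by (rule Lp_Cauchy_imp_dominated_subseq[of 1 \<xi> M, OF zero_less_one \<xi>_meas i1 gradients_L1_Cauchy]) blast+
  interpret seq: quasilinear_sequence \<Omega> p a C0 \<nu> R "\<lambda>n. u (r n)" "\<lambda>n. \<xi> (r n)" "\<lambda>n. g (r n)" W B u0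
    by (rule subsequence[OF r])
  interpret sub: quasilinear_limit \<Omega> p a C0 \<nu> R "\<lambda>n. u (r n)" "\<lambda>n. \<xi> (r n)" "\<lambda>n. g (r n)" W B u0 \<xi>0
    by unfold_locales (use \<xi>0 in auto)
  show ?thesis by (rule that[OF r \<xi>0(1) sub.\<xi>0_int sub.gradients_Lp_tendsto])
qed

end

section \<open>Systems\<close>

text \<open>The finitely many components are handled one after the other, each extraction refining
  the previous one; \<open>stable\<close> keeps what has been achieved for the earlier
  components.\<close>

lemma finite_subseq_extraction:
  fixes P :: "'d::finite \<Rightarrow> (nat \<Rightarrow> nat) \<Rightarrow> bool"
  assumes stable: "\<And>k (r :: nat \<Rightarrow> nat) s. P k r \<Longrightarrow> strict_mono s \<Longrightarrow> P k (r \<circ> s)"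
    and ex: "\<And>k (r :: nat \<Rightarrow> nat). strict_mono r \<Longrightarrow> \<exists>s. strict_mono s \<and> P k (r \<circ> s)"
  obtains r where "strict_mono r" "\<And>k. P k r"
proof -
  have "\<exists>r. strict_mono r \<and> (\<forall>k\<in>K. P k r)" for K :: "'d set"
    using finite[of K]
  proof (induction K)
    case empty
    show ?case using strict_mono_id by blast
  next
    case (insert k K)
    then obtain r where r: "strict_mono r" "\<forall>k\<in>K. P k r" by blast
    obtain s where s: "strict_mono s" "P k (r \<circ> s)" using ex[OF r(1)] by blast
    have "strict_mono (r \<circ> s)" using r(1) s(1) by (rule strict_mono_o)
    then show ?case using r(2) s stable by blast
  qed
  from this[of UNIV] show ?thesis using that by blast
qed

lemma unbounded_subseq:
  fixes f :: "nat \<Rightarrow> real"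
  assumes "\<nexists>K. \<forall>n. f n \<le> K"
  obtains r where "strict_mono r" "\<And>n. real n < f (r n)"
proof -
  have large: "\<exists>n>N. K < f n" for N K
  proof (rule ccontr)
    assume *: "\<not> ?thesis"
    have "f n \<le> max K (Max (f ` {..N}))" for n
    proof (cases "n \<le> N")
      case True
      then have "f n \<le> Max (f ` {..N})" by (intro Max_ge) auto
      then show ?thesis by simp
    next
      case False
      then have "f n \<le> K" using * by (meson not_le)
      then show ?thesis by simp
    qed
    then show False using assms by blast
  qed
  have "\<exists>r. \<forall>n. real n < f (r n) \<and> r n < r (Suc n)"
    by (rule dependent_nat_choice) (use large in blast)+
  then obtain r where "\<And>n. real n < f (r n)" "\<And>n. r n < r (Suc n)" by blast
  then show ?thesis using that[of r] by (simp add: strict_mono_Suc_iff)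
qed

lemma borel_measurable_vec_lambda:
  fixes u :: "'d::finite \<Rightarrow> 'b \<Rightarrow> real"
  assumes "\<And>j. u j \<in> borel_measurable N"
  shows "(\<lambda>x. \<chi> j. u j x) \<in> borel_measurable N"
  by (subst borel_measurable_euclidean_space) (use assms in \<open>auto simp: Basis_vec_def inner_axis\<close>)

text \<open>With T = 1 + sum of |s_j|^(q_j) and \<beta> = (q_k - 1)/q_k, every term of the growth
  condition is at most T^\<beta>: this is the meaning of the exponents q_j (q_k - 1)/q_k. Since
  |s_k| \<le> T^(1/q_k) and the two exponents add up to 1, multiplication by s_k still leaves a
  multiple of T.\<close>

lemma coupled_growth:
  fixes s :: "real^'d::finite" and q :: "'d \<Rightarrow> real"
  assumes C: "0 \<le> C" and q: "\<And>j. 1 < q j"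
    and t: "\<bar>t\<bar> \<le> C * (1 + \<bar>s $ k\<bar> powr (q k - 1) + (\<Sum>j\<in>UNIV - {k}. \<bar>s $ j\<bar> powr (q j * (q k - 1) / q k)))"
  shows "\<bar>t\<bar> \<le> C * (1 + real CARD('d)) * (1 + (\<Sum>j\<in>UNIV. \<bar>s $ j\<bar> powr q j))"
    "\<bar>t * s $ k\<bar> \<le> C * (1 + real CARD('d)) * (1 + (\<Sum>j\<in>UNIV. \<bar>s $ j\<bar> powr q j))"
proof -
  define T where "T = 1 + (\<Sum>j\<in>UNIV. \<bar>s $ j\<bar> powr q j)"
  define \<beta> where "\<beta> = (q k - 1) / q k"
  have q0: "0 < q j" for j using q[of j] by simp
  have \<beta>: "0 \<le> \<beta>" "\<beta> \<le> 1" "\<beta> + 1 / q k = 1" using q[of k] by (auto simp: \<beta>_def field_simps)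
  have T1: "1 \<le> T" unfolding T_def using sum_nonneg[of UNIV "\<lambda>j. \<bar>s $ j\<bar> powr q j"] by simp
  have sT: "\<bar>s $ j\<bar> powr q j \<le> T" for j
    using member_le_sum[of j UNIV "\<lambda>j. \<bar>s $ j\<bar> powr q j"] by (simp add: T_def)
  have summand: "\<bar>s $ j\<bar> powr (q j * (q k - 1) / q k) \<le> T powr \<beta>" for j
  proof -
    have "\<bar>s $ j\<bar> powr (q j * (q k - 1) / q k) = (\<bar>s $ j\<bar> powr q j) powr \<beta>" by (simp add: powr_powr \<beta>_def)
    also have "\<dots> \<le> T powr \<beta>" using \<beta> sT by (intro powr_mono2) auto
    finally show ?thesis .
  qed
  have one: "1 \<le> T powr \<beta>" using T1 \<beta> by (simp add: ge_one_powr_ge_zero)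
  have "\<bar>s $ k\<bar> powr (q k - 1) + (\<Sum>j\<in>UNIV - {k}. \<bar>s $ j\<bar> powr (q j * (q k - 1) / q k))
    = (\<Sum>j\<in>UNIV. \<bar>s $ j\<bar> powr (q j * (q k - 1) / q k))"
    using q0[of k] by (subst sum.remove[of UNIV k]) auto
  also have "\<dots> \<le> real CARD('d) * T powr \<beta>"
    using sum_bounded_above[of UNIV "\<lambda>j. \<bar>s $ j\<bar> powr (q j * (q k - 1) / q k)" "T powr \<beta>"] summand by simp
  finally have "1 + \<bar>s $ k\<bar> powr (q k - 1) + (\<Sum>j\<in>UNIV - {k}. \<bar>s $ j\<bar> powr (q j * (q k - 1) / q k))
    \<le> (1 + real CARD('d)) * T powr \<beta>" using one by (simp add: distrib_right)
  from order_trans[OF t mult_left_mono[OF this C]]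
  have t': "\<bar>t\<bar> \<le> C * (1 + real CARD('d)) * T powr \<beta>" by (simp add: mult.assoc)
  have C': "0 \<le> C * (1 + real CARD('d))" using C by simp
  have "T powr \<beta> \<le> T powr 1" using T1 \<beta> by (intro powr_mono) auto
  then have "C * (1 + real CARD('d)) * T powr \<beta> \<le> C * (1 + real CARD('d)) * T"
    using C' T1 by (intro mult_left_mono) auto
  with t' show "\<bar>t\<bar> \<le> C * (1 + real CARD('d)) * (1 + (\<Sum>j\<in>UNIV. \<bar>s $ j\<bar> powr q j))" by (simp add: T_def)
  have "\<bar>s $ k\<bar> = (\<bar>s $ k\<bar> powr q k) powr (1 / q k)" using q0[of k] by (simp add: powr_powr)
  also have "\<dots> \<le> T powr (1 / q k)" using q0[of k] sT by (intro powr_mono2) auto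
  finally have "\<bar>t * s $ k\<bar> \<le> (C * (1 + real CARD('d)) * T powr \<beta>) * T powr (1 / q k)"
    unfolding abs_mult using t' C' by (intro mult_mono) auto
  also have "\<dots> = C * (1 + real CARD('d)) * T" using T1 \<beta>(3) by (simp add: mult.assoc powr_add[symmetric])
  finally show "\<bar>t * s $ k\<bar> \<le> C * (1 + real CARD('d)) * (1 + (\<Sum>j\<in>UNIV. \<bar>s $ j\<bar> powr q j))" by (simp add: T_def)
qed

lemma CPS_seq_subseq:
  assumes "CPS_seq \<Omega> A G p c un" "strict_mono r"
  shows "CPS_seq \<Omega> A G p c (\<lambda>n. un (r n))"
  unfolding CPS_seq_def
proof (intro conjI allI impI)
  show "W01p_vec \<Omega> p (un (r n))" for n using assms(1) by (simp add: CPS_seq_def)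
  have "(\<lambda>n. energy \<Omega> A G p (un n)) \<longlonglongrightarrow> c" using assms(1) by (simp add: CPS_seq_def)
  from LIMSEQ_subseq_LIMSEQ[OF this assms(2)] show "(\<lambda>n. energy \<Omega> A G p (un (r n))) \<longlonglongrightarrow> c" by (simp add: o_def)
  fix k and \<epsilon> :: real assume "0 < \<epsilon>"
  with assms(1) have "\<forall>\<^sub>F n in sequentially. \<forall>\<phi>. test_fun \<Omega> \<phi> \<longrightarrow>
    \<bar>omega \<Omega> A G p (un n) k \<phi>\<bar> \<le> \<epsilon> * Lp_norm \<Omega> (p k) (wgrad \<Omega> \<phi>)" by (simp add: CPS_seq_def)
  from eventually_subseq[OF assms(2) this]
  show "\<forall>\<^sub>F n in sequentially. \<forall>\<phi>. test_fun \<Omega> \<phi> \<longrightarrow>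
    \<bar>omega \<Omega> A G p (un (r n)) k \<phi>\<bar> \<le> \<epsilon> * Lp_norm \<Omega> (p k) (wgrad \<Omega> \<phi>)" .
qed

lemma Lp_norm_le_sob_norm: "Lp_norm \<Omega> (p k) (wgrad \<Omega> (u k)) \<le> sob_norm \<Omega> p u"
  unfolding sob_norm_def by (rule member_le_sum) (auto simp: Lp_norm_nonneg)

lemma Lp_norm_powr:
  assumes "0 < p" "integrable (lebesgue_on \<Omega>) (\<lambda>x. norm (f x) powr p)"
  shows "Lp_norm \<Omega> p f powr p = (\<integral>x. norm (f x) powr p \<partial>lebesgue_on \<Omega>)"
proof -
  have "0 \<le> (\<integral>x. norm (f x) powr p \<partial>lebesgue_on \<Omega>)" by (rule integral_nonneg_AE) simp
  then show ?thesis using assms(1) by (simp add: Lp_norm_eq[OF assms(2)] powr_powr)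
qed

context bounded_open
begin

lemma wgrad_W01p:
  assumes "W01p \<Omega> p u" "0 < p"
  shows "u \<in> borel_measurable M" "wgrad \<Omega> u \<in> borel_measurable M" "integrable M (\<lambda>x. norm (wgrad \<Omega> u x) powr p)"
  using test_closure_integrable[OF W01p_imp_test_closure[OF assms] assms(2)] by auto

lemma wgrad_diff_W01p:
  assumes "W01p \<Omega> p u" "W01p \<Omega> p v" "1 < p"
  shows "AE x in M. wgrad \<Omega> (\<lambda>x. u x - v x) x = wgrad \<Omega> u x - wgrad \<Omega> v x"
proof -
  have p: "0 < p" "1 \<le> p" using assms(3) by auto
  show ?thesis
    by (rule test_closure_imp_W01p(2)[OF test_closure_diff[OF assms(1,2)[THEN W01p_imp_test_closure[OF _ p(1)]] p(1)] p(2)]) simp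
qed

text \<open>The bound is built componentwise from p-th powers: eventually the gradient differences
  have norm at most 1, so the gradient integrals are at most 2^p (1 + those of the limit).\<close>

lemma sob_norm_bounded_of_convergent:
  fixes p :: "'d::finite \<Rightarrow> real"
  assumes p: "\<And>k. 1 < p k" and w: "\<And>n. W01p_vec \<Omega> p (w n)" and u: "W01p_vec \<Omega> p u"
    and lim: "(\<lambda>n. sob_norm \<Omega> p (\<lambda>k x. w n k x - u k x)) \<longlonglongrightarrow> 0"
  shows "\<exists>K. \<forall>\<^sub>F n in sequentially. sob_norm \<Omega> p (w n) \<le> K"
proof -
  define b where "b k = (2 powr p k * (1 + Lp_norm \<Omega> (p k) (wgrad \<Omega> (u k)) powr p k)) powr (1 / p k)" for k
  have "\<forall>\<^sub>F n in sequentially. sob_norm \<Omega> p (\<lambda>k x. w n k x - u k x) < 1"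
    using lim by (rule order_tendstoD(2)) simp
  then have "\<forall>\<^sub>F n in sequentially. sob_norm \<Omega> p (w n) \<le> sum b UNIV"
  proof eventually_elim
    case (elim n)
    have "Lp_norm \<Omega> (p k) (wgrad \<Omega> (w n k)) \<le> b k" for k
    proof -
      have p0: "0 < p k" using p[of k] by simp
      have W: "W01p \<Omega> (p k) (w n k)" "W01p \<Omega> (p k) (u k)" using w u by (auto simp: W01p_vec_def)
      note iw = wgrad_W01p[OF W(1) p0] and iu = wgrad_W01p[OF W(2) p0]
      have id: "integrable M (\<lambda>x. norm (wgrad \<Omega> (w n k) x - wgrad \<Omega> (u k) x) powr p k)"
        using integrable_diff_powr[OF iw(2) iu(2) _ iw(3) iu(3)] p0 by simp
      have "Lp_norm \<Omega> (p k) (\<lambda>x. wgrad \<Omega> (w n k) x - wgrad \<Omega> (u k) x) = Lp_norm \<Omega> (p k) (wgrad \<Omega> (\<lambda>x. w n k x - u k x))"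
        by (rule Lp_norm_cong_AE) (use wgrad_diff_W01p[OF W p] in eventually_elim, simp)
      also have "\<dots> \<le> 1"
        using Lp_norm_le_sob_norm[of \<Omega> p k "\<lambda>k x. w n k x - u k x"] elim by simp
      finally have "Lp_norm \<Omega> (p k) (\<lambda>x. wgrad \<Omega> (w n k) x - wgrad \<Omega> (u k) x) powr p k \<le> 1"
        using p0 by (intro powr_le1) (auto simp: Lp_norm_nonneg)
      then have d1: "(\<integral>x. norm (wgrad \<Omega> (w n k) x - wgrad \<Omega> (u k) x) powr p k \<partial>M) \<le> 1"
        by (simp add: Lp_norm_powr[OF p0 id])
      have "(\<integral>x. norm (wgrad \<Omega> (w n k) x) powr p k \<partial>M)
        \<le> (\<integral>x. 2 powr p k * (norm (wgrad \<Omega> (w n k) x - wgrad \<Omega> (u k) x) powr p k + norm (wgrad \<Omega> (u k) x) powr p k) \<partial>M)"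
        using iw(3) iu(3) id p0 by (intro integral_mono norm_powr_le_diff) auto
      also have "\<dots> = 2 powr p k * ((\<integral>x. norm (wgrad \<Omega> (w n k) x - wgrad \<Omega> (u k) x) powr p k \<partial>M)
          + Lp_norm \<Omega> (p k) (wgrad \<Omega> (u k)) powr p k)"
        using iu(3) id by (simp add: Lp_norm_powr[OF p0 iu(3)])
      also have "\<dots> \<le> 2 powr p k * (1 + Lp_norm \<Omega> (p k) (wgrad \<Omega> (u k)) powr p k)"
        using d1 by (intro mult_left_mono add_right_mono) auto
      finally show ?thesis unfolding b_def by (rule Lp_norm_le[OF p0 iw(3)])
    qed
    then show ?case unfolding sob_norm_def by (rule sum_mono)
  qed
  then show ?thesis by blast
qed

end

section \<open>From the system to its components\<close>

locale quasilinear_system = bounded_open \<Omega> for \<Omega> :: "'a::euclidean_space set" +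
  fixes p :: "'d::finite \<Rightarrow> real" and A :: "'d \<Rightarrow> 'a \<Rightarrow> real \<Rightarrow> real" and G :: "'a \<Rightarrow> real^'d \<Rightarrow> real"
    and C0 \<nu> C R :: real and q :: "'d \<Rightarrow> real"
  assumes dim: "2 \<le> DIM('a)" and p_gt1: "\<And>k. 1 < p k"
    and A_meas: "\<And>k s. (\<lambda>x. A k x s) \<in> borel_measurable M"
    and A_C1: "\<And>k. AE x in M. (\<forall>s. A k x differentiable (at s)) \<and> continuous_on UNIV (deriv (A k x))"
    and C0_pos: "0 < C0" and \<nu>_pos: "0 < \<nu>"
    and a1: "\<And>k. AE x in M. \<forall>s. \<bar>A k x s\<bar> \<le> C0 \<and> \<bar>deriv (A k x) s\<bar> \<le> C0"
    and a2: "\<And>k. AE x in M. \<forall>s. \<nu> \<le> A k x s"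
    and G_meas: "\<And>s. (\<lambda>x. G x s) \<in> borel_measurable M"
    and G_C1: "AE x in M. (\<forall>s. G x differentiable (at s)) \<and> (\<forall>k. continuous_on UNIV (gpart G k x))"
    and C_pos: "0 < C"
    and q_range: "\<And>k. p k < q k \<and> (real DIM('a) > p k \<longrightarrow> q k < real DIM('a) * p k / (real DIM('a) - p k))"
    and g1: "AE x in M. \<forall>s k. \<bar>gpart G k x s\<bar> \<le>
      C * (1 + \<bar>s $ k\<bar> powr (q k - 1) + (\<Sum>j\<in>UNIV - {k}. \<bar>s $ j\<bar> powr (q j * (q k - 1) / q k)))"
    and R_pos: "0 < R"
    and a3: "\<And>k. AE x in M. \<forall>s. R \<le> \<bar>s\<bar> \<longrightarrow> 0 \<le> s * deriv (A k x) s"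
begin

lemma p_pos: "0 < p k" and p_ge1: "1 \<le> p k" and q_gt1: "1 < q k"
  using p_gt1[of k] q_range[of k] by auto

text \<open>Measurability of the superpositions is what has to be derived: A_k and its derivative in
  s are Caratheodory functions, the derivative being measurable in x as a limit of difference
  quotients.\<close>

lemma quasilinear_component: "quasilinear \<Omega> (p k) (A k) C0 \<nu> R"
proof
  have dA: "AE x in M. \<forall>s. (A k x has_real_derivative deriv (A k x) s) (at s)"
    using A_C1[of k] by eventually_elim (simp add: DERIV_deriv_iff_real_differentiable)
  show "(\<lambda>x. A k x (u x)) \<in> borel_measurable M" if "u \<in> borel_measurable M" for u
  proof (rule Caratheodory_compose_measurable[OF sets_domain A_meas _ that])
    show "AE x in M. continuous_on UNIV (A k x)"
      using dA by eventually_elim (auto intro!: continuous_at_imp_continuous_on DERIV_isCont)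
  qed
  show "(\<lambda>x. deriv (A k x) (u x)) \<in> borel_measurable M" if "u \<in> borel_measurable M" for u
  proof (rule Caratheodory_compose_measurable[OF sets_domain _ _ that])
    fix s
    have "(\<lambda>x. (\<lambda>t. deriv (A k x) s * t) 1) \<in> borel_measurable M"
      by (rule directional_derivative_measurable[where f="A k" and s=s, OF sets_domain A_meas])
        (use dA in eventually_elim, simp add: has_field_derivative_def)
    then show "(\<lambda>x. deriv (A k x) s) \<in> borel_measurable M" by simp
    show "AE x in M. continuous_on UNIV (deriv (A k x))" using A_C1[of k] by eventually_elim simp
  qed
  show "AE x in M. (\<forall>s. (A k x has_real_derivative deriv (A k x) s) (at s)) \<and>
      continuous_on UNIV (deriv (A k x)) \<and> (\<forall>s. \<nu> \<le> A k x s \<and> \<bar>A k x s\<bar> \<le> C0 \<and> \<bar>deriv (A k x) s\<bar> \<le> C0) \<and>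
      (\<forall>s. R \<le> \<bar>s\<bar> \<longrightarrow> 0 \<le> s * deriv (A k x) s)"
    using dA A_C1[of k] a1[of k] a2[of k] a3[of k] by eventually_elim blast
qed (use p_gt1 C0_pos \<nu>_pos R_pos in auto)

lemma gpart_measurable:
  assumes "\<And>j. u j \<in> borel_measurable M"
  shows "(\<lambda>x. gpart G k x (\<chi> j. u j x)) \<in> borel_measurable M"
proof (rule Caratheodory_compose_measurable[OF sets_domain _ _ borel_measurable_vec_lambda[OF assms]])
  show "(\<lambda>x. gpart G k x s) \<in> borel_measurable M" for s
    unfolding gpart_def
    by (rule directional_derivative_measurable[where f=G and s=s, OF sets_domain G_meas])
      (use G_C1 in eventually_elim, simp add: frechet_derivative_works[symmetric])
  show "AE x in M. continuous_on UNIV (gpart G k x)" using G_C1 by eventually_elim simp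
qed

text \<open>\<open>omega\<close> is composed of separate Bochner integrals, and such an integral is
  0 by default for a non-integrable integrand. Merging the two L^1 terms into one therefore needs
  integrability of both, for which the majorant W of the coupling term is supplied.\<close>

lemma omega_eq:
  assumes u: "\<And>j. W01p \<Omega> (p j) (u j)" and W: "integrable M W"
    and gW: "AE x in M. \<bar>gpart G k x (\<chi> j. u j x)\<bar> \<le> W x" and \<phi>: "test_fun \<Omega> \<phi>"
  shows "omega \<Omega> A G p u k \<phi>
    = (\<integral>x. (A k x (u k x) *\<^sub>R flux (p k) (wgrad \<Omega> (u k) x)) \<bullet> grad \<phi> x \<partial>M)
      + (\<integral>x. (1 / p k * deriv (A k x) (u k x) * norm (wgrad \<Omega> (u k) x) powr p k - gpart G k x (\<chi> j. u j x)) * \<phi> x \<partial>M)"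
proof -
  interpret quasilinear \<Omega> "p k" "A k" C0 \<nu> R by (rule quasilinear_component)
  note m = wgrad_W01p[OF u p_pos]
  obtain b where b: "0 < b" "\<And>x. norm (\<phi> x) \<le> b" using test_fun_bounded[OF \<phi>] by metis
  have \<phi>m: "\<phi> \<in> borel_measurable M" by (rule test_fun_measurable(1)[OF \<phi>])
  have i1: "integrable M (\<lambda>x. 1 / p k * deriv (A k x) (u k x) * norm (wgrad \<Omega> (u k) x) powr p k * \<phi> x)"
  proof (rule Bochner_Integration.integrable_bound)
    show "integrable M (\<lambda>x. C0 * b * norm (wgrad \<Omega> (u k) x) powr p k)" using m(3) by simp
    show "(\<lambda>x. 1 / p k * deriv (A k x) (u k x) * norm (wgrad \<Omega> (u k) x) powr p k * \<phi> x) \<in> borel_measurable M"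
      using da_meas[OF m(1)[of k]] m(2)[of k] \<phi>m by (intro borel_measurable_times) auto
    show "AE x in M. norm (1 / p k * deriv (A k x) (u k x) * norm (wgrad \<Omega> (u k) x) powr p k * \<phi> x)
      \<le> norm (C0 * b * norm (wgrad \<Omega> (u k) x) powr p k)"
      using a1[of k]
    proof eventually_elim
      case (elim x)
      have "\<bar>1 / p k * deriv (A k x) (u k x)\<bar> \<le> 1 * C0"
        unfolding abs_mult using elim p_ge1[of k] p_pos[of k] by (intro mult_mono) auto
      then have "\<bar>1 / p k * deriv (A k x) (u k x)\<bar> * norm (wgrad \<Omega> (u k) x) powr p k * \<bar>\<phi> x\<bar>
        \<le> C0 * norm (wgrad \<Omega> (u k) x) powr p k * b"
        using b(2)[of x] C0_pos by (intro mult_mono) auto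
      then show ?case using C0_pos b(1) by (simp add: abs_mult mult_ac)
    qed
  qed
  have i2: "integrable M (\<lambda>x. gpart G k x (\<chi> j. u j x) * \<phi> x)"
  proof (rule Bochner_Integration.integrable_bound)
    show "integrable M (\<lambda>x. W x * b)" using W by simp
    show "(\<lambda>x. gpart G k x (\<chi> j. u j x) * \<phi> x) \<in> borel_measurable M"
      using gpart_measurable[OF m(1)] \<phi>m by (intro borel_measurable_times)
    show "AE x in M. norm (gpart G k x (\<chi> j. u j x) * \<phi> x) \<le> norm (W x * b)"
      using gW
    proof eventually_elim
      case (elim x)
      have "\<bar>gpart G k x (\<chi> j. u j x)\<bar> * \<bar>\<phi> x\<bar> \<le> W x * b"
        using elim b(2)[of x] by (intro mult_mono) auto
      then show ?case using abs_ge_self[of "W x * b"] by (simp add: abs_mult)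
    qed
  qed
  have "(\<integral>x. A k x (u k x) * norm (wgrad \<Omega> (u k) x) powr (p k - 2) * (wgrad \<Omega> (u k) x \<bullet> wgrad \<Omega> \<phi> x) \<partial>M)
    = (\<integral>x. (A k x (u k x) *\<^sub>R flux (p k) (wgrad \<Omega> (u k) x)) \<bullet> grad \<phi> x \<partial>M)"
  proof (rule integral_cong_AE)
    have gm: "grad \<phi> \<in> borel_measurable M" by (rule test_fun_measurable(2)[OF \<phi>])
    have wm: "wgrad \<Omega> \<phi> \<in> borel_measurable M"
      by (rule AE_measurable_lebesgue_on[OF gm wgrad_test_fun[OF \<phi>] sets_domain])
    show "(\<lambda>x. A k x (u k x) * norm (wgrad \<Omega> (u k) x) powr (p k - 2) * (wgrad \<Omega> (u k) x \<bullet> wgrad \<Omega> \<phi> x)) \<in> borel_measurable M"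
      using a_meas[OF m(1)[of k]] m(2)[of k] wm by (intro borel_measurable_times borel_measurable_inner) auto
    show "(\<lambda>x. (A k x (u k x) *\<^sub>R flux (p k) (wgrad \<Omega> (u k) x)) \<bullet> grad \<phi> x) \<in> borel_measurable M"
      unfolding flux_def
      using a_meas[OF m(1)[of k]] m(2)[of k] gm by (intro borel_measurable_scaleR borel_measurable_inner) auto
    show "AE x in M. A k x (u k x) * norm (wgrad \<Omega> (u k) x) powr (p k - 2) * (wgrad \<Omega> (u k) x \<bullet> wgrad \<Omega> \<phi> x)
      = (A k x (u k x) *\<^sub>R flux (p k) (wgrad \<Omega> (u k) x)) \<bullet> grad \<phi> x"
      using wgrad_test_fun[OF \<phi>] by eventually_elim (simp add: flux_def)
  qed
  then show ?thesis
    using i1 i2 by (simp add: omega_def left_diff_distrib)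
qed

text \<open>All components must converge along a common subsequence before any single equation is
  considered, because each coupling term g_k(x, u_n) depends on all of them. Hence two rounds of
  extraction over the components: one for the functions with their majorants, one for the
  gradients.\<close>

theorem bounded_CPS_seq_convergent:
  assumes cps: "CPS_seq \<Omega> A G p c un" and bd: "\<And>n. sob_norm \<Omega> p (un n) \<le> K"
  shows "\<exists>r u. strict_mono r \<and> W01p_vec \<Omega> p u \<and> (\<lambda>n. sob_norm \<Omega> p (\<lambda>k x. un (r n) k x - u k x)) \<longlonglongrightarrow> 0"
proof -
  have un: "W01p \<Omega> (p k) (un n k)" for n k using cps by (simp add: CPS_seq_def W01p_vec_def)
  note tc = W01p_imp_test_closure[OF un p_pos]
  note m = wgrad_W01p[OF un p_pos]
  define B where "B k = K powr p k" for k
  have B: "(\<integral>x. norm (wgrad \<Omega> (un n k) x) powr p k \<partial>M) \<le> B k" for n k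
  proof -
    have "Lp_norm \<Omega> (p k) (wgrad \<Omega> (un n k)) \<le> K" using Lp_norm_le_sob_norm bd by (rule order_trans)
    then have "Lp_norm \<Omega> (p k) (wgrad \<Omega> (un n k)) powr p k \<le> K powr p k"
      using p_pos[of k] by (intro powr_mono2) (auto simp: Lp_norm_nonneg)
    then show ?thesis by (simp add: B_def Lp_norm_powr[OF p_pos m(3)])
  qed
  \<comment> \<open>The majorant of the q_k-th powers is part of the property, since the coupling
    terms of all equations are to be dominated with it.\<close>
  define P where "P k r \<longleftrightarrow> (\<exists>W v. integrable M W \<and> (\<forall>n. AE x in M. \<bar>un (r n) k x\<bar> powr q k \<le> W x) \<and>
    v \<in> borel_measurable M \<and> (AE x in M. (\<lambda>n. un (r n) k x) \<longlonglongrightarrow> v x))" for k and r :: "nat \<Rightarrow> nat"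
  obtain r1 where r1: "strict_mono r1" "\<And>k. P k r1"
  proof (rule finite_subseq_extraction[of P])
    fix k and r s :: "nat \<Rightarrow> nat" assume P: "P k r" and s: "strict_mono s"
    obtain W v where W: "integrable M W" "\<And>n. AE x in M. \<bar>un (r n) k x\<bar> powr q k \<le> W x"
      "v \<in> borel_measurable M" "AE x in M. (\<lambda>n. un (r n) k x) \<longlonglongrightarrow> v x"
      using P unfolding P_def by blast
    have "AE x in M. (\<lambda>n. un (r (s n)) k x) \<longlonglongrightarrow> v x"
      using W(4) by eventually_elim (use LIMSEQ_subseq_LIMSEQ[OF _ s] in \<open>auto simp: o_def\<close>)
    then show "P k (r \<circ> s)" unfolding P_def o_def using W(1,2,3) by blast
  next
    fix k and r :: "nat \<Rightarrow> nat" assume "strict_mono r"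
    have crit: "p k < q k" "p k < real DIM('a) \<Longrightarrow> q k < real DIM('a) * p k / (real DIM('a) - p k)"
      using q_range[of k] by auto
    obtain s :: "nat \<Rightarrow> nat" and W v where "strict_mono s" "integrable M W" "\<And>n. AE x in M. \<bar>un (r (s n)) k x\<bar> powr q k \<le> W x"
      "v \<in> borel_measurable M" "AE x in M. (\<lambda>n. un (r (s n)) k x) \<longlonglongrightarrow> v x"
      by (rule sobolev_compact[where u="\<lambda>n. un (r n) k" and \<xi>="\<lambda>n. wgrad \<Omega> (un (r n) k)", OF dim p_ge1 crit(1) _ tc B]) (use crit(2) that in blast)+
    then show "\<exists>s. strict_mono s \<and> P k (r \<circ> s)" unfolding P_def o_def by blast
  qed blast
  have "\<exists>W v. \<forall>k. integrable M (W k) \<and> (\<forall>n. AE x in M. \<bar>un (r1 n) k x\<bar> powr q k \<le> W k x) \<and>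
    v k \<in> borel_measurable M \<and> (AE x in M. (\<lambda>n. un (r1 n) k x) \<longlonglongrightarrow> v k x)"
    using allI[OF r1(2), unfolded P_def choice_iff] .
  then obtain W v where W: "\<And>k. integrable M (W k)" "\<And>k n. AE x in M. \<bar>un (r1 n) k x\<bar> powr q k \<le> W k x"
    and v: "\<And>k. v k \<in> borel_measurable M" "\<And>k. AE x in M. (\<lambda>n. un (r1 n) k x) \<longlonglongrightarrow> v k x" by blast
  \<comment> \<open>The constant of \<open>coupled_growth\<close> times its right-hand side, with
    each |s_j|^(q_j) replaced by its majorant; one V serves all components and all n.\<close>
  define V where "V x = C * (1 + real CARD('d)) * (1 + (\<Sum>j\<in>UNIV. W j x))" for x
  have V: "integrable M V" unfolding V_def[abs_def] using W(1) integrable_const_domain[of 1] by simp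
  have gV: "AE x in M. \<bar>gpart G k x (\<chi> j. un (r1 n) j x)\<bar> \<le> V x \<and> \<bar>gpart G k x (\<chi> j. un (r1 n) j x) * un (r1 n) k x\<bar> \<le> V x" for n k
  proof -
    have "AE x in M. \<forall>j. \<bar>un (r1 n) j x\<bar> powr q j \<le> W j x"
      using W(2) by (simp add: AE_all_countable)
    then show ?thesis using g1
    proof eventually_elim
      case (elim x)
      define s where "s = (\<chi> j. un (r1 n) j x)"
      have "C * (1 + real CARD('d)) * (1 + (\<Sum>j\<in>UNIV. \<bar>s $ j\<bar> powr q j)) \<le> V x"
        unfolding V_def using C_pos elim(1) by (intro mult_left_mono add_left_mono sum_mono) (auto simp: s_def)
      moreover have "\<bar>gpart G k x s\<bar> \<le> C * (1 + \<bar>s $ k\<bar> powr (q k - 1) + (\<Sum>j\<in>UNIV - {k}. \<bar>s $ j\<bar> powr (q j * (q k - 1) / q k)))"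
        using elim(2) by blast
      note coupled_growth[OF less_imp_le[OF C_pos] q_gt1 this]
      ultimately have "\<bar>gpart G k x s\<bar> \<le> V x \<and> \<bar>gpart G k x s * s $ k\<bar> \<le> V x" by linarith
      then show ?case by (simp add: s_def)
    qed
  qed
  have seq: "quasilinear_sequence \<Omega> (p k) (A k) C0 \<nu> R (\<lambda>n. un (r1 n) k) (\<lambda>n. wgrad \<Omega> (un (r1 n) k))
    (\<lambda>n x. gpart G k x (\<chi> j. un (r1 n) j x)) V (B k) (v k)" for k
  proof -
    interpret quasilinear \<Omega> "p k" "A k" C0 \<nu> R by (rule quasilinear_component)
    show ?thesis
    proof
      show "AE x in M. \<bar>gpart G k x (\<chi> j. un (r1 n) j x)\<bar> \<le> V x" "AE x in M. \<bar>gpart G k x (\<chi> j. un (r1 n) j x) * un (r1 n) k x\<bar> \<le> V x" for n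
        using gV[of k n] by (auto elim: eventually_mono)
      show "(\<lambda>x. gpart G k x (\<chi> j. un (r1 n) j x)) \<in> borel_measurable M" for n
        by (rule gpart_measurable[OF m(1)])
      fix \<epsilon> :: real assume "0 < \<epsilon>"
      then have "\<forall>\<^sub>F n in sequentially. \<forall>\<phi>. test_fun \<Omega> \<phi> \<longrightarrow> \<bar>omega \<Omega> A G p (un (r1 n)) k \<phi>\<bar> \<le> \<epsilon> * Lp_norm \<Omega> (p k) (wgrad \<Omega> \<phi>)"
        using CPS_seq_subseq[OF cps r1(1)] by (simp add: CPS_seq_def)
      then show "\<forall>\<^sub>F n in sequentially. \<forall>\<phi>. test_fun \<Omega> \<phi> \<longrightarrow>
        \<bar>(\<integral>x. (A k x (un (r1 n) k x) *\<^sub>R flux (p k) (wgrad \<Omega> (un (r1 n) k) x)) \<bullet> grad \<phi> x \<partial>M)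
          + (\<integral>x. (1 / p k * deriv (A k x) (un (r1 n) k x) * norm (wgrad \<Omega> (un (r1 n) k) x) powr p k
              - gpart G k x (\<chi> j. un (r1 n) j x)) * \<phi> x \<partial>M)\<bar>
        \<le> \<epsilon> * Lp_norm \<Omega> (p k) (grad \<phi>)"
      proof eventually_elim
        case (elim n)
        show ?case
        proof (intro allI impI)
          fix \<phi> assume \<phi>: "test_fun \<Omega> \<phi>"
          have g: "AE x in M. \<bar>gpart G k x (\<chi> j. un (r1 n) j x)\<bar> \<le> V x" using gV[of k n] by (auto elim: eventually_mono)
          have "Lp_norm \<Omega> (p k) (wgrad \<Omega> \<phi>) = Lp_norm \<Omega> (p k) (grad \<phi>)"
            by (rule Lp_norm_cong_AE) (use wgrad_test_fun[OF \<phi>] in eventually_elim, simp)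
          then show "\<bar>(\<integral>x. (A k x (un (r1 n) k x) *\<^sub>R flux (p k) (wgrad \<Omega> (un (r1 n) k) x)) \<bullet> grad \<phi> x \<partial>M)
            + (\<integral>x. (1 / p k * deriv (A k x) (un (r1 n) k x) * norm (wgrad \<Omega> (un (r1 n) k) x) powr p k
                - gpart G k x (\<chi> j. un (r1 n) j x)) * \<phi> x \<partial>M)\<bar>
            \<le> \<epsilon> * Lp_norm \<Omega> (p k) (grad \<phi>)"
            using elim \<phi> unfolding omega_eq[OF un V g \<phi>, symmetric] by metis
        qed
      qed
    qed (use tc B V v in auto)
  qed
  \<comment> \<open>The gradient limits need not be gradients for this round; they are matched with
    the limits v afterwards.\<close>
  define Q where "Q k r \<longleftrightarrow> (\<exists>\<xi>. \<xi> \<in> borel_measurable M \<and> integrable M (\<lambda>x. norm (\<xi> x) powr p k) \<and>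
    (\<lambda>n. \<integral>x. norm (wgrad \<Omega> (un (r1 (r n)) k) x - \<xi> x) powr p k \<partial>M) \<longlonglongrightarrow> 0)" for k and r :: "nat \<Rightarrow> nat"
  obtain r2 where r2: "strict_mono r2" "\<And>k. Q k r2"
  proof (rule finite_subseq_extraction[of Q])
    fix k and r s :: "nat \<Rightarrow> nat" assume Q: "Q k r" and s: "strict_mono s"
    obtain \<xi> where \<xi>: "\<xi> \<in> borel_measurable M" "integrable M (\<lambda>x. norm (\<xi> x) powr p k)"
      "(\<lambda>n. \<integral>x. norm (wgrad \<Omega> (un (r1 (r n)) k) x - \<xi> x) powr p k \<partial>M) \<longlonglongrightarrow> 0"
      using Q unfolding Q_def by blast
    have "(\<lambda>n. \<integral>x. norm (wgrad \<Omega> (un (r1 (r (s n))) k) x - \<xi> x) powr p k \<partial>M) \<longlonglongrightarrow> 0"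
      using LIMSEQ_subseq_LIMSEQ[OF \<xi>(3) s] by (simp add: o_def)
    then show "Q k (r \<circ> s)" unfolding Q_def o_def using \<xi>(1,2) by blast
  next
    fix k and r :: "nat \<Rightarrow> nat" assume r: "strict_mono r"
    interpret seq: quasilinear_sequence \<Omega> "p k" "A k" C0 \<nu> R "\<lambda>n. un (r1 n) k" "\<lambda>n. wgrad \<Omega> (un (r1 n) k)"
      "\<lambda>n x. gpart G k x (\<chi> j. un (r1 n) j x)" V "B k" "v k" by (rule seq)
    interpret sub: quasilinear_sequence \<Omega> "p k" "A k" C0 \<nu> R "\<lambda>n. un (r1 (r n)) k" "\<lambda>n. wgrad \<Omega> (un (r1 (r n)) k)"
      "\<lambda>n x. gpart G k x (\<chi> j. un (r1 (r n)) j x)" V "B k" "v k" by (rule seq.subsequence[OF r])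
    obtain s :: "nat \<Rightarrow> nat" and \<xi> where "strict_mono s" "\<xi> \<in> borel_measurable M" "integrable M (\<lambda>x. norm (\<xi> x) powr p k)"
      "(\<lambda>n. \<integral>x. norm (wgrad \<Omega> (un (r1 (r (s n))) k) x - \<xi> x) powr p k \<partial>M) \<longlonglongrightarrow> 0"
      by (rule sub.gradients_Lp_compact)
    then show "\<exists>s. strict_mono s \<and> Q k (r \<circ> s)" unfolding Q_def o_def by blast
  qed blast
  have "\<exists>\<xi>. \<forall>k. \<xi> k \<in> borel_measurable M \<and> integrable M (\<lambda>x. norm (\<xi> k x) powr p k) \<and>
    (\<lambda>n. \<integral>x. norm (wgrad \<Omega> (un (r1 (r2 n)) k) x - \<xi> k x) powr p k \<partial>M) \<longlonglongrightarrow> 0"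
    using allI[OF r2(2), unfolded Q_def choice_iff] .
  then obtain \<xi> where \<xi>: "\<And>k. \<xi> k \<in> borel_measurable M" "\<And>k. integrable M (\<lambda>x. norm (\<xi> k x) powr p k)"
    "\<And>k. (\<lambda>n. \<integral>x. norm (wgrad \<Omega> (un (r1 (r2 n)) k) x - \<xi> k x) powr p k \<partial>M) \<longlonglongrightarrow> 0" by blast
  \<comment> \<open>Functions and gradients now both converge in L^(p_k), so closedness puts the
    limit into the Sobolev space with \<xi> as its gradient. Convergence of the functions follows
    from the majorants, as |t|^(p_k) \<le> 1 + |t|^(q_k).\<close>
  have vc: "test_closure \<Omega> (p k) UNIV (v k) (\<xi> k)" for k
  proof (rule test_closure_limit[where w="\<lambda>n. un (r1 (r2 n)) k" and \<zeta>="\<lambda>n. wgrad \<Omega> (un (r1 (r2 n)) k)",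
      OF p_pos v(1)[of k] \<xi>(1)[of k] _ \<xi>(2)[of k] tc _ \<xi>(3)[of k]])
    have dom: "AE x in M. norm (un (r1 (r2 n)) k x) powr p k \<le> 1 + W k x" for n
      using W(2)[of "r2 n" k]
    proof eventually_elim
      case (elim x)
      have "\<bar>un (r1 (r2 n)) k x\<bar> powr p k \<le> 1 + \<bar>un (r1 (r2 n)) k x\<bar> powr q k"
        using p_pos[of k] q_range[of k] by (intro powr_le_1_add_powr) auto
      with elim show ?case by simp
    qed
    have W1: "integrable M (\<lambda>x. 1 + W k x)" using W(1) integrable_const_domain[of 1] by simp
    have lim: "AE x in M. (\<lambda>n. un (r1 (r2 n)) k x) \<longlonglongrightarrow> v k x"
      using v(2) by eventually_elim (use LIMSEQ_subseq_LIMSEQ[OF _ r2(1)] in \<open>auto simp: o_def\<close>)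
    note dc = Lp_dominated_convergence[where f="\<lambda>n. un (r1 (r2 n)) k", OF p_pos m(1) v(1)[of k] W1 dom lim]
    show "integrable M (\<lambda>x. norm (v k x) powr p k)" by (rule dc(1))
    show "(\<lambda>n. \<integral>x. norm (un (r1 (r2 n)) k x - v k x) powr p k \<partial>M) \<longlonglongrightarrow> 0" by (rule dc(3))
  qed
  note vW = test_closure_imp_W01p[OF vc p_ge1]
  have lim: "(\<lambda>n. Lp_norm \<Omega> (p k) (wgrad \<Omega> (\<lambda>x. un (r1 (r2 n)) k x - v k x))) \<longlonglongrightarrow> 0" for k
  proof -
    have "Lp_norm \<Omega> (p k) (wgrad \<Omega> (\<lambda>x. un (r1 (r2 n)) k x - v k x))
      = (\<integral>x. norm (wgrad \<Omega> (un (r1 (r2 n)) k) x - \<xi> k x) powr p k \<partial>M) powr (1 / p k)" for n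
    proof -
      have "Lp_norm \<Omega> (p k) (wgrad \<Omega> (\<lambda>x. un (r1 (r2 n)) k x - v k x))
        = Lp_norm \<Omega> (p k) (\<lambda>x. wgrad \<Omega> (un (r1 (r2 n)) k) x - \<xi> k x)"
        by (rule Lp_norm_cong_AE)
          (use wgrad_diff_W01p[OF un[of k "r1 (r2 n)"] vW(1)[of k] p_gt1] vW(2)[of k] in eventually_elim, simp)
      also have "\<dots> = (\<integral>x. norm (wgrad \<Omega> (un (r1 (r2 n)) k) x - \<xi> k x) powr p k \<partial>M) powr (1 / p k)"
        by (rule Lp_norm_eq[OF integrable_diff_powr[OF m(2) \<xi>(1)[of k] less_imp_le[OF p_pos] m(3) \<xi>(2)[of k]]])
      finally show ?thesis .
    qed
    moreover have "(\<lambda>n. (\<integral>x. norm (wgrad \<Omega> (un (r1 (r2 n)) k) x - \<xi> k x) powr p k \<partial>M) powr (1 / p k)) \<longlonglongrightarrow> 0"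
      by (rule tendsto_zero_powrI[OF \<xi>(3)[of k] tendsto_const]) (use p_pos[of k] in \<open>auto intro!: integral_nonneg_AE\<close>)
    ultimately show ?thesis by simp
  qed
  have "(\<lambda>n. sob_norm \<Omega> p (\<lambda>k x. un ((r1 \<circ> r2) n) k x - v k x)) \<longlonglongrightarrow> (\<Sum>k\<in>(UNIV :: 'd set). 0)"
    unfolding sob_norm_def o_def by (rule tendsto_sum) (rule lim)
  moreover have "W01p_vec \<Omega> p v" unfolding W01p_vec_def using vW(1) by blast
  moreover have "strict_mono (r1 \<circ> r2)" using r1(1) r2(1) by (rule strict_mono_o)
  ultimately show ?thesis by (intro exI[of _ "r1 \<circ> r2"] exI[of _ v] conjI) auto
qed

lemma CPS_condition_imp_bounded:
  assumes cond: "CPS_condition \<Omega> A G p c" and cps: "CPS_seq \<Omega> A G p c un"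
  shows "\<exists>K. \<forall>n. sob_norm \<Omega> p (un n) \<le> K"
proof (rule ccontr)
  assume "\<not> ?thesis"
  then obtain r where r: "strict_mono r" "\<And>n. real n < sob_norm \<Omega> p (un (r n))"
    by (rule unbounded_subseq[where f="\<lambda>n. sob_norm \<Omega> p (un n)"]) (use that in blast)
  obtain s u where s: "strict_mono s" "W01p_vec \<Omega> p u"
    "(\<lambda>n. sob_norm \<Omega> p (\<lambda>k x. un (r (s n)) k x - u k x)) \<longlonglongrightarrow> 0"
    using cond[unfolded CPS_condition_def, rule_format, OF CPS_seq_subseq[OF cps r(1)]] by blast
  have "W01p_vec \<Omega> p (un (r (s n)))" for n using cps by (simp add: CPS_seq_def)
  from sob_norm_bounded_of_convergent[OF p_gt1 this s(2,3)]
  obtain K where "\<forall>\<^sub>F n in sequentially. sob_norm \<Omega> p (un (r (s n))) \<le> K" by blast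
  moreover have "\<forall>\<^sub>F n in sequentially. K < real n" using filterlim_real_sequentially unfolding filterlim_at_top_dense by blast
  ultimately have "\<forall>\<^sub>F n in sequentially. False"
  proof eventually_elim
    case (elim n)
    have "real n \<le> real (s n)" using strict_mono_imp_increasing[OF s(1)] by simp
    with elim r(2)[of "s n"] show ?case by simp
  qed
  then show False by simp
qed

end

theorem theorem4p2:
  fixes \<Omega> :: "'a::euclidean_space set"
    and p :: "'d::finite \<Rightarrow> real"
    and A :: "'d \<Rightarrow> 'a \<Rightarrow> real \<Rightarrow> real"
    and G :: "'a \<Rightarrow> real^'d \<Rightarrow> real"
    and C0 \<nu> C R \<mu> \<gamma> :: real
    and q :: "'d \<Rightarrow> real"
    and c :: real
  assumes dim: "DIM('a) \<ge> 2"
    and dom: "open \<Omega>" "connected \<Omega>" "bounded \<Omega>" "\<Omega> \<noteq> {}"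
    and p_gt1: "\<And>k. p k > 1"
    and A_meas: "\<And>k s. (\<lambda>x. A k x s) \<in> borel_measurable (lebesgue_on \<Omega>)"
    and A_C1: "\<And>k. AE x in lebesgue_on \<Omega>.
                  (\<forall>s. A k x differentiable (at s)) \<and> continuous_on UNIV (deriv (A k x))"
    and C0_pos: "C0 > 0" and nu_pos: "\<nu> > 0"
    and a1: "\<And>k. AE x in lebesgue_on \<Omega>. \<forall>s. \<bar>A k x s\<bar> \<le> C0 \<and> \<bar>deriv (A k x) s\<bar> \<le> C0"
    and a2: "\<And>k. AE x in lebesgue_on \<Omega>. \<forall>s. A k x s \<ge> \<nu>"
    and G_meas: "\<And>s. (\<lambda>x. G x s) \<in> borel_measurable (lebesgue_on \<Omega>)"
    and G_C1: "AE x in lebesgue_on \<Omega>. (\<forall>s. G x differentiable (at s)) \<and>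
                  (\<forall>k. continuous_on UNIV (gpart G k x))"
    and G0: "AE x in lebesgue_on \<Omega>. G x 0 = 0 \<and> (\<forall>k. gpart G k x 0 = 0)"
    and C_pos: "C > 0"
    and q_range: "\<And>k. p k < q k \<and> (real DIM('a) > p k \<longrightarrow> q k < real DIM('a) * p k / (real DIM('a) - p k))"
    and g1: "AE x in lebesgue_on \<Omega>. \<forall>s k. \<bar>gpart G k x s\<bar> \<le>
               C * (1 + \<bar>s $ k\<bar> powr (q k - 1)
                      + (\<Sum>j\<in>UNIV - {k}. \<bar>s $ j\<bar> powr (q j * (q k - 1) / q k)))"
    and R_pos: "R > 0"
    and mu: "\<mu> > Max (range p)"
    and gamma: "0 < \<gamma>" "\<gamma> < \<mu> - Max (range p)"
    and g2: "AE x in lebesgue_on \<Omega>. \<forall>s. norm s \<ge> R \<longrightarrow>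
               0 < \<mu> * G x s \<and> \<mu> * G x s \<le> (\<Sum>k\<in>UNIV. s $ k * gpart G k x s)"
    and a3: "\<And>k. AE x in lebesgue_on \<Omega>. \<forall>s. \<bar>s\<bar> \<ge> R \<longrightarrow>
               0 \<le> s * deriv (A k x) s \<and> s * deriv (A k x) s \<le> \<gamma> * A k x s"
  shows "CPS_condition \<Omega> A G p c \<longleftrightarrow>
         (\<forall>un. CPS_seq \<Omega> A G p c un \<longrightarrow> (\<exists>M. \<forall>n. sob_norm \<Omega> p (un n) \<le> M))"
proof -
  interpret quasilinear_system \<Omega> p A G C0 \<nu> C R q
  proof
    show "AE x in lebesgue_on \<Omega>. \<forall>s. R \<le> \<bar>s\<bar> \<longrightarrow> 0 \<le> s * deriv (A k x) s" for k
      using a3[of k] by eventually_elim blast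
  qed (fact assms)+
  show ?thesis
  proof
    assume "CPS_condition \<Omega> A G p c"
    then show "\<forall>un. CPS_seq \<Omega> A G p c un \<longrightarrow> (\<exists>M. \<forall>n. sob_norm \<Omega> p (un n) \<le> M)"
      using CPS_condition_imp_bounded by blast
  next
    assume bd: "\<forall>un. CPS_seq \<Omega> A G p c un \<longrightarrow> (\<exists>M. \<forall>n. sob_norm \<Omega> p (un n) \<le> M)"
    show "CPS_condition \<Omega> A G p c"
      unfolding CPS_condition_def
    proof (intro allI impI)
      fix un assume cps: "CPS_seq \<Omega> A G p c un"
      with bd obtain K where "\<And>n. sob_norm \<Omega> p (un n) \<le> K" by blast
      from bounded_CPS_seq_convergent[OF cps this]
      show "\<exists>r u. strict_mono r \<and> W01p_vec \<Omega> p u \<and>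
        (\<lambda>n. sob_norm \<Omega> p (\<lambda>k x. un (r n) k x - u k x)) \<longlonglongrightarrow> 0" .
    qed
  qed
qed

end
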